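(* Let $n\in\{1,2,3\}$, $0<s<1$ and $k>0$. The outgoing fundamental solution $G^k_{n,s}$ of $(-\Delta)^s-k^{2s}$ behaves asymptotically as $|x|\to\infty$ like the rescaled outgoing Helmholtz fundamental solution $G^k_{n,helm}$: namely $G^k_{n,s}$ is $C^1$ on $\{|x|>1\}$ and, with $r=|x|$, $$|x|^{\frac{n-1}{2}}\big|G^k_{n,s}(x)-G^k_{n,helm}(x)\big|\to 0,\qquad |x|^{\frac{n-1}{2}}\big|\partial_r\big(G^k_{n,s}-G^k_{n,helm}\big)(x)\big|\to 0 \quad\text{as }|x|\to\infty .$$ In particular $G^k_{n,s}$ satisfies the Sommerfeld radiation condition $$\lim_{r\to\infty} r^{\frac{n-1}{2}}\Big(\frac{\partial G^k_{n,s}}{\partial r}-ik\,G^k_{n,s}\Big)=0 \quad\text{uniformly in } \hat x=x/|x|.$$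
   Context: Fourier transform convention: $\mathcal F f(\xi)=\int_{\mathbb R^n}e^{-ix\cdot\xi}f(x)\,dx$. The fractional Laplacian $(-\Delta)^s$ is the Fourier multiplier $\mathcal F^{-1}|\xi|^{2s}\mathcal F$. For $k>0$, $\epsilon>0$, write $k_\epsilon^{2s}:=k^{2s}+i\epsilon$ and let $G^{k_\epsilon}_{n,s}:=\mathcal F^{-1}\big[(|\xi|^{2s}-k^{2s}-i\epsilon)^{-1}\big]$ (a tempered distribution, smooth on $\mathbb R^n\setminus\{0\}$), i.e. the fundamental solution of $(-\Delta)^s-k_\epsilon^{2s}$. The outgoing fundamental solution is $G^k_{n,s}(x):=\lim_{\epsilon\to0^+}G^{k_\epsilon}_{n,s}(x)$ for $x\neq0$ (this limit exists). The rescaled Helmholtz fundamental solutions are $G^k_{1,helm}(x)=\frac{i e^{ik|x|}}{2s k^{2s-1}}$, $G^k_{2,helm}(x)=\frac{i k^{2-2s}}{4s}H^{(1)}_0(k|x|)$, $G^k_{3,helm}(x)=\frac{k^{2-2s}}{s}\frac{e^{ik|x|}}{4\pi|x|}$, where $H^{(1)}_0$ is the Hankel function of the first kind of order zero. For $n=1$, "uniformly in $\hat x$" means for $\hat x\in\{\pm1\}$. *)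

theory Defs
  imports "HOL-Analysis.Analysis"
begin

text \<open>Inverse Fourier transform of an integrable function
  (convention: F f(xi) = int e^(-i x.xi) f(x) dx, so
   F^-1 g(x) = (2 pi)^(-n) int e^(i x.xi) g(xi) dxi).\<close>
definition inv_fourier :: "('a::euclidean_space \<Rightarrow> complex) \<Rightarrow> 'a \<Rightarrow> complex" where
  "inv_fourier g x =
     (LINT xi|lborel. cis (x \<bullet> xi) * g xi) / complex_of_real ((2 * pi) ^ DIM('a))"

text \<open>Test functions: continuous, boundedly supported, with integrable inverse
  Fourier transform (this class contains all of C_c^infinity).\<close>
definition test_fun :: "('a::euclidean_space \<Rightarrow> complex) \<Rightarrow> bool" where
  "test_fun \<phi> \<longleftrightarrow> continuous_on UNIV \<phi> \<and> bounded {x. \<phi> x \<noteq> 0}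
      \<and> integrable lborel (inv_fourier \<phi>)"

definition is_inv_fourier_distr ::
    "('a::euclidean_space \<Rightarrow> complex) \<Rightarrow> ('a \<Rightarrow> complex) \<Rightarrow> bool" where
  "is_inv_fourier_distr m g \<longleftrightarrow>
     (\<forall>K. compact K \<longrightarrow> set_integrable lborel K g) \<and>
     (\<forall>\<phi>. test_fun \<phi> \<longrightarrow>
        (LINT x|lborel. g x * \<phi> x) = (LINT xi|lborel. m xi * inv_fourier \<phi> xi))"

text \<open>Symbol of the fundamental solution of (-Delta)^s - (k^(2s) + i eps).\<close>
definition frac_symbol :: "real \<Rightarrow> real \<Rightarrow> real \<Rightarrow> 'a::euclidean_space \<Rightarrow> complex" where
  "frac_symbol s k \<epsilon> xi =
     1 / (complex_of_real (norm xi powr (2 * s)) - complex_of_real (k powr (2 * s)) - \<i> * complex_of_real \<epsilon>)"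

text \<open>G^{k_eps}_{n,s}(x) for x \<noteq> 0: the value at x of the representative of
  F^-1[(|xi|^(2s) - k^(2s) - i eps)^-1] that is continuous on R^n - {0}.\<close>
definition G_eps :: "real \<Rightarrow> real \<Rightarrow> real \<Rightarrow> 'a::euclidean_space \<Rightarrow> complex" where
  "G_eps s k \<epsilon> x = (THE c. \<exists>g. is_inv_fourier_distr (frac_symbol s k \<epsilon>) g
        \<and> continuous_on (UNIV - {0}) g \<and> g x = c)"

definition G_out :: "real \<Rightarrow> real \<Rightarrow> 'a::euclidean_space \<Rightarrow> complex" where
  "G_out s k x = Lim (at_right 0) (\<lambda>\<epsilon>. G_eps s k \<epsilon> x)"

definition bessel_J0 :: "real \<Rightarrow> real" where
  "bessel_J0 r = (\<Sum>m. (-1) ^ m * (r / 2) ^ (2 * m) / (fact m) ^ 2)"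

definition bessel_Y0 :: "real \<Rightarrow> real" where
  "bessel_Y0 r = (2 / pi) * (ln (r / 2) + euler_mascheroni) * bessel_J0 r
     + (2 / pi) * (\<Sum>m. (-1) ^ (m + 2) * harm (m + 1) * (r / 2) ^ (2 * (m + 1)) / (fact (m + 1)) ^ 2)"

definition hankel1_0 :: "real \<Rightarrow> complex" where
  "hankel1_0 r = Complex (bessel_J0 r) (bessel_Y0 r)"

definition G_helm :: "real \<Rightarrow> real \<Rightarrow> 'a::euclidean_space \<Rightarrow> complex" where
  "G_helm s k x =
    (if DIM('a) = 1 then
       \<i> * cis (k * norm x) / complex_of_real (2 * s * k powr (2 * s - 1))
     else if DIM('a) = 2 then
       \<i> * complex_of_real (k powr (2 - 2 * s) / (4 * s)) * hankel1_0 (k * norm x)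
     else
       complex_of_real (k powr (2 - 2 * s) / s) * cis (k * norm x)
         / complex_of_real (4 * pi * norm x))"

definition radial_deriv :: "('a::euclidean_space \<Rightarrow> complex) \<Rightarrow> 'a \<Rightarrow> complex" where
  "radial_deriv f x = vector_derivative (\<lambda>t::real. f (t *\<^sub>R sgn x)) (at (norm x))"

end

theory Submission
  imports Defs "HOL-Probability.Probability" "HOL-Complex_Analysis.Complex_Analysis" "HOL-Real_Asymp.Real_Asymp"
begin

text \<open>Let $\mu = k^{2s} + i\epsilon$ and $\lambda_0 = \mu^{1/s}$. Shifting the contour to the negative axis splits
  the symbol as
  $$\frac{1}{\lambda^s - \mu} = \frac{\lambda_0}{s\mu}\,\frac{1}{\lambda - \lambda_0} + \int_0^\infty \frac{\rho_\epsilon(t)}{t + \lambda}\,dt,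
    \qquad \lambda = |\xi|^2,$$
  so the fundamental solution is a multiple of the Helmholtz kernel with wave number $\sqrt{\lambda_0}$ plus a
  superposition of Yukawa potentials. The densities are dominated uniformly in $\epsilon$, so the limit
  $\epsilon \to 0$ can be taken termwise: the first term becomes the rescaled outgoing Helmholtz solution, and the
  second a superposition of heat kernels, holomorphic in the radius and $O(r^{-n})$ in a sector. Cauchy's estimate
  then bounds the radial derivatives, both of this remainder and of the amplitude $e^{-ikr} G^k_{helm}$.

  The Helmholtz kernel is obtained from the Yukawa potential by analytic continuation in the wave number. In
  dimension two this gives the Laplace integral of the Hankel function, which is identified with its power series by
  a Wronskian argument: both solve Bessel's equation and have the same asymptotics at the origin.\<close>

text \<open>\<open>G_eps\<close> is a definite description over distributional identities, so every
  formula for it has to pass through pairings with test functions, of which only an integrable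
  inverse transform is known. Heat kernels suit this: they are positive with mass one and their
  symbols are at most one, so a single integrable weight justifies each exchange of integrals. The
  Helmholtz kernel itself is no such superposition: its weight e^(\<kappa>^2 \<tau>) is integrable
  only for Re \<kappa>^2 < 0, whereas \<kappa> close to \<open>k\<close> is needed; hence the detour
  over imaginary \<kappa>. As \<epsilon> tends to 0 the wave number reaches the real axis, which is
  why the profiles are built on a union of two half-planes. The recurring restriction \<epsilon>
  \<le> sin(pi s) K / 4 does two jobs: it costs at most half of the lower bound for the denominators
  of the density, and it keeps arg \<mu> below pi s, so that the pole at \<lambda>_0 lies between
  the two sides of the cut. Dividing out the phase e^(ikr) is essential for the radiation condition:
  the amplitude gains a factor 1/r on differentiation, while the full wave does not.\<close>

section \<open>Holomorphic parameter integrals\<close>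

text \<open>No bound on the derivative is assumed: Cauchy's inequality on discs of radius
  \<open>r/2\<close> turns the bound \<open>g\<close> on \<open>f\<close> into a Lipschitz bound
  \<open>g x / (r/2)\<close>, which dominates the difference quotients.\<close>

lemma has_field_derivative_lebesgue_integral:
  fixes f :: "complex \<Rightarrow> 'b \<Rightarrow> complex"
  assumes U: "open U"
    and hol: "\<And>x. x \<in> space M \<Longrightarrow> (\<lambda>z. f z x) holomorphic_on U"
    and meas: "\<And>z. z \<in> U \<Longrightarrow> f z \<in> borel_measurable M"
    and g: "integrable M g"
    and bound: "\<And>z x. z \<in> U \<Longrightarrow> x \<in> space M \<Longrightarrow> norm (f z x) \<le> g x"
    and z: "z \<in> U"
  shows "((\<lambda>z. \<integral>x. f z x \<partial>M) has_field_derivative (\<integral>x. deriv (\<lambda>z. f z x) z \<partial>M)) (at z)"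
proof -
  from U z obtain r where r: "r > 0" "cball z r \<subseteq> U"
    by (meson open_contains_cball)
  have int: "integrable M (f w)" if "w \<in> U" for w
    by (rule Bochner_Integration.integrable_bound[OF g meas[OF that]])
       (use bound[OF that] in \<open>auto intro!: AE_I2 order_trans[OF _ abs_ge_self]\<close>)
  have lip: "norm (f w x - f z x) \<le> (g x / (r/2)) * norm (w - z)"
    if w: "w \<in> ball z (r/2)" and x: "x \<in> space M" for w x
  proof (rule field_differentiable_bound[where S = "ball z (r/2)" and f' = "\<lambda>u. deriv (\<lambda>z. f z x) u"])
    fix u assume u: "u \<in> ball z (r/2)"
    have sub: "cball u (r/2) \<subseteq> U"
    proof
      fix v assume "v \<in> cball u (r/2)"
      hence "dist z v \<le> r" using u dist_triangle[of z v u] by (auto simp: dist_commute)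
      thus "v \<in> U" using r by auto
    qed
    have hU: "(\<lambda>z. f z x) holomorphic_on U" using hol x by auto
    show "((\<lambda>z. f z x) has_field_derivative deriv (\<lambda>z. f z x) u) (at u within ball z (r/2))"
      using holomorphic_derivI[OF hU U] centre_in_cball[of u "r/2"] sub r by (meson half_gt_zero less_imp_le subsetD)
    have "norm ((deriv ^^ 1) (\<lambda>z. f z x) u) \<le> fact 1 * g x / (r/2) ^ 1"
    proof (rule Cauchy_inequality)
      show "(\<lambda>z. f z x) holomorphic_on ball u (r/2)"
        using hU sub by (meson ball_subset_cball holomorphic_on_subset order_trans)
      show "continuous_on (cball u (r/2)) (\<lambda>z. f z x)"
        using hU sub holomorphic_on_imp_continuous_on holomorphic_on_subset by blast
      show "norm (f v x) \<le> g x" if "norm (u - v) = r/2" for v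
        using sub that x by (intro bound) (auto simp: dist_norm)
    qed (use r in auto)
    thus "norm (deriv (\<lambda>z. f z x) u) \<le> g x / (r/2)" by simp
  qed (use w r in auto)
  define L where "L = (\<integral>x. deriv (\<lambda>z. f z x) z \<partial>M)"
  have "((\<lambda>w. ((\<integral>x. f w x \<partial>M) - (\<integral>x. f z x \<partial>M)) / (w - z)) \<longlongrightarrow> L) (at z)"
    unfolding tendsto_at_iff_sequentially
  proof (intro allI impI)
    fix X :: "nat \<Rightarrow> complex"
    assume X0: "\<forall>i. X i \<in> UNIV - {z}" and X: "X \<longlonglongrightarrow> z"
    obtain N where N: "\<And>n. n \<ge> N \<Longrightarrow> X n \<in> ball z (r/2)"
      using X r by (metis dist_commute half_gt_zero lim_sequentially mem_ball)
    define Y where "Y n = X (n + N)" for n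
    have Yz: "Y n \<noteq> z" for n using X0 by (auto simp: Y_def)
    have Yb: "Y n \<in> ball z (r/2)" for n using N by (auto simp: Y_def)
    have YU: "Y n \<in> U" for n using Yb[of n] r by auto
    have Ylim: "Y \<longlonglongrightarrow> z" unfolding Y_def using X by (rule LIMSEQ_ignore_initial_segment)
    have q: "(\<lambda>n. (f (Y n) x - f z x) / (Y n - z)) \<longlonglongrightarrow> deriv (\<lambda>z. f z x) z"
      if "x \<in> space M" for x
    proof -
      have "((\<lambda>w. (f w x - f z x) / (w - z)) \<longlongrightarrow> deriv (\<lambda>z. f z x) z) (at z)"
        using holomorphic_derivI[OF hol[OF that] U z] by (simp add: has_field_derivative_iff)
      thus ?thesis
        using Yz Ylim by (auto simp: tendsto_at_iff_sequentially o_def)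
    qed
    have "(\<lambda>n. \<integral>x. (f (Y n) x - f z x) / (Y n - z) \<partial>M) \<longlonglongrightarrow> L"
      unfolding L_def
    proof (rule integral_dominated_convergence[where w = "\<lambda>x. g x / (r/2)"])
      show m: "(\<lambda>x. (f (Y n) x - f z x) / (Y n - z)) \<in> borel_measurable M" for n
        using meas[OF YU, of n] meas[OF z] by measurable
      \<comment> \<open>The derivative inherits measurability as a pointwise limit of difference
        quotients.\<close>
      show "(\<lambda>x. deriv (\<lambda>z. f z x) z) \<in> borel_measurable M"
        by (rule borel_measurable_LIMSEQ_metric[where f = "\<lambda>n x. (f (Y n) x - f z x) / (Y n - z)"]) (use m q in auto)
      show "integrable M (\<lambda>x. g x / (r/2))" using g by simp
      show "AE x in M. (\<lambda>n. (f (Y n) x - f z x) / (Y n - z)) \<longlonglongrightarrow> deriv (\<lambda>z. f z x) z"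
        using q by auto
      show "AE x in M. norm ((f (Y n) x - f z x) / (Y n - z)) \<le> g x / (r/2)" for n
        using lip[OF Yb] Yz[of n] by (intro AE_I2) (auto simp: norm_divide divide_simps mult_ac)
    qed
    also have "(\<lambda>n. \<integral>x. (f (Y n) x - f z x) / (Y n - z) \<partial>M)
        = (\<lambda>n. ((\<integral>x. f (Y n) x \<partial>M) - (\<integral>x. f z x \<partial>M)) / (Y n - z))"
      using int YU z by (simp add: Bochner_Integration.integral_diff)
    finally show "((\<lambda>w. ((\<integral>x. f w x \<partial>M) - (\<integral>x. f z x \<partial>M)) / (w - z)) \<circ> X) \<longlonglongrightarrow> L"
      unfolding Y_def o_def by (rule LIMSEQ_offset)
  qed
  thus ?thesis by (simp add: has_field_derivative_iff L_def)
qed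

lemma holomorphic_on_lebesgue_integral:
  fixes f :: "complex \<Rightarrow> 'b \<Rightarrow> complex"
  assumes "open U"
    and "\<And>x. x \<in> space M \<Longrightarrow> (\<lambda>z. f z x) holomorphic_on U"
    and "\<And>z. z \<in> U \<Longrightarrow> f z \<in> borel_measurable M"
    and "integrable M g"
    and "\<And>z x. z \<in> U \<Longrightarrow> x \<in> space M \<Longrightarrow> norm (f z x) \<le> g x"
  shows "(\<lambda>z. \<integral>x. f z x \<partial>M) holomorphic_on U"
  using has_field_derivative_lebesgue_integral[OF assms] assms(1) by (auto simp: holomorphic_on_open)

section \<open>Gaussians and the heat kernel\<close>

text \<open>\<open>lborel\<close> on a Euclidean space is the image of a product measure under the
  basis expansion, so Fubini for finite products applies coordinatewise.\<close>

lemma lborel_integral_prod_Basis: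
  fixes f :: "'a::euclidean_space \<Rightarrow> real \<Rightarrow> complex"
  assumes f: "\<And>b. b \<in> Basis \<Longrightarrow> integrable lborel (f b)"
  shows "integrable lborel (\<lambda>x::'a. \<Prod>b\<in>Basis. f b (x \<bullet> b))"
    and "(LINT x|lborel. (\<Prod>b\<in>Basis. f b (x \<bullet> b))) = (\<Prod>b\<in>Basis. LINT t|lborel. f b t)"
proof -
  interpret product_sigma_finite "\<lambda>b::'a. lborel :: real measure" by standard
  have [measurable]: "f b \<in> borel_measurable borel" if "b \<in> Basis" for b
    using f[OF that] by auto
  have meas: "(\<lambda>f. \<Sum>b\<in>Basis. f b *\<^sub>R b) \<in> measurable (\<Pi>\<^sub>M b\<in>(Basis::'a set). (lborel :: real measure)) borel"
    by measurable
  have m2: "(\<lambda>x::'a. \<Prod>b\<in>Basis. f b (x \<bullet> b)) \<in> borel_measurable borel"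
    by measurable
  have eq: "(\<Prod>b\<in>Basis. f b ((\<Sum>c\<in>Basis. w c *\<^sub>R c) \<bullet> b)) = (\<Prod>b\<in>Basis. f b (w b))" for w :: "'a \<Rightarrow> real"
    by (rule prod.cong) (simp_all add: inner_sum_left inner_Basis if_distrib cong: if_cong)
  show "integrable lborel (\<lambda>x::'a. \<Prod>b\<in>Basis. f b (x \<bullet> b))"
    apply (subst lborel_eq)
    apply (subst integrable_distr_eq[OF meas m2])
    unfolding eq by (rule product_integrable_prod) (use f in auto)
  show "(LINT x|lborel. (\<Prod>b\<in>Basis. f b (x \<bullet> b))) = (\<Prod>b\<in>Basis. LINT t|lborel. f b t)"
    apply (subst lborel_eq)
    apply (subst integral_distr[OF meas m2])
    unfolding eq by (rule product_integral_prod) (use f in auto)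
qed

lemma gaussian_integrable:
  assumes a: "a > 0" shows "integrable lborel (\<lambda>x::real. exp (- a * x\<^sup>2))"
proof -
  have "integrable lborel (\<lambda>x. normal_density 0 (sqrt (1/(2*a))) x)"
    using a by (intro integrable_normal_density) auto
  hence "integrable lborel (\<lambda>x. sqrt (pi/a) * normal_density 0 (sqrt (1/(2*a))) x)"
    by (rule integrable_mult_right)
  also have "(\<lambda>x. sqrt (pi/a) * normal_density 0 (sqrt (1/(2*a))) x) = (\<lambda>x::real. exp (- a * x\<^sup>2))"
    using a by (auto simp: normal_density_def real_sqrt_divide fun_eq_iff field_simps)
  finally show ?thesis .
qed

lemma gaussian_fourier_1:
  assumes a: "a > 0"
  shows "(LINT x|lborel. cis (t * x) * complex_of_real (exp (- a * x\<^sup>2)))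
           = complex_of_real (sqrt (pi / a) * exp (- (t\<^sup>2 / (4 * a))))"
proof -
  \<comment> \<open>Rescaling by c with c^2 = 2 a normalises the Gaussian to variance one, where the
    characteristic function is known.\<close>
  define c where "c = sqrt (2 * a)"
  have c: "c > 0" "c\<^sup>2 = 2 * a" using a by (auto simp: c_def)
  have "char std_normal_distribution (t/c)
      = (LINT x|lborel. std_normal_density x *\<^sub>R cis (t / c * x))"
    unfolding char_def
    by (subst integral_density) (auto simp: cis_conv_exp mult_ac simp del: of_real_mult)
  also have "\<dots> = (LINT x|lborel. (1 / sqrt (2*pi)) *\<^sub>R (exp (-x\<^sup>2/2) *\<^sub>R cis (t / c * x)))"
    by (simp add: normal_density_def)
  also have "\<dots> = (1 / sqrt (2*pi)) *\<^sub>R (LINT x|lborel. exp (-x\<^sup>2/2) *\<^sub>R cis (t / c * x))"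
    by (rule Bochner_Integration.integral_scaleR_right)
  also have "(LINT x|lborel. exp (-x\<^sup>2/2) *\<^sub>R cis (t / c * x))
     = c *\<^sub>R (LINT x|lborel. exp (-(c*x)\<^sup>2/2) *\<^sub>R cis (t / c * (c * x)))"
    using c by (subst lborel_integral_real_affine[where c = c and t = 0]) auto
  also have "(\<lambda>x. exp (-(c*x)\<^sup>2/2) *\<^sub>R cis (t / c * (c * x))) = (\<lambda>x. cis (t * x) * complex_of_real (exp (- a * x\<^sup>2)))"
    using c by (auto simp: fun_eq_iff power_mult_distrib scaleR_conv_of_real mult_ac)
  finally have *: "complex_of_real (exp (- ((t/c)\<^sup>2 / 2)))
     = (1 / sqrt (2*pi)) *\<^sub>R c *\<^sub>R (LINT x|lborel. cis (t * x) * complex_of_real (exp (- a * x\<^sup>2)))"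
    by (simp add: char_std_normal_distribution)
  have e: "(t/c)\<^sup>2 / 2 = t\<^sup>2 / (4 * a)" using c by (simp add: power_divide)
  have "sqrt (2*pi) / c = sqrt (pi / a)" using a by (simp add: c_def real_sqrt_divide real_sqrt_mult)
  hence s: "(1 / sqrt (2*pi)) * c = 1 / sqrt (pi / a)"
    using a c by (simp add: field_simps)
  have "complex_of_real (sqrt (pi / a)) * complex_of_real (exp (- (t\<^sup>2 / (4 * a))))
     = sqrt (pi/a) *\<^sub>R ((1 / sqrt (2*pi)) *\<^sub>R c *\<^sub>R (LINT x|lborel. cis (t * x) * complex_of_real (exp (- a * x\<^sup>2))))"
    using * unfolding e by (simp add: scaleR_conv_of_real)
  also have "\<dots> = (LINT x|lborel. cis (t * x) * complex_of_real (exp (- a * x\<^sup>2)))"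
    unfolding scaleR_scaleR s using a by simp
  finally show ?thesis by simp
qed

lemma norm_Basis_sum: "(norm (x::'a::euclidean_space))\<^sup>2 = (\<Sum>b\<in>Basis. (x \<bullet> b)\<^sup>2)"
  unfolding power2_norm_eq_inner by (subst euclidean_inner) (simp add: power2_eq_square)

lemma gaussian_integrable_euclidean:
  assumes a: "a > 0" shows "integrable lborel (\<lambda>x::'a::euclidean_space. exp (- a * (norm x)\<^sup>2))"
proof -
  have "integrable lborel (\<lambda>x::'a. \<Prod>b\<in>Basis. complex_of_real (exp (- a * (x \<bullet> b)\<^sup>2)))"
    by (rule lborel_integral_prod_Basis) (use gaussian_integrable[OF a] in \<open>auto intro!: integrable_of_real\<close>)
  also have "(\<lambda>x::'a. \<Prod>b\<in>Basis. complex_of_real (exp (- a * (x \<bullet> b)\<^sup>2))) = (\<lambda>x. complex_of_real (exp (- a * (norm x)\<^sup>2)))"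
    by (simp add: fun_eq_iff norm_Basis_sum sum_distrib_left exp_sum flip: of_real_prod)
  finally show ?thesis by (simp only: complex_of_real_integrable_eq)
qed

lemma cis_sum: "finite A \<Longrightarrow> cis (sum f A) = (\<Prod>b\<in>A. cis (f b))"
  by (induction rule: finite_induct) (auto simp: cis_mult[symmetric])

lemma gaussian_fourier:
  fixes x :: "'a::euclidean_space"
  assumes a: "a > 0"
  shows "(LINT xi|lborel. cis (x \<bullet> xi) * complex_of_real (exp (- a * (norm xi)\<^sup>2)))
     = complex_of_real (sqrt (pi / a) ^ DIM('a) * exp (- ((norm x)\<^sup>2 / (4 * a))))"
proof -
  have i: "integrable lborel (\<lambda>t::real. cis (c * t) * complex_of_real (exp (- a * t\<^sup>2)))" for c
    by (rule Bochner_Integration.integrable_bound[OF gaussian_integrable[OF a]])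
       (auto simp: norm_mult cis_conv_exp)
  have "(\<lambda>xi. cis (x \<bullet> xi) * complex_of_real (exp (- a * (norm xi)\<^sup>2)))
     = (\<lambda>xi::'a. \<Prod>b\<in>Basis. (cis ((x \<bullet> b) * (xi \<bullet> b)) * complex_of_real (exp (- a * (xi \<bullet> b)\<^sup>2))))"
  proof
    fix xi :: 'a
    have "cis (x \<bullet> xi) = (\<Prod>b\<in>Basis. cis ((x \<bullet> b) * (xi \<bullet> b)))"
      by (subst euclidean_inner) (simp add: cis_sum)
    moreover have "complex_of_real (exp (- a * (norm xi)\<^sup>2)) = (\<Prod>b\<in>Basis. complex_of_real (exp (- a * (xi \<bullet> b)\<^sup>2)))"
      by (simp add: norm_Basis_sum sum_distrib_left exp_sum flip: of_real_prod)
    ultimately show "cis (x \<bullet> xi) * complex_of_real (exp (- a * (norm xi)\<^sup>2))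
        = (\<Prod>b\<in>Basis. (cis ((x \<bullet> b) * (xi \<bullet> b)) * complex_of_real (exp (- a * (xi \<bullet> b)\<^sup>2))))"
      by (simp only: prod.distrib)
  qed
  hence "(LINT xi|lborel. cis (x \<bullet> xi) * complex_of_real (exp (- a * (norm xi)\<^sup>2)))
     = (\<Prod>b\<in>Basis. complex_of_real (sqrt (pi / a) * exp (- ((x \<bullet> b)\<^sup>2 / (4 * a)))))"
    by (simp only:) (subst lborel_integral_prod_Basis[OF i], simp only: gaussian_fourier_1[OF a])
  also have "\<dots> = complex_of_real (sqrt (pi / a) ^ DIM('a) * exp (- ((norm x)\<^sup>2 / (4 * a))))"
  proof -
    have "exp (- ((norm x)\<^sup>2 / (4 * a))) = (\<Prod>b\<in>Basis. exp (- ((x \<bullet> b)\<^sup>2 / (4 * a))))"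
      unfolding norm_Basis_sum sum_divide_distrib sum_negf[symmetric] by (rule exp_sum) simp
    thus ?thesis by (simp only: prod.distrib of_real_prod[symmetric] prod_constant)
  qed
  finally show ?thesis .
qed

definition heat_kernel :: "real \<Rightarrow> 'a::euclidean_space \<Rightarrow> real" where
  "heat_kernel \<tau> x = exp (- ((norm x)\<^sup>2 / (4 * \<tau>))) / sqrt (4 * pi * \<tau>) ^ DIM('a)"

lemma heat_kernel_nonneg: "\<tau> > 0 \<Longrightarrow> heat_kernel \<tau> x \<ge> 0"
  by (simp add: heat_kernel_def)

lemma heat_kernel_integral:
  assumes t: "\<tau> > 0"
  shows "integrable lborel (heat_kernel \<tau> :: 'a::euclidean_space \<Rightarrow> real)"
    and "(LINT x|lborel. heat_kernel \<tau> (x::'a)) = 1"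
proof -
  have a: "1/(4*\<tau>) > 0" using t by simp
  have eq: "(\<lambda>x::'a. exp (- (1/(4*\<tau>)) * (norm x)\<^sup>2) / sqrt (4 * pi * \<tau>) ^ DIM('a)) = heat_kernel \<tau>"
    by (auto simp: heat_kernel_def fun_eq_iff)
  show "integrable lborel (heat_kernel \<tau> :: 'a \<Rightarrow> real)"
    using integrable_divide_zero[OF gaussian_integrable_euclidean[OF a, where 'a='a], of "sqrt (4 * pi * \<tau>) ^ DIM('a)"]
    unfolding eq by blast
  have "complex_of_real (LINT x|lborel. exp (- (1/(4*\<tau>)) * (norm (x::'a))\<^sup>2)) = complex_of_real (sqrt (4 * pi * \<tau>) ^ DIM('a))"
    using gaussian_fourier[OF a, of "0::'a"] by (simp add: mult_ac)
  hence "(LINT x|lborel. exp (- (1/(4*\<tau>)) * (norm (x::'a))\<^sup>2)) = sqrt (4 * pi * \<tau>) ^ DIM('a)"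
    by (simp only: of_real_eq_iff)
  hence "(LINT x::'a|lborel. exp (- (1/(4*\<tau>)) * (norm x)\<^sup>2) / sqrt (4 * pi * \<tau>) ^ DIM('a)) = 1"
    using t by (subst Bochner_Integration.integral_divide_zero) simp
  thus "(LINT x|lborel. heat_kernel \<tau> (x::'a)) = 1" unfolding eq .
qed

section \<open>Test functions and their pairing with heat kernels\<close>

lemma test_funD:
  fixes \<phi> :: "'a::euclidean_space \<Rightarrow> complex"
  assumes "test_fun \<phi>"
  shows "\<phi> \<in> borel_measurable borel" "integrable lborel \<phi>" "integrable lborel (inv_fourier \<phi>)"
    "\<exists>B. \<forall>x. norm (\<phi> x) \<le> B" "\<exists>R. \<forall>x. norm x > R \<longrightarrow> \<phi> x = 0"
proof -
  have c: "continuous_on UNIV \<phi>" and b: "bounded {x. \<phi> x \<noteq> 0}"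
    and "integrable lborel (inv_fourier \<phi>)" using assms by (auto simp: test_fun_def)
  show "integrable lborel (inv_fourier \<phi>)" by fact
  show m: "\<phi> \<in> borel_measurable borel" using c by (rule borel_measurable_continuous_onI)
  obtain R where R: "\<And>x. \<phi> x \<noteq> 0 \<Longrightarrow> norm x \<le> R" using b unfolding bounded_iff by auto
  thus "\<exists>R. \<forall>x. norm x > R \<longrightarrow> \<phi> x = 0" by (metis not_le)
  have "compact (\<phi> ` cball 0 R)" by (rule compact_continuous_image[OF continuous_on_subset[OF c]]) auto
  then obtain B where B: "\<And>x. x \<in> cball 0 R \<Longrightarrow> norm (\<phi> x) \<le> B"
    by (meson bounded_iff compact_imp_bounded imageI)
  show "\<exists>B. \<forall>x. norm (\<phi> x) \<le> B"
  proof (intro exI allI)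
    fix x show "norm (\<phi> x) \<le> max B 0" using B[of x] R[of x] by (cases "\<phi> x = 0") auto
  qed
  have "integrable lborel (\<lambda>x. indicator (cball 0 R) x *\<^sub>R \<phi> x)"
    by (rule borel_integrable_compact) (auto intro: continuous_on_subset[OF c])
  also have "(\<lambda>x. indicator (cball 0 R) x *\<^sub>R \<phi> x) = \<phi>"
    using R by (force simp: indicator_def fun_eq_iff)
  finally show "integrable lborel \<phi>" .
qed

lemma test_fun_mult_integrable:
  fixes g :: "'a::euclidean_space \<Rightarrow> complex"
  assumes g: "\<And>K. compact K \<Longrightarrow> set_integrable lborel K g" and \<phi>: "test_fun \<phi>"
  shows "integrable lborel (\<lambda>x. g x * \<phi> x)"
proof -
  obtain B where B: "\<And>x. norm (\<phi> x) \<le> B" using test_funD(4)[OF \<phi>] by auto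
  obtain R where R: "\<And>x. norm x > R \<Longrightarrow> \<phi> x = 0" using test_funD(5)[OF \<phi>] by auto
  have i: "integrable lborel (\<lambda>x. indicator (cball 0 R) x *\<^sub>R g x)"
    using g[of "cball 0 R"] by (simp add: set_integrable_def)
  have "integrable lborel (\<lambda>x. (indicator (cball 0 R) x *\<^sub>R g x) * \<phi> x)"
  proof (rule Bochner_Integration.integrable_bound[OF integrable_mult_left[OF integrable_norm[OF i], of B]])
    show "(\<lambda>x. (indicator (cball 0 R) x *\<^sub>R g x) * \<phi> x) \<in> borel_measurable lborel"
      by (rule borel_measurable_times) (use test_funD(1)[OF \<phi>] i in auto)
    show "AE x in lborel. norm ((indicator (cball 0 R) x *\<^sub>R g x) * \<phi> x) \<le> norm (norm (indicator (cball 0 R) x *\<^sub>R g x) * B)"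
      unfolding norm_mult by (intro AE_I2 mult_mono order_trans[OF B]) auto
  qed
  also have "(\<lambda>x. (indicator (cball 0 R) x *\<^sub>R g x) * \<phi> x) = (\<lambda>x. g x * \<phi> x)"
    using R by (force simp: fun_eq_iff indicator_def)
  finally show ?thesis .
qed

text \<open>The Gaussian makes the double integral over \<open>(xi, x)\<close> absolutely
  convergent, so Fubini moves the transform from \<phi> onto the Gaussian, where
  \<open>gaussian_fourier\<close> evaluates it.\<close>

lemma heat_kernel_pairing:
  fixes \<phi> :: "'a::euclidean_space \<Rightarrow> complex"
  assumes t: "\<tau> > 0" and \<phi>: "test_fun \<phi>"
  shows "(LINT x|lborel. complex_of_real (heat_kernel \<tau> x) * \<phi> x)
       = (LINT xi|lborel. complex_of_real (exp (- \<tau> * (norm xi)\<^sup>2)) * inv_fourier \<phi> xi)"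
proof -
  note [measurable] = test_funD(1)[OF \<phi>]
  define C where "C = complex_of_real ((2 * pi) ^ DIM('a))"
  let ?F = "\<lambda>(xi::'a, x::'a). complex_of_real (exp (- \<tau> * (norm xi)\<^sup>2)) * (cis (xi \<bullet> x) * \<phi> x)"
  have cism[measurable]: "(\<lambda>(xi, x). cis (xi \<bullet> x)) \<in> borel_measurable (borel \<Otimes>\<^sub>M (borel :: 'a measure))"
    unfolding cis_conv_exp by measurable
  have int: "integrable (lborel \<Otimes>\<^sub>M lborel) ?F"
  proof (rule lborel_pair.Fubini_integrable)
    show "?F \<in> borel_measurable (lborel \<Otimes>\<^sub>M lborel)" by measurable
    have "(\<lambda>xi. LINT x|lborel. norm (?F (xi, x))) = (\<lambda>xi. exp (- \<tau> * (norm xi)\<^sup>2) * (LINT x|lborel. norm (\<phi> x)))"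
      by (simp add: norm_mult)
    thus "integrable lborel (\<lambda>xi. LINT x|lborel. norm (?F (xi, x)))"
      using integrable_mult_left[OF gaussian_integrable_euclidean[OF t, where 'a='a], of "LINT x|lborel. norm (\<phi> x)"]
      by (simp only:)
    have "integrable lborel (\<lambda>x. cis (xi \<bullet> x) * \<phi> x)" for xi
      by (rule Bochner_Integration.integrable_bound[OF integrable_norm[OF test_funD(2)[OF \<phi>]]])
         (auto simp: norm_mult cis_conv_exp)
    thus "AE xi in lborel. integrable lborel (\<lambda>x. ?F (xi, x))" by (intro AE_I2) simp
  qed
  have hk: "(LINT xi|lborel. cis (xi \<bullet> x) * complex_of_real (exp (- \<tau> * (norm xi)\<^sup>2))) / C = complex_of_real (heat_kernel \<tau> x)" for x :: 'a
  proof -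
    \<comment> \<open>In each dimension the factor 1/(2 pi) of \<open>inv_fourier\<close> combines
      with the Gaussian integral to the normalisation of the heat kernel.\<close>
    have "sqrt (pi / \<tau>) / (2 * pi) = 1 / sqrt (4 * pi * \<tau>)"
    proof -
      have "sqrt (pi / \<tau>) * sqrt (4 * pi * \<tau>) = sqrt ((2 * pi)\<^sup>2)"
        using t by (simp add: power2_eq_square flip: real_sqrt_mult)
      hence "sqrt (pi / \<tau>) * sqrt (4 * pi * \<tau>) = 2 * pi" by (simp only: real_sqrt_abs) simp
      thus ?thesis using t by (simp add: divide_simps)
    qed
    hence "sqrt (pi / \<tau>) ^ DIM('a) / (2 * pi) ^ DIM('a) = 1 / sqrt (4 * pi * \<tau>) ^ DIM('a)"
      by (metis power_divide power_one)
    hence A: "sqrt (pi / \<tau>) ^ DIM('a) / (2 * pi) ^ DIM('a) * exp (- ((norm x)\<^sup>2 / (4 * \<tau>)))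
       = 1 / sqrt (4 * pi * \<tau>) ^ DIM('a) * exp (- ((norm x)\<^sup>2 / (4 * \<tau>)))"
      by (simp only:)
    hence "sqrt (pi / \<tau>) ^ DIM('a) * exp (- ((norm x)\<^sup>2 / (4 * \<tau>))) / (2 * pi) ^ DIM('a) = heat_kernel \<tau> x"
      unfolding heat_kernel_def by (simp only: times_divide_eq_left mult_1)
    hence "complex_of_real (sqrt (pi / \<tau>) ^ DIM('a) * exp (- ((norm x)\<^sup>2 / (4 * \<tau>)))) / C = complex_of_real (heat_kernel \<tau> x)"
      unfolding C_def by (metis of_real_divide)
    thus ?thesis using gaussian_fourier[OF t, of x] by (simp only: inner_commute)
  qed
  have "(LINT xi|lborel. complex_of_real (exp (- \<tau> * (norm xi)\<^sup>2)) * inv_fourier \<phi> xi)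
      = (LINT xi|lborel. (LINT x|lborel. ?F (xi, x)) / C)"
    by (simp add: inv_fourier_def C_def)
  also have "\<dots> = (LINT xi|lborel. (LINT x|lborel. ?F (xi, x))) / C" by simp
  also have "(LINT xi|lborel. (LINT x|lborel. ?F (xi, x))) = (LINT x|lborel. (LINT xi|lborel. ?F (xi, x)))"
    by (rule lborel_pair.Fubini_integral[symmetric]) (use int in \<open>simp add: case_prod_unfold\<close>)
  also have "\<dots> / C = (LINT x|lborel. (LINT xi|lborel. ?F (xi, x)) / C)" by simp
  also have "\<dots> = (LINT x|lborel. complex_of_real (heat_kernel \<tau> x) * \<phi> x)"
  proof (rule Bochner_Integration.integral_cong[OF refl])
    fix x
    have "(LINT xi|lborel. ?F (xi, x)) = (LINT xi|lborel. (cis (xi \<bullet> x) * complex_of_real (exp (- \<tau> * (norm xi)\<^sup>2))) * \<phi> x)"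
      by (simp only: mult_ac prod.case)
    also have "\<dots> = (LINT xi|lborel. cis (xi \<bullet> x) * complex_of_real (exp (- \<tau> * (norm xi)\<^sup>2))) * \<phi> x"
      by simp
    finally show "(LINT xi|lborel. ?F (xi, x)) / C = complex_of_real (heat_kernel \<tau> x) * \<phi> x"
      using hk[of x] by (metis times_divide_eq_left)
  qed
  finally show ?thesis ..
qed

text \<open>Mass one in \<open>x\<close> and a symbol of size at most one in \<open>xi\<close> mean
  that integrability of \<open>w\<close> alone dominates both double integrals. The parameter space
  is arbitrary because the weight lives on times for Yukawa potentials and on pairs for the
  remainder.\<close>

lemma heat_superposition:
  fixes w :: "'p \<Rightarrow> complex" and T :: "'p \<Rightarrow> real"
  assumes M: "sigma_finite_measure M" and w: "integrable M w" and T[measurable]: "T \<in> borel_measurable M"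
    and pos: "\<And>p. w p \<noteq> 0 \<Longrightarrow> T p > 0"
  shows "integrable lborel (\<lambda>x::'a::euclidean_space. \<integral>p. w p * heat_kernel (T p) x \<partial>M)"
    and "test_fun \<phi> \<Longrightarrow> (LINT x|lborel. (\<integral>p. w p * heat_kernel (T p) x \<partial>M) * \<phi> x)
       = (LINT xi|lborel. (\<integral>p. w p * complex_of_real (exp (- T p * (norm xi)\<^sup>2)) \<partial>M) * inv_fourier \<phi> (xi::'a))"
proof -
  interpret M: sigma_finite_measure M by fact
  interpret pair_sigma_finite M "lborel :: 'a measure" by standard
  have [measurable]: "w \<in> borel_measurable M" using w by auto
  have hm[measurable]: "(\<lambda>(p, x). heat_kernel (T p) x) \<in> borel_measurable (M \<Otimes>\<^sub>M (borel :: 'a measure))"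
    unfolding heat_kernel_def by measurable
  have 1: "(LINT x|lborel. norm (w p * heat_kernel (T p) (x::'a))) = norm (w p)" for p
  proof (cases "w p = 0")
    case False
    hence "T p > 0" using pos by auto
    hence "(LINT x|lborel. norm (w p * heat_kernel (T p) (x::'a))) = (LINT x|lborel. norm (w p) * heat_kernel (T p) (x::'a))"
      by (simp add: norm_mult heat_kernel_nonneg)
    also have "\<dots> = norm (w p)" using heat_kernel_integral(2)[OF \<open>T p > 0\<close>, where 'a='a]
      by simp
    finally show ?thesis .
  qed simp
  have i1: "integrable lborel (\<lambda>x. w p * heat_kernel (T p) (x::'a))" for p
  proof (cases "w p = 0")
    case False
    hence "integrable lborel (\<lambda>x::'a. complex_of_real (heat_kernel (T p) x))"
      using heat_kernel_integral(1)[OF pos] by (simp add: complex_of_real_integrable_eq)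
    thus ?thesis by (rule integrable_mult_right)
  qed simp
  have int1: "integrable (M \<Otimes>\<^sub>M lborel) (\<lambda>(p, x). w p * heat_kernel (T p) (x::'a))"
  proof (rule Fubini_integrable)
    show "(\<lambda>(p, x). w p * heat_kernel (T p) (x::'a)) \<in> borel_measurable (M \<Otimes>\<^sub>M lborel)" by measurable
    show "integrable M (\<lambda>p. LINT x|lborel. norm (case (p, x) of (p, x) \<Rightarrow> w p * heat_kernel (T p) (x::'a)))"
      using 1 integrable_norm[OF w] by simp
    show "AE p in M. integrable lborel (\<lambda>x. case (p, x) of (p, x) \<Rightarrow> w p * heat_kernel (T p) (x::'a))"
      using i1 by simp
  qed
  show "integrable lborel (\<lambda>x::'a. \<integral>p. w p * heat_kernel (T p) x \<partial>M)"
    by (rule integrable_snd) (use int1 in auto)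
  assume \<phi>: "test_fun \<phi>"
  note [measurable] = test_funD(1)[OF \<phi>]
  have [measurable]: "inv_fourier \<phi> \<in> borel_measurable borel" using test_funD(3)[OF \<phi>] by auto
  obtain B where B: "\<And>x. norm (\<phi> x) \<le> B" using test_funD(4)[OF \<phi>] by auto
  have int2: "integrable (M \<Otimes>\<^sub>M lborel) (\<lambda>(p, x). w p * heat_kernel (T p) x * \<phi> x)"
  proof (rule Bochner_Integration.integrable_bound[OF integrable_mult_left[OF integrable_norm[OF int1], of B]])
    show "(\<lambda>(p, x). w p * heat_kernel (T p) x * \<phi> x) \<in> borel_measurable (M \<Otimes>\<^sub>M lborel)" by measurable
    show "AE px in M \<Otimes>\<^sub>M lborel. norm (case px of (p, x) \<Rightarrow> w p * heat_kernel (T p) x * \<phi> x)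
            \<le> norm (norm (case px of (p, x) \<Rightarrow> w p * heat_kernel (T p) x) * B)"
    proof (intro AE_I2, clarsimp)
      fix p x
      have "norm (w p * heat_kernel (T p) x) * norm (\<phi> x) \<le> norm (w p * heat_kernel (T p) x) * B"
        using B by (intro mult_left_mono) auto
      thus "norm (w p * heat_kernel (T p) x * \<phi> x) \<le> \<bar>norm (w p * heat_kernel (T p) x) * B\<bar>"
        by (simp only: norm_mult)
    qed
  qed
  have e: "norm (w p * complex_of_real (exp (- T p * (norm xi)\<^sup>2))) \<le> norm (w p)" for p and xi :: 'a
    using pos[of p] by (cases "w p = 0") (auto simp: norm_mult intro!: mult_left_le)
  have int3: "integrable (M \<Otimes>\<^sub>M lborel) (\<lambda>(p, xi). w p * complex_of_real (exp (- T p * (norm xi)\<^sup>2)) * inv_fourier \<phi> xi)"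
  proof (rule Fubini_integrable)
    show "(\<lambda>(p, xi). w p * complex_of_real (exp (- T p * (norm xi)\<^sup>2)) * inv_fourier \<phi> xi) \<in> borel_measurable (M \<Otimes>\<^sub>M lborel)"
      by measurable
    have b: "integrable lborel (\<lambda>xi. w p * complex_of_real (exp (- T p * (norm xi)\<^sup>2)) * inv_fourier \<phi> xi)" for p
    proof (rule Bochner_Integration.integrable_bound[OF integrable_mult_right[OF integrable_norm[OF test_funD(3)[OF \<phi>]], of "norm (w p)"]])
      show "(\<lambda>xi. w p * complex_of_real (exp (- T p * (norm xi)\<^sup>2)) * inv_fourier \<phi> xi) \<in> borel_measurable lborel" by measurable
      show "AE xi in lborel. norm (w p * complex_of_real (exp (- T p * (norm xi)\<^sup>2)) * inv_fourier \<phi> xi)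
          \<le> norm (norm (w p) * norm (inv_fourier \<phi> xi))"
        by (intro AE_I2) (subst norm_mult, use e in \<open>auto intro!: mult_right_mono\<close>)
    qed
    thus "AE p in M. integrable lborel (\<lambda>x. case (p, x) of (p, xi) \<Rightarrow> w p * complex_of_real (exp (- T p * (norm xi)\<^sup>2)) * inv_fourier \<phi> xi)"
      by simp
    show "integrable M (\<lambda>p. LINT x|lborel. norm (case (p, x) of (p, xi) \<Rightarrow> w p * complex_of_real (exp (- T p * (norm xi)\<^sup>2)) * inv_fourier \<phi> xi))"
    proof (rule Bochner_Integration.integrable_bound[OF integrable_mult_left[OF integrable_norm[OF w], of "LINT xi|lborel. norm (inv_fourier \<phi> xi)"]])
      show "(\<lambda>p. LINT x|lborel. norm (case (p, x) of (p, xi) \<Rightarrow> w p * complex_of_real (exp (- T p * (norm xi)\<^sup>2)) * inv_fourier \<phi> xi)) \<in> borel_measurable M"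
        by measurable
      have "(LINT xi|lborel. norm (w p * complex_of_real (exp (- T p * (norm xi)\<^sup>2)) * inv_fourier \<phi> xi))
          \<le> (LINT xi|lborel. norm (w p) * norm (inv_fourier \<phi> xi))" for p
        by (rule integral_mono[OF integrable_norm[OF b]])
           (use test_funD(3)[OF \<phi>] e[of p] in \<open>auto intro!: integrable_mult_right integrable_norm mult_right_mono simp: norm_mult[of "_ * _"]\<close>)
      thus "AE p in M. norm (LINT x|lborel. norm (case (p, x) of (p, xi) \<Rightarrow> w p * complex_of_real (exp (- T p * (norm xi)\<^sup>2)) * inv_fourier \<phi> xi))
          \<le> norm (norm (w p) * (LINT xi|lborel. norm (inv_fourier \<phi> xi)))"
        by (intro AE_I2) (simp add: integral_nonneg_AE)
    qed
  qed
  have "(LINT x|lborel. (\<integral>p. w p * heat_kernel (T p) x \<partial>M) * \<phi> x)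
      = (LINT x|lborel. (\<integral>p. w p * heat_kernel (T p) x * \<phi> x \<partial>M))"
    by simp
  also have "\<dots> = (\<integral>p. (LINT x|lborel. w p * heat_kernel (T p) x * \<phi> x) \<partial>M)"
    by (rule Fubini_integral[OF int2])
  also have "\<dots> = (\<integral>p. (LINT xi|lborel. w p * complex_of_real (exp (- T p * (norm xi)\<^sup>2)) * inv_fourier \<phi> xi) \<partial>M)"
  proof (rule Bochner_Integration.integral_cong[OF refl])
    fix p
    show "(LINT x|lborel. w p * heat_kernel (T p) x * \<phi> x)
       = (LINT xi|lborel. w p * complex_of_real (exp (- T p * (norm xi)\<^sup>2)) * inv_fourier \<phi> xi)"
      using heat_kernel_pairing[OF pos \<phi>, of p] by (cases "w p = 0") (simp_all add: mult.assoc)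
  qed
  also have "\<dots> = (LINT xi|lborel. (\<integral>p. w p * complex_of_real (exp (- T p * (norm xi)\<^sup>2)) * inv_fourier \<phi> xi \<partial>M))"
    by (rule Fubini_integral[OF int3, symmetric])
  also have "\<dots> = (LINT xi|lborel. (\<integral>p. w p * complex_of_real (exp (- T p * (norm xi)\<^sup>2)) \<partial>M) * inv_fourier \<phi> xi)"
    by simp
  finally show "(LINT x|lborel. (\<integral>p. w p * heat_kernel (T p) x \<partial>M) * \<phi> x)
       = (LINT xi|lborel. (\<integral>p. w p * complex_of_real (exp (- T p * (norm xi)\<^sup>2)) \<partial>M) * inv_fourier \<phi> xi)" .
qed

section \<open>Uniqueness of the continuous representative\<close>

text \<open>The tent stands in for a smooth bump: it is continuous with compact support, and its
  Fourier transform (2 - 2 cos v)/v^2 is already integrable, which is all that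
  \<open>test_fun\<close> demands.\<close>

definition tent :: "real \<Rightarrow> real" where "tent u = max 0 (1 - \<bar>u\<bar>)"

lemma tent_continuous: "continuous_on S tent"
  unfolding tent_def by (intro continuous_intros)

lemma tent_integrable: "integrable lborel (\<lambda>u. complex_of_real (tent u) * cis (v * u))"
proof -
  have "integrable lborel (\<lambda>u. indicator {-1..1} u *\<^sub>R (complex_of_real (tent u) * cis (v * u)))"
    by (rule borel_integrable_compact) (auto intro!: continuous_intros tent_continuous simp: cis_conv_exp)
  also have "(\<lambda>u. indicator {-1..1} u *\<^sub>R (complex_of_real (tent u) * cis (v * u)))
     = (\<lambda>u. complex_of_real (tent u) * cis (v * u))"
    by (auto simp: fun_eq_iff tent_def indicator_def)
  finally show ?thesis .
qed

lemma tent_fourier: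
  assumes v: "v \<noteq> 0"
  shows "(LINT u|lborel. complex_of_real (tent u) * cis (v * u)) = complex_of_real ((2 - 2 * cos v) / v\<^sup>2)"
proof -
  \<comment> \<open>Antiderivative of (a + b u) e^(i v u), found by parts; the tent has this form on
    [-1, 0] and on [0, 1].\<close>
  define F where "F a b u = cis (v * u) * (complex_of_real (a + b * u) / (\<i> * v) + complex_of_real (b / v\<^sup>2))" for a b u :: real
  have F: "(F a b has_vector_derivative (complex_of_real (a + b * u) * cis (v * u))) (at u within S)" for a b u S
  proof -
    have "((\<lambda>z. exp (\<i> * v * z) * ((of_real a + of_real b * z) / (\<i> * v) + of_real b / of_real v ^ 2)) has_field_derivative
            ((of_real a + of_real b * u) * exp (\<i> * v * u))) (at (complex_of_real u))"
      using v by (auto intro!: derivative_eq_intros simp: field_simps power2_eq_square)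
    from has_vector_derivative_real_field[OF this, of S] show ?thesis
      unfolding F_def cis_conv_exp by (simp add: mult_ac)
  qed
  have cF: "continuous_on S (\<lambda>u. complex_of_real (a + b * u) * cis (v * u))" for S a b
    unfolding cis_conv_exp by (intro continuous_intros)
  have 1: "(LINT u|lborel. indicator {-1..0} u *\<^sub>R (complex_of_real (1 + 1 * u) * cis (v * u))) = F 1 1 0 - F 1 1 (-1)"
    by (rule integral_FTC_atLeastAtMost[OF _ F cF]) simp
  have 2: "(LINT u|lborel. indicator {0..1} u *\<^sub>R (complex_of_real (1 + (-1) * u) * cis (v * u))) = F 1 (-1) 1 - F 1 (-1) 0"
    by (rule integral_FTC_atLeastAtMost[OF _ F cF]) simp
  have i: "integrable lborel (\<lambda>u. indicator {c..d} u *\<^sub>R (complex_of_real (a + b * u) * cis (v * u)))" for a b c d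
    by (rule borel_integrable_compact) (auto intro!: continuous_intros simp: cis_conv_exp)
  have "(LINT u|lborel. complex_of_real (tent u) * cis (v * u))
     = (LINT u|lborel. indicator {-1..0} u *\<^sub>R (complex_of_real (1 + 1 * u) * cis (v * u)) +
            indicator {0..1} u *\<^sub>R (complex_of_real (1 + (-1) * u) * cis (v * u)))"
  proof (rule integral_cong_AE)
    show "AE u in lborel. complex_of_real (tent u) * cis (v * u) = indicator {-1..0} u *\<^sub>R (complex_of_real (1 + 1 * u) * cis (v * u)) +
            indicator {0..1} u *\<^sub>R (complex_of_real (1 + (-1) * u) * cis (v * u))"
      using AE_lborel_singleton[of 0] by eventually_elim (auto simp: tent_def indicator_def)
    show "(\<lambda>u. complex_of_real (tent u) * cis (v * u)) \<in> borel_measurable lborel"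
      by (rule borel_measurable_integrable[OF tent_integrable])
  qed (rule borel_measurable_integrable[OF Bochner_Integration.integrable_add[OF i i]])
  also have "\<dots> = (F 1 1 0 - F 1 1 (-1)) + (F 1 (-1) 1 - F 1 (-1) 0)"
    unfolding Bochner_Integration.integral_add[OF i i] 1 2 ..
  also have "\<dots> = complex_of_real ((2 - 2 * cos v) / v\<^sup>2)"
    using v by (auto simp: F_def complex_eq_iff field_simps cis.ctr power2_eq_square)
  finally show ?thesis .
qed

lemma inverse_1_plus_square_integrable: "integrable lborel (\<lambda>x::real. inverse (1 + x\<^sup>2))"
  using integrable_inverse_1_plus_square by (simp add: set_integrable_def)

lemma tent_fourier_integrable: "integrable lborel (\<lambda>v. LINT u|lborel. complex_of_real (tent u) * cis (v * u))"
proof (rule Bochner_Integration.integrable_bound[OF integrable_mult_right[OF inverse_1_plus_square_integrable, of 8]])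
  have [measurable]: "tent \<in> borel_measurable borel" by (rule borel_measurable_continuous_onI[OF tent_continuous])
  show "(\<lambda>v. LINT u|lborel. complex_of_real (tent u) * cis (v * u)) \<in> borel_measurable lborel"
    unfolding cis_conv_exp by measurable
  \<comment> \<open>Small \<open>v\<close>: the support [-1, 1] has length 2. Large
    \<open>v\<close>: the explicit transform is at most 4/v^2. The factor 8 covers both
    cases.\<close>
  have b: "norm (LINT u|lborel. complex_of_real (tent u) * cis (v * u)) \<le> 8 * inverse (1 + v\<^sup>2)" if "v \<noteq> 0" for v
  proof (cases "\<bar>v\<bar> \<le> 1")
    case True
    have "norm (LINT u|lborel. complex_of_real (tent u) * cis (v * u)) \<le> (LINT u|lborel. norm (complex_of_real (tent u) * cis (v * u)))"
      by (rule integral_norm_bound)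
    also have "\<dots> \<le> (LINT u|lborel. indicator {-1..1::real} u *\<^sub>R (1::real))"
    proof (rule Bochner_Integration.integral_mono)
      show "integrable lborel (\<lambda>u. norm (complex_of_real (tent u) * cis (v * u)))"
        by (rule integrable_norm[OF tent_integrable])
      show "integrable lborel (\<lambda>u::real. indicator {-1..1} u *\<^sub>R (1::real))" by (rule borel_integrable_compact) auto
      show "norm (complex_of_real (tent u) * cis (v * u)) \<le> indicator {-1..1} u *\<^sub>R 1" for u
        by (auto simp: norm_mult tent_def indicator_def)
    qed
    also have "\<dots> = 2" by simp
    also have "\<dots> \<le> 8 * inverse (1 + v\<^sup>2)"
    proof -
      have "v\<^sup>2 \<le> 1" using True by (simp add: abs_square_le_1)
      thus ?thesis by (simp add: divide_simps add_pos_nonneg)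
    qed
    finally show ?thesis .
  next
    case False
    hence v2: "v\<^sup>2 \<ge> 1" using power_mono[of 1 "\<bar>v\<bar>" 2] by simp
    have "norm (LINT u|lborel. complex_of_real (tent u) * cis (v * u)) = \<bar>(2 - 2 * cos v) / v\<^sup>2\<bar>"
      unfolding tent_fourier[OF that] norm_of_real ..
    also have "\<dots> \<le> 4 / v\<^sup>2"
    proof -
      have "\<bar>2 - 2 * cos v\<bar> \<le> 4" using cos_ge_minus_one[of v] cos_le_one[of v] by linarith
      thus ?thesis using v2 unfolding abs_divide by (intro frac_le) auto
    qed
    also have "\<dots> \<le> 8 * inverse (1 + v\<^sup>2)" using v2 by (simp add: divide_simps)
    finally show ?thesis .
  qed
  show "AE v in lborel. norm (LINT u|lborel. complex_of_real (tent u) * cis (v * u)) \<le> norm (8 * inverse (1 + v\<^sup>2))"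
    using AE_lborel_singleton[of 0]
  proof eventually_elim
    case (elim v)
    show ?case unfolding real_norm_def by (rule order_trans[OF b[OF elim] abs_ge_self])
  qed
qed

definition tent_bump :: "'a::euclidean_space \<Rightarrow> real \<Rightarrow> 'a \<Rightarrow> real" where
  "tent_bump c \<delta> x = (\<Prod>b\<in>Basis. tent ((x \<bullet> b - c \<bullet> b) / \<delta>))"

text \<open>A nonzero product forces every coordinate of x - c below \<delta>, and the Euclidean
  norm is at most the sum of the coordinates; hence the factor \<open>DIM('a)\<close>.\<close>

lemma tent_bump_zero:
  fixes x :: "'a::euclidean_space" and \<delta> :: real
  assumes "\<delta> > 0" "norm (x - c) \<ge> DIM('a) * \<delta>"
  shows "tent_bump c \<delta> x = 0"
proof (rule ccontr)
  assume "tent_bump c \<delta> x \<noteq> 0"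
  hence "tent ((x \<bullet> b - c \<bullet> b) / \<delta>) \<noteq> 0" if "b \<in> Basis" for b using that by (auto simp: tent_bump_def)
  hence "\<bar>(x - c) \<bullet> b\<bar> < \<delta>" if "b \<in> Basis" for b
    using that assms(1) by (force simp: tent_def max_def abs_divide divide_simps inner_diff_left split: if_splits)
  hence "(\<Sum>b\<in>Basis. \<bar>(x - c) \<bullet> b\<bar>) < (\<Sum>b\<in>(Basis::'a set). \<delta>)"
    by (intro sum_strict_mono) auto
  thus False using norm_le_l1[of "x - c"] assms(2) by simp
qed

lemma tent_bump_nonneg: "tent_bump c \<delta> x \<ge> 0"
  by (auto simp: tent_bump_def tent_def intro!: prod_nonneg)

lemma tent_bump_pos:
  assumes "\<delta> > 0" "norm (x - c) < \<delta>"
  shows "tent_bump c \<delta> x > 0"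
  unfolding tent_bump_def
proof (rule prod_pos)
  fix b :: 'a assume "b \<in> Basis"
  hence "\<bar>(x - c) \<bullet> b\<bar> < \<delta>" using Basis_le_norm[of b "x - c"] assms(2) by simp
  thus "tent ((x \<bullet> b - c \<bullet> b) / \<delta>) > 0"
    using assms(1) by (simp add: tent_def abs_divide inner_diff_left)
qed

text \<open>The transform of a product of one-dimensional tents is the product of their transforms,
  and each of these is a phase times a rescaled tent transform.\<close>

lemma tent_bump_test_fun:
  fixes c :: "'a::euclidean_space"
  assumes d: "\<delta> > 0"
  shows "test_fun (\<lambda>x. complex_of_real (tent_bump c \<delta> x))"
  unfolding test_fun_def
proof (intro conjI)
  have "continuous_on UNIV (\<lambda>x::'a. tent ((x \<bullet> b - c \<bullet> b) / \<delta>))" for b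
    by (rule continuous_on_compose2[OF tent_continuous[of UNIV]]) (use d in \<open>auto intro!: continuous_intros\<close>)
  thus "continuous_on UNIV (\<lambda>x. complex_of_real (tent_bump c \<delta> x))"
    unfolding tent_bump_def by (intro continuous_intros)
  have "norm x \<le> norm c + DIM('a) * \<delta>" if "tent_bump c \<delta> x \<noteq> 0" for x
    using tent_bump_zero[OF d, of x c] that norm_triangle_ineq2[of x c] by linarith
  thus "bounded {x. complex_of_real (tent_bump c \<delta> x) \<noteq> 0}"
    unfolding bounded_iff by auto
  define J where "J b y = (LINT t|lborel. cis (y * t) * complex_of_real (tent ((t - c \<bullet> b) / \<delta>)))" for b y
  have ti: "integrable lborel (\<lambda>t. cis (y * t) * complex_of_real (tent ((t - c \<bullet> b) / \<delta>)))" for b y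
  proof -
    have "integrable lborel (\<lambda>t. (\<lambda>u. complex_of_real (tent u) * cis ((y * \<delta>) * u)) (- ((c \<bullet> b) / \<delta>) + (1 / \<delta>) * t))"
      using d by (intro lborel_integrable_real_affine tent_integrable) auto
    hence "integrable lborel (\<lambda>t. cis (y * (c \<bullet> b)) * (\<lambda>u. complex_of_real (tent u) * cis ((y * \<delta>) * u)) (- ((c \<bullet> b) / \<delta>) + (1 / \<delta>) * t))"
      by (rule integrable_mult_right)
    also have "(\<lambda>t. cis (y * (c \<bullet> b)) * (\<lambda>u. complex_of_real (tent u) * cis ((y * \<delta>) * u)) (- ((c \<bullet> b) / \<delta>) + (1 / \<delta>) * t))
        = (\<lambda>t. cis (y * t) * complex_of_real (tent ((t - c \<bullet> b) / \<delta>)))"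
    proof
      fix t
      have "y * t = y * (c \<bullet> b) + (y * \<delta>) * (- ((c \<bullet> b) / \<delta>) + (1 / \<delta>) * t)" using d by (simp add: field_simps)
      hence "cis (y * t) = cis (y * (c \<bullet> b)) * cis ((y * \<delta>) * (- ((c \<bullet> b) / \<delta>) + (1 / \<delta>) * t))"
        by (simp only: cis_mult)
      moreover have "(t - c \<bullet> b) / \<delta> = - ((c \<bullet> b) / \<delta>) + (1 / \<delta>) * t" by (simp add: diff_divide_distrib)
      ultimately show "cis (y * (c \<bullet> b)) * (\<lambda>u. complex_of_real (tent u) * cis ((y * \<delta>) * u)) (- ((c \<bullet> b) / \<delta>) + (1 / \<delta>) * t)
        = cis (y * t) * complex_of_real (tent ((t - c \<bullet> b) / \<delta>))" by simp
    qed
    finally show ?thesis .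
  qed
  have "inv_fourier (\<lambda>x. complex_of_real (tent_bump c \<delta> x)) xi
       = (\<Prod>b\<in>Basis. J b (xi \<bullet> b)) / complex_of_real ((2 * pi) ^ DIM('a))" for xi
  proof -
    have "cis (xi \<bullet> x) * complex_of_real (tent_bump c \<delta> x) = (\<Prod>b\<in>Basis. cis ((xi \<bullet> b) * (x \<bullet> b)) * complex_of_real (tent ((x \<bullet> b - c \<bullet> b) / \<delta>)))" for x
      unfolding tent_bump_def by (subst euclidean_inner) (simp add: cis_sum prod.distrib)
    hence "(LINT x|lborel. cis (xi \<bullet> x) * complex_of_real (tent_bump c \<delta> x))
       = (LINT x|lborel. (\<Prod>b\<in>Basis. (\<lambda>b t. cis ((xi \<bullet> b) * t) * complex_of_real (tent ((t - c \<bullet> b) / \<delta>))) b (x \<bullet> b)))"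
      by simp
    also have "\<dots> = (\<Prod>b\<in>Basis. J b (xi \<bullet> b))"
      unfolding J_def by (rule lborel_integral_prod_Basis) (rule ti)
    finally show ?thesis by (simp add: inv_fourier_def)
  qed
  moreover have "integrable lborel (J b)" for b
  proof -
    have J: "J b y = \<delta> *\<^sub>R (cis (y * (c \<bullet> b)) * (LINT u|lborel. complex_of_real (tent u) * cis (0 + \<delta> * y * u)))" for y
    proof -
      have "J b y = \<delta> *\<^sub>R (LINT u|lborel. cis (y * (c \<bullet> b + \<delta> * u)) * complex_of_real (tent ((c \<bullet> b + \<delta> * u - c \<bullet> b) / \<delta>)))"
        unfolding J_def using d by (subst lborel_integral_real_affine[where c = \<delta> and t = "c \<bullet> b"]) auto
      also have "(\<lambda>u. cis (y * (c \<bullet> b + \<delta> * u)) * complex_of_real (tent ((c \<bullet> b + \<delta> * u - c \<bullet> b) / \<delta>)))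
        = (\<lambda>u. cis (y * (c \<bullet> b)) * (complex_of_real (tent u) * cis (0 + \<delta> * y * u)))"
        using d by (simp add: fun_eq_iff cis_mult[symmetric] distrib_left mult_ac)
      finally show ?thesis by simp
    qed
    have "integrable lborel (\<lambda>y. LINT u|lborel. complex_of_real (tent u) * cis ((0 + \<delta> * y) * u))"
      using d lborel_integrable_real_affine[OF tent_fourier_integrable, of \<delta> 0] by simp
    hence "integrable lborel (\<lambda>y. cis (y * (c \<bullet> b)) * (LINT u|lborel. complex_of_real (tent u) * cis ((0 + \<delta> * y) * u)))"
    proof (rule Bochner_Integration.integrable_bound)
      have "(\<lambda>y. cis (y * (c \<bullet> b))) \<in> borel_measurable lborel" unfolding cis_conv_exp by measurable
      thus "(\<lambda>y. cis (y * (c \<bullet> b)) * (LINT u|lborel. complex_of_real (tent u) * cis ((0 + \<delta> * y) * u))) \<in> borel_measurable lborel"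
        by (rule borel_measurable_times) (rule borel_measurable_integrable, fact)
    qed (auto simp: norm_mult)
    thus ?thesis unfolding J[abs_def] by (simp add: algebra_simps)
  qed
  ultimately show "integrable lborel (\<lambda>xi. inv_fourier (\<lambda>x. complex_of_real (tent_bump c \<delta> x)) xi)"
    using lborel_integral_prod_Basis(1)[of J] by simp
qed

text \<open>If the difference \<open>d\<close> were nonzero at \<open>x\<close>, multiplication by
  \<open>cnj (d x)\<close> would make its real part positive near \<open>x\<close>. Pairing with a
  nonnegative bump supported there gives zero, so a ball would be a null set.\<close>

lemma inv_fourier_distr_unique:
  fixes g1 g2 :: "'a::euclidean_space \<Rightarrow> complex"
  assumes g1: "is_inv_fourier_distr m g1" "continuous_on (UNIV - {0}) g1"
    and g2: "is_inv_fourier_distr m g2" "continuous_on (UNIV - {0}) g2"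
    and x: "x \<noteq> 0"
  shows "g1 x = g2 x"
proof (rule ccontr)
  assume ne: "g1 x \<noteq> g2 x"
  define d where "d y = g1 y - g2 y" for y
  define f where "f y = Re (cnj (d x) * d y)" for y
  have "continuous_on (UNIV - {0}) f" unfolding f_def d_def by (intro continuous_intros g1 g2)
  hence "isCont f x" using x by (simp add: continuous_on_eq_continuous_at open_delete)
  moreover have "f x > 0"
  proof -
    have "f x = (norm (d x))\<^sup>2" unfolding f_def by (metis Re_complex_of_real complex_norm_square mult.commute)
    thus ?thesis using ne by (simp add: d_def)
  qed
  ultimately obtain r where r: "r > 0" "\<And>y. dist y x < r \<Longrightarrow> f y > 0"
    unfolding continuous_at_eps_delta by (smt (verit) dist_real_def)
  \<comment> \<open>By \<open>tent_bump_zero\<close> the bump then vanishes outside the ball of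
    radius \<open>r\<close> on which \<open>f\<close> is positive.\<close>
  define \<delta> where "\<delta> = r / DIM('a)"
  have d0: "\<delta> > 0" using r by (simp add: \<delta>_def)
  define \<phi> where "\<phi> y = complex_of_real (tent_bump x \<delta> y)" for y
  have tf: "test_fun \<phi>" unfolding \<phi>_def by (rule tent_bump_test_fun[OF d0])
  have zero: "\<phi> y = 0" if "dist y x \<ge> r" for y
    using tent_bump_zero[OF d0, of y x] that unfolding \<phi>_def by (simp add: \<delta>_def dist_norm)
  have int: "integrable lborel (\<lambda>y. g y * \<phi> y)" if "is_inv_fourier_distr m g" for g
    using that by (intro test_fun_mult_integrable tf) (auto simp: is_inv_fourier_distr_def)
  have i: "integrable lborel (\<lambda>y. d y * \<phi> y)"
    using Bochner_Integration.integrable_diff[OF int[OF g1(1)] int[OF g2(1)]] by (simp add: d_def left_diff_distrib)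
  have "(LINT y|lborel. d y * \<phi> y) = (LINT y|lborel. g1 y * \<phi> y) - (LINT y|lborel. g2 y * \<phi> y)"
    unfolding d_def left_diff_distrib by (rule Bochner_Integration.integral_diff[OF int[OF g1(1)] int[OF g2(1)]])
  also have "\<dots> = 0" using g1(1) g2(1) tf by (simp add: is_inv_fourier_distr_def)
  finally have "(LINT y|lborel. cnj (d x) * (d y * \<phi> y)) = 0" by simp
  moreover have i2: "integrable lborel (\<lambda>y. cnj (d x) * (d y * \<phi> y))" using i by simp
  ultimately have "(LINT y|lborel. Re (cnj (d x) * (d y * \<phi> y))) = 0" by (subst integral_Re) auto
  hence e: "(LINT y|lborel. f y * tent_bump x \<delta> y) = 0"
    by (simp add: f_def \<phi>_def algebra_simps)
  have "integrable lborel (\<lambda>y. Re (cnj (d x) * (d y * \<phi> y)))" using i2 by (rule integrable_Re)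
  hence i3: "integrable lborel (\<lambda>y. f y * tent_bump x \<delta> y)" by (simp add: f_def \<phi>_def algebra_simps)
  have nn: "f y * tent_bump x \<delta> y \<ge> 0" for y
  proof (cases "dist y x < r")
    case True thus ?thesis using r(2)[of y] tent_bump_nonneg[of x \<delta> y] by simp
  next
    case False thus ?thesis using zero[of y] by (simp add: \<phi>_def)
  qed
  have "AE y in lborel. f y * tent_bump x \<delta> y = 0"
    using e by (subst (asm) integral_nonneg_eq_0_iff_AE[OF i3]) (use nn in auto)
  hence ae: "AE y in lborel. y \<notin> ball x (min r \<delta>)"
  proof eventually_elim
    case (elim y)
    thus ?case using r(2)[of y] tent_bump_pos[OF d0, of y x] by (auto simp: dist_norm norm_minus_commute)
  qed
  have "ball x (min r \<delta>) \<in> null_sets lborel"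
    using ae by (subst (asm) AE_iff_null) (auto simp: ball_def)
  hence "negligible (ball x (min r \<delta>))"
    unfolding negligible_iff_null_sets by (rule null_sets_completionI)
  thus False using open_not_negligible[of "ball x (min r \<delta>)"] r d0 by auto
qed

text \<open>Uniqueness resolves the definite description as soon as one representative continuous
  away from the origin is exhibited.\<close>

lemma G_eps_eqI:
  fixes x :: "'a::euclidean_space"
  assumes "is_inv_fourier_distr (frac_symbol s k \<epsilon>) g" "continuous_on (UNIV - {0}) g" "x \<noteq> 0"
  shows "G_eps s k \<epsilon> x = g x"
  unfolding G_eps_def using assms inv_fourier_distr_unique by (intro the_equality) blast+

section \<open>Yukawa potentials\<close>

text \<open>\<open>has_absolute_integral_change_of_variables_1'\<close> is about Lebesgue measure;
  Borel measurability of both integrands lets completion carry integrability and value over to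
  \<open>lborel\<close>.\<close>

lemma lborel_substitution:
  fixes f g h :: "real \<Rightarrow> real"
  assumes S: "S \<in> sets borel" "g ` S \<in> sets borel"
    and der: "\<And>x. x \<in> S \<Longrightarrow> (g has_field_derivative h x) (at x)"
    and inj: "inj_on g S"
    and f[measurable]: "f \<in> borel_measurable borel"
    and hf[measurable]: "(\<lambda>x. \<bar>h x\<bar> * f (g x)) \<in> borel_measurable borel"
  shows "set_integrable lborel (g ` S) f \<longleftrightarrow> set_integrable lborel S (\<lambda>x. \<bar>h x\<bar> * f (g x))" (is ?A)
    and "set_integrable lborel S (\<lambda>x. \<bar>h x\<bar> * f (g x)) \<Longrightarrow>
           (LINT x:g ` S|lborel. f x) = (LINT x:S|lborel. \<bar>h x\<bar> * f (g x))"
proof -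
  note [measurable] = S
  have S': "S \<in> sets lebesgue" using S by auto
  have d: "\<And>x. x \<in> S \<Longrightarrow> (g has_field_derivative h x) (at x within S)"
    using der has_field_derivative_at_within by blast
  have c1: "set_integrable lebesgue (g ` S) f \<longleftrightarrow> set_integrable lborel (g ` S) f"
    unfolding set_integrable_def by (rule integrable_completion) measurable
  have c2: "set_integrable lebesgue S (\<lambda>x. \<bar>h x\<bar> * f (g x)) \<longleftrightarrow> set_integrable lborel S (\<lambda>x. \<bar>h x\<bar> * f (g x))"
    unfolding set_integrable_def by (rule integrable_completion) measurable
  note ch = has_absolute_integral_change_of_variables_1'[OF S' d inj, of f]
  show ?A unfolding c1[symmetric] c2[symmetric] using ch by blast
  assume i: "set_integrable lborel S (\<lambda>x. \<bar>h x\<bar> * f (g x))"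
  hence i': "set_integrable lebesgue S (\<lambda>x. \<bar>h x\<bar> * f (g x))" using c2 by simp
  hence j: "set_integrable lebesgue (g ` S) f" "integral (g ` S) f = integral S (\<lambda>x. \<bar>h x\<bar> * f (g x))"
    using ch by blast+
  have "(LINT x:g ` S|lborel. f x) = (LINT x:g ` S|lebesgue. f x)"
    unfolding set_lebesgue_integral_def by (rule integral_completion[symmetric]) measurable
  also have "\<dots> = (LINT x:S|lebesgue. \<bar>h x\<bar> * f (g x))"
    using set_lebesgue_integral_eq_integral(2)[OF i'] set_lebesgue_integral_eq_integral(2)[OF j(1)] j(2) by simp
  also have "\<dots> = (LINT x:S|lborel. \<bar>h x\<bar> * f (g x))"
    unfolding set_lebesgue_integral_def by (rule integral_completion) measurable
  finally show "(LINT x:g ` S|lborel. f x) = (LINT x:S|lborel. \<bar>h x\<bar> * f (g x))" .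
qed

lemma exp_integrable: "r > 0 \<Longrightarrow> set_integrable lborel {0<..} (\<lambda>w::real. exp (- r * w))"
  using integrable_I0i_exp_mscale[of r] by (simp add: mult.commute)

lemma exponential_integral:
  assumes "c > (0::real)"
  shows "integrable lborel (\<lambda>t. indicator {0<..} t *\<^sub>R exp (- c * t))"
    and "(LINT t|lborel. indicator {0<..} t *\<^sub>R exp (- c * t)) = 1 / c"
proof -
  show "integrable lborel (\<lambda>t. indicator {0<..} t *\<^sub>R exp (- c * t))"
    using exp_integrable[OF assms] by (simp only: set_integrable_def)
  have "(LINT t:{0<..}|lborel. exp (- (t * c))) = 1 / c"
    using LBINT_I0i_exp_mscale[OF assms] by (simp add: interval_lebesgue_integral_0_infty divide_inverse)
  thus "(LINT t|lborel. indicator {0<..} t *\<^sub>R exp (- c * t)) = 1 / c"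
    by (simp add: set_lebesgue_integral_def mult.commute)
qed

lemma image_square_pos: "(\<lambda>y::real. y\<^sup>2) ` {0<..} = {0<..}"
proof (intro equalityI subsetI)
  fix x :: real assume "x \<in> {0<..}"
  thus "x \<in> (\<lambda>y::real. y\<^sup>2) ` {0<..}" by (intro image_eqI[of _ _ "sqrt x"]) auto
qed auto

text \<open>The singularity at 0 disappears under w = y^2, which leaves a Gaussian.\<close>

lemma exp_over_sqrt_integrable:
  assumes r: "r > 0" shows "set_integrable lborel {0<..} (\<lambda>w::real. exp (- r * w) / sqrt w)"
proof -
  note im = image_square_pos
  have "set_integrable lborel ((\<lambda>y::real. y\<^sup>2) ` {0<..}) (\<lambda>w. exp (- r * w) / sqrt w)
      \<longleftrightarrow> set_integrable lborel {0<..} (\<lambda>y. \<bar>2 * y\<bar> * (exp (- r * y\<^sup>2) / sqrt (y\<^sup>2)))"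
  proof (rule lborel_substitution(1))
    show "inj_on (\<lambda>y::real. y\<^sup>2) {0<..}" by (auto simp: inj_on_def)
  qed (auto intro!: derivative_eq_intros simp: im)
  also have "\<dots> \<longleftrightarrow> set_integrable lborel {0<..} (\<lambda>y. 2 * exp (- r * y\<^sup>2))"
    by (rule set_integrable_cong) auto
  also have "\<dots>" unfolding set_integrable_def
    by (intro integrable_mult_indicator) (use gaussian_integrable[OF r] in auto)
  finally show ?thesis unfolding im by simp
qed

text \<open>Since z cosh v = z + 2 z sinh(v/2)^2, the substitution y = sqrt(2 z) sinh(v/2) leaves
  the Gaussian integral. The value is 2 K_(1/2)(z), with K the Macdonald function.\<close>

lemma cosh_half_integral:
  assumes z: "z > 0"
  shows "integrable lborel (\<lambda>v. cosh (v / 2) * exp (- z * cosh v))"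
    and "(LINT v|lborel. cosh (v / 2) * exp (- z * cosh v)) = sqrt (2 * pi / z) * exp (- z)"
proof -
  define c where "c = sqrt (2 * z)"
  have c: "c > 0" "c\<^sup>2 = 2 * z" using z by (auto simp: c_def)
  define g where "g v = c * sinh (v / 2)" for v
  have ch: "cosh v = 1 + 2 * (sinh (v/2))\<^sup>2" for v :: real
    using cosh_double[of "v/2"] cosh_square_eq[of "v/2"] by simp
  have im: "g ` UNIV = UNIV"
  proof (intro equalityI subsetI)
    fix y
    show "y \<in> g ` UNIV" by (rule image_eqI[of _ _ "2 * arsinh (y / c)"]) (use c in \<open>auto simp: g_def\<close>)
  qed auto
  have e: "\<bar>c / 2 * cosh (v/2)\<bar> * exp (- 1 * (g v)\<^sup>2) = (c / 2 * exp z) * (cosh (v / 2) * exp (- z * cosh v))" for v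
  proof -
    have "z + - z * cosh v = - 1 * (g v)\<^sup>2" unfolding ch g_def power_mult_distrib c by (simp add: algebra_simps)
    hence "exp z * exp (- z * cosh v) = exp (- 1 * (g v)\<^sup>2)" by (metis exp_add)
    thus ?thesis using c by (simp add: abs_mult mult_ac)
  qed
  have der: "(g has_field_derivative c / 2 * cosh (v/2)) (at v)" for v
    unfolding g_def by (auto intro!: derivative_eq_intros)
  have inj: "inj_on g UNIV" using c by (auto simp: inj_on_def g_def)
  have gm[measurable]: "g \<in> borel_measurable borel"
    unfolding g_def by (intro borel_measurable_continuous_onI continuous_intros) auto
  have m: "(\<lambda>v. \<bar>c / 2 * cosh (v/2)\<bar> * exp (- 1 * (g v)\<^sup>2)) \<in> borel_measurable borel"
    unfolding g_def by (intro borel_measurable_continuous_onI continuous_intros) auto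
  have "set_integrable lborel (g ` UNIV) (\<lambda>y. exp (- 1 * y\<^sup>2))"
    using gaussian_integrable[of 1] unfolding im set_integrable_def by simp
  hence i: "set_integrable lborel UNIV (\<lambda>v. \<bar>c / 2 * cosh (v/2)\<bar> * exp (- 1 * (g v)\<^sup>2))"
    using lborel_substitution(1)[of UNIV g "\<lambda>v. c / 2 * cosh (v/2)" "\<lambda>y. exp (- 1 * y\<^sup>2)", OF _ _ der inj _ m] im by simp
  hence "integrable lborel (\<lambda>v. (c / 2 * exp z) * (cosh (v / 2) * exp (- z * cosh v)))"
    unfolding e set_integrable_def by simp
  hence "integrable lborel (\<lambda>v. 1 / (c / 2 * exp z) * ((c / 2 * exp z) * (cosh (v / 2) * exp (- z * cosh v))))"
    by (rule integrable_mult_right)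
  moreover have "1 / (c / 2 * exp z) * ((c / 2 * exp z) * y) = y" for y using c by simp
  ultimately show ii: "integrable lborel (\<lambda>v. cosh (v / 2) * exp (- z * cosh v))" by (simp only:)
  have "(LINT y:g ` UNIV|lborel. exp (- 1 * y\<^sup>2)) = (LINT v:UNIV|lborel. \<bar>c / 2 * cosh (v/2)\<bar> * exp (- 1 * (g v)\<^sup>2))"
    using lborel_substitution(2)[of UNIV g "\<lambda>v. c / 2 * cosh (v/2)" "\<lambda>y. exp (- 1 * y\<^sup>2)", OF _ _ der inj _ m i] im by simp
  hence "(LINT y|lborel. exp (- y\<^sup>2)) = (c / 2 * exp z) * (LINT v|lborel. cosh (v / 2) * exp (- z * cosh v))"
    unfolding im e set_lebesgue_integral_def by simp
  moreover have "complex_of_real (LINT y|lborel. exp (- y\<^sup>2)) = complex_of_real (sqrt pi)"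
    using gaussian_fourier_1[of 1 0] by simp
  ultimately have "sqrt pi = (c / 2 * exp z) * (LINT v|lborel. cosh (v / 2) * exp (- z * cosh v))" by simp
  moreover have "sqrt pi * exp (-z) * 2 / c = sqrt (2 * pi / z) * exp (- z)"
    using z by (simp add: c_def real_sqrt_mult real_sqrt_divide field_simps)
  ultimately show "(LINT v|lborel. cosh (v / 2) * exp (- z * cosh v)) = sqrt (2 * pi / z) * exp (- z)"
    using c by (simp add: exp_minus field_simps)
qed

text \<open>Reflection of \<open>v\<close> exchanges the two signs, and their sum is twice the
  integrand with \<open>cosh (v / 2)\<close>. The sign 1 serves dimension one, the sign -1 dimension
  three.\<close>

lemma exp_half_integral:
  assumes z: "z > 0" and \<sigma>: "\<sigma> = 1 \<or> \<sigma> = -1"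
  shows "integrable lborel (\<lambda>v. exp (\<sigma> * v / 2) * exp (- z * cosh v))"
    and "(LINT v|lborel. exp (\<sigma> * v / 2) * exp (- z * cosh v)) = sqrt (2 * pi / z) * exp (- z)"
proof -
  let ?k = "\<lambda>s v. exp (s * v / 2) * exp (- z * cosh v)"
  have k: "?k 1 v + ?k (-1) v = 2 * (cosh (v / 2) * exp (- z * cosh v))" for v
    by (simp add: cosh_def algebra_simps)
  have i: "integrable lborel (?k s)" if "s = 1 \<or> s = -1" for s
  proof (rule Bochner_Integration.integrable_bound[OF integrable_mult_right[OF cosh_half_integral(1)[OF z], of 2]])
    show "?k s \<in> borel_measurable lborel"
      by (simp, intro borel_measurable_continuous_onI continuous_intros) auto
    show "AE v in lborel. norm (?k s v) \<le> norm (2 * (cosh (v / 2) * exp (- z * cosh v)))"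
      unfolding k[symmetric] using that by (intro AE_I2) (auto simp: abs_mult)
  qed
  show "integrable lborel (?k \<sigma>)" by (rule i[OF \<sigma>])
  have "(LINT v|lborel. ?k 1 v) = (LINT v|lborel. ?k (-1) v)"
    by (subst lborel_integral_real_affine[where c = "-1" and t = 0]) auto
  moreover have "(LINT v|lborel. ?k 1 v) + (LINT v|lborel. ?k (-1) v) = 2 * (LINT v|lborel. cosh (v / 2) * exp (- z * cosh v))"
    by (subst Bochner_Integration.integral_add[symmetric]) (use i in \<open>auto simp only: k integral_mult_right_zero\<close>)
  ultimately show "(LINT v|lborel. ?k \<sigma> v) = sqrt (2 * pi / z) * exp (- z)"
    using \<sigma> cosh_half_integral(2)[OF z] by auto
qed

text \<open>Two forms of 2 K_0(q r), related by w = q (cosh v - 1) on the half-line and evenness in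
  \<open>v\<close>. In the second form \<open>q\<close> occurs only in an exponential prefactor and
  under the root, and this form continues to complex wave numbers.\<close>

lemma cosh_integral:
  assumes q: "q > 0" and r: "r > 0"
  shows "integrable lborel (\<lambda>v. exp (- (q * r) * cosh v))"
    and "set_integrable lborel {0<..} (\<lambda>w. exp (- r * w) / sqrt (w\<^sup>2 + 2 * q * w))"
    and "(LINT v|lborel. exp (- (q * r) * cosh v)) = 2 * exp (- q * r) * (LINT w:{0<..}|lborel. exp (- r * w) / sqrt (w\<^sup>2 + 2 * q * w))"
proof -
  define g where "g v = q * (cosh v - 1)" for v :: real
  define f where "f w = exp (- r * w) / sqrt (w\<^sup>2 + 2 * q * w)" for w
  have fm[measurable]: "f \<in> borel_measurable borel" unfolding f_def by measurable
  show fi: "set_integrable lborel {0<..} (\<lambda>w. exp (- r * w) / sqrt (w\<^sup>2 + 2 * q * w))"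
    unfolding f_def[symmetric] set_integrable_def
  proof (rule Bochner_Integration.integrable_bound)
    show "integrable lborel (\<lambda>w. indicator {0<..} w *\<^sub>R (exp (- r * w) / sqrt w * (1 / sqrt (2 * q))))"
      using integrable_mult_left[OF exp_over_sqrt_integrable[OF r, unfolded set_integrable_def], of "1 / sqrt (2 * q)"]
      by (simp only: real_scaleR_def mult.assoc)
    have "f w \<le> exp (- r * w) / sqrt w * (1 / sqrt (2 * q))" if "w > 0" for w
    proof -
      have "sqrt w * sqrt (2 * q) \<le> sqrt (w\<^sup>2 + 2 * q * w)" using that q
        by (simp flip: real_sqrt_mult)
      hence "exp (- r * w) / sqrt (w\<^sup>2 + 2 * q * w) \<le> exp (- r * w) / (sqrt w * sqrt (2 * q))"
        by (rule divide_left_mono) (use that q in \<open>auto intro!: mult_pos_pos add_pos_pos\<close>)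
      thus ?thesis by (simp add: f_def)
    qed
    thus "AE w in lborel. norm (indicator {0<..} w *\<^sub>R f w) \<le> norm (indicator {0<..} w *\<^sub>R (exp (- r * w) / sqrt w * (1 / sqrt (2 * q))))"
      using q by (intro AE_I2) (auto simp: indicator_def f_def abs_mult add_nonneg_nonneg)
  qed measurable
  have c1: "cosh v > 1" if "v > 0" for v :: real
    using that cosh_real_strict_mono[of 0 v] by simp
  have im: "g ` {0<..} = {0<..}"
  proof (intro equalityI subsetI)
    fix w :: real assume w: "w \<in> {0<..}"
    show "w \<in> g ` {0<..}"
    proof (rule image_eqI[of _ _ "arcosh (1 + w / q)"])
      have "1 + w / q > 1" using w q by simp
      thus "w = g (arcosh (1 + w / q))" "arcosh (1 + w / q) \<in> {0<..}"
        using w q by (auto simp: g_def)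
    qed
  qed (use c1 q in \<open>auto simp: g_def\<close>)
  have inj: "inj_on g {0<..}"
    using q by (auto simp: inj_on_def g_def cosh_real_eq_iff)
  have der: "(g has_field_derivative q * sinh v) (at v)" for v
    unfolding g_def by (auto intro!: derivative_eq_intros)
  have gm[measurable]: "g \<in> borel_measurable borel" unfolding g_def by (intro borel_measurable_continuous_onI continuous_intros)
  have sm[measurable]: "sinh \<in> borel_measurable (borel :: real measure)" by (intro borel_measurable_continuous_onI continuous_intros)
  have e: "\<bar>q * sinh v\<bar> * f (g v) = exp (q * r) * exp (- (q * r) * cosh v)" if "v > 0" for v
  proof -
    have "(g v)\<^sup>2 + 2 * q * g v = (q * sinh v)\<^sup>2"
      unfolding g_def power_mult_distrib sinh_square_eq by (simp add: power2_eq_square algebra_simps)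
    hence "sqrt ((g v)\<^sup>2 + 2 * q * g v) = \<bar>q * sinh v\<bar>" by (simp only: real_sqrt_abs)
    moreover have "sinh v \<noteq> 0" using that by simp
    moreover have "- r * g v = q * r + - (q * r) * cosh v" by (simp add: g_def algebra_simps)
    hence "exp (- r * g v) = exp (q * r) * exp (- (q * r) * cosh v)" by (simp only: exp_add)
    ultimately show ?thesis using q by (simp add: f_def)
  qed
  have hm: "(\<lambda>v. \<bar>q * sinh v\<bar> * f (g v)) \<in> borel_measurable borel" by measurable
  have "set_integrable lborel (g ` {0<..}) f" using fi unfolding im f_def .
  hence i: "set_integrable lborel {0<..} (\<lambda>v. \<bar>q * sinh v\<bar> * f (g v))"
    using lborel_substitution(1)[of "{0<..}" g "\<lambda>v. q * sinh v" f, OF _ _ der inj fm hm] im by simp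
  moreover have "set_integrable lborel {0<..} (\<lambda>v. \<bar>q * sinh v\<bar> * f (g v))
      \<longleftrightarrow> set_integrable lborel {0<..} (\<lambda>v. exp (q * r) * exp (- (q * r) * cosh v))"
    by (rule set_integrable_cong) (auto simp only: e greaterThan_iff)
  ultimately have "set_integrable lborel {0<..} (\<lambda>v. exp (q * r) * exp (- (q * r) * cosh v))" by simp
  hence i2: "set_integrable lborel {0<..} (\<lambda>v. exp (- (q * r) * cosh v))" by simp
  define k where "k v = exp (- (q * r) * cosh v)" for v
  have i2': "integrable lborel (\<lambda>v. indicator {0<..} v * k v)" using i2 by (simp add: set_integrable_def k_def)
  have i3: "integrable lborel (\<lambda>v. indicator {0<..} (-v) * k v)"
    using lborel_integrable_real_affine[OF i2', of "-1" 0] by (simp add: k_def)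
  have eq: "AE v in lborel. k v = indicator {0<..} v * k v + indicator {0<..} (-v) * k v"
    using AE_lborel_singleton[of 0] by eventually_elim (auto simp: indicator_def)
  have km: "k \<in> borel_measurable lborel" unfolding k_def by (simp, intro borel_measurable_continuous_onI continuous_intros)
  have si: "integrable lborel (\<lambda>v. indicator {0<..} v * k v + indicator {0<..} (-v) * k v)"
    using i2' i3 by simp
  show "integrable lborel (\<lambda>v. exp (- (q * r) * cosh v))" unfolding k_def[symmetric]
    using integrable_cong_AE[OF km borel_measurable_integrable[OF si] eq] si by simp
  have "(LINT v|lborel. k v) = (LINT v|lborel. indicator {0<..} v * k v) + (LINT v|lborel. indicator {0<..} (-v) * k v)"
    using integral_cong_AE[OF km borel_measurable_integrable[OF si] eq] Bochner_Integration.integral_add[OF i2' i3] by simp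
  also have "(LINT v|lborel. indicator {0<..} (-v) * k v) = (LINT v|lborel. indicator {0<..} v * k v)"
    by (subst lborel_integral_real_affine[where c = "-1" and t = 0]) (auto simp: k_def)
  finally have A: "(LINT v|lborel. k v) = 2 * (LINT v:{0<..}|lborel. k v)" by (simp add: set_lebesgue_integral_def)
  have "(LINT w:g ` {0<..}|lborel. f w) = (LINT v:{0<..}|lborel. \<bar>q * sinh v\<bar> * f (g v))"
    using lborel_substitution(2)[of "{0<..}" g "\<lambda>v. q * sinh v" f, OF _ _ der inj fm hm i] im by simp
  also have "\<dots> = (LINT v:{0<..}|lborel. exp (q * r) * k v)"
    by (rule set_lebesgue_integral_cong) (auto simp: e k_def)
  also have "\<dots> = exp (q * r) * (LINT v:{0<..}|lborel. k v)" by simp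
  finally have "(LINT v:{0<..}|lborel. k v) = exp (- q * r) * (LINT w:{0<..}|lborel. f w)"
    unfolding im by (simp add: exp_minus)
  thus "(LINT v|lborel. exp (- (q * r) * cosh v)) = 2 * exp (- q * r) * (LINT w:{0<..}|lborel. exp (- r * w) / sqrt (w\<^sup>2 + 2 * q * w))"
    using A by (simp add: k_def f_def)
qed

abbreviation heat_factor :: "nat \<Rightarrow> real \<Rightarrow> real \<Rightarrow> real" where
  "heat_factor n r \<tau> \<equiv> exp (- (r\<^sup>2 / (4 * \<tau>))) / sqrt (4 * pi * \<tau>) ^ n"

text \<open>With \<tau> = r/(2 q) e^v the exponent q^2 \<tau> + r^2/(4 \<tau>) takes the symmetric
  form q r cosh v.\<close>

lemma heat_time_substitution:
  assumes q: "q > 0" and r: "r > 0"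
  shows "set_integrable lborel {0<..} (\<lambda>\<tau>. exp (- q\<^sup>2 * \<tau>) * heat_factor n r \<tau>)
     \<longleftrightarrow> integrable lborel (\<lambda>v. (r / (2 * q) * exp v) * (exp (- (q * r) * cosh v) / sqrt (4 * pi * (r / (2 * q) * exp v)) ^ n))" (is "?L = ?R")
    and "integrable lborel (\<lambda>v. (r / (2 * q) * exp v) * (exp (- (q * r) * cosh v) / sqrt (4 * pi * (r / (2 * q) * exp v)) ^ n)) \<Longrightarrow> (LINT \<tau>:{0<..}|lborel. exp (- q\<^sup>2 * \<tau>) * heat_factor n r \<tau>)
      = (LINT v|lborel. (r / (2 * q) * exp v) * (exp (- (q * r) * cosh v) / sqrt (4 * pi * (r / (2 * q) * exp v)) ^ n))"
proof -
  define g where "g v = r / (2 * q) * exp v" for v :: real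
  define f where "f \<tau> = exp (- q\<^sup>2 * \<tau>) * heat_factor n r \<tau>" for \<tau>
  have [measurable]: "f \<in> borel_measurable borel" "g \<in> borel_measurable borel" unfolding f_def g_def by measurable
  have im: "g ` UNIV = {0<..}"
  proof (intro equalityI subsetI)
    fix y :: real assume "y \<in> {0<..}"
    thus "y \<in> g ` UNIV" by (intro image_eqI[of _ _ "ln (2 * q * y / r)"]) (use q r in \<open>auto simp: g_def\<close>)
  qed (use q r in \<open>auto simp: g_def\<close>)
  have inj: "inj_on g UNIV" using q r by (auto simp: inj_on_def g_def)
  have der: "(g has_field_derivative g v) (at v)" for v
    unfolding g_def using q by (auto intro!: derivative_eq_intros)
  have g0: "g v > 0" for v using q r by (simp add: g_def)
  have e: "\<bar>g v\<bar> * f (g v) = g v * (exp (- (q * r) * cosh v) / sqrt (4 * pi * g v) ^ n)" for v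
  proof -
    have "- q\<^sup>2 * g v + - (r\<^sup>2 / (4 * g v)) = - (q * r) * cosh v"
      using q r by (simp add: g_def cosh_def exp_minus field_simps power2_eq_square)
    hence "exp (- q\<^sup>2 * g v) * exp (- (r\<^sup>2 / (4 * g v))) = exp (- (q * r) * cosh v)" by (metis exp_add)
    thus ?thesis using g0[of v] by (simp add: f_def)
  qed
  have m: "(\<lambda>v. \<bar>g v\<bar> * f (g v)) \<in> borel_measurable borel" by measurable
  show "?L = ?R"
    using lborel_substitution(1)[of UNIV g g f, OF _ _ der inj _ m] unfolding im e
    unfolding f_def g_def set_integrable_def by simp
  assume "integrable lborel (\<lambda>v. (r / (2 * q) * exp v) * (exp (- (q * r) * cosh v) / sqrt (4 * pi * (r / (2 * q) * exp v)) ^ n))"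
  hence "set_integrable lborel UNIV (\<lambda>v. \<bar>g v\<bar> * f (g v))" unfolding e unfolding g_def set_integrable_def by simp
  thus "(LINT \<tau>:{0<..}|lborel. exp (- q\<^sup>2 * \<tau>) * heat_factor n r \<tau>)
      = (LINT v|lborel. (r / (2 * q) * exp v) * (exp (- (q * r) * cosh v) / sqrt (4 * pi * (r / (2 * q) * exp v)) ^ n))"
    using lborel_substitution(2)[of UNIV g g f, OF _ _ der inj _ m] unfolding im e
    unfolding f_def g_def set_lebesgue_integral_def by simp
qed

text \<open>The fundamental solution of -Laplace + q^2 in terms of the radius. For
  \<open>n = 2\<close> the formula is K_0(q r)/(2 pi) written as a Laplace integral; the last branch
  is meant for dimension three.\<close>

definition yukawa_kernel :: "nat \<Rightarrow> real \<Rightarrow> real \<Rightarrow> real" where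
  "yukawa_kernel n q r = (if n = 1 then exp (- q * r) / (2 * q)
     else if n = 2 then exp (- q * r) / (2 * pi) * (LINT w:{0<..}|lborel. exp (- r * w) / sqrt (w\<^sup>2 + 2 * q * w))
     else exp (- q * r) / (4 * pi * r))"

text \<open>After the substitution the integrand is a constant times e^((1 - n/2) v) exp(-q r cosh
  v), so the three dimensions lead to the Macdonald integrals of order 1/2, 0 and 1/2.\<close>

lemma yukawa_kernel_heat:
  assumes q: "q > 0" and r: "r > 0" and n: "n \<in> {1, 2, 3}"
  shows "set_integrable lborel {0<..} (\<lambda>\<tau>. exp (- q\<^sup>2 * \<tau>) * heat_factor n r \<tau>)"
    and "(LINT \<tau>:{0<..}|lborel. exp (- q\<^sup>2 * \<tau>) * heat_factor n r \<tau>) = yukawa_kernel n q r"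
proof -
  let ?f = "\<lambda>v. (r / (2 * q) * exp v) * (exp (- (q * r) * cosh v) / sqrt (4 * pi * (r / (2 * q) * exp v)) ^ n)"
  have qr: "q * r > 0" using q r by simp
  have sq: "sqrt (exp v) = exp (v / 2)" for v :: real
    by (rule real_sqrt_unique) (auto simp: power2_eq_square simp flip: exp_add)
  have "integrable lborel ?f \<and> (LINT v|lborel. ?f v) = yukawa_kernel n q r"
  proof -
    consider "n = 1" | "n = 2" | "n = 3" using n by auto
    thus ?thesis
    proof cases
      case 1
      have f_eq: "?f v = sqrt (r / (8 * pi * q)) * (exp (1 * v / 2) * exp (- (q * r) * cosh v))" for v
      proof -
        define G where "G = r / (2 * q) * exp v"
        have G: "G > 0" using q r by (simp add: G_def)
        have "G / sqrt (4 * pi * G) = sqrt (G / (4 * pi))" using G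
          by (simp add: real_sqrt_mult real_sqrt_divide real_div_sqrt field_simps)
        also have "\<dots> = sqrt (r / (8 * pi * q) * exp v)" using q by (simp add: G_def field_simps)
        also have "\<dots> = sqrt (r / (8 * pi * q)) * exp (v / 2)" by (simp only: real_sqrt_mult sq)
        finally have A: "G / sqrt (4 * pi * G) = sqrt (r / (8 * pi * q)) * exp (v / 2)" .
        have "G * (exp (- (q * r) * cosh v) / sqrt (4 * pi * G) ^ n) = G / sqrt (4 * pi * G) * exp (- (q * r) * cosh v)"
          unfolding 1 by simp
        thus ?thesis unfolding G_def[symmetric] A by simp
      qed
      have K: "sqrt (r / (8 * pi * q)) * sqrt (2 * pi / (q * r)) = 1 / (2 * q)"
      proof -
        have "r / (8 * pi * q) * (2 * pi / (q * r)) = (1 / (2 * q))\<^sup>2" using q r by (simp add: power2_eq_square field_simps)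
        thus ?thesis using q by (simp flip: real_sqrt_mult)
      qed
      have "integrable lborel ?f" unfolding f_eq using exp_half_integral(1)[OF qr, of 1] by simp
      moreover have "(LINT v|lborel. ?f v) = sqrt (r / (8 * pi * q)) * (sqrt (2 * pi / (q * r)) * exp (- (q * r)))"
        unfolding f_eq by (subst Bochner_Integration.integral_mult_right_zero, subst exp_half_integral(2)[OF qr]) auto
      hence "(LINT v|lborel. ?f v) = 1 / (2 * q) * exp (- (q * r))"
        by (simp only: mult.assoc[symmetric] K)
      ultimately show ?thesis by (simp add: yukawa_kernel_def 1)
    next
      case 2
      have "?f v = 1 / (4 * pi) * exp (- (q * r) * cosh v)" for v
        using q r unfolding 2 by simp
      thus ?thesis using cosh_integral[OF q r] 2 by (simp add: yukawa_kernel_def)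
    next
      case 3
      have f_eq: "?f v = sqrt (q / (32 * pi ^ 3 * r)) * (exp (-1 * v / 2) * exp (- (q * r) * cosh v))" for v
      proof -
        define G where "G = r / (2 * q) * exp v"
        have G: "G > 0" using q r by (simp add: G_def)
        have "G / sqrt (4 * pi * G) ^ 3 = 1 / (4 * pi * sqrt (4 * pi * G))" using G
          by (simp add: power3_eq_cube)
        also have "\<dots> = sqrt (1 / ((4 * pi)\<^sup>2 * (4 * pi * G)))"
          by (simp add: real_sqrt_divide real_sqrt_mult)
        also have "1 / ((4 * pi)\<^sup>2 * (4 * pi * G)) = q / (32 * pi ^ 3 * r) * exp (- v)"
          using q r by (simp add: G_def exp_minus field_simps power2_eq_square power3_eq_cube)
        also have "sqrt \<dots> = sqrt (q / (32 * pi ^ 3 * r)) * exp (-1 * v / 2)" by (simp only: real_sqrt_mult sq) simp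
        finally have A: "G / sqrt (4 * pi * G) ^ 3 = sqrt (q / (32 * pi ^ 3 * r)) * exp (-1 * v / 2)" .
        have "G * (exp (- (q * r) * cosh v) / sqrt (4 * pi * G) ^ n) = G / sqrt (4 * pi * G) ^ 3 * exp (- (q * r) * cosh v)"
          unfolding 3 by (simp only: times_divide_eq_right times_divide_eq_left)
        thus ?thesis unfolding G_def[symmetric] A by (simp only: mult.assoc)
      qed
      have K: "sqrt (q / (32 * pi ^ 3 * r)) * sqrt (2 * pi / (q * r)) = 1 / (4 * pi * r)"
      proof -
        have "q / (32 * pi ^ 3 * r) * (2 * pi / (q * r)) = (1 / (4 * pi * r))\<^sup>2"
          using q r by (simp add: power2_eq_square power3_eq_cube field_simps)
        thus ?thesis using r by (simp flip: real_sqrt_mult)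
      qed
      have "integrable lborel ?f" unfolding f_eq using exp_half_integral(1)[OF qr, of "-1"] by simp
      moreover have "(LINT v|lborel. ?f v) = sqrt (q / (32 * pi ^ 3 * r)) * (sqrt (2 * pi / (q * r)) * exp (- (q * r)))"
        unfolding f_eq by (subst Bochner_Integration.integral_mult_right_zero, subst exp_half_integral(2)[OF qr]) auto
      hence "(LINT v|lborel. ?f v) = 1 / (4 * pi * r) * exp (- (q * r))"
        by (simp only: mult.assoc[symmetric] K)
      ultimately show ?thesis by (simp add: yukawa_kernel_def 3)
    qed
  qed
  thus "set_integrable lborel {0<..} (\<lambda>\<tau>. exp (- q\<^sup>2 * \<tau>) * heat_factor n r \<tau>)"
    and "(LINT \<tau>:{0<..}|lborel. exp (- q\<^sup>2 * \<tau>) * heat_factor n r \<tau>) = yukawa_kernel n q r"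
    using heat_time_substitution[OF q r, of n] by simp_all
qed

section \<open>Helmholtz kernels\<close>

text \<open>The root of w^2 - 2 i \<kappa> w, which is w^2 + 2 q w at \<kappa> = i q, is split into
  two factors: for w > 0 the radicand of the second one stays off the branch cut for all \<kappa> in
  \<open>half_planes 0\<close>.\<close>

abbreviation hankel_integrand :: "complex \<Rightarrow> complex \<Rightarrow> real \<Rightarrow> complex" where
  "hankel_integrand \<kappa> z w \<equiv> exp (- z * complex_of_real w) / (complex_of_real (sqrt w) * csqrt (complex_of_real w - 2 * \<i> * \<kappa>))"

definition hankel_laplace :: "complex \<Rightarrow> complex \<Rightarrow> complex" where
  "hankel_laplace \<kappa> z = (LINT w:{0<..}|lborel. hankel_integrand \<kappa> z w)"

text \<open>This is \<open>yukawa_kernel\<close> at q = -i \<kappa>, with the radius made complex as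
  well so that Cauchy's estimate can be applied in it.\<close>

definition helm_profile :: "nat \<Rightarrow> complex \<Rightarrow> complex \<Rightarrow> complex" where
  "helm_profile n \<kappa> z = (if n = 1 then \<i> / (2 * \<kappa>) * exp (\<i> * \<kappa> * z)
     else if n = 2 then exp (\<i> * \<kappa> * z) / (2 * complex_of_real pi) * hankel_laplace \<kappa> z
     else exp (\<i> * \<kappa> * z) / (4 * complex_of_real pi * z))"

text \<open>The upper half-plane is where the distributional identity is proved; the right
  half-plane contains the limit wave number \<open>k\<close>. The margin \<open>b\<close> keeps |w -
  2 i \<kappa>| above 2 b, uniformly in w > 0.\<close>

definition half_planes :: "real \<Rightarrow> complex set" where
  "half_planes b = {\<kappa>. Im \<kappa> > b} \<union> {\<kappa>. Re \<kappa> > b}"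

lemma open_half_planes: "open (half_planes b)"
  unfolding half_planes_def by (intro open_Un open_halfspace_Im_gt open_halfspace_Re_gt)

lemma half_planes_UN: "half_planes 0 = (\<Union>b\<in>{0<..}. half_planes b)"
proof (intro equalityI subsetI)
  fix \<kappa> assume "\<kappa> \<in> half_planes 0"
  then consider "Im \<kappa> > 0" | "Re \<kappa> > 0" by (auto simp: half_planes_def)
  thus "\<kappa> \<in> (\<Union>b\<in>{0<..}. half_planes b)"
    by cases (auto simp: half_planes_def intro: bexI[of _ "Im \<kappa> / 2"] bexI[of _ "Re \<kappa> / 2"])
qed (auto simp: half_planes_def)

lemma hankel_denominator:
  assumes \<kappa>: "\<kappa> \<in> half_planes b" "b > 0" and w: "w > 0"
  shows "complex_of_real w - 2 * \<i> * \<kappa> \<notin> \<real>\<^sub>\<le>\<^sub>0"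
    and "norm (complex_of_real w - 2 * \<i> * \<kappa>) \<ge> 2 * b"
proof -
  let ?d = "complex_of_real w - 2 * \<i> * \<kappa>"
  have d: "Re ?d = w + 2 * Im \<kappa>" "Im ?d = - 2 * Re \<kappa>" by simp_all
  show "?d \<notin> \<real>\<^sub>\<le>\<^sub>0" using assms by (auto simp: complex_nonpos_Reals_iff half_planes_def)
  show "norm ?d \<ge> 2 * b" using assms abs_Re_le_cmod[of ?d] abs_Im_le_cmod[of ?d] unfolding d half_planes_def by auto
qed

lemma hankel_integrand_bound:
  assumes \<kappa>: "\<kappa> \<in> half_planes b" "b > 0" and w: "w > 0" and z: "Re z \<ge> r"
  shows "norm (hankel_integrand \<kappa> z w)
     \<le> exp (- r * w) / sqrt w * (1 / sqrt (2 * b))"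
proof -
  have "norm (hankel_integrand \<kappa> z w)
     = exp (- Re z * w) / (sqrt w * sqrt (norm (complex_of_real w - 2 * \<i> * \<kappa>)))"
    using w by (simp add: norm_divide norm_mult)
  also have "\<dots> \<le> exp (- r * w) / (sqrt w * sqrt (2 * b))"
    using hankel_denominator(2)[OF \<kappa> w] w z \<kappa>(2) by (intro frac_le mult_left_mono mult_pos_pos) auto
  finally show ?thesis by simp
qed

lemma hankel_integrand_measurable:
  assumes \<kappa>: "\<kappa> \<in> half_planes 0"
  shows "(\<lambda>w. indicator {0<..} w *\<^sub>R (hankel_integrand \<kappa> z w)) \<in> borel_measurable borel"
proof (rule borel_measurable_continuous_on_indicator)
  obtain b where b: "b > 0" "\<kappa> \<in> half_planes b" using \<kappa> by (auto simp: half_planes_UN)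
  have nz: "complex_of_real w - 2 * \<i> * \<kappa> \<noteq> 0" if "w > 0" for w
    using hankel_denominator(1)[OF b(2,1) that] by auto
  show "continuous_on {0<..} (\<lambda>w. hankel_integrand \<kappa> z w)"
  proof -
    have "continuous_on {0<..} (\<lambda>w. csqrt (complex_of_real w - 2 * \<i> * \<kappa>))"
      by (rule continuous_on_compose2[of "- \<real>\<^sub>\<le>\<^sub>0"]) (use hankel_denominator(1)[OF b(2,1)] in \<open>auto intro!: continuous_intros\<close>)
    thus ?thesis using nz by (intro continuous_intros) auto
  qed
qed auto

lemma hankel_bound_integrable:
  assumes "r > 0" "b > 0"
  shows "integrable lborel (\<lambda>w. indicator {0<..} w *\<^sub>R (exp (- r * w) / sqrt w * (1 / sqrt (2 * b))))"
  using integrable_mult_left[OF exp_over_sqrt_integrable[OF assms(1), unfolded set_integrable_def], of "1 / sqrt (2 * b)"]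
  by (simp only: real_scaleR_def mult.assoc)

lemma hankel_laplace_integrable:
  assumes \<kappa>: "\<kappa> \<in> half_planes 0" and z: "Re z > 0"
  shows "set_integrable lborel {0<..} (\<lambda>w. hankel_integrand \<kappa> z w)"
  unfolding set_integrable_def
proof -
  obtain b where b: "b > 0" "\<kappa> \<in> half_planes b" using \<kappa> by (auto simp: half_planes_UN)
  show "integrable lborel (\<lambda>w. indicator {0<..} w *\<^sub>R (hankel_integrand \<kappa> z w))"
  proof (rule Bochner_Integration.integrable_bound[OF hankel_bound_integrable[OF z b(1)]])
    show "AE w in lborel. norm (indicator {0<..} w *\<^sub>R (hankel_integrand \<kappa> z w))
        \<le> norm (indicator {0<..} w *\<^sub>R (exp (- Re z * w) / sqrt w * (1 / sqrt (2 * b))))"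
      using hankel_integrand_bound[OF b(2,1) _ order_refl] b(1)
      by (intro AE_I2) (auto simp: indicator_def abs_mult)
  qed (use hankel_integrand_measurable[OF \<kappa>] in simp)
qed

lemma hankel_laplace_holomorphic_kappa:
  assumes z: "Re z > 0"
  shows "(\<lambda>\<kappa>. hankel_laplace \<kappa> z) holomorphic_on half_planes 0"
  unfolding half_planes_UN
proof (rule holomorphic_on_UN_open)
  fix b :: real assume b: "b \<in> {0<..}"
  show "open (half_planes b)" by (rule open_half_planes)
  show "(\<lambda>\<kappa>. hankel_laplace \<kappa> z) holomorphic_on half_planes b"
    unfolding hankel_laplace_def set_lebesgue_integral_def
  proof (rule holomorphic_on_lebesgue_integral[OF open_half_planes _ _ hankel_bound_integrable[OF z]])
    fix w :: real
    show "(\<lambda>\<kappa>. indicator {0<..} w *\<^sub>R (hankel_integrand \<kappa> z w)) holomorphic_on half_planes b"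
    proof (cases "w > 0")
      case True
      have nz: "complex_of_real w - 2 * \<i> * \<kappa> \<noteq> 0" if "\<kappa> \<in> half_planes b" for \<kappa>
        using hankel_denominator(1)[OF that _ True] b by auto
      show ?thesis using True b nz hankel_denominator(1)[of _ b, OF _ _ True]
        by (intro holomorphic_intros) (auto simp: indicator_def)
    qed (auto simp: indicator_def)
  next
    fix \<kappa> assume \<kappa>: "\<kappa> \<in> half_planes b"
    hence k0: "\<kappa> \<in> half_planes 0" using b by (auto simp: half_planes_UN)
    show "(\<lambda>w. indicator {0<..} w *\<^sub>R (hankel_integrand \<kappa> z w)) \<in> borel_measurable lborel"
      using hankel_integrand_measurable[OF k0] by simp
    show "norm (indicator {0<..} w *\<^sub>R (hankel_integrand \<kappa> z w))
        \<le> indicator {0<..} w *\<^sub>R (exp (- Re z * w) / sqrt w * (1 / sqrt (2 * b)))" for w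
      using hankel_integrand_bound[OF \<kappa> _ _ order_refl, of w z] b by (auto simp: indicator_def)
  qed (use b in auto)
qed

lemma hankel_laplace_holomorphic:
  assumes \<kappa>: "\<kappa> \<in> half_planes 0"
  shows "hankel_laplace \<kappa> holomorphic_on {z. Re z > 0}"
proof -
  obtain b where b: "b > 0" "\<kappa> \<in> half_planes b" using \<kappa> by (auto simp: half_planes_UN)
  have eq: "{z. Re z > 0} = (\<Union>r\<in>{0<..}. {z. Re z > r})"
  proof (intro equalityI subsetI)
    fix z assume "z \<in> {z. Re z > 0}"
    thus "z \<in> (\<Union>r\<in>{0<..}. {z. Re z > r})" by (auto intro!: bexI[of _ "Re z / 2"])
  qed auto
  show ?thesis unfolding eq
  proof (rule holomorphic_on_UN_open)
    fix r :: real assume r: "r \<in> {0<..}"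
    show "open {z. Re z > r}" by (rule open_halfspace_Re_gt)
    show "hankel_laplace \<kappa> holomorphic_on {z. Re z > r}"
      unfolding hankel_laplace_def set_lebesgue_integral_def
    proof (rule holomorphic_on_lebesgue_integral[OF open_halfspace_Re_gt _ _ hankel_bound_integrable[OF _ b(1), of r]])
      fix w :: real
      show "(\<lambda>z. indicator {0<..} w *\<^sub>R (hankel_integrand \<kappa> z w)) holomorphic_on {z. Re z > r}"
      proof (cases "w > 0")
        case True
        have nz: "complex_of_real w - 2 * \<i> * \<kappa> \<noteq> 0"
          using hankel_denominator(1)[OF b(2,1) True] by auto
        show ?thesis using True nz by (intro holomorphic_intros) (auto simp: indicator_def)
      qed (auto simp: indicator_def)
    next
      fix z assume z: "z \<in> {z. Re z > r}"
      show "norm (indicator {0<..} w *\<^sub>R (hankel_integrand \<kappa> z w))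
        \<le> indicator {0<..} w *\<^sub>R (exp (- r * w) / sqrt w * (1 / sqrt (2 * b)))" for w
        using hankel_integrand_bound[OF b(2,1), of w r z] z by (auto simp: indicator_def)
    qed (use hankel_integrand_measurable[OF \<kappa>] r in auto)
  qed
qed

lemma exp_over_sqrt_scaling:
  assumes r: "r > 0"
  shows "(LINT w:{0<..}|lborel. exp (- r * w) / sqrt w) = (LINT w:{0<..}|lborel. exp (- w) / sqrt w) / sqrt r"
proof -
  have "(LINT w|lborel. indicator {0<..} w *\<^sub>R (exp (- r * w) / sqrt w))
      = (1 / r) *\<^sub>R (LINT w|lborel. indicator {0<..} (0 + 1 / r * w) *\<^sub>R (exp (- r * (0 + 1 / r * w)) / sqrt (0 + 1 / r * w)))"
    using r by (subst lborel_integral_real_affine[where c = "1 / r" and t = 0]) auto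
  also have "(\<lambda>w. indicator {0<..} (0 + 1 / r * w) *\<^sub>R (exp (- r * (0 + 1 / r * w)) / sqrt (0 + 1 / r * w)))
      = (\<lambda>w. sqrt r * (indicator {0<..} w *\<^sub>R (exp (- w) / sqrt w)))"
    using r by (auto simp: fun_eq_iff indicator_def real_sqrt_divide zero_less_divide_iff)
  also have "(1 / r) *\<^sub>R (LINT w|lborel. sqrt r * (indicator {0<..} w *\<^sub>R (exp (- w) / sqrt w)))
     = (sqrt r / r) * (LINT w|lborel. indicator {0<..} w *\<^sub>R (exp (- w) / sqrt w))"
    by (subst integral_mult_right_zero) simp
  also have "sqrt r / r = 1 / sqrt r" using r by (simp add: field_simps)
  finally show ?thesis by (simp add: set_lebesgue_integral_def)
qed

text \<open>Once the second root is bounded from below, only e^(-r w)/sqrt w is left, and scaling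
  \<open>w\<close> extracts r^(-1/2), the decay of a two-dimensional outgoing wave.\<close>

lemma hankel_laplace_bound:
  assumes \<kappa>: "\<kappa> \<in> half_planes 0"
  obtains C where "\<And>z. Re z > 0 \<Longrightarrow> norm (hankel_laplace \<kappa> z) \<le> C / sqrt (Re z)"
proof -
  obtain b where b: "b > 0" "\<kappa> \<in> half_planes b" using \<kappa> by (auto simp: half_planes_UN)
  define C where "C = (LINT w:{0<..}|lborel. exp (- w) / sqrt w) * (1 / sqrt (2 * b))"
  have "norm (hankel_laplace \<kappa> z) \<le> C / sqrt (Re z)" if z: "Re z > 0" for z
  proof -
    have "norm (hankel_laplace \<kappa> z) \<le> (LINT w|lborel. norm (indicator {0<..} w *\<^sub>R (hankel_integrand \<kappa> z w)))"
      unfolding hankel_laplace_def set_lebesgue_integral_def by (rule integral_norm_bound)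
    also have "\<dots> \<le> (LINT w|lborel. indicator {0<..} w *\<^sub>R (exp (- Re z * w) / sqrt w * (1 / sqrt (2 * b))))"
    proof (rule Bochner_Integration.integral_mono)
      show "integrable lborel (\<lambda>w. norm (indicator {0<..} w *\<^sub>R (hankel_integrand \<kappa> z w)))"
        using hankel_laplace_integrable[OF \<kappa> z] unfolding set_integrable_def by (rule integrable_norm)
      show "norm (indicator {0<..} w *\<^sub>R (hankel_integrand \<kappa> z w))
         \<le> indicator {0<..} w *\<^sub>R (exp (- Re z * w) / sqrt w * (1 / sqrt (2 * b)))" for w
        using hankel_integrand_bound[OF b(2,1) _ order_refl, of w z] by (auto simp: indicator_def)
    qed (rule hankel_bound_integrable[OF z b(1)])
    also have "\<dots> = (LINT w:{0<..}|lborel. exp (- Re z * w) / sqrt w) * (1 / sqrt (2 * b))"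
      unfolding set_lebesgue_integral_def by (subst integral_mult_left_zero[symmetric]) (simp only: real_scaleR_def mult.assoc)
    also have "\<dots> = C / sqrt (Re z)" unfolding exp_over_sqrt_scaling[OF z] C_def by simp
    finally show ?thesis .
  qed
  thus ?thesis by (rule that)
qed

lemma helm_profile_holomorphic_kappa:
  assumes z: "Re z > 0"
  shows "(\<lambda>\<kappa>. helm_profile n \<kappa> z) holomorphic_on half_planes 0"
proof -
  have "\<kappa> \<noteq> 0" if "\<kappa> \<in> half_planes 0" for \<kappa> using that by (auto simp: half_planes_def)
  moreover have "z \<noteq> 0" using z by auto
  ultimately show ?thesis using hankel_laplace_holomorphic_kappa[OF z]
    unfolding helm_profile_def by (cases "n = 1"; cases "n = 2"; simp) (auto intro!: holomorphic_intros)
qed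

lemma helm_profile_holomorphic:
  assumes \<kappa>: "\<kappa> \<in> half_planes 0"
  shows "helm_profile n \<kappa> holomorphic_on {z. Re z > 0}"
proof -
  have [simp]: "z \<noteq> 0" if "Re z > 0" for z using that by auto
  show ?thesis using hankel_laplace_holomorphic[OF \<kappa>]
    unfolding helm_profile_def[abs_def] by (cases "n = 1"; cases "n = 2"; simp) (auto intro!: holomorphic_intros)
qed

text \<open>Imaginary wave numbers are those with a heat kernel representation; they form the set
  from which the analytic continuation starts.\<close>

lemma helm_profile_imaginary:
  assumes q: "q > 0" and r: "r > 0"
  shows "helm_profile n (\<i> * complex_of_real q) (complex_of_real r) = complex_of_real (yukawa_kernel n q r)"
proof -
  have e: "exp (\<i> * (\<i> * complex_of_real q) * complex_of_real r) = complex_of_real (exp (- q * r))"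
  proof -
    have "\<i> * (\<i> * complex_of_real q) * complex_of_real r = complex_of_real (- q * r)" by (simp flip: mult.assoc)
    thus ?thesis by (simp only: exp_of_real)
  qed
  have "hankel_laplace (\<i> * complex_of_real q) (complex_of_real r)
      = (LINT w:{0<..}|lborel. complex_of_real (exp (- r * w) / sqrt (w\<^sup>2 + 2 * q * w)))"
    unfolding hankel_laplace_def
  proof (rule set_lebesgue_integral_cong)
    show "\<forall>w. w \<in> {0<..} \<longrightarrow> exp (- complex_of_real r * complex_of_real w) /
           (complex_of_real (sqrt w) * csqrt (complex_of_real w - 2 * \<i> * (\<i> * complex_of_real q))) =
           complex_of_real (exp (- r * w) / sqrt (w\<^sup>2 + 2 * q * w))"
    proof (intro allI impI)
      fix w :: real assume w: "w \<in> {0<..}"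
      have "complex_of_real w - 2 * \<i> * (\<i> * complex_of_real q) = complex_of_real (w + 2 * q)"
        by (simp add: complex_eq_iff)
      hence "csqrt (complex_of_real w - 2 * \<i> * (\<i> * complex_of_real q)) = complex_of_real (sqrt (w + 2 * q))"
        using w q csqrt_of_real[of "w + 2 * q"] by (simp only: greaterThan_iff)
      moreover have "sqrt w * sqrt (w + 2 * q) = sqrt (w\<^sup>2 + 2 * q * w)"
        by (simp add: power2_eq_square algebra_simps flip: real_sqrt_mult)
      moreover have "exp (- complex_of_real r * complex_of_real w) = complex_of_real (exp (- r * w))"
        by (simp flip: exp_of_real)
      ultimately show "exp (- complex_of_real r * complex_of_real w) /
           (complex_of_real (sqrt w) * csqrt (complex_of_real w - 2 * \<i> * (\<i> * complex_of_real q))) =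
           complex_of_real (exp (- r * w) / sqrt (w\<^sup>2 + 2 * q * w))"
        by (simp only: of_real_divide of_real_mult[symmetric])
    qed
  qed auto
  also have "\<dots> = complex_of_real (LINT w:{0<..}|lborel. exp (- r * w) / sqrt (w\<^sup>2 + 2 * q * w))"
    unfolding set_lebesgue_integral_def
    by (subst integral_complex_of_real[symmetric]) (simp add: scaleR_conv_of_real)
  finally have h: "hankel_laplace (\<i> * complex_of_real q) (complex_of_real r) = \<dots>" .
  show ?thesis unfolding helm_profile_def yukawa_kernel_def e h by simp
qed

text \<open>A positive kernel that dominates all \<kappa> with Im \<kappa> \<ge> q at once. Only
  |e^(i \<kappa> r)| \<le> 1 is used, hence the factor e^(q r) undoing the decay of the Yukawa
  kernel; on a bounded set it is harmless.\<close>

lemma helm_profile_le_yukawa: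
  assumes q: "q > 0" and r: "r > 0" and \<kappa>: "Im \<kappa> \<ge> q"
  shows "norm (helm_profile n \<kappa> (complex_of_real r)) \<le> exp (q * r) * yukawa_kernel n q r"
proof -
  have k0: "\<kappa> \<in> half_planes 0" using q \<kappa> by (auto simp: half_planes_def)
  have e: "norm (exp (\<i> * \<kappa> * complex_of_real r)) \<le> 1" using q r \<kappa> by (simp add: mult_nonneg_nonneg)
  have nk: "norm \<kappa> \<ge> q" using abs_Im_le_cmod[of \<kappa>] q \<kappa> by simp
  have ee: "exp (q * r) * exp (- q * r) = 1" by (simp flip: exp_add)
  have "norm (hankel_laplace \<kappa> (complex_of_real r)) \<le> (LINT w:{0<..}|lborel. exp (- r * w) / sqrt (w\<^sup>2 + 2 * q * w))"
  proof -
    have "norm (hankel_laplace \<kappa> (complex_of_real r)) \<le> (LINT w|lborel. norm (indicator {0<..} w *\<^sub>R (hankel_integrand \<kappa> (complex_of_real r) w)))"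
      unfolding hankel_laplace_def set_lebesgue_integral_def by (rule integral_norm_bound)
    also have "\<dots> \<le> (LINT w|lborel. indicator {0<..} w *\<^sub>R (exp (- r * w) / sqrt (w\<^sup>2 + 2 * q * w)))"
    proof (rule Bochner_Integration.integral_mono)
      show "integrable lborel (\<lambda>w. norm (indicator {0<..} w *\<^sub>R (hankel_integrand \<kappa> (complex_of_real r) w)))"
        using hankel_laplace_integrable[OF k0, of r] r unfolding set_integrable_def by (intro integrable_norm) auto
      show "integrable lborel (\<lambda>w. indicator {0<..} w *\<^sub>R (exp (- r * w) / sqrt (w\<^sup>2 + 2 * q * w)))"
        using cosh_integral(2)[OF q r] by (simp only: set_integrable_def)
      fix w :: real
      show "norm (indicator {0<..} w *\<^sub>R (hankel_integrand \<kappa> (complex_of_real r) w))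
         \<le> indicator {0<..} w *\<^sub>R (exp (- r * w) / sqrt (w\<^sup>2 + 2 * q * w))"
      proof (cases "w > 0")
        case True
        have "w + 2 * q \<le> norm (complex_of_real w - 2 * \<i> * \<kappa>)"
          using abs_Re_le_cmod[of "complex_of_real w - 2 * \<i> * \<kappa>"] \<kappa> q True by simp
        hence "sqrt (w\<^sup>2 + 2 * q * w) \<le> sqrt (w * norm (complex_of_real w - 2 * \<i> * \<kappa>))"
        proof -
          have "w\<^sup>2 + 2 * q * w = w * (w + 2 * q)" by (simp add: power2_eq_square algebra_simps)
          also have "\<dots> \<le> w * norm (complex_of_real w - 2 * \<i> * \<kappa>)"
            using True \<open>w + 2 * q \<le> _\<close> by (intro mult_left_mono) auto
          finally show ?thesis by (simp only: real_sqrt_le_iff)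
        qed
        moreover have "0 < sqrt (w\<^sup>2 + 2 * q * w)" using True q by (simp add: add_pos_pos)
        ultimately have "exp (- r * w) / sqrt (w * norm (complex_of_real w - 2 * \<i> * \<kappa>)) \<le> exp (- r * w) / sqrt (w\<^sup>2 + 2 * q * w)"
          by (intro divide_left_mono mult_pos_pos) auto
        thus ?thesis using True by (simp add: norm_divide norm_mult real_sqrt_mult)
      qed simp
    qed
    finally show ?thesis by (simp add: set_lebesgue_integral_def)
  qed
  note h = this
  consider "n = 1" | "n = 2" | "n \<noteq> 1" "n \<noteq> 2" by blast
  thus ?thesis
  proof cases
    case 1
    have "norm (helm_profile n \<kappa> (complex_of_real r)) = norm (exp (\<i> * \<kappa> * complex_of_real r)) / (2 * norm \<kappa>)"
      by (simp add: 1 helm_profile_def norm_mult norm_divide)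
    also have "\<dots> \<le> 1 / (2 * q)" using e nk q by (intro frac_le) auto
    also have "\<dots> = exp (q * r) * yukawa_kernel n q r" by (simp add: 1 yukawa_kernel_def ee flip: exp_minus exp_add)
    finally show ?thesis .
  next
    case 2
    have "norm (helm_profile n \<kappa> (complex_of_real r)) = norm (exp (\<i> * \<kappa> * complex_of_real r)) * (norm (hankel_laplace \<kappa> r) / (2 * pi))"
      by (simp add: 2 helm_profile_def norm_mult norm_divide)
    also have "\<dots> \<le> 1 * ((LINT w:{0<..}|lborel. exp (- r * w) / sqrt (w\<^sup>2 + 2 * q * w)) / (2 * pi))"
      using e h by (intro mult_mono divide_right_mono) auto
    also have "\<dots> = (exp (q * r) * exp (- q * r)) * ((LINT w:{0<..}|lborel. exp (- r * w) / sqrt (w\<^sup>2 + 2 * q * w)) / (2 * pi))"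
      by (simp only: ee)
    also have "\<dots> = exp (q * r) * yukawa_kernel n q r"
      by (simp only: 2 yukawa_kernel_def) simp
    finally show ?thesis .
  next
    case 3
    have "norm (helm_profile n \<kappa> (complex_of_real r)) = norm (exp (\<i> * \<kappa> * complex_of_real r)) / (4 * pi * r)"
      using 3 r by (simp add: helm_profile_def norm_mult norm_divide)
    also have "\<dots> \<le> 1 / (4 * pi * r)" using e r by (intro divide_right_mono) auto
    also have "\<dots> = exp (q * r) * yukawa_kernel n q r" using 3 by (simp add: yukawa_kernel_def flip: exp_add)
    finally show ?thesis .
  qed
qed

section \<open>The Helmholtz kernel as a distribution\<close>

lemma borel_measurable_punctured:
  fixes f :: "'a::euclidean_space \<Rightarrow> 'b::real_normed_vector"
  assumes "continuous_on (UNIV - {0}) f"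
  shows "f \<in> borel_measurable borel"
proof -
  have 1: "(\<lambda>x. indicator (UNIV - {0}) x *\<^sub>R f x) \<in> borel_measurable borel"
    by (rule borel_measurable_continuous_on_indicator[OF _ assms]) auto
  have "(\<lambda>x. if x = 0 then f 0 else indicator (UNIV - {0}) x *\<^sub>R f x) \<in> borel_measurable borel"
    by (intro measurable_If 1) auto
  also have "(\<lambda>x. if x = 0 then f 0 else indicator (UNIV - {0}) x *\<^sub>R f x) = f"
    by (auto simp: fun_eq_iff)
  finally show ?thesis .
qed

lemma continuous_on_radial:
  fixes f :: "complex \<Rightarrow> complex"
  assumes "continuous_on {z. Re z > 0} f"
  shows "continuous_on (UNIV - {0::'a::real_normed_vector}) (\<lambda>x. f (complex_of_real (norm x)))"
  by (rule continuous_on_compose2[OF assms]) (auto intro!: continuous_intros)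

lemma helm_profile_continuous:
  assumes "\<kappa> \<in> half_planes 0"
  shows "continuous_on (UNIV - {0::'a::euclidean_space}) (\<lambda>x. helm_profile n \<kappa> (complex_of_real (norm x)))"
  by (intro continuous_on_radial holomorphic_on_imp_continuous_on helm_profile_holomorphic assms)

text \<open>\<open>heat_superposition\<close> with weight e^(-q^2 \<tau>) on \<tau> > 0: the time
  integral produces the kernel on one side and 1/(|xi|^2 + q^2) on the other. The identification of
  the kernel leaves out the origin, a null set.\<close>

lemma yukawa_distribution:
  assumes q: "q > 0" and n: "DIM('a::euclidean_space) \<in> {1, 2, 3}"
  shows "integrable lborel (\<lambda>x::'a. complex_of_real (yukawa_kernel DIM('a) q (norm x)))"
    and "test_fun \<phi> \<Longrightarrow> (LINT x|lborel. complex_of_real (yukawa_kernel DIM('a) q (norm x)) * \<phi> (x::'a))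
       = (LINT xi|lborel. 1 / complex_of_real ((norm xi)\<^sup>2 + q\<^sup>2) * inv_fourier \<phi> xi)"
proof -
  define w where "w \<tau> = indicator {0<..} \<tau> *\<^sub>R complex_of_real (exp (- q\<^sup>2 * \<tau>))" for \<tau> :: real
  have wi: "integrable lborel w"
  proof -
    have "integrable lborel (\<lambda>\<tau>. complex_of_real (indicator {0<..} \<tau> *\<^sub>R exp (- q\<^sup>2 * \<tau>)))"
      using exponential_integral(1)[of "q\<^sup>2"] q by (intro integrable_of_real) auto
    thus ?thesis by (simp add: w_def[abs_def] scaleR_conv_of_real)
  qed
  have w0: "w \<tau> \<noteq> 0 \<Longrightarrow> \<tau> > 0" for \<tau> by (auto simp: w_def indicator_def)
  have heat: "(\<integral>\<tau>. w \<tau> * heat_kernel \<tau> x \<partial>lborel) = complex_of_real (yukawa_kernel DIM('a) q (norm x))"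
    if "x \<noteq> 0" for x :: 'a
  proof -
    have "(\<integral>\<tau>. w \<tau> * heat_kernel \<tau> x \<partial>lborel) = (\<integral>\<tau>. complex_of_real (indicator {0<..} \<tau> *\<^sub>R (exp (- q\<^sup>2 * \<tau>) * heat_factor DIM('a) (norm x) \<tau>)) \<partial>lborel)"
      by (simp add: w_def heat_kernel_def scaleR_conv_of_real mult.assoc)
    also have "\<dots> = complex_of_real (yukawa_kernel DIM('a) q (norm x))"
    proof -
      have "norm x > 0" using that by simp
      from yukawa_kernel_heat(2)[OF q this n, unfolded set_lebesgue_integral_def] show ?thesis
        by (simp only: integral_complex_of_real)
    qed
    finally show ?thesis .
  qed
  note sup = heat_superposition[OF sigma_finite_lborel wi _ w0, where 'a='a]
  have meas: "(\<lambda>x::'a. complex_of_real (yukawa_kernel DIM('a) q (norm x))) \<in> borel_measurable borel"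
  proof (rule borel_measurable_punctured)
    have "\<i> * complex_of_real q \<in> half_planes 0" using q by (auto simp: half_planes_def)
    from helm_profile_continuous[OF this] show "continuous_on (UNIV - {0}) (\<lambda>x::'a. complex_of_real (yukawa_kernel DIM('a) q (norm x)))"
      by (rule continuous_on_eq) (use helm_profile_imaginary[OF q] in auto)
  qed
  have ae: "AE x::'a in lborel. (\<integral>\<tau>. w \<tau> * heat_kernel \<tau> x \<partial>lborel) = complex_of_real (yukawa_kernel DIM('a) q (norm x))"
    using AE_lborel_singleton[of "0::'a"] by eventually_elim (rule heat)
  have i: "integrable lborel (\<lambda>x::'a. \<integral>\<tau>. w \<tau> * heat_kernel \<tau> x \<partial>lborel)" by (rule sup(1)) auto
  show "integrable lborel (\<lambda>x::'a. complex_of_real (yukawa_kernel DIM('a) q (norm x)))"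
    using integrable_cong_AE[OF borel_measurable_integrable[OF i] _ ae] meas i by simp
  assume \<phi>: "test_fun \<phi>"
  note [measurable] = test_funD(1)[OF \<phi>] meas
  have "(LINT x|lborel. complex_of_real (yukawa_kernel DIM('a) q (norm x)) * \<phi> (x::'a))
      = (LINT x|lborel. (\<integral>\<tau>. w \<tau> * heat_kernel \<tau> x \<partial>lborel) * \<phi> x)"
  proof (rule integral_cong_AE)
    show "AE x in lborel. complex_of_real (yukawa_kernel DIM('a) q (norm x)) * \<phi> (x::'a) = (\<integral>\<tau>. w \<tau> * heat_kernel \<tau> x \<partial>lborel) * \<phi> x"
      using ae by eventually_elim simp
  qed (use borel_measurable_integrable[OF i] in simp_all)
  also have "\<dots> = (LINT xi|lborel. (\<integral>\<tau>. w \<tau> * complex_of_real (exp (- \<tau> * (norm xi)\<^sup>2)) \<partial>lborel) * inv_fourier \<phi> (xi::'a))"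
    by (rule sup(2)) (use \<phi> in auto)
  also have "\<dots> = (LINT xi|lborel. 1 / complex_of_real ((norm xi)\<^sup>2 + q\<^sup>2) * inv_fourier \<phi> xi)"
  proof (rule Bochner_Integration.integral_cong[OF refl])
    fix xi :: 'a
    have p: "(norm xi)\<^sup>2 + q\<^sup>2 > 0" using q by (intro add_nonneg_pos) auto
    have "(\<integral>\<tau>. w \<tau> * complex_of_real (exp (- \<tau> * (norm xi)\<^sup>2)) \<partial>lborel)
       = (\<integral>\<tau>. complex_of_real (indicator {0<..} \<tau> *\<^sub>R exp (- ((norm xi)\<^sup>2 + q\<^sup>2) * \<tau>)) \<partial>lborel)"
      by (rule Bochner_Integration.integral_cong[OF refl]) (simp add: w_def scaleR_conv_of_real exp_add[symmetric] algebra_simps flip: of_real_mult)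
    also have "\<dots> = 1 / complex_of_real ((norm xi)\<^sup>2 + q\<^sup>2)"
      by (subst integral_complex_of_real) (simp only: exponential_integral(2)[OF p] of_real_divide of_real_1)
    finally show "(\<integral>\<tau>. w \<tau> * complex_of_real (exp (- \<tau> * (norm xi)\<^sup>2)) \<partial>lborel) * inv_fourier \<phi> (xi::'a)
        = 1 / complex_of_real ((norm xi)\<^sup>2 + q\<^sup>2) * inv_fourier \<phi> xi" by simp
  qed
  finally show "(LINT x|lborel. complex_of_real (yukawa_kernel DIM('a) q (norm x)) * \<phi> (x::'a))
       = (LINT xi|lborel. 1 / complex_of_real ((norm xi)\<^sup>2 + q\<^sup>2) * inv_fourier \<phi> xi)" .
qed

text \<open>Both factors of x^2 - \<kappa>^2 = (x - \<kappa>)(x + \<kappa>) have an imaginary part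
  of absolute value \<open>Im \<kappa>\<close>.\<close>

lemma norm_square_diff_ge:
  assumes "Im \<kappa> > 0" shows "norm (complex_of_real (x\<^sup>2) - \<kappa>\<^sup>2) \<ge> (Im \<kappa>)\<^sup>2"
proof -
  have "complex_of_real (x\<^sup>2) - \<kappa>\<^sup>2 = (complex_of_real x - \<kappa>) * (complex_of_real x + \<kappa>)"
    by (simp add: power2_eq_square algebra_simps)
  moreover have "norm (complex_of_real x - \<kappa>) \<ge> Im \<kappa>" "norm (complex_of_real x + \<kappa>) \<ge> Im \<kappa>"
    using abs_Im_le_cmod[of "complex_of_real x - \<kappa>"] abs_Im_le_cmod[of "complex_of_real x + \<kappa>"] assms by auto
  ultimately show ?thesis using assms by (simp add: norm_mult power2_eq_square mult_mono)
qed

text \<open>Integrability at the origin is inherited from the Yukawa kernel with q = Im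
  \<kappa>.\<close>

lemma helm_profile_compact_integrable:
  assumes \<kappa>: "Im \<kappa> > 0" and n: "DIM('a::euclidean_space) \<in> {1, 2, 3}" and K: "compact K"
  shows "set_integrable lborel K (\<lambda>x::'a. helm_profile DIM('a) \<kappa> (complex_of_real (norm x)))"
proof -
  define q where "q = Im \<kappa>"
  have q: "q > 0" using \<kappa> by (simp add: q_def)
  obtain R where R: "\<And>x. x \<in> K \<Longrightarrow> norm x \<le> R"
    using compact_imp_bounded[OF K] unfolding bounded_iff by auto
  have [measurable]: "(\<lambda>x::'a. helm_profile DIM('a) \<kappa> (complex_of_real (norm x))) \<in> borel_measurable borel"
    by (intro borel_measurable_punctured helm_profile_continuous) (use \<kappa> in \<open>auto simp: half_planes_def\<close>)
  have [measurable]: "K \<in> sets borel" using K by (simp add: borel_compact)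
  show ?thesis unfolding set_integrable_def
  proof (rule Bochner_Integration.integrable_bound[OF integrable_mult_right[OF integrable_norm[OF yukawa_distribution(1)[OF q n]], of "exp (q * R)"]])
    show "AE x::'a in lborel. norm (indicator K x *\<^sub>R helm_profile DIM('a) \<kappa> (complex_of_real (norm x)))
       \<le> norm (exp (q * R) * norm (complex_of_real (yukawa_kernel DIM('a) q (norm x))))"
      using AE_lborel_singleton[of "0::'a"]
    proof eventually_elim
      case (elim x)
      show ?case
      proof (cases "x \<in> K")
        case True
        have "norm (helm_profile DIM('a) \<kappa> (complex_of_real (norm x))) \<le> exp (q * norm x) * yukawa_kernel DIM('a) q (norm x)"
          by (rule helm_profile_le_yukawa[OF q]) (use elim in \<open>auto simp: q_def\<close>)
        also have "\<dots> \<le> exp (q * norm x) * \<bar>yukawa_kernel DIM('a) q (norm x)\<bar>" by (intro mult_left_mono) auto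
        also have "\<dots> \<le> exp (q * R) * \<bar>yukawa_kernel DIM('a) q (norm x)\<bar>"
          using R[OF True] q by (intro mult_right_mono) auto
        finally show ?thesis using True by simp
      qed simp
    qed
  qed measurable
qed

text \<open>Both pairings are holomorphic in \<kappa> on the upper half-plane, dominated by a
  multiple of the Yukawa kernel and by |\<open>inv_fourier \<phi>\<close>|/q^2 respectively, and
  \<open>yukawa_distribution\<close> makes them agree on the positive imaginary axis.\<close>

theorem helmholtz_distribution:
  assumes \<kappa>: "Im \<kappa> > 0" and n: "DIM('a::euclidean_space) \<in> {1, 2, 3}" and \<phi>: "test_fun \<phi>"
  shows "(LINT x|lborel. helm_profile DIM('a) \<kappa> (complex_of_real (norm x)) * \<phi> (x::'a))
       = (LINT xi|lborel. 1 / (complex_of_real ((norm xi)\<^sup>2) - \<kappa>\<^sup>2) * inv_fourier \<phi> xi)"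
proof -
  note [measurable] = test_funD(1)[OF \<phi>]
  have [measurable]: "inv_fourier \<phi> \<in> borel_measurable borel" using test_funD(3)[OF \<phi>] by auto
  obtain B where B: "\<And>x. norm (\<phi> x) \<le> B" using test_funD(4)[OF \<phi>] by auto
  obtain R where R: "\<And>x. norm x > R \<Longrightarrow> \<phi> x = 0" using test_funD(5)[OF \<phi>] by auto
  have B0: "B \<ge> 0" using B[of 0] norm_ge_zero order_trans by blast
  \<comment> \<open>The origin is cut out because holomorphy of the profile in \<kappa> is available
    for positive radius only; \<open>PA\<close> restores the original integral.\<close>
  define P where "P \<kappa> x = indicator (UNIV - {0}) x *\<^sub>R (helm_profile DIM('a) \<kappa> (complex_of_real (norm x)) * \<phi> (x::'a))" for \<kappa> x
  define Q where "Q \<kappa> xi = 1 / (complex_of_real ((norm xi)\<^sup>2) - \<kappa>\<^sup>2) * inv_fourier \<phi> (xi::'a)" for \<kappa> xi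
  have S: "{\<kappa>. Im \<kappa> > 0} = (\<Union>q\<in>{0<..}. {\<kappa>. Im \<kappa> > q})"
  proof (intro equalityI subsetI)
    fix z assume "z \<in> {z. Im z > 0}"
    thus "z \<in> (\<Union>r\<in>{0<..}. {z. Im z > r})" by (auto intro!: bexI[of _ "Im z / 2"])
  qed auto
  have hP: "(\<lambda>\<kappa>. LINT x|lborel. P \<kappa> x) holomorphic_on {\<kappa>. Im \<kappa> > 0}"
    unfolding S
  proof (rule holomorphic_on_UN_open)
    fix q :: real assume q': "q \<in> {0<..}"
    hence q: "q > 0" by simp
    show "open {\<kappa>. Im \<kappa> > q}" by (rule open_halfspace_Im_gt)
    show "(\<lambda>\<kappa>. LINT x|lborel. P \<kappa> x) holomorphic_on {\<kappa>. Im \<kappa> > q}"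
    proof (rule holomorphic_on_lebesgue_integral[OF open_halfspace_Im_gt _ _
          integrable_mult_right[OF integrable_norm[OF yukawa_distribution(1)[OF q n]], of "exp (q * R) * B"]])
      fix x :: 'a
      show "(\<lambda>\<kappa>. P \<kappa> x) holomorphic_on {\<kappa>. Im \<kappa> > q}"
      proof (cases "x = 0")
        case False
        have "(\<lambda>\<kappa>. helm_profile DIM('a) \<kappa> (complex_of_real (norm x))) holomorphic_on {\<kappa>. Im \<kappa> > q}"
          by (rule holomorphic_on_subset[OF helm_profile_holomorphic_kappa]) (use False q in \<open>auto simp: half_planes_def\<close>)
        thus ?thesis using False by (auto simp: P_def intro!: holomorphic_intros)
      qed (simp add: P_def)
    next
      fix \<kappa> assume \<kappa>: "\<kappa> \<in> {\<kappa>. Im \<kappa> > q}"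
      have [measurable]: "(\<lambda>x::'a. helm_profile DIM('a) \<kappa> (complex_of_real (norm x))) \<in> borel_measurable borel"
        by (intro borel_measurable_punctured helm_profile_continuous) (use \<kappa> q in \<open>auto simp: half_planes_def\<close>)
      show "P \<kappa> \<in> borel_measurable lborel" unfolding P_def by measurable
      fix x :: 'a
      show "norm (P \<kappa> x) \<le> exp (q * R) * B * norm (complex_of_real (yukawa_kernel DIM('a) q (norm x)))"
      proof (cases "x = 0 \<or> norm x > R")
        case True
        thus ?thesis using R[of x] B0 by (auto simp: P_def)
      next
        case False
        have "norm (helm_profile DIM('a) \<kappa> (complex_of_real (norm x))) \<le> exp (q * norm x) * yukawa_kernel DIM('a) q (norm x)"
          by (rule helm_profile_le_yukawa[OF q]) (use False \<kappa> in auto)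
        also have "\<dots> \<le> exp (q * norm x) * \<bar>yukawa_kernel DIM('a) q (norm x)\<bar>" by (intro mult_left_mono) auto
        also have "\<dots> \<le> exp (q * R) * \<bar>yukawa_kernel DIM('a) q (norm x)\<bar>"
          using False q by (intro mult_right_mono) auto
        finally have "norm (P \<kappa> x) \<le> (exp (q * R) * \<bar>yukawa_kernel DIM('a) q (norm x)\<bar>) * B"
          using False B[of x] B0 by (auto simp: P_def norm_mult intro!: mult_mono)
        thus ?thesis by (simp add: mult_ac)
      qed
    qed
  qed
  have hQ: "(\<lambda>\<kappa>. LINT xi|lborel. Q \<kappa> xi) holomorphic_on {\<kappa>. Im \<kappa> > 0}"
    unfolding S
  proof (rule holomorphic_on_UN_open)
    fix q :: real assume q': "q \<in> {0<..}"
    hence q: "q > 0" by simp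
    show "open {\<kappa>. Im \<kappa> > q}" by (rule open_halfspace_Im_gt)
    show "(\<lambda>\<kappa>. LINT x|lborel. Q \<kappa> x) holomorphic_on {\<kappa>. Im \<kappa> > q}"
    proof (rule holomorphic_on_lebesgue_integral[OF open_halfspace_Im_gt _ _
          integrable_mult_right[OF integrable_norm[OF test_funD(3)[OF \<phi>]], of "1 / q\<^sup>2"]])
      have b: "norm (complex_of_real ((norm xi)\<^sup>2) - \<kappa>\<^sup>2) \<ge> q\<^sup>2" if "Im \<kappa> > q" for \<kappa> and xi :: 'a
      proof -
        have "q\<^sup>2 \<le> (Im \<kappa>)\<^sup>2" using that q by (intro power_mono) auto
        thus ?thesis using norm_square_diff_ge[of \<kappa> "norm xi"] that q by linarith
      qed
      have nz: "complex_of_real ((norm xi)\<^sup>2) - \<kappa>\<^sup>2 \<noteq> 0" if "Im \<kappa> > q" for \<kappa> and xi :: 'a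
        using b[OF that, of xi] zero_less_power[OF q, of 2] by (metis norm_zero not_le)
      fix xi :: 'a
      show "(\<lambda>\<kappa>. Q \<kappa> xi) holomorphic_on {\<kappa>. Im \<kappa> > q}"
        unfolding Q_def using nz by (intro holomorphic_intros) auto
      fix \<kappa> assume \<kappa>: "\<kappa> \<in> {\<kappa>. Im \<kappa> > q}"
      show "Q \<kappa> \<in> borel_measurable lborel" unfolding Q_def by measurable
      have "norm (1 / (complex_of_real ((norm xi)\<^sup>2) - \<kappa>\<^sup>2)) \<le> 1 / q\<^sup>2"
        unfolding norm_divide norm_one using b[of \<kappa> xi] \<kappa> q by (intro divide_left_mono mult_pos_pos) (auto intro: less_le_trans[OF _ b])
      thus "norm (Q \<kappa> xi) \<le> 1 / q\<^sup>2 * norm (inv_fourier \<phi> xi)"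
        unfolding Q_def norm_mult by (intro mult_right_mono) auto
    qed
  qed
  have PA: "(LINT x|lborel. P \<kappa> x) = (LINT x|lborel. helm_profile DIM('a) \<kappa> (complex_of_real (norm x)) * \<phi> (x::'a))"
    if "Im \<kappa> > 0" for \<kappa>
  proof (rule integral_cong_AE)
    have [measurable]: "(\<lambda>x::'a. helm_profile DIM('a) \<kappa> (complex_of_real (norm x))) \<in> borel_measurable borel"
      by (intro borel_measurable_punctured helm_profile_continuous) (use that in \<open>auto simp: half_planes_def\<close>)
    show "P \<kappa> \<in> borel_measurable lborel" unfolding P_def by measurable
    show "(\<lambda>x. helm_profile DIM('a) \<kappa> (complex_of_real (norm x)) * \<phi> (x::'a)) \<in> borel_measurable lborel" by measurable
    show "AE x in lborel. P \<kappa> x = helm_profile DIM('a) \<kappa> (complex_of_real (norm x)) * \<phi> (x::'a)"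
      using AE_lborel_singleton[of "0::'a"] by eventually_elim (simp add: P_def)
  qed
  have "(LINT x|lborel. P \<kappa> x) - (LINT xi|lborel. Q \<kappa> xi) = 0"
  proof (rule analytic_continuation[where f = "\<lambda>\<kappa>. (LINT x|lborel. P \<kappa> x) - (LINT xi|lborel. Q \<kappa> xi)"
        and S = "{\<kappa>. Im \<kappa> > 0}" and U = "(\<lambda>q. \<i> * complex_of_real q) ` {0<..}" and \<xi> = \<i>])
    show "(\<lambda>\<kappa>. (LINT x|lborel. P \<kappa> x) - (LINT xi|lborel. Q \<kappa> xi)) holomorphic_on {\<kappa>. Im \<kappa> > 0}"
      by (intro holomorphic_intros hP hQ)
    show "open {\<kappa>. Im \<kappa> > 0}" by (rule open_halfspace_Im_gt)
    show "connected {\<kappa>. Im \<kappa> > 0}" by (intro convex_connected convex_halfspace_Im_gt)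
    show "\<i> islimpt (\<lambda>q. \<i> * complex_of_real q) ` {0<..}"
      unfolding islimpt_approachable
    proof (intro allI impI)
      fix e :: real assume e: "e > 0"
      have "dist (\<i> * complex_of_real (1 + e / 2)) \<i> = norm (complex_of_real (e / 2) * \<i>)"
        unfolding dist_norm by (rule arg_cong[of _ _ norm]) (simp add: complex_eq_iff)
      also have "\<dots> < e" using e by (simp only: norm_mult norm_of_real norm_ii)
      finally have "dist (\<i> * complex_of_real (1 + e / 2)) \<i> < e" .
      moreover have "\<i> * complex_of_real (1 + e / 2) \<noteq> \<i>" using e by (simp add: complex_eq_iff)
      ultimately show "\<exists>x'\<in>(\<lambda>q. \<i> * complex_of_real q) ` {0<..}. x' \<noteq> \<i> \<and> dist x' \<i> < e"
        using e by (intro bexI[of _ "\<i> * complex_of_real (1 + e / 2)"] imageI) auto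
    qed
  next
    fix z assume "z \<in> (\<lambda>q. \<i> * complex_of_real q) ` {0<..}"
    then obtain q where q: "q > 0" "z = \<i> * complex_of_real q" by auto
    have "(LINT x|lborel. P z x) = (LINT x|lborel. complex_of_real (yukawa_kernel DIM('a) q (norm x)) * \<phi> (x::'a))"
    proof (rule integral_cong_AE)
      have zk: "z \<in> half_planes 0" using q by (auto simp: half_planes_def)
      have [measurable]: "(\<lambda>x::'a. helm_profile DIM('a) z (complex_of_real (norm x))) \<in> borel_measurable borel"
        by (intro borel_measurable_punctured helm_profile_continuous zk)
      show "P z \<in> borel_measurable lborel" unfolding P_def by measurable
      show "(\<lambda>x. complex_of_real (yukawa_kernel DIM('a) q (norm x)) * \<phi> (x::'a)) \<in> borel_measurable lborel"
        using borel_measurable_integrable[OF yukawa_distribution(1)[OF q(1) n]] by measurable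
      show "AE x in lborel. P z x = complex_of_real (yukawa_kernel DIM('a) q (norm x)) * \<phi> (x::'a)"
        using AE_lborel_singleton[of "0::'a"] by eventually_elim (simp add: P_def q helm_profile_imaginary)
    qed
    also have "\<dots> = (LINT xi|lborel. Q z xi)"
      using yukawa_distribution(2)[OF q(1) n \<phi>] by (simp add: Q_def q power_mult_distrib)
    finally show "(LINT x|lborel. P z x) - (LINT xi|lborel. Q z xi) = 0" by simp
  qed (use \<kappa> in auto)
  thus ?thesis unfolding PA[OF \<kappa>] Q_def by (simp only: right_minus_eq)
qed

section \<open>Partial fractions of the symbol\<close>

text \<open>The jump of 1/(\<lambda>^s - \<mu>) across the negative axis at \<lambda> = -t, divided
  by 2 pi i, in the variable t = e^u and with the Jacobian e^u included.\<close>

definition frac_density :: "real \<Rightarrow> complex \<Rightarrow> real \<Rightarrow> complex" where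
  "frac_density s \<mu> u = complex_of_real (sin (pi * s) / pi * exp u * exp (s * u)) /
     ((complex_of_real (exp (s * u)) * cis (pi * s) - \<mu>) * (complex_of_real (exp (s * u)) * cis (- (pi * s)) - \<mu>))"

text \<open>The imaginary part of the difference, before and after rotation by -\<alpha>, bounds the
  norm below by |sin \<alpha>| y and by |sin \<alpha>| K; the claim is the average of the
  two.\<close>

lemma norm_cis_diff_ge:
  assumes "y \<ge> 0" "K \<ge> 0"
  shows "norm (complex_of_real y * cis \<alpha> - complex_of_real K) \<ge> \<bar>sin \<alpha>\<bar> * (y + K) / 2"
proof -
  let ?d = "complex_of_real y * cis \<alpha> - complex_of_real K"
  have "\<bar>Im ?d\<bar> \<le> norm ?d" by (rule abs_Im_le_cmod)
  hence 1: "\<bar>sin \<alpha>\<bar> * y \<le> norm ?d" using assms by (simp add: abs_mult mult_ac)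
  have "\<bar>Im (?d * cis (-\<alpha>))\<bar> \<le> norm (?d * cis (-\<alpha>))" by (rule abs_Im_le_cmod)
  moreover have "?d * cis (-\<alpha>) = complex_of_real y - complex_of_real K * cis (-\<alpha>)"
    by (simp add: algebra_simps cis_mult)
  moreover have "norm (?d * cis (-\<alpha>)) = norm ?d" by (simp add: norm_mult)
  ultimately have "\<bar>Im (complex_of_real y - complex_of_real K * cis (-\<alpha>))\<bar> \<le> norm ?d" by (simp only:)
  hence 2: "\<bar>sin \<alpha>\<bar> * K \<le> norm ?d" using assms by (simp add: abs_mult mult_ac)
  show ?thesis using 1 2 by (simp add: algebra_simps)
qed

lemma integrable_exp_neg_abs:
  assumes s: "s > 0" shows "integrable lborel (\<lambda>u::real. exp (- s * \<bar>u\<bar>))"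
proof -
  have i: "integrable lborel (\<lambda>u. indicator {0<..} u * exp (- s * \<bar>u\<bar>))"
  proof -
    have "integrable lborel (\<lambda>u. indicator {0<..} u *\<^sub>R exp (- (u * s)))"
      using integrable_I0i_exp_mscale[OF s] by (simp add: set_integrable_def)
    also have "(\<lambda>u. indicator {0<..} u *\<^sub>R exp (- (u * s))) = (\<lambda>u. indicator {0<..} u * exp (- s * \<bar>u\<bar>))"
      by (auto simp: indicator_def fun_eq_iff)
    finally show ?thesis .
  qed
  have i2: "integrable lborel (\<lambda>u. indicator {0<..} (-u) * exp (- s * \<bar>u\<bar>))"
    using lborel_integrable_real_affine[OF i, of "-1" 0] by simp
  have si: "integrable lborel (\<lambda>u. indicator {0<..} u * exp (- s * \<bar>u\<bar>) + indicator {0<..} (-u) * exp (- s * \<bar>u\<bar>))"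
    using i i2 by (rule Bochner_Integration.integrable_add)
  have "AE u in lborel. exp (- s * \<bar>u\<bar>) = indicator {0<..} u * exp (- s * \<bar>u\<bar>) + indicator {0<..} (-u) * exp (- s * \<bar>u\<bar>)"
    using AE_lborel_singleton[of 0] by eventually_elim (auto simp: indicator_def)
  from integrable_cong_AE[OF _ borel_measurable_integrable[OF si] this] si show ?thesis by simp
qed

context
  fixes s K :: real
  assumes s: "0 < s" "s < 1" and K: "0 < K"
begin

text \<open>Each of the two denominators contributes 4/sin(pi s), and one sine cancels against the
  numerator. With y = e^(s u), the summand 1 covers u \<ge> 0, where y/(y + K)^2 \<le> 1/y, and
  1/K^2 covers u < 0, where it is at most y/K^2.\<close>

definition density_bound :: real where
  "density_bound = 16 / (pi * sin (pi * s)) * (1 + 1 / K\<^sup>2)"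

lemma sin_pi_s_pos: "sin (pi * s) > 0"
  using s by (intro sin_gt_zero) auto

text \<open>At \<epsilon> = 0 the bound holds with 2 in place of 4; moving \<mu> by i \<epsilon>
  costs at most half of it.\<close>

lemma frac_denominator_ge:
  assumes \<epsilon>: "\<bar>\<epsilon>\<bar> \<le> sin (pi * s) * K / 4" and \<alpha>: "\<alpha> = pi * s \<or> \<alpha> = - (pi * s)"
  shows "norm (complex_of_real (exp (s * u)) * cis \<alpha> - Complex K \<epsilon>) \<ge> sin (pi * s) * (exp (s * u) + K) / 4"
proof -
  let ?y = "exp (s * u)"
  have "sin (pi * s) * (?y + K) / 2 \<le> norm (complex_of_real ?y * cis \<alpha> - complex_of_real K)"
    using norm_cis_diff_ge[of ?y K \<alpha>] K sin_pi_s_pos \<alpha> by auto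
  also have "\<dots> = norm ((complex_of_real ?y * cis \<alpha> - Complex K \<epsilon>) + \<i> * complex_of_real \<epsilon>)"
    by (rule arg_cong[of _ _ norm]) (simp add: complex_eq_iff)
  also have "\<dots> \<le> norm (complex_of_real ?y * cis \<alpha> - Complex K \<epsilon>) + \<bar>\<epsilon>\<bar>"
    by (rule norm_triangle_le) (simp add: norm_mult)
  finally have "sin (pi * s) * (?y + K) / 2 - \<bar>\<epsilon>\<bar> \<le> norm (complex_of_real ?y * cis \<alpha> - Complex K \<epsilon>)" by simp
  moreover have "sin (pi * s) * K / 4 \<le> sin (pi * s) * (?y + K) / 4" using sin_pi_s_pos by simp
  ultimately show ?thesis using \<epsilon> by simp
qed

lemma frac_density_bound:
  assumes \<epsilon>: "\<bar>\<epsilon>\<bar> \<le> sin (pi * s) * K / 4"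
  shows "norm (frac_density s (Complex K \<epsilon>) u) \<le> density_bound * exp (- s * \<bar>u\<bar>) * exp u"
proof -
  let ?y = "exp (s * u)" and ?S = "sin (pi * s)"
  have S: "?S > 0" by (rule sin_pi_s_pos)
  have y: "?y / (?y + K)\<^sup>2 \<le> (1 + 1 / K\<^sup>2) * exp (- s * \<bar>u\<bar>)"
  proof (cases "u \<ge> 0")
    case True
    have "?y / (?y + K)\<^sup>2 \<le> ?y / ?y\<^sup>2" using K by (intro divide_left_mono power_mono mult_pos_pos zero_less_power add_pos_pos) auto
    also have "\<dots> = 1 * exp (- s * \<bar>u\<bar>)" using True by (simp add: power2_eq_square exp_minus field_simps)
    also have "\<dots> \<le> (1 + 1 / K\<^sup>2) * exp (- s * \<bar>u\<bar>)" by (intro mult_right_mono) auto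
    finally show ?thesis .
  next
    case False
    have "?y / (?y + K)\<^sup>2 \<le> ?y / K\<^sup>2" using K by (intro divide_left_mono power_mono mult_pos_pos zero_less_power add_pos_pos) auto
    also have "\<dots> = (1 / K\<^sup>2) * exp (- s * \<bar>u\<bar>)" using False by simp
    also have "\<dots> \<le> (1 + 1 / K\<^sup>2) * exp (- s * \<bar>u\<bar>)" by (intro mult_right_mono) auto
    finally show ?thesis .
  qed
  have p: "?S * (?y + K) / 4 > 0" using S K by (simp add: add_pos_pos)
  have "norm (frac_density s (Complex K \<epsilon>) u) \<le> (?S / pi * exp u * ?y) / ((?S * (?y + K) / 4) * (?S * (?y + K) / 4))"
    unfolding frac_density_def norm_divide norm_mult
  proof (rule frac_le)
    show "?S * (?y + K) / 4 * (?S * (?y + K) / 4) \<le>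
       norm (complex_of_real ?y * cis (pi * s) - Complex K \<epsilon>) * norm (complex_of_real ?y * cis (- (pi * s)) - Complex K \<epsilon>)"
      using frac_denominator_ge[OF \<epsilon>, of _ u] p by (intro mult_mono) auto
    show "cmod (complex_of_real (?S / pi * exp u * ?y)) \<le> ?S / pi * exp u * ?y"
      unfolding norm_of_real using S by simp
  qed (use p S in auto)
  also have "\<dots> = 16 / (pi * ?S) * (?y / (?y + K)\<^sup>2) * exp u"
    using S by (simp add: power2_eq_square mult_ac)
  also have "\<dots> \<le> 16 / (pi * ?S) * ((1 + 1 / K\<^sup>2) * exp (- s * \<bar>u\<bar>)) * exp u"
    using y S by (intro mult_right_mono mult_left_mono) auto
  finally show ?thesis by (simp add: density_bound_def mult_ac)
qed

lemma frac_density_measurable[measurable]: "frac_density s \<mu> \<in> borel_measurable borel"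
  unfolding frac_density_def by measurable

lemma frac_density_integrable:
  assumes \<epsilon>: "\<bar>\<epsilon>\<bar> \<le> sin (pi * s) * K / 4" and lam: "lam \<ge> 0"
  shows "integrable lborel (\<lambda>u. frac_density s (Complex K \<epsilon>) u / complex_of_real (exp u + lam))"
proof (rule Bochner_Integration.integrable_bound[OF integrable_mult_right[OF integrable_exp_neg_abs[OF s(1)], of density_bound]])
  have "norm (frac_density s (Complex K \<epsilon>) u / complex_of_real (exp u + lam)) \<le> density_bound * exp (- s * \<bar>u\<bar>)" for u
  proof -
    have d: "density_bound * exp (- s * \<bar>u\<bar>) \<ge> 0"
      using sin_pi_s_pos by (auto simp: density_bound_def intro!: mult_nonneg_nonneg)
    have "norm (frac_density s (Complex K \<epsilon>) u / complex_of_real (exp u + lam)) \<le> (density_bound * exp (- s * \<bar>u\<bar>) * exp u) / (exp u)"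
      unfolding norm_divide norm_of_real
      using frac_density_bound[OF \<epsilon>, of u] lam d by (intro frac_le) auto
    thus ?thesis by simp
  qed
  thus "AE u in lborel. norm (frac_density s (Complex K \<epsilon>) u / complex_of_real (exp u + lam)) \<le> norm (density_bound * exp (- s * \<bar>u\<bar>))"
    by (intro AE_I2) (auto intro: order_trans[OF _ abs_ge_self])
qed measurable

text \<open>An argument below pi s places the pole between the two sides of the cut in the contour
  argument. Otherwise sin(arg \<mu>) \<ge> sin(pi s), by monotonicity up to pi/2, whereas sin(arg
  \<mu>) = \<epsilon>/|\<mu>| is at most sin(pi s)/4.\<close>

lemma Arg_bound:
  assumes \<epsilon>: "0 < \<epsilon>" "\<epsilon> \<le> sin (pi * s) * K / 4"
  shows "0 < Im (Ln (Complex K \<epsilon>))" "Im (Ln (Complex K \<epsilon>)) < pi * s" "Im (Ln (Complex K \<epsilon>)) < pi / 2"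
proof -
  define \<mu> where "\<mu> = Complex K \<epsilon>"
  have \<mu>: "Re \<mu> > 0" "Im \<mu> > 0" using K \<epsilon> by (auto simp: \<mu>_def)
  hence n0: "\<mu> \<noteq> 0" by auto
  show 1: "0 < Im (Ln (Complex K \<epsilon>))"
    using \<mu> Im_Ln_pos_lt_imp[of \<mu>] by (simp add: \<mu>_def)
  show 2: "Im (Ln (Complex K \<epsilon>)) < pi / 2"
    using \<mu> Re_Ln_pos_lt_imp[of \<mu>] by (simp add: \<mu>_def)
  let ?t = "Im (Ln \<mu>)"
  have t: "0 < ?t" "?t < pi / 2" using 1 2 by (auto simp: \<mu>_def)
  show "Im (Ln (Complex K \<epsilon>)) < pi * s"
  proof (rule ccontr)
    assume "\<not> ?thesis"
    hence ge: "pi * s \<le> ?t" by (simp add: \<mu>_def)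
    hence "sin (pi * s) \<le> sin ?t" using t s by (intro sin_monotone_2pi_le) (auto intro: order_trans[of _ 0])
    also have "norm \<mu> * sin ?t = \<epsilon>"
    proof -
      have "\<mu> = exp (Ln \<mu>)" using n0 by simp
      hence "Im \<mu> = exp (Re (Ln \<mu>)) * sin ?t" by (metis Im_exp)
      moreover have "exp (Re (Ln \<mu>)) = norm \<mu>" using n0 by simp
      ultimately show ?thesis by (simp add: \<mu>_def)
    qed
    hence "sin ?t = \<epsilon> / norm \<mu>" using n0 by (simp add: field_simps)
    also have "\<epsilon> / norm \<mu> \<le> \<epsilon> / K"
      using K \<epsilon> abs_Re_le_cmod[of \<mu>] by (intro divide_left_mono) (auto simp: \<mu>_def intro!: mult_pos_pos)
    also have "\<dots> \<le> sin (pi * s) / 4" using \<epsilon> K by (simp add: field_simps)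
    finally show False using sin_pi_s_pos by simp
  qed
qed

end

section \<open>The residue computation for the symbol\<close>

lemma exp_quotient_limit:
  fixes c p :: complex
  assumes c: "c \<noteq> 0"
  shows "((\<lambda>z. (z - p) / (exp (c * z) - exp (c * p))) \<longlongrightarrow> 1 / (c * exp (c * p))) (at p)"
proof -
  have "((\<lambda>z. exp (c * z)) has_field_derivative c * exp (c * p)) (at p)"
    by (auto intro!: derivative_eq_intros)
  hence "((\<lambda>z. (exp (c * z) - exp (c * p)) / (z - p)) \<longlongrightarrow> c * exp (c * p)) (at p)"
    by (simp add: has_field_derivative_iff)
  hence "((\<lambda>z. 1 / ((exp (c * z) - exp (c * p)) / (z - p))) \<longlongrightarrow> 1 / (c * exp (c * p))) (at p)"
    by (rule tendsto_divide[OF tendsto_const]) (use c in auto)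
  thus ?thesis by simp
qed

text \<open>The map \<lambda> = e^(-i \<zeta>) unrolls the plane cut along the negative axis to the
  strip |Re \<zeta>| < pi. Both boundary lines lie over \<lambda> = -e^y, and the difference of
  \<open>F\<close> between them is the density. The residue at \<open>p1\<close> gives the symbol,
  the one at \<open>p2\<close> the Helmholtz term, and the horizontal sides of a tall rectangle
  contribute nothing in the limit.\<close>

theorem frac_partial_fractions:
  fixes s K \<epsilon> lam :: real and \<mu> z0 :: complex
  assumes s: "0 < s" "s < 1" and K: "0 < K" and \<epsilon>: "0 < \<epsilon>" "\<epsilon> \<le> sin (pi * s) * K / 4" and lam: "lam > 0"
  defines "\<mu> \<equiv> Complex K \<epsilon>"
  defines "z0 \<equiv> Ln \<mu> / s"
  shows "1 / (complex_of_real (lam powr s) - \<mu>)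
    = exp z0 / (s * \<mu>) / (lam - exp z0) + (LINT u|lborel. frac_density s \<mu> u / complex_of_real (exp u + lam))"
proof -
  \<comment> \<open>This is \<lambda>/((\<lambda>^s - \<mu>)(\<lambda> - lam)) at \<lambda> = e^(-i
    \<zeta>); the numerator \<lambda> is the Jacobian up to the constant -i.\<close>
  define F where "F \<zeta> = exp (-\<i> * \<zeta>) / ((exp (-\<i> * s * \<zeta>) - \<mu>) * (exp (-\<i> * \<zeta>) - lam))" for \<zeta> :: complex
  define \<theta> where "\<theta> = Im (Ln \<mu>)"
  have \<theta>: "0 < \<theta>" "\<theta> < pi * s" "\<theta> < pi / 2" unfolding \<theta>_def \<mu>_def using Arg_bound[OF s K \<epsilon>] by auto
  have \<mu>0: "\<mu> \<noteq> 0" using K by (auto simp: \<mu>_def complex_eq_iff)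
  \<comment> \<open>Half-width of a strip that contains the closed rectangle but no further zero of
    the denominators: other solutions of e^(-i \<zeta>) = lam lie at least 2 pi away, and other
    solutions of e^(-i s \<zeta>) = \<mu> have |Re \<zeta>| \<ge> (2 pi - \<theta>)/s.\<close>
  define L where "L = min (2 * pi) ((2 * pi - \<theta>) / s)"
  have pis: "pi * s < pi" using s by simp
  have L: "pi < L" "L \<le> 2 * pi" "s * L \<le> 2 * pi - \<theta>"
  proof -
    have "pi * s < 2 * pi - \<theta>" using \<theta> pis pi_gt_zero by linarith
    hence "pi < (2 * pi - \<theta>) / s" using s by (simp add: pos_less_divide_eq)
    thus "pi < L" by (simp add: L_def)
    show "L \<le> 2 * pi" by (simp add: L_def)
    have "L \<le> (2 * pi - \<theta>) / s" by (simp add: L_def)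
    thus "s * L \<le> 2 * pi - \<theta>" using s by (simp add: field_simps)
  qed
  define S where "S = {\<zeta>. \<bar>Re \<zeta>\<bar> < L}"
  have S_eq: "S = {\<zeta>. Re \<zeta> < L} \<inter> {\<zeta>. - L < Re \<zeta>}" by (auto simp: S_def abs_less_iff)
  have openS: "open S" unfolding S_eq by (intro open_Int open_halfspace_Re_lt open_halfspace_Re_gt)
  have convS: "convex S" unfolding S_eq by (intro convex_Int convex_halfspace_Re_lt convex_halfspace_Re_gt)
  \<comment> \<open>\<open>p1\<close> lies over \<lambda> = lam, and \<open>p2\<close> over
    \<lambda> = exp z0, the point with \<lambda>^s = \<mu>.\<close>
  define p1 where "p1 = \<i> * complex_of_real (ln lam)"
  define p2 where "p2 = \<i> * z0"
  have e1: "exp (-\<i> * p1) = lam" using lam by (simp add: p1_def exp_of_real flip: mult.assoc)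
  have e2: "exp (-\<i> * s * p2) = \<mu>"
  proof -
    have "-\<i> * s * p2 = - (\<i> * \<i>) * (s * (Ln \<mu> / s))" unfolding p2_def z0_def by (simp only: mult_ac mult_minus_left mult_minus_right)
    hence "-\<i> * s * p2 = Ln \<mu>" using s by simp
    thus ?thesis using \<mu>0 by simp
  qed
  have e1s: "exp (-\<i> * s * p1) = complex_of_real (lam powr s)"
  proof -
    have "-\<i> * s * p1 = complex_of_real (s * ln lam)" by (simp add: p1_def complex_eq_iff)
    thus ?thesis using lam by (simp only: exp_of_real) (simp add: powr_def)
  qed
  have e2l: "exp (-\<i> * p2) = exp z0" by (simp add: p2_def)
  have ne1: "complex_of_real (lam powr s) \<noteq> \<mu>" using \<epsilon> by (auto simp: \<mu>_def complex_eq_iff)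
  have p12: "p1 \<noteq> p2" using e1s e2 ne1 by auto
  have Rep2: "Re p2 = - \<theta> / s" by (simp add: p2_def z0_def \<theta>_def)
  have p1S: "p1 \<in> S" using L pi_gt_zero by (simp add: S_def p1_def)
  have p2S: "p2 \<in> S"
  proof -
    have "\<theta> / s < pi" using \<theta> s by (simp add: pos_divide_less_eq)
    thus ?thesis using L \<theta> s unfolding S_def mem_Collect_eq Rep2 by (simp add: abs_if)
  qed
  have z1: "\<zeta> = p1" if "\<zeta> \<in> S" "exp (-\<i> * \<zeta>) = lam" for \<zeta>
  proof -
    have "exp (-\<i> * \<zeta>) = exp (-\<i> * p1)" using that e1 by simp
    then obtain n :: int where n: "-\<i> * \<zeta> = -\<i> * p1 + (of_int (2 * n) * pi) * \<i>"
      unfolding exp_eq by blast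
    hence "\<zeta> = p1 - of_int (2 * n) * pi" by (simp add: complex_eq_iff)
    hence "Re \<zeta> = - (2 * real_of_int n * pi)" by (simp add: p1_def)
    hence "\<bar>Re \<zeta>\<bar> = \<bar>real_of_int n\<bar> * (2 * pi)" by (simp add: abs_mult)
    moreover have "\<bar>Re \<zeta>\<bar> < L" using that(1) by (simp add: S_def)
    ultimately have "\<bar>real_of_int n\<bar> * (2 * pi) < 1 * (2 * pi)" using L(2) by linarith
    hence "\<bar>real_of_int n\<bar> < 1" using pi_gt_zero by (subst (asm) mult_less_cancel_right_pos) auto
    hence "n = 0" by linarith
    thus ?thesis using \<open>\<zeta> = _\<close> by simp
  qed
  have z2: "\<zeta> = p2" if "\<zeta> \<in> S" "exp (-\<i> * s * \<zeta>) = \<mu>" for \<zeta>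
  proof -
    have "exp (-\<i> * s * \<zeta>) = exp (-\<i> * s * p2)" using that e2 by simp
    then obtain n :: int where n: "-\<i> * s * \<zeta> = -\<i> * s * p2 + (of_int (2 * n) * pi) * \<i>"
      unfolding exp_eq by blast
    hence eq: "s * \<zeta> = s * p2 - of_int (2 * n) * pi" by (simp add: complex_eq_iff)
    hence "Re (s * \<zeta>) = Re (s * p2 - of_int (2 * n) * pi)" by simp
    hence "s * Re \<zeta> = - \<theta> - 2 * real_of_int n * pi" using s by (simp add: Rep2)
    moreover have "\<bar>s * Re \<zeta>\<bar> < 2 * pi - \<theta>"
    proof -
      have "\<bar>s * Re \<zeta>\<bar> = s * \<bar>Re \<zeta>\<bar>" using s by (simp add: abs_mult)
      also have "\<dots> < s * L" using that(1) s by (simp add: S_def)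
      finally show ?thesis using L by simp
    qed
    moreover have "\<bar>\<theta> + 2 * real_of_int n * pi\<bar> = \<bar>- \<theta> - 2 * real_of_int n * pi\<bar>"
      by (subst abs_minus_cancel[symmetric]) (rule arg_cong[of _ _ abs], linarith)
    ultimately have b: "\<bar>\<theta> + 2 * real_of_int n * pi\<bar> < 2 * pi - \<theta>" by simp
    have "n = 0"
    proof (rule ccontr)
      assume "n \<noteq> 0"
      then consider "n \<ge> 1" | "n \<le> -1" by linarith
      thus False
      proof cases
        case 1
        hence "1 * pi \<le> real_of_int n * pi" using pi_gt_zero by (intro mult_right_mono) auto
        thus False using b \<theta> by linarith
      next
        case 2
        hence "real_of_int n * pi \<le> (-1) * pi" using pi_gt_zero by (intro mult_right_mono) auto
        thus False using b \<theta> pi_gt_zero by linarith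
      qed
    qed
    thus ?thesis using eq s by simp
  qed
  have holo: "F holomorphic_on S - {p1, p2}"
    unfolding F_def by (intro holomorphic_intros) (use z1 z2 in auto)
  have r1: "residue F p1 = \<i> / (complex_of_real (lam powr s) - \<mu>)"
  proof (rule residue_simple'[of "S - {p2}"])
    have "F holomorphic_on S - {p1, p2}" by fact
    thus "F holomorphic_on S - {p2} - {p1}" by (simp add: insert_commute Diff_insert2[symmetric])
    have "((\<lambda>\<zeta>. exp (-\<i> * \<zeta>) / (exp (-\<i> * s * \<zeta>) - \<mu>) * ((\<zeta> - p1) / (exp (-\<i> * \<zeta>) - exp (-\<i> * p1))))
        \<longlongrightarrow> exp (-\<i> * p1) / (exp (-\<i> * s * p1) - \<mu>) * (1 / (-\<i> * exp (-\<i> * p1)))) (at p1)"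
      by (intro tendsto_mult tendsto_divide tendsto_intros exp_quotient_limit) (use e1s ne1 in auto)
    also have "exp (-\<i> * p1) / (exp (-\<i> * s * p1) - \<mu>) * (1 / (-\<i> * exp (-\<i> * p1))) = \<i> / (complex_of_real (lam powr s) - \<mu>)"
      unfolding e1s by (simp add: divide_simps)
    finally show "((\<lambda>\<zeta>. F \<zeta> * (\<zeta> - p1)) \<longlongrightarrow> \<i> / (complex_of_real (lam powr s) - \<mu>)) (at p1)"
      unfolding e1 by (simp add: F_def)
  qed (use openS p1S p12 in auto)
  have r2: "residue F p2 = exp z0 / (exp z0 - lam) * (\<i> / (s * \<mu>))"
  proof (rule residue_simple'[of "S - {p1}"])
    have "F holomorphic_on S - {p1, p2}" by fact
    thus "F holomorphic_on S - {p1} - {p2}" by (simp add: Diff_insert2[symmetric])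
    have "((\<lambda>\<zeta>. exp (-\<i> * \<zeta>) / (exp (-\<i> * \<zeta>) - lam) * ((\<zeta> - p2) / (exp (-\<i> * s * \<zeta>) - exp (-\<i> * s * p2))))
        \<longlongrightarrow> exp (-\<i> * p2) / (exp (-\<i> * p2) - lam) * (1 / (-\<i> * s * exp (-\<i> * s * p2)))) (at p2)"
      by (intro tendsto_mult tendsto_divide tendsto_intros exp_quotient_limit) (use z1[OF p2S] p12 s in auto)
    also have "exp (-\<i> * p2) / (exp (-\<i> * p2) - lam) * (1 / (-\<i> * s * exp (-\<i> * s * p2))) = exp z0 / (exp z0 - lam) * (\<i> / (s * \<mu>))"
      unfolding e2 e2l by (simp add: divide_simps)
    finally show "((\<lambda>\<zeta>. F \<zeta> * (\<zeta> - p2)) \<longlongrightarrow> exp z0 / (exp z0 - lam) * (\<i> / (s * \<mu>))) (at p2)"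
      unfolding e2 by (simp add: F_def mult_ac)
  qed (use openS p2S p12 in auto)
  \<comment> \<open>The two residues add up to i R, so the contour integral will be -2 pi R.\<close>
  define R where "R = 1 / (complex_of_real (lam powr s) - \<mu>) + exp z0 / (exp z0 - lam) / (s * \<mu>)"
  define D where "D y = F (Complex pi y) - F (Complex (- pi) y)" for y
  have cexp: "exp (-\<i> * Complex x y) = complex_of_real (exp y) * cis (-x)" for x y
    by (simp add: exp_eq_polar cis_conv_exp[symmetric])
  have cexps: "exp (-\<i> * s * Complex x y) = complex_of_real (exp (s * y)) * cis (-(x * s))" for x y
  proof -
    have "-\<i> * s * Complex x y = Complex (s * y) (- (x * s))" by (simp add: complex_eq_iff)
    thus ?thesis by (simp add: exp_eq_polar)
  qed
  have D: "D y = (2 * pi * \<i>) * (frac_density s \<mu> y / complex_of_real (exp y + lam))" for y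
  proof -
    define E where "E = complex_of_real (exp (s * y))"
    define A where "A = E * cis (pi * s) - \<mu>"
    define B where "B = E * cis (- (pi * s)) - \<mu>"
    define Y where "Y = complex_of_real (exp y)"
    have A0: "A \<noteq> 0" "B \<noteq> 0"
      using frac_denominator_ge[OF s K, of \<epsilon> "pi * s" y] frac_denominator_ge[OF s K, of \<epsilon> "- (pi * s)" y] \<epsilon>
        mult_pos_pos[OF sin_pi_s_pos[OF s K], of "exp (s * y) + K"] K unfolding A_def B_def E_def \<mu>_def
      by (auto simp: add_pos_pos)
    have Y0: "Y + lam \<noteq> 0" using lam exp_gt_zero[of y] unfolding Y_def by (metis add_pos_pos less_irrefl of_real_add of_real_eq_0_iff)
    have cpi: "cis pi = -1" "cis (- pi) = -1" by (simp_all add: complex_eq_iff)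
    have Yl: "- Y - lam = - (Y + lam)" by simp
    have c: "exp (-\<i> * Complex pi y) = - Y" "exp (-\<i> * Complex (- pi) y) = - Y"
        "exp (-\<i> * s * Complex pi y) - \<mu> = B" "exp (-\<i> * s * Complex (- pi) y) - \<mu> = A"
      unfolding cexp cexps using cpi by (simp_all add: Y_def A_def B_def E_def)
    have 1: "F (Complex pi y) = Y / (B * (Y + lam))"
      unfolding F_def c by (simp only: Yl mult_minus_right minus_divide_divide)
    have 2: "F (Complex (-pi) y) = Y / (A * (Y + lam))"
      unfolding F_def c by (simp only: Yl mult_minus_right minus_divide_divide)
    have "D y = Y * (A - B) / (A * B * (Y + lam))"
      unfolding D_def 1 2 using A0 Y0 by (simp add: divide_simps) (simp add: algebra_simps)
    also have "A - B = 2 * \<i> * sin (pi * s) * E"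
      by (simp add: A_def B_def complex_eq_iff)
    also have "Y * (2 * \<i> * sin (pi * s) * E) / (A * B * (Y + lam)) = (2 * pi * \<i>) * (frac_density s \<mu> y / complex_of_real (exp y + lam))"
      unfolding frac_density_def A_def[symmetric] B_def[symmetric] E_def[symmetric] Y_def
      using A0 Y0 by (simp add: divide_simps E_def Y_def)
    finally show ?thesis .
  qed
  have \<epsilon>': "\<bar>\<epsilon>\<bar> \<le> sin (pi * s) * K / 4" using \<epsilon> by simp
  have intD: "integrable lborel D" unfolding D[abs_def] \<mu>_def
    by (intro integrable_mult_right frac_density_integrable[OF s K \<epsilon>' less_imp_le[OF lam]])
  \<comment> \<open>Bound for |F| on the horizontal sides: the first summand serves Im \<zeta> = N
    and is of order e^(-s N), the second serves Im \<zeta> = -N and is of order e^(-N).\<close>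
  define bnd where "bnd N = exp (real N) / ((exp (s * N) - norm \<mu>) * (exp (real N) - lam))
       + exp (- real N) / ((norm \<mu> - exp (- s * N)) * (lam - exp (- real N)))" for N :: nat
  \<comment> \<open>The length 4 pi is that of the two horizontal sides together.\<close>
  have ev: "eventually (\<lambda>N::nat. norm (- (2 * pi) * R - \<i> * integral {- real N..real N} D) \<le> bnd N * (4 * pi)) sequentially"
  proof -
    have l1: "eventually (\<lambda>N::nat. exp (s * N) > norm \<mu>) sequentially"
      using s by real_asymp
    have l2: "eventually (\<lambda>N::nat. exp (real N) > lam) sequentially" by real_asymp
    have l3: "eventually (\<lambda>N::nat. exp (- s * N) < norm \<mu>) sequentially"
    proof -
      have "(\<lambda>N::nat. exp (- s * N)) \<longlonglongrightarrow> 0" using s by real_asymp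
      thus ?thesis using \<mu>0 by (intro order_tendstoD(2)) auto
    qed
    have l4: "eventually (\<lambda>N::nat. exp (- real N) < lam) sequentially"
    proof -
      have "(\<lambda>N::nat. exp (- real N)) \<longlonglongrightarrow> 0" by real_asymp
      thus ?thesis using lam by (intro order_tendstoD(2)) auto
    qed
    have l5: "eventually (\<lambda>N::nat. real N > \<bar>ln lam\<bar> + \<bar>Im p2\<bar> + 1) sequentially" by real_asymp
    show ?thesis using l1 l2 l3 l4 l5
    proof eventually_elim
      case (elim N)
      define a1 where "a1 = Complex (-pi) (- real N)"
      define a2 where "a2 = Complex pi (- real N)"
      define a3 where "a3 = Complex pi (real N)"
      define a4 where "a4 = Complex (-pi) (real N)"
      have N0: "real N > 0" using elim by linarith
      have rect: "rectpath a1 a3 = linepath a1 a2 +++ linepath a2 a3 +++ linepath a3 a4 +++ linepath a4 a1"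
        by (simp add: rectpath_def Let_def a1_def a2_def a3_def a4_def)
      have box: "p1 \<in> box a1 a3" "p2 \<in> box a1 a3"
      proof -
        have "\<bar>ln lam\<bar> < real N" "\<bar>Im p2\<bar> < real N" using elim by linarith+
        note N1 = this[unfolded abs_less_iff]
        show "p1 \<in> box a1 a3" using N1 by (simp add: in_box_complex_iff p1_def a1_def a3_def)
        have "\<theta> / s < pi" using \<theta> s by (simp add: pos_divide_less_eq)
        thus "p2 \<in> box a1 a3" using N1 \<theta> s
          by (simp add: in_box_complex_iff Rep2 a1_def a3_def divide_neg_pos less_trans[of _ 0 pi])
      qed
      have cb: "cbox a1 a3 \<subseteq> S" using L by (auto simp: in_cbox_complex_iff a1_def a3_def S_def)
      have pim: "path_image (rectpath a1 a3) = cbox a1 a3 - box a1 a3"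
        by (rule path_image_rectpath_cbox_minus_box) (use N0 in \<open>auto simp: a1_def a3_def\<close>)
      have sub: "path_image (rectpath a1 a3) \<subseteq> S - {p1, p2}"
        unfolding pim using cb box by auto
      have "contour_integral (rectpath a1 a3) F
          = 2 * pi * \<i> * (\<Sum>p\<in>{p1, p2}. winding_number (rectpath a1 a3) p * residue F p)"
      proof (rule Residue_theorem[OF openS convex_connected[OF convS] _ holo])
        show "\<forall>z. z \<notin> S \<longrightarrow> winding_number (rectpath a1 a3) z = 0"
          using cb N0 by (auto intro!: winding_number_rectpath_outside simp: a1_def a3_def)
      qed (use sub in auto)
      also have "\<dots> = 2 * pi * \<i> * (residue F p1 + residue F p2)"
        using p12 winding_number_rectpath[OF box(1)] winding_number_rectpath[OF box(2)] by simp
      also have "\<dots> = - (2 * pi) * R" unfolding r1 r2 R_def by (simp add: algebra_simps)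
      finally have ci: "contour_integral (rectpath a1 a3) F = - (2 * pi) * R" .
      have pi': "path_image (rectpath a1 a3) = closed_segment a1 a2 \<union> closed_segment a2 a3 \<union> closed_segment a3 a4 \<union> closed_segment a4 a1"
        unfolding rect by (simp add: path_image_join Un_assoc)
      have cont: "continuous_on (closed_segment a b) F" if "closed_segment a b \<subseteq> path_image (rectpath a1 a3)" for a b
        using holomorphic_on_imp_continuous_on[OF holo] sub that continuous_on_subset by blast
      have cint: "F contour_integrable_on linepath a1 a2" "F contour_integrable_on linepath a2 a3"
         "F contour_integrable_on linepath a3 a4" "F contour_integrable_on linepath a4 a1"
        by (intro contour_integrable_continuous_linepath cont; use pi' in blast)+
      have sum: "contour_integral (rectpath a1 a3) F = contour_integral (linepath a1 a2) F + contour_integral (linepath a2 a3) F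
          + contour_integral (linepath a3 a4) F + contour_integral (linepath a4 a1) F"
        unfolding rect using cint by (simp add: contour_integrable_joinI)
      have v1: "contour_integral (linepath a2 a3) F = \<i> * integral {- real N..real N} (\<lambda>y. F (Complex pi y))"
        by (rule contour_integral_linepath_same_Re) (use N0 in \<open>auto simp: a2_def a3_def\<close>)
      have "contour_integral (linepath a4 a1) F = - contour_integral (linepath a1 a4) F"
        by (rule contour_integral_reverse_linepath) (use cont[of a4 a1] pi' in \<open>auto simp: closed_segment_commute\<close>)
      also have "contour_integral (linepath a1 a4) F = \<i> * integral {- real N..real N} (\<lambda>y. F (Complex (-pi) y))"
        by (rule contour_integral_linepath_same_Re) (use N0 in \<open>auto simp: a1_def a4_def\<close>)
      finally have v2: "contour_integral (linepath a4 a1) F = - (\<i> * integral {- real N..real N} (\<lambda>y. F (Complex (-pi) y)))" .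
      have ic: "(\<lambda>y. F (Complex x y)) integrable_on {- real N..real N}" if "x = pi \<or> x = -pi" for x
      proof (rule integrable_continuous_interval, rule continuous_on_compose2[OF holomorphic_on_imp_continuous_on[OF holo]])
        show "continuous_on {- real N..real N} (Complex x)"
          unfolding Complex_eq by (intro continuous_intros)
        have in_path: "Complex x y \<in> path_image (rectpath a1 a3)" if "y \<in> {- real N..real N}" for y
          using that \<open>x = pi \<or> x = -pi\<close> N0 by (subst path_image_rectpath) (auto simp: a1_def a3_def)
        thus "Complex x ` {- real N..real N} \<subseteq> S - {p1, p2}" by (intro image_subsetI subsetD[OF sub] in_path)
      qed
      have "integral {- real N..real N} D = integral {- real N..real N} (\<lambda>y. F (Complex pi y)) - integral {- real N..real N} (\<lambda>y. F (Complex (-pi) y))"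
        unfolding D_def by (rule Henstock_Kurzweil_Integration.integral_diff) (use ic in auto)
      hence E: "- (2 * pi) * R - \<i> * integral {- real N..real N} D = contour_integral (linepath a1 a2) F + contour_integral (linepath a3 a4) F"
      proof -
        have "contour_integral (linepath a1 a2) F + \<i> * integral {- real N..real N} (\<lambda>y. F (Complex pi y))
          + contour_integral (linepath a3 a4) F + - (\<i> * integral {- real N..real N} (\<lambda>y. F (Complex (-pi) y))) = - (2 * pi) * R"
          using sum ci v1 v2 by (simp only:)
        note eq = this[symmetric]
        show ?thesis unfolding eq \<open>integral {- real N..real N} D = _\<close> by (simp add: right_diff_distrib)
      qed
      have bp: "exp (real N) / ((exp (s * N) - norm \<mu>) * (exp (real N) - lam)) \<ge> 0"
          "exp (- real N) / ((norm \<mu> - exp (- s * N)) * (lam - exp (- real N))) \<ge> 0" using elim by auto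
      have Fb: "norm (F \<zeta>) \<le> bnd N" if z: "Im \<zeta> = real N \<or> Im \<zeta> = - real N" for \<zeta>
      proof -
        have n1: "norm (exp (-\<i> * \<zeta>)) = exp (Im \<zeta>)" by simp
        have n2: "norm (exp (-\<i> * s * \<zeta>)) = exp (s * Im \<zeta>)" by simp
        show ?thesis using z
        proof
          assume z: "Im \<zeta> = real N"
          have "norm (F \<zeta>) \<le> exp (real N) / ((exp (s * N) - norm \<mu>) * (exp (real N) - lam))"
            unfolding F_def norm_divide norm_mult n1 z
          proof (intro divide_left_mono mult_mono mult_pos_pos)
            show "exp (s * real N) - norm \<mu> \<le> norm (exp (-\<i> * s * \<zeta>) - \<mu>)"
              using norm_triangle_ineq2[of "exp (-\<i> * s * \<zeta>)" \<mu>] unfolding n2 z by simp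
            show "exp (real N) - lam \<le> norm (exp (-\<i> * \<zeta>) - lam)"
              using norm_triangle_ineq2[of "exp (-\<i> * \<zeta>)" lam] lam unfolding n1 z by simp
            show "0 < norm (exp (-\<i> * s * \<zeta>) - \<mu>)" using elim n2 z by auto
            show "0 < norm (exp (-\<i> * \<zeta>) - lam)" using elim n1 z lam by (metis less_irrefl norm_of_real abs_of_pos zero_less_norm_iff right_minus_eq)
          qed (use elim in auto)
          thus ?thesis using bp by (simp add: bnd_def)
        next
          assume z: "Im \<zeta> = - real N"
          have "norm (F \<zeta>) \<le> exp (- real N) / ((norm \<mu> - exp (- s * N)) * (lam - exp (- real N)))"
            unfolding F_def norm_divide norm_mult n1 z
          proof (intro divide_left_mono mult_mono mult_pos_pos)
            show "norm \<mu> - exp (- s * real N) \<le> norm (exp (-\<i> * s * \<zeta>) - \<mu>)"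
              using norm_triangle_ineq2[of \<mu> "exp (-\<i> * s * \<zeta>)"] unfolding n2 z by (simp add: norm_minus_commute)
            show "lam - exp (- real N) \<le> norm (exp (-\<i> * \<zeta>) - lam)"
              using norm_triangle_ineq2[of lam "exp (-\<i> * \<zeta>)"] lam unfolding n1 z by (simp add: norm_minus_commute)
            show "0 < norm (exp (-\<i> * s * \<zeta>) - \<mu>)" using elim n2 z by auto
            show "0 < norm (exp (-\<i> * \<zeta>) - lam)" using elim n1 z lam by (metis less_irrefl norm_of_real abs_of_pos zero_less_norm_iff right_minus_eq)
          qed (use elim in auto)
          thus ?thesis using bp by (simp add: bnd_def)
        qed
      qed
      have bn0: "bnd N \<ge> 0" using bp by (simp add: bnd_def)
      have h1: "norm (contour_integral (linepath a1 a2) F) \<le> bnd N * norm (a2 - a1)"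
        by (rule contour_integral_bound_linepath[OF cint(1) bn0])
           (intro Fb, auto simp: a1_def a2_def closed_segment_same_Im)
      have h2: "norm (contour_integral (linepath a3 a4) F) \<le> bnd N * norm (a4 - a3)"
        by (rule contour_integral_bound_linepath[OF cint(3) bn0])
           (intro Fb, auto simp: a3_def a4_def closed_segment_same_Im)
      have "a2 - a1 = complex_of_real (2 * pi)" "a4 - a3 = - complex_of_real (2 * pi)"
        by (simp_all add: a1_def a2_def a3_def a4_def complex_eq_iff)
      hence nn: "norm (a2 - a1) = 2 * pi" "norm (a4 - a3) = 2 * pi"
        by (simp_all only: norm_minus_cancel norm_of_real) simp_all
      show ?case unfolding E
        using norm_triangle_ineq[of "contour_integral (linepath a1 a2) F" "contour_integral (linepath a3 a4) F"] h1 h2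
        unfolding nn by simp
    qed
  qed
  have "bnd \<longlonglongrightarrow> 0"
  proof -
    have m: "norm \<mu> > 0" using \<mu>0 by simp
    show ?thesis unfolding bnd_def using s lam m by real_asymp
  qed
  hence "(\<lambda>N. bnd N * (4 * pi)) \<longlonglongrightarrow> 0" using tendsto_mult_left_zero by blast
  hence "(\<lambda>N. - (2 * pi) * R - \<i> * integral {- real N..real N} D) \<longlonglongrightarrow> 0"
    by (rule Lim_null_comparison[OF ev])
  moreover have "(\<lambda>N. - (2 * pi) * R - \<i> * integral {- real N..real N} D) \<longlonglongrightarrow> - (2 * pi) * R - \<i> * (LINT y|lborel. D y)"
  proof (intro tendsto_intros)
    \<comment> \<open>\<open>D\<close> dominates its own truncations, which identifies the limit of
      the vertical contour integrals with the Lebesgue integral.\<close>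
    have "(\<lambda>N. LINT y|lborel. indicator {- real N..real N} y *\<^sub>R D y) \<longlonglongrightarrow> (LINT y|lborel. D y)"
    proof (rule integral_dominated_convergence[where w = "\<lambda>y. norm (D y)"])
      show "D \<in> borel_measurable lborel" "\<And>N. (\<lambda>y. indicator {- real N..real N} y *\<^sub>R D y) \<in> borel_measurable lborel"
        using borel_measurable_integrable[OF intD] by auto
      show "integrable lborel (\<lambda>y. norm (D y))" using intD by simp
      show "AE y in lborel. (\<lambda>N. indicator {- real N..real N} y *\<^sub>R D y) \<longlonglongrightarrow> D y"
      proof (intro AE_I2 tendsto_eventually)
        fix y :: real
        have "eventually (\<lambda>N::nat. real N > \<bar>y\<bar>) sequentially" by real_asymp
        thus "eventually (\<lambda>N. indicator {- real N..real N} y *\<^sub>R D y = D y) sequentially"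
          by eventually_elim (auto simp: indicator_def)
      qed
    qed (auto simp: indicator_def)
    moreover have "(LINT y|lborel. indicator {- real N..real N} y *\<^sub>R D y) = integral {- real N..real N} D" for N
    proof -
      have "set_integrable lborel {- real N..real N} D"
        using intD unfolding set_integrable_def by (intro integrable_mult_indicator) auto
      from set_borel_integral_eq_integral(2)[OF this] show ?thesis by (simp add: set_lebesgue_integral_def)
    qed
    ultimately show "(\<lambda>N. integral {- real N..real N} D) \<longlonglongrightarrow> (LINT y|lborel. D y)" by simp
  qed
  ultimately have "- (2 * pi) * R - \<i> * (LINT y|lborel. D y) = 0"
    using LIMSEQ_unique by blast
  moreover have "(LINT y|lborel. D y) = (2 * pi * \<i>) * (LINT u|lborel. frac_density s \<mu> u / complex_of_real (exp u + lam))"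
    by (simp only: D integral_mult_right_zero)
  ultimately have "(2 * pi) * R = (2 * pi) * (LINT u|lborel. frac_density s \<mu> u / complex_of_real (exp u + lam))"
    by (simp add: algebra_simps)
  hence "R = (LINT u|lborel. frac_density s \<mu> u / complex_of_real (exp u + lam))" by simp
  moreover have "exp z0 / (s * \<mu>) / (lam - exp z0) = - (exp z0 / (exp z0 - lam) / (s * \<mu>))"
  proof -
    have "complex_of_real lam - exp z0 = - (exp z0 - lam)" by simp
    thus ?thesis by (simp only: divide_minus_right divide_divide_eq_left mult.commute)
  qed
  moreover have "1 / (complex_of_real (lam powr s) - \<mu>) = R + - (exp z0 / (exp z0 - lam) / (s * \<mu>))"
    by (simp add: R_def)
  ultimately show ?thesis by (simp only: add.commute)
qed

section \<open>Bessel's equation\<close>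

text \<open>Coefficients of J_0 in powers of y = z^2; \<open>neumann_coeff\<close> belongs to the
  part of (pi/2) Y_0 outside the logarithmic term. In the variable y Bessel's equation becomes 4 (y
  f'' + f') + f = 0.\<close>

definition bessel_coeff :: "nat \<Rightarrow> complex" where
  "bessel_coeff m = (-1) ^ m / (4 ^ m * (fact m)\<^sup>2)"

definition neumann_coeff :: "nat \<Rightarrow> complex" where
  "neumann_coeff m = - bessel_coeff m * harm m"

lemma bessel_coeff_Suc: "4 * (of_nat (Suc m))\<^sup>2 * bessel_coeff (Suc m) = - bessel_coeff m"
proof -
  have "of_nat (Suc m) \<noteq> (0::complex)" by (simp only: of_nat_eq_0_iff)
  thus ?thesis by (simp add: bessel_coeff_def power2_eq_square field_simps del: of_nat_Suc)
qed

lemma norm_bessel_coeff_le: "norm (bessel_coeff m) \<le> 1 / (fact m)\<^sup>2"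
proof -
  have "norm (bessel_coeff m) = 1 / (4 ^ m * (fact m)\<^sup>2)"
    by (simp add: bessel_coeff_def norm_divide norm_mult norm_power)
  also have "\<dots> \<le> 1 / (1 * (fact m)\<^sup>2)"
    by (intro divide_left_mono mult_right_mono mult_pos_pos) (auto intro: one_le_power)
  finally show ?thesis by simp
qed

lemma norm_neumann_coeff_le: "norm (neumann_coeff m) \<le> 1 / fact m"
proof -
  have h: "(harm m :: real) \<le> fact m"
  proof -
    have "(harm m :: real) \<le> (\<Sum>k=1..m. 1)"
      unfolding harm_def by (intro sum_mono) (auto simp: divide_simps)
    also have "\<dots> = of_nat m" by simp
    also have "\<dots> \<le> fact m" using fact_ge_self[of m] by (metis of_nat_fact of_nat_le_iff)
    finally show ?thesis .
  qed
  have "norm (neumann_coeff m) = norm (bessel_coeff m) * harm m"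
    by (simp add: neumann_coeff_def norm_mult norm_harm)
  also have "\<dots> \<le> 1 / (fact m)\<^sup>2 * fact m"
    using h norm_bessel_coeff_le harm_nonneg by (intro mult_mono) auto
  also have "\<dots> = 1 / fact m" by (simp add: power2_eq_square)
  finally show ?thesis .
qed

lemma summable_exp_bound:
  fixes c :: "nat \<Rightarrow> complex"
  assumes "\<And>m. norm (c m) \<le> 1 / fact m"
  shows "summable (\<lambda>m. c m * y ^ m)"
proof (rule summable_comparison_test'[of "\<lambda>m. inverse (fact m) * norm y ^ m" 0])
  show "summable (\<lambda>m. inverse (fact m) * norm y ^ m)" by (rule summable_exp)
  show "norm (c n * y ^ n) \<le> inverse (fact n) * norm y ^ n" for n
    unfolding norm_mult norm_power using assms[of n] by (intro mult_right_mono) (auto simp: inverse_eq_divide)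
qed

lemma bessel_summable: "summable (\<lambda>m. bessel_coeff m * y ^ m)"
proof (rule summable_exp_bound)
  fix m
  have "1 / (fact m)\<^sup>2 \<le> 1 / (fact m :: real)"
    by (intro divide_left_mono) (auto simp: power2_eq_square intro: fact_ge_1)
  thus "norm (bessel_coeff m) \<le> 1 / fact m" using norm_bessel_coeff_le[of m] by linarith
qed

lemma neumann_summable: "summable (\<lambda>m. neumann_coeff m * y ^ m)"
  by (rule summable_exp_bound[OF norm_neumann_coeff_le])

definition pser :: "(nat \<Rightarrow> complex) \<Rightarrow> complex \<Rightarrow> complex" where
  "pser c y = (\<Sum>m. c m * y ^ m)"

lemma summable_diffs:
  assumes "\<And>y. summable (\<lambda>m. c m * y ^ m)"
  shows "summable (\<lambda>m. diffs c m * (y::complex) ^ m)"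
  using termdiff_converges_all[of c y] assms by auto

lemma pser_derivative:
  assumes "\<And>y. summable (\<lambda>m. c m * y ^ m)"
  shows "(pser c has_field_derivative pser (diffs c) y) (at y)"
  unfolding pser_def by (rule termdiffs_strong_converges_everywhere[OF assms])

text \<open>The m-th coefficient of y f'' + f' is (m+1)^2 c_(m+1), so the recurrence is the
  differential equation read off termwise.\<close>

lemma pser_second_order:
  fixes c :: "nat \<Rightarrow> complex"
  assumes c: "\<And>y. summable (\<lambda>m. c m * y ^ m)"
    and rec: "\<And>m. 4 * (of_nat (Suc m))\<^sup>2 * c (Suc m) + c m = d m"
  shows "4 * (y * pser (diffs (diffs c)) y + pser (diffs c) y) + pser c y = pser d y"
proof -
  note c1 = summable_diffs[of c, OF c]
  note c2 = summable_diffs[of "diffs c", OF c1]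
  have s1: "(\<lambda>m. of_nat m * diffs c m * y ^ m) sums (y * pser (diffs (diffs c)) y)"
  proof -
    have "(\<lambda>m. of_nat m * diffs c m * y ^ (m - Suc 0)) sums pser (diffs (diffs c)) y"
      unfolding pser_def by (rule diffs_equiv[OF c2])
    hence "(\<lambda>m. y * (of_nat m * diffs c m * y ^ (m - Suc 0))) sums (y * pser (diffs (diffs c)) y)"
      by (rule sums_mult)
    also have "(\<lambda>m. y * (of_nat m * diffs c m * y ^ (m - Suc 0))) = (\<lambda>m. of_nat m * diffs c m * y ^ m)"
    proof
      fix m show "y * (of_nat m * diffs c m * y ^ (m - Suc 0)) = of_nat m * diffs c m * y ^ m"
        by (cases m) auto
    qed
    finally show ?thesis .
  qed
  have s2: "(\<lambda>m. diffs c m * y ^ m) sums pser (diffs c) y" unfolding pser_def by (rule summable_sums[OF c1])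
  have s3: "(\<lambda>m. c m * y ^ m) sums pser c y" unfolding pser_def by (rule summable_sums[OF c])
  have "(\<lambda>m. 4 * (of_nat m * diffs c m * y ^ m + diffs c m * y ^ m) + c m * y ^ m)
      sums (4 * (y * pser (diffs (diffs c)) y + pser (diffs c) y) + pser c y)"
    by (intro sums_add sums_mult s1 s2 s3)
  also have "(\<lambda>m. 4 * (of_nat m * diffs c m * y ^ m + diffs c m * y ^ m) + c m * y ^ m) = (\<lambda>m. d m * y ^ m)"
  proof
    fix m
    have "4 * (of_nat m * diffs c m * y ^ m + diffs c m * y ^ m) + c m * y ^ m
       = (4 * (of_nat (Suc m))\<^sup>2 * c (Suc m) + c m) * y ^ m"
      by (simp add: diffs_def power2_eq_square algebra_simps)
    thus "4 * (of_nat m * diffs c m * y ^ m + diffs c m * y ^ m) + c m * y ^ m = d m * y ^ m"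
      by (simp only: rec)
  qed
  finally show ?thesis unfolding pser_def by (simp only: sums_unique)
qed

lemma bessel_ode: "4 * (y * pser (diffs (diffs bessel_coeff)) y + pser (diffs bessel_coeff) y) + pser bessel_coeff y = 0"
proof -
  have "4 * (y * pser (diffs (diffs bessel_coeff)) y + pser (diffs bessel_coeff) y) + pser bessel_coeff y = pser (\<lambda>_. 0) y"
    by (rule pser_second_order[OF bessel_summable]) (simp only: bessel_coeff_Suc add.left_inverse)
  thus ?thesis by (simp add: pser_def)
qed

text \<open>The right-hand side cancels what the logarithm produces: for L = Ln (z/2) + const one
  has z (L J)'' + (L J)' + z L J = 2 J'. On the level of coefficients it comes from harm (m+1) -
  harm m = 1/(m+1).\<close>

lemma neumann_ode: "4 * (y * pser (diffs (diffs neumann_coeff)) y + pser (diffs neumann_coeff) y) + pser neumann_coeff y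
   = - 4 * pser (diffs bessel_coeff) y"
proof -
  have "4 * (y * pser (diffs (diffs neumann_coeff)) y + pser (diffs neumann_coeff) y) + pser neumann_coeff y
     = pser (\<lambda>m. - 4 * diffs bessel_coeff m) y"
  proof (rule pser_second_order[OF neumann_summable])
    fix m
    have S: "of_nat (Suc m) \<noteq> (0::complex)" by (simp only: of_nat_eq_0_iff)
    have "4 * (of_nat (Suc m))\<^sup>2 * neumann_coeff (Suc m) + neumann_coeff m
       = - (4 * (of_nat (Suc m))\<^sup>2 * bessel_coeff (Suc m)) * harm (Suc m) - bessel_coeff m * harm m"
      by (simp add: neumann_coeff_def)
    also have "\<dots> = bessel_coeff m * (harm (Suc m) - harm m)"
      unfolding bessel_coeff_Suc by (simp add: algebra_simps)
    also have "harm (Suc m) - harm m = (1 / of_nat (Suc m) :: complex)" by (simp add: harm_Suc inverse_eq_divide)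
    also have "bessel_coeff m * (1 / of_nat (Suc m)) = - (4 * (of_nat (Suc m))\<^sup>2 * bessel_coeff (Suc m)) * (1 / of_nat (Suc m))"
      by (simp only: bessel_coeff_Suc minus_minus)
    also have "\<dots> = - 4 * diffs bessel_coeff m"
      using S by (simp add: diffs_def power2_eq_square del: of_nat_Suc)
    finally show "4 * (of_nat (Suc m))\<^sup>2 * neumann_coeff (Suc m) + neumann_coeff m = - 4 * diffs bessel_coeff m" .
  qed
  also have "\<dots> = - 4 * pser (diffs bessel_coeff) y"
    unfolding pser_def using suminf_mult[OF summable_diffs[OF bessel_summable, of y], of "-4"] by (simp add: mult.assoc)
  finally show ?thesis .
qed

section \<open>Solutions of Bessel's equation on the right half-plane\<close>

definition bessel_solution :: "(complex \<Rightarrow> complex) \<Rightarrow> (complex \<Rightarrow> complex) \<Rightarrow> (complex \<Rightarrow> complex) \<Rightarrow> bool" where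
  "bessel_solution u u1 u2 \<longleftrightarrow> (\<forall>z. Re z > 0 \<longrightarrow>
     (u has_field_derivative u1 z) (at z) \<and> (u1 has_field_derivative u2 z) (at z) \<and> z * u2 z + u1 z + z * u z = 0)"

definition besselJ :: "complex \<Rightarrow> complex" where "besselJ z = pser bessel_coeff (z\<^sup>2)"
definition besselJ1 :: "complex \<Rightarrow> complex" where "besselJ1 z = 2 * z * pser (diffs bessel_coeff) (z\<^sup>2)"
definition besselJ2 :: "complex \<Rightarrow> complex" where
  "besselJ2 z = 2 * pser (diffs bessel_coeff) (z\<^sup>2) + 4 * z\<^sup>2 * pser (diffs (diffs bessel_coeff)) (z\<^sup>2)"

lemma besselJ_derivs:
  shows "(besselJ has_field_derivative besselJ1 z) (at z)"
    and "(besselJ1 has_field_derivative besselJ2 z) (at z)"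
proof -
  have 0: "((\<lambda>z. pser bessel_coeff (z\<^sup>2)) has_field_derivative pser (diffs bessel_coeff) (z\<^sup>2) * (2 * z)) (at z)"
    by (rule DERIV_chain2[OF pser_derivative[OF bessel_summable]]) (auto intro!: derivative_eq_intros)
  show "(besselJ has_field_derivative besselJ1 z) (at z)"
    using 0 by (simp add: besselJ_def[abs_def] besselJ1_def mult_ac)
  have 1: "((\<lambda>z. pser (diffs bessel_coeff) (z\<^sup>2)) has_field_derivative pser (diffs (diffs bessel_coeff)) (z\<^sup>2) * (2 * z)) (at z)"
    by (rule DERIV_chain2[OF pser_derivative[OF summable_diffs[OF bessel_summable]]]) (auto intro!: derivative_eq_intros)
  show "(besselJ1 has_field_derivative besselJ2 z) (at z)"
    unfolding besselJ1_def[abs_def] besselJ2_def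
    by (rule DERIV_cong[OF DERIV_mult[OF _ 1]]) (auto intro!: derivative_eq_intros simp: power2_eq_square)
qed

lemma besselJ_equation: "z * besselJ2 z + besselJ1 z + z * besselJ z = 0"
proof -
  have "z * besselJ2 z + besselJ1 z + z * besselJ z
    = z * (4 * (z\<^sup>2 * pser (diffs (diffs bessel_coeff)) (z\<^sup>2) + pser (diffs bessel_coeff) (z\<^sup>2)) + pser bessel_coeff (z\<^sup>2))"
    by (simp add: besselJ_def besselJ1_def besselJ2_def algebra_simps)
  thus ?thesis by (simp only: bessel_ode mult_zero_right)
qed

text \<open>This is (pi/2) Y_0; the next two functions are its first and second derivative, written
  out so that the equation can be checked by algebra.\<close>

definition neumann :: "complex \<Rightarrow> complex" where
  "neumann z = (Ln (z / 2) + euler_mascheroni) * besselJ z + pser neumann_coeff (z\<^sup>2)"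
definition neumann1 :: "complex \<Rightarrow> complex" where
  "neumann1 z = besselJ z / z + (Ln (z / 2) + euler_mascheroni) * besselJ1 z + 2 * z * pser (diffs neumann_coeff) (z\<^sup>2)"
definition neumann2 :: "complex \<Rightarrow> complex" where
  "neumann2 z = - besselJ z / z\<^sup>2 + 2 * besselJ1 z / z + (Ln (z / 2) + euler_mascheroni) * besselJ2 z
     + 2 * pser (diffs neumann_coeff) (z\<^sup>2) + 4 * z\<^sup>2 * pser (diffs (diffs neumann_coeff)) (z\<^sup>2)"

lemma neumann_solution: "bessel_solution neumann neumann1 neumann2"
  unfolding bessel_solution_def
proof (intro allI impI conjI)
  fix z :: complex assume z: "Re z > 0"
  hence z0: "z \<noteq> 0" by auto
  have Lg: "((\<lambda>z. Ln (z / 2) + euler_mascheroni) has_field_derivative 1 / z) (at z)"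
    using z by (auto intro!: derivative_eq_intros simp: complex_nonpos_Reals_iff)
  have 0: "((\<lambda>z. pser neumann_coeff (z\<^sup>2)) has_field_derivative pser (diffs neumann_coeff) (z\<^sup>2) * (2 * z)) (at z)"
    by (rule DERIV_chain2[OF pser_derivative[OF neumann_summable]]) (auto intro!: derivative_eq_intros)
  have 1: "((\<lambda>z. pser (diffs neumann_coeff) (z\<^sup>2)) has_field_derivative pser (diffs (diffs neumann_coeff)) (z\<^sup>2) * (2 * z)) (at z)"
    by (rule DERIV_chain2[OF pser_derivative[OF summable_diffs[OF neumann_summable]]]) (auto intro!: derivative_eq_intros)
  show "(neumann has_field_derivative neumann1 z) (at z)"
    unfolding neumann_def[abs_def] neumann1_def
    by (rule DERIV_cong[OF DERIV_add[OF DERIV_mult[OF Lg besselJ_derivs(1)] 0]]) (simp add: mult_ac)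
  have j: "((\<lambda>z. besselJ z / z) has_field_derivative (besselJ1 z * z - besselJ z * 1) / (z * z)) (at z)"
    by (rule DERIV_divide[OF besselJ_derivs(1) DERIV_ident z0])
  have k: "((\<lambda>z. 2 * z * pser (diffs neumann_coeff) (z\<^sup>2)) has_field_derivative
       (2 * pser (diffs neumann_coeff) (z\<^sup>2) + 4 * z\<^sup>2 * pser (diffs (diffs neumann_coeff)) (z\<^sup>2))) (at z)"
    by (rule DERIV_cong[OF DERIV_mult[OF _ 1]]) (auto intro!: derivative_eq_intros simp: power2_eq_square)
  show "(neumann1 has_field_derivative neumann2 z) (at z)"
    unfolding neumann1_def[abs_def] neumann2_def
    by (rule DERIV_cong[OF DERIV_add[OF DERIV_add[OF j DERIV_mult[OF Lg besselJ_derivs(2)]] k]])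
       (use z0 in \<open>simp add: field_simps power2_eq_square\<close>)
  have b: "z * pser neumann_coeff (z\<^sup>2) = z * (- 4 * pser (diffs bessel_coeff) (z\<^sup>2)
      - 4 * (z\<^sup>2 * pser (diffs (diffs neumann_coeff)) (z\<^sup>2) + pser (diffs neumann_coeff) (z\<^sup>2)))"
  proof -
    have "pser neumann_coeff (z\<^sup>2) = - 4 * pser (diffs bessel_coeff) (z\<^sup>2)
      - 4 * (z\<^sup>2 * pser (diffs (diffs neumann_coeff)) (z\<^sup>2) + pser (diffs neumann_coeff) (z\<^sup>2))"
      using neumann_ode[of "z\<^sup>2"] by (simp only: eq_diff_eq add.commute)
    thus ?thesis by (simp only:)
  qed
  have l: "(Ln (z / 2) + euler_mascheroni) * (z * besselJ z) = - (Ln (z / 2) + euler_mascheroni) * (z * besselJ2 z + besselJ1 z)"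
  proof -
    have "z * besselJ z = - (z * besselJ2 z + besselJ1 z)" using besselJ_equation[of z] by (simp only: eq_neg_iff_add_eq_0 add_ac)
    thus ?thesis by (simp only: mult_minus_left mult_minus_right)
  qed
  have "z * neumann2 z + neumann1 z + z * neumann z =
     (- besselJ z / z + besselJ z / z) + 2 * besselJ1 z + (Ln (z / 2) + euler_mascheroni) * (z * besselJ2 z + besselJ1 z)
     + (Ln (z / 2) + euler_mascheroni) * (z * besselJ z)
     + (4 * z * pser (diffs neumann_coeff) (z\<^sup>2) + 4 * z * z\<^sup>2 * pser (diffs (diffs neumann_coeff)) (z\<^sup>2)) + z * pser neumann_coeff (z\<^sup>2)"
    using z0 by (simp add: neumann_def neumann1_def neumann2_def field_simps power2_eq_square)
  also have "\<dots> = 0"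
    unfolding l b by (simp add: besselJ1_def algebra_simps)
  finally show "z * neumann2 z + neumann1 z + z * neumann z = 0" .
qed

lemma besselJ_solution: "bessel_solution besselJ besselJ1 besselJ2"
  unfolding bessel_solution_def using besselJ_derivs besselJ_equation by auto

lemma bessel_solution_add:
  assumes "bessel_solution u u1 u2" "bessel_solution v v1 v2"
  shows "bessel_solution (\<lambda>z. a * u z + b * v z) (\<lambda>z. a * u1 z + b * v1 z) (\<lambda>z. a * u2 z + b * v2 z)"
  unfolding bessel_solution_def
proof (intro allI impI conjI)
  fix z :: complex assume z: "Re z > 0"
  note u = assms(1)[unfolded bessel_solution_def, rule_format, OF z]
  note v = assms(2)[unfolded bessel_solution_def, rule_format, OF z]
  show "((\<lambda>z. a * u z + b * v z) has_field_derivative a * u1 z + b * v1 z) (at z)"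
    "((\<lambda>z. a * u1 z + b * v1 z) has_field_derivative a * u2 z + b * v2 z) (at z)"
    using u v by (auto intro!: DERIV_add DERIV_cmult)
  have "z * (a * u2 z + b * v2 z) + (a * u1 z + b * v1 z) + z * (a * u z + b * v z)
     = a * (z * u2 z + u1 z + z * u z) + b * (z * v2 z + v1 z + z * v z)" by (simp add: algebra_simps)
  thus "z * (a * u2 z + b * v2 z) + (a * u1 z + b * v1 z) + z * (a * u z + b * v z) = 0" using u v by simp
qed

lemma of_real_at_right_0: "filterlim complex_of_real (at 0) (at_right 0)"
  unfolding filterlim_at by (auto intro!: tendsto_eq_intros simp: eventually_at_filter)

lemma besselJ_at_0: "besselJ 0 = 1" "besselJ1 0 = 0"
proof -
  have "pser bessel_coeff 0 = bessel_coeff 0"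
    unfolding pser_def by (rule powser_zero)
  thus "besselJ 0 = 1" by (simp add: besselJ_def bessel_coeff_def)
qed (simp add: besselJ1_def)

text \<open>The Wronskian with the regular solution is constant, so a solution that is negligible at the
  origin in the sense below vanishes.\<close>

lemma bessel_solution_unique:
  assumes u: "bessel_solution u u1 u2"
    and lim: "((\<lambda>r. u (complex_of_real r)) \<longlongrightarrow> 0) (at_right 0)"
    and lim1: "((\<lambda>r. complex_of_real r * u1 (complex_of_real r)) \<longlongrightarrow> 0) (at_right 0)"
    and z: "Re z > 0"
  shows "u z = 0"
proof -
  let ?H = "{z::complex. Re z > 0}"
  have cH: "convex ?H" "open ?H" by (rule convex_halfspace_Re_gt, rule open_halfspace_Re_gt)
  note u' = u[unfolded bessel_solution_def, rule_format]
  \<comment> \<open>The factor z turns the Wronskian, a multiple of 1/z for Bessel's equation, into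
    a constant; the two limits at 0 make this constant vanish.\<close>
  define W where "W z = z * (u z * besselJ1 z - u1 z * besselJ z)" for z
  have "\<exists>c. \<forall>z\<in>?H. W z = c"
  proof (rule has_field_derivative_zero_constant[OF cH(1)])
    fix z assume "z \<in> ?H"
    hence z: "Re z > 0" by simp
    have "(W has_field_derivative (1 * (u z * besselJ1 z - u1 z * besselJ z) + ((u1 z * besselJ1 z + besselJ2 z * u z) - (u2 z * besselJ z + besselJ1 z * u1 z)) * z)) (at z)"
      unfolding W_def[abs_def]
      by (intro DERIV_mult DERIV_diff DERIV_ident besselJ_derivs) (use u'[OF z] in auto)
    moreover have "1 * (u z * besselJ1 z - u1 z * besselJ z) + ((u1 z * besselJ1 z + besselJ2 z * u z) - (u2 z * besselJ z + besselJ1 z * u1 z)) * z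
       = u z * (z * besselJ2 z + besselJ1 z + z * besselJ z) - besselJ z * (z * u2 z + u1 z + z * u z)"
      by (simp add: algebra_simps)
    ultimately have "(W has_field_derivative 0) (at z)" using u'[OF z] besselJ_equation[of z] by simp
    thus "(W has_field_derivative 0) (at z within ?H)" by (rule has_field_derivative_at_within)
  qed
  then obtain c where c: "\<And>z. Re z > 0 \<Longrightarrow> W z = c" by auto
  have contJ: "isCont besselJ 0" "isCont besselJ1 0" using besselJ_derivs DERIV_isCont by blast+
  have limJ: "((\<lambda>r. besselJ (complex_of_real r)) \<longlongrightarrow> 1) (at_right 0)" "((\<lambda>r. besselJ1 (complex_of_real r)) \<longlongrightarrow> 0) (at_right 0)"
    using filterlim_compose[OF contJ(1)[unfolded isCont_def] of_real_at_right_0]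
      filterlim_compose[OF contJ(2)[unfolded isCont_def] of_real_at_right_0] by (simp_all add: besselJ_at_0)
  have limr: "((\<lambda>r. complex_of_real r) \<longlongrightarrow> 0) (at_right 0)" by (auto intro!: tendsto_eq_intros)
  have "((\<lambda>r. complex_of_real r * (u (complex_of_real r) * besselJ1 (complex_of_real r))
       - (complex_of_real r * u1 (complex_of_real r)) * besselJ (complex_of_real r)) \<longlongrightarrow> 0 * (0 * 0) - 0 * 1) (at_right 0)"
    by (intro tendsto_intros lim lim1 limJ limr)
  hence "((\<lambda>r. W (complex_of_real r)) \<longlongrightarrow> 0) (at_right 0)" by (simp add: W_def algebra_simps)
  moreover have "((\<lambda>r. W (complex_of_real r)) \<longlongrightarrow> c) (at_right 0)"
    by (rule tendsto_eventually) (auto simp: eventually_at_filter c)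
  ultimately have c0: "c = 0" using tendsto_unique trivial_limit_at_right_real by blast
  \<comment> \<open>With zero Wronskian the quotient \<open>u / besselJ\<close> is locally constant,
    but only away from zeros of \<open>besselJ\<close>. Near the origin there are none, the constant
    is 0 there, and the identity theorem covers the rest of the half-plane.\<close>
  obtain d where d: "d > 0" "\<And>z. dist z 0 < d \<Longrightarrow> besselJ z \<noteq> 0"
  proof -
    have "\<forall>\<^sub>F z in at 0. besselJ z \<noteq> 0"
      using contJ(1) unfolding isCont_def besselJ_at_0 by (rule tendsto_imp_eventually_ne) simp
    then obtain d where "d > 0" "\<And>z. z \<noteq> 0 \<Longrightarrow> dist z 0 < d \<Longrightarrow> besselJ z \<noteq> 0"
      unfolding eventually_at by auto
    thus ?thesis using that[of d] besselJ_at_0(1) by (metis zero_neq_one)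
  qed
  define B where "B = ?H \<inter> ball 0 d"
  have B: "open B" "convex B" unfolding B_def using cH by (auto intro: convex_Int)
  have "\<exists>b. \<forall>z\<in>B. u z / besselJ z = b"
  proof (rule has_field_derivative_zero_constant[OF B(2)])
    fix z assume "z \<in> B"
    hence z: "Re z > 0" "besselJ z \<noteq> 0" using d by (auto simp: B_def)
    have z0: "z \<noteq> 0" using z by auto
    have "((\<lambda>z. u z / besselJ z) has_field_derivative (u1 z * besselJ z - u z * besselJ1 z) / (besselJ z * besselJ z)) (at z)"
      by (intro DERIV_divide besselJ_derivs z) (use u'[OF z(1)] in auto)
    moreover have "u1 z * besselJ z - u z * besselJ1 z = 0"
      using c[OF z(1)] c0 z0 by (simp add: W_def)
    ultimately show "((\<lambda>z. u z / besselJ z) has_field_derivative 0) (at z within B)"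
      by (simp add: has_field_derivative_at_within)
  qed
  then obtain b where b: "\<And>z. z \<in> B \<Longrightarrow> u z / besselJ z = b" by auto
  have "((\<lambda>r. u (complex_of_real r) / besselJ (complex_of_real r)) \<longlongrightarrow> 0 / 1) (at_right 0)"
    by (intro tendsto_divide lim limJ) auto
  moreover have "((\<lambda>r. u (complex_of_real r) / besselJ (complex_of_real r)) \<longlongrightarrow> b) (at_right 0)"
  proof (rule tendsto_eventually)
    have "\<forall>\<^sub>F r in at_right 0. r < d" using d(1) by (simp add: eventually_at_right_less order_tendstoD(2)[OF tendsto_ident_at])
    thus "\<forall>\<^sub>F r in at_right 0. u (complex_of_real r) / besselJ (complex_of_real r) = b"
      using eventually_at_right_less[of 0] by eventually_elim (rule b, auto simp: B_def)
  qed
  ultimately have "b = 0" using tendsto_unique trivial_limit_at_right_real by (metis div_by_1)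
  show ?thesis
  proof (rule analytic_continuation_open[where f = u and g = "\<lambda>_. 0" and s = B and s' = ?H])
    have "complex_of_real (d / 2) \<in> B" using d(1) by (simp add: B_def)
    thus "B \<noteq> {}" by auto
    show "u holomorphic_on ?H" using u' cH(2) by (auto simp: holomorphic_on_open)
    show "u z = 0" if "z \<in> B" for z
      using b[OF that] \<open>b = 0\<close> that d(2)[of z] by (auto simp: B_def)
  qed (use B cH z in \<open>auto simp: B_def intro: convex_connected\<close>)
qed

lemma hankel1_0_series:
  assumes r: "r > 0"
  shows "hankel1_0 r = besselJ (complex_of_real r) + \<i> * (2 / pi) * neumann (complex_of_real r)"
proof -
  have J: "complex_of_real (bessel_J0 r) = besselJ (complex_of_real r)"
  proof -
    have t: "complex_of_real ((-1) ^ m * (r / 2) ^ (2 * m) / (fact m)\<^sup>2) = bessel_coeff m * ((complex_of_real r)\<^sup>2) ^ m" for m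
      by (simp add: bessel_coeff_def power_divide power_mult power2_eq_square)
    have F: "(\<lambda>m. complex_of_real ((-1) ^ m * (r / 2) ^ (2 * m) / (fact m)\<^sup>2)) sums besselJ (complex_of_real r)"
      unfolding t besselJ_def pser_def by (rule summable_sums[OF bessel_summable])
    have s: "summable (\<lambda>m. (-1) ^ m * (r / 2) ^ (2 * m) / (fact m)\<^sup>2)"
      using sums_summable[OF F] unfolding summable_complex_of_real .
    have G: "(\<lambda>m. complex_of_real ((-1) ^ m * (r / 2) ^ (2 * m) / (fact m)\<^sup>2)) sums complex_of_real (bessel_J0 r)"
      unfolding bessel_J0_def by (rule sums_of_real[OF summable_sums[OF s]])
    show ?thesis by (rule sums_unique2[OF G F])
  qed
  have N: "complex_of_real (\<Sum>m. (-1) ^ (m + 2) * harm (m + 1) * (r / 2) ^ (2 * (m + 1)) / (fact (m + 1)) ^ 2) = pser neumann_coeff ((complex_of_real r)\<^sup>2)"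
  proof -
    let ?f = "\<lambda>m. (-1) ^ (m + 2) * harm (m + 1) * (r / 2) ^ (2 * (m + 1)) / (fact (m + 1)) ^ 2"
    have t: "complex_of_real (?f m) = neumann_coeff (Suc m) * ((complex_of_real r)\<^sup>2) ^ Suc m" for m
    proof -
      have h: "complex_of_real (harm (Suc m)) = harm (Suc m)" by (rule of_real_harm)
      have p: "complex_of_real ((r / 2) ^ (2 * Suc m)) = ((complex_of_real r)\<^sup>2) ^ Suc m / 4 ^ Suc m"
        by (simp only: power_mult power_divide of_real_power of_real_divide) simp
      have "complex_of_real (?f m) = (-1) ^ m * harm (Suc m) * (((complex_of_real r)\<^sup>2) ^ Suc m / 4 ^ Suc m) / (fact (Suc m))\<^sup>2"
        unfolding Suc_eq_plus1[symmetric] of_real_divide of_real_mult p h by simp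
      also have "\<dots> = neumann_coeff (Suc m) * ((complex_of_real r)\<^sup>2) ^ Suc m"
        unfolding neumann_coeff_def bessel_coeff_def by (simp add: mult_ac)
      finally show ?thesis .
    qed
    \<comment> \<open>The series of \<open>bessel_Y0\<close> starts with the index 1; the extra term
      at index 0 vanishes because harm 0 = 0, which permits the shift.\<close>
    have "neumann_coeff 0 = 0" by (simp add: neumann_coeff_def harm_def)
    hence F: "(\<lambda>m. complex_of_real (?f m)) sums pser neumann_coeff ((complex_of_real r)\<^sup>2)"
      unfolding t using summable_sums[OF neumann_summable, of "(complex_of_real r)\<^sup>2"]
      by (subst sums_Suc_iff) (simp add: pser_def)
    have s: "summable ?f" using sums_summable[OF F] unfolding summable_complex_of_real .
    have G: "(\<lambda>m. complex_of_real (?f m)) sums complex_of_real (suminf ?f)"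
      by (rule sums_of_real[OF summable_sums[OF s]])
    show ?thesis by (rule sums_unique2[OF G F])
  qed
  have "Ln (complex_of_real r / 2) = complex_of_real (ln (r / 2))"
    using r Ln_of_real[of "r / 2"] by simp
  hence Y: "complex_of_real (bessel_Y0 r) = (2 / pi) * neumann (complex_of_real r)"
    unfolding bessel_Y0_def neumann_def of_real_add of_real_mult N J[symmetric]
    by (simp add: algebra_simps)
  have "hankel1_0 r = complex_of_real (bessel_J0 r) + \<i> * complex_of_real (bessel_Y0 r)"
    by (simp add: hankel1_0_def complex_eq_iff)
  thus ?thesis unfolding Y J by (simp add: mult_ac)
qed

section \<open>The outgoing Hankel function\<close>

lemma integral_FTC_0_infty:
  fixes f F :: "real \<Rightarrow> 'a::euclidean_space"
  assumes F: "\<And>w. w > 0 \<Longrightarrow> (F has_vector_derivative f w) (at w)"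
    and f: "\<And>w. w > 0 \<Longrightarrow> isCont f w" and i: "set_integrable lborel {0<..} f"
    and A: "(F \<longlongrightarrow> A) (at_right 0)" and B: "(F \<longlongrightarrow> B) at_top"
  shows "(LINT w:{0<..}|lborel. f w) = B - A"
proof -
  have e: "einterval 0 \<infinity> = {0<..}" by (auto simp: einterval_def zero_ereal_def)
  have "(LBINT w=0..\<infinity>. f w) = B - A"
  proof (rule interval_integral_FTC_integrable)
    show "((F \<circ> real_of_ereal) \<longlongrightarrow> A) (at_right 0)" "((F \<circ> real_of_ereal) \<longlongrightarrow> B) (at_left \<infinity>)"
      using A B by (simp_all add: ereal_tendsto_simps zero_ereal_def)
  qed (use F f i in \<open>auto simp: e zero_ereal_def\<close>)
  thus ?thesis by (simp add: interval_lebesgue_integral_0_infty)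
qed

text \<open>Dominated convergence along sequences. Since \<open>g\<close> dominates only for r \<le>
  d, an initial segment of each sequence is dropped.\<close>

lemma tendsto_integral_at_right_0:
  fixes f :: "real \<Rightarrow> 'a \<Rightarrow> 'b::{banach, second_countable_topology}"
  assumes f: "\<And>r. r > 0 \<Longrightarrow> f r \<in> borel_measurable M" and f0: "f0 \<in> borel_measurable M"
    and g: "integrable M g" and d: "d > 0"
    and bound: "\<And>r x. 0 < r \<Longrightarrow> r \<le> d \<Longrightarrow> x \<in> space M \<Longrightarrow> norm (f r x) \<le> g x"
    and lim: "\<And>x. x \<in> space M \<Longrightarrow> ((\<lambda>r. f r x) \<longlongrightarrow> f0 x) (at_right 0)"
  shows "((\<lambda>r. \<integral>x. f r x \<partial>M) \<longlongrightarrow> (\<integral>x. f0 x \<partial>M)) (at_right 0)"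
  unfolding tendsto_at_iff_sequentially
proof (intro allI impI)
  fix X :: "nat \<Rightarrow> real"
  assume X0: "\<forall>i. X i \<in> {0<..} - {0}" and X: "X \<longlonglongrightarrow> 0"
  obtain N where N: "\<And>n. n \<ge> N \<Longrightarrow> X n < d"
    using order_tendstoD(2)[OF X d] by (auto simp: eventually_sequentially)
  have "(\<lambda>n. \<integral>x. f (X (n + N)) x \<partial>M) \<longlonglongrightarrow> (\<integral>x. f0 x \<partial>M)"
  proof (rule integral_dominated_convergence[where w = g])
    show "AE x in M. (\<lambda>n. f (X (n + N)) x) \<longlonglongrightarrow> f0 x"
    proof (rule AE_I2)
      fix x assume "x \<in> space M"
      from lim[OF this, unfolded tendsto_at_iff_sequentially] X0 X have "(\<lambda>n. f (X n) x) \<longlonglongrightarrow> f0 x"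
        by (auto simp: o_def)
      thus "(\<lambda>n. f (X (n + N)) x) \<longlonglongrightarrow> f0 x" by (rule LIMSEQ_ignore_initial_segment)
    qed
    show "AE x in M. norm (f (X (n + N)) x) \<le> g x" for n
      using bound[of "X (n + N)"] X0 less_imp_le[OF N[of "n + N"]] by (intro AE_I2) auto
    show "f (X (n + N)) \<in> borel_measurable M" for n using f X0 by auto
  qed fact+
  thus "((\<lambda>r. \<integral>x. f r x \<partial>M) \<circ> X) \<longlonglongrightarrow> (\<integral>x. f0 x \<partial>M)" unfolding o_def by (rule LIMSEQ_offset)
qed

text \<open>The denominator of \<open>hankel_integrand\<close> at \<kappa> = 1. Using
  \<open>csqrt\<close> for the first root too makes it the restriction of a holomorphic function, so
  the complex derivative rules apply.\<close>

definition hroot :: "real \<Rightarrow> complex" where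
  "hroot w = csqrt (complex_of_real w) * csqrt (complex_of_real w - 2 * \<i>)"

lemma hroot_domain:
  assumes w: "w > 0"
  shows "complex_of_real w \<notin> \<real>\<^sub>\<le>\<^sub>0" "complex_of_real w - 2 * \<i> \<notin> \<real>\<^sub>\<le>\<^sub>0" "complex_of_real w \<noteq> 0" "complex_of_real w - 2 * \<i> \<noteq> 0"
  using w by (auto simp: complex_nonpos_Reals_iff complex_eq_iff)

lemma hroot_eq: "w > 0 \<Longrightarrow> hroot w = complex_of_real (sqrt w) * csqrt (complex_of_real w - 2 * \<i>)"
  by (simp add: hroot_def)

lemma hroot_nz: "w > 0 \<Longrightarrow> hroot w \<noteq> 0"
  using hroot_domain[of w] by (simp add: hroot_def)

lemma hroot_square: "(hroot w)\<^sup>2 = (complex_of_real w)\<^sup>2 - 2 * \<i> * complex_of_real w"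
  by (simp add: hroot_def power_mult_distrib) (simp add: algebra_simps power2_eq_square)

lemma Re_hroot: "w > 0 \<Longrightarrow> Re (hroot w) \<ge> 0"
  using Re_csqrt[of "complex_of_real w - 2 * \<i>"] by (simp add: hroot_eq)

lemma norm_hroot_ge:
  assumes w: "w > 0" shows "norm (hroot w) \<ge> w" "norm (hroot w) \<ge> sqrt w * sqrt ((1 + w) / 2)"
proof -
  let ?d = "complex_of_real w - 2 * \<i>"
  have n: "norm (hroot w) = sqrt w * sqrt (norm ?d)" using w by (simp add: hroot_eq norm_mult)
  have 1: "norm ?d \<ge> w" using abs_Re_le_cmod[of ?d] w by simp
  have 2: "norm ?d \<ge> 2" using abs_Im_le_cmod[of ?d] by simp
  have "sqrt w * sqrt w \<le> sqrt w * sqrt (norm ?d)" using 1 w by (intro mult_left_mono) auto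
  thus "norm (hroot w) \<ge> w" using w by (simp add: n)
  have "(1 + w) / 2 \<le> norm ?d" using 1 2 by simp
  thus "norm (hroot w) \<ge> sqrt w * sqrt ((1 + w) / 2)" unfolding n using w by (intro mult_left_mono) auto
qed

lemma hroot_deriv:
  assumes w: "w > 0"
  shows "(hroot has_vector_derivative (complex_of_real w - \<i>) / hroot w) (at w)"
proof -
  let ?z = "complex_of_real w"
  note d = hroot_domain[OF w]
  have a: "csqrt ?z \<noteq> 0" "csqrt (?z - 2 * \<i>) \<noteq> 0" using d by auto
  have "((\<lambda>z. csqrt z * csqrt (z - 2 * \<i>)) has_field_derivative
      (inverse (2 * csqrt ?z) * csqrt (?z - 2 * \<i>) + inverse (2 * csqrt (?z - 2 * \<i>)) * csqrt ?z)) (at ?z)"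
    using d by (auto intro!: derivative_eq_intros simp: field_simps)
  also have "inverse (2 * csqrt ?z) * csqrt (?z - 2 * \<i>) + inverse (2 * csqrt (?z - 2 * \<i>)) * csqrt ?z
     = ((csqrt (?z - 2 * \<i>))\<^sup>2 + (csqrt ?z)\<^sup>2) / (2 * hroot w)"
    using a by (simp add: hroot_def field_simps power2_eq_square)
  also have "(csqrt (?z - 2 * \<i>))\<^sup>2 + (csqrt ?z)\<^sup>2 = 2 * (?z - \<i>)" by simp
  also have "2 * (?z - \<i>) / (2 * hroot w) = (?z - \<i>) / hroot w"
    by (subst mult_divide_mult_cancel_left_if) simp
  finally show ?thesis unfolding hroot_def[abs_def, symmetric]
    using has_vector_derivative_real_field[of "\<lambda>z. csqrt z * csqrt (z - 2 * \<i>)" _ w UNIV]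
    by (simp add: hroot_def[abs_def])
qed

lemma hroot_isCont: "w > 0 \<Longrightarrow> isCont hroot w"
  using hroot_deriv has_vector_derivative_continuous by blast

lemma csqrt_of_real_mult:
  assumes "c \<ge> 0" shows "csqrt (complex_of_real c * z) = complex_of_real (sqrt c) * csqrt z"
proof (cases "c = 0")
  case False
  show ?thesis
  proof (rule csqrt_unique)
    show "(complex_of_real (sqrt c) * csqrt z)\<^sup>2 = complex_of_real c * z"
      using assms by (simp add: power_mult_distrib flip: of_real_power)
    show "0 < Re (complex_of_real (sqrt c) * csqrt z) \<or> Re (complex_of_real (sqrt c) * csqrt z) = 0 \<and> 0 \<le> Im (complex_of_real (sqrt c) * csqrt z)"
      using csqrt_principal[of z] assms False by auto
  qed
qed simp

text \<open>A normalised form with a visible limit for large \<open>w\<close>; it is applied with c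
  = 1 + w and with c = w.\<close>

lemma hroot_ratio:
  assumes "w > 0" "c > 0"
  shows "hroot w / complex_of_real c = complex_of_real (sqrt (w / c)) * csqrt (complex_of_real (w / c) - 2 * \<i> / complex_of_real c)"
proof -
  have "complex_of_real c * (complex_of_real (w / c) - 2 * \<i> / complex_of_real c) = complex_of_real w - 2 * \<i>"
    using assms by (simp add: field_simps)
  hence A: "csqrt (complex_of_real w - 2 * \<i>) = complex_of_real (sqrt c) * csqrt (complex_of_real (w / c) - 2 * \<i> / complex_of_real c)"
    using csqrt_of_real_mult[of c] assms by (metis less_imp_le)
  have B: "sqrt w * sqrt c / c = sqrt (w / c)"
    using assms by (simp add: real_sqrt_divide field_simps)
  have "complex_of_real (sqrt w) * (complex_of_real (sqrt c) * X) / complex_of_real c = complex_of_real (sqrt w * sqrt c / c) * X" for X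
    by simp
  thus ?thesis unfolding hroot_eq[OF assms(1)] A B .
qed

text \<open>Since hroot^2 = (w - i)^2 + 1, this primitive of 1/hroot is arsinh (w - i). For w > 0
  the argument of \<open>Ln\<close> has positive real part and so avoids the cut.\<close>

definition hprim :: "real \<Rightarrow> complex" where "hprim w = Ln (complex_of_real w - \<i> + hroot w)"

lemma hprim_deriv:
  assumes w: "w > 0" shows "(hprim has_vector_derivative 1 / hroot w) (at w)"
proof -
  let ?a = "complex_of_real w - \<i> + hroot w"
  have p: "Re ?a > 0" using w Re_hroot[OF w] by simp
  have "((\<lambda>w. complex_of_real w - \<i> + hroot w) has_vector_derivative (1 - 0 + (complex_of_real w - \<i>) / hroot w)) (at w)"
    by (intro has_vector_derivative_add has_vector_derivative_diff hroot_deriv[OF w] has_vector_derivative_const)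
       (use has_vector_derivative_of_real[OF DERIV_ident] in simp)
  moreover have "(Ln has_field_derivative inverse ?a) (at ?a)"
    using p by (intro has_field_derivative_Ln) (auto simp: complex_nonpos_Reals_iff)
  ultimately have "((Ln \<circ> (\<lambda>w. complex_of_real w - \<i> + hroot w)) has_vector_derivative (1 - 0 + (complex_of_real w - \<i>) / hroot w) * inverse ?a) (at w)"
    by (rule field_vector_diff_chain_at)
  also have "(1 - 0 + (complex_of_real w - \<i>) / hroot w) * inverse ?a = 1 / hroot w"
  proof -
    have "?a \<noteq> 0" using p by (metis less_irrefl zero_complex.sel(1))
    thus ?thesis using hroot_nz[OF w] by (simp add: field_simps)
  qed
  finally show ?thesis by (simp add: hprim_def[abs_def] o_def)
qed

lemma hroot_at_0: "(hroot \<longlongrightarrow> 0) (at_right 0)"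
proof (rule tendsto_norm_zero_cancel)
  have "((\<lambda>w. sqrt w * sqrt (norm (complex_of_real w - 2 * \<i>))) \<longlongrightarrow> sqrt 0 * sqrt (norm (complex_of_real 0 - 2 * \<i>))) (at_right 0)"
    by (intro tendsto_intros)
  moreover have "\<forall>\<^sub>F w in at_right 0. norm (hroot w) = sqrt w * sqrt (norm (complex_of_real w - 2 * \<i>))"
    using eventually_at_right_less[of 0] by eventually_elim (simp add: hroot_eq norm_mult)
  ultimately show "((\<lambda>w. norm (hroot w)) \<longlongrightarrow> 0) (at_right 0)"
    by (simp add: tendsto_cong)
qed

text \<open>The value Ln (-i) is the source of the constant i pi/2 below, hence of the J_0 component
  of the Hankel function.\<close>

lemma hprim_at_0: "(hprim \<longlongrightarrow> - (\<i> * pi / 2)) (at_right 0)"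
proof -
  have "((\<lambda>w. complex_of_real w - \<i> + hroot w) \<longlongrightarrow> complex_of_real 0 - \<i> + 0) (at_right 0)"
    by (intro tendsto_intros hroot_at_0)
  hence "((\<lambda>w. Ln (complex_of_real w - \<i> + hroot w)) \<longlongrightarrow> Ln (- \<i>)) (at_right 0)"
    by (intro tendsto_Ln) (auto simp: complex_nonpos_Reals_iff)
  thus ?thesis by (simp add: hprim_def[abs_def])
qed

text \<open>The argument w - i + hroot w grows like 2 w, whence ln 2; dividing it by 1 + w inside
  \<open>Ln\<close> makes the limit a matter of continuity.\<close>

lemma hprim_at_infinity: "((\<lambda>w. hprim w - complex_of_real (ln (1 + w))) \<longlongrightarrow> complex_of_real (ln 2)) at_top"
proof -
  have l1: "((\<lambda>w::real. complex_of_real (w / (1 + w))) \<longlongrightarrow> complex_of_real 1) at_top"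
    by (intro tendsto_of_real) real_asymp
  have l2: "((\<lambda>w::real. complex_of_real (1 / (1 + w))) \<longlongrightarrow> complex_of_real 0) at_top"
    by (intro tendsto_of_real) real_asymp
  have l3: "((\<lambda>w::real. sqrt (w / (1 + w))) \<longlongrightarrow> 1) at_top" by real_asymp
  have "((\<lambda>w. complex_of_real (w / (1 + w)) - \<i> * complex_of_real (1 / (1 + w))
       + complex_of_real (sqrt (w / (1 + w))) * csqrt (complex_of_real (w / (1 + w)) - 2 * \<i> * complex_of_real (1 / (1 + w))))
      \<longlongrightarrow> complex_of_real 1 - \<i> * complex_of_real 0 + complex_of_real 1 * csqrt (complex_of_real 1 - 2 * \<i> * complex_of_real 0)) at_top"
    by (intro tendsto_intros l1 l2 l3 tendsto_compose[OF isContD[OF continuous_at_csqrt]]) (auto simp: complex_nonpos_Reals_iff)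
  hence "((\<lambda>w. Ln (complex_of_real (w / (1 + w)) - \<i> * complex_of_real (1 / (1 + w))
       + complex_of_real (sqrt (w / (1 + w))) * csqrt (complex_of_real (w / (1 + w)) - 2 * \<i> * complex_of_real (1 / (1 + w)))))
      \<longlongrightarrow> Ln 2) at_top"
    by (intro tendsto_Ln) (auto simp: complex_nonpos_Reals_iff)
  moreover have "\<forall>\<^sub>F w in at_top. Ln (complex_of_real (w / (1 + w)) - \<i> * complex_of_real (1 / (1 + w))
       + complex_of_real (sqrt (w / (1 + w))) * csqrt (complex_of_real (w / (1 + w)) - 2 * \<i> * complex_of_real (1 / (1 + w))))
     = hprim w - complex_of_real (ln (1 + w))"
    using eventually_gt_at_top[of 0]
  proof eventually_elim
    case (elim w)
    have w: "1 + w > 0" using elim by simp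
    have "complex_of_real (w / (1 + w)) - \<i> * complex_of_real (1 / (1 + w))
       + complex_of_real (sqrt (w / (1 + w))) * csqrt (complex_of_real (w / (1 + w)) - 2 * \<i> * complex_of_real (1 / (1 + w)))
       = (complex_of_real w - \<i> + hroot w) / complex_of_real (1 + w)"
      using hroot_ratio[OF elim w] by (simp add: add_divide_distrib diff_divide_distrib)
    moreover have "complex_of_real w - \<i> + hroot w \<noteq> 0" using elim Re_hroot[OF elim] by (auto simp: complex_eq_iff)
    ultimately show ?case using w Ln_divide_of_real[of "1 + w" "complex_of_real w - \<i> + hroot w"]
      by (simp add: hprim_def)
  qed
  moreover have "Ln 2 = complex_of_real (ln 2)" using Ln_of_real[of 2] by simp
  ultimately show ?thesis using tendsto_cong by force
qed

lemma inverse_sqrt_integrable: "set_integrable lborel {0<..} (\<lambda>w::real. 1 / (sqrt w * (1 + w)))"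
proof -
  note im = image_square_pos
  have "set_integrable lborel ((\<lambda>y::real. y\<^sup>2) ` {0<..}) (\<lambda>w. 1 / (sqrt w * (1 + w)))
      \<longleftrightarrow> set_integrable lborel {0<..} (\<lambda>y. \<bar>2 * y\<bar> * (1 / (sqrt (y\<^sup>2) * (1 + y\<^sup>2))))"
  proof (rule lborel_substitution(1))
    show "inj_on (\<lambda>y::real. y\<^sup>2) {0<..}" by (auto simp: inj_on_def)
  qed (auto intro!: derivative_eq_intros simp: im)
  also have "\<dots> \<longleftrightarrow> set_integrable lborel {0<..} (\<lambda>y::real. 2 * inverse (1 + y\<^sup>2))"
    by (rule set_integrable_cong) (auto simp: divide_simps)
  also have "\<dots>" unfolding set_integrable_def
    by (intro integrable_mult_indicator integrable_mult_right inverse_1_plus_square_integrable) auto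
  finally show ?thesis unfolding im by simp
qed

abbreviation hroot_diff :: "real \<Rightarrow> complex" where
  "hroot_diff w \<equiv> 1 / hroot w - complex_of_real (1 / (1 + w))"

text \<open>1/hroot decays only like 1/w, so 1/(1 + w) is subtracted. The difference is rationalised
  by (1 + w) + hroot w, of norm at least 1 + w because Re hroot \<ge> 0. The constant 6 is 4/(2/3),
  from sqrt((1 + w)/2) \<ge> 2/3.\<close>

lemma hroot_diff_bound:
  assumes w: "w > 0"
  shows "norm (hroot_diff w) \<le> 6 * (1 / (sqrt w * (1 + w)))"
proof -
  have w1: "complex_of_real (1 + w) \<noteq> 0" using w by (simp only: of_real_eq_0_iff)
  define P where "P = complex_of_real (1 + w) + hroot w"
  have P: "norm P \<ge> 1 + w" using abs_Re_le_cmod[of P] Re_hroot[OF w] w by (simp add: P_def)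
  hence P0: "P \<noteq> 0" using w by auto
  have "(complex_of_real (1 + w) - hroot w) * P = (complex_of_real (1 + w))\<^sup>2 - (hroot w)\<^sup>2"
    by (simp add: P_def algebra_simps power2_eq_square)
  also have "\<dots> = 1 + complex_of_real (2 * w) + complex_of_real (2 * w) * \<i>"
    unfolding hroot_square by (simp add: power2_eq_square algebra_simps)
  finally have e: "(complex_of_real (1 + w) - hroot w) * P = 1 + complex_of_real (2 * w) + complex_of_real (2 * w) * \<i>" .
  have "hroot_diff w = ((complex_of_real (1 + w) - hroot w) * P) / (hroot w * complex_of_real (1 + w) * P)"
    using w1 hroot_nz[OF w] P0 by (simp add: divide_simps)
  hence "norm (hroot_diff w) = norm (1 + complex_of_real (2 * w) + complex_of_real (2 * w) * \<i>) / (norm (hroot w) * (1 + w) * norm P)"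
    unfolding e using w by (simp only: norm_divide norm_mult norm_of_real)
  also have "\<dots> \<le> (4 * (1 + w)) / (sqrt w * sqrt ((1 + w) / 2) * (1 + w) * (1 + w))"
  proof (rule frac_le)
    have "norm (1 + complex_of_real (2 * w) + complex_of_real (2 * w) * \<i>) \<le> norm (1 + complex_of_real (2 * w)) + norm (complex_of_real (2 * w) * \<i>)"
      by (rule norm_triangle_ineq)
    also have "norm (1 + complex_of_real (2 * w)) \<le> 1 + 2 * w"
      by (rule norm_triangle_le) (use w in simp)
    also have "norm (complex_of_real (2 * w) * \<i>) = 2 * w" using w by (simp only: norm_mult norm_of_real norm_ii)
    finally show "norm (1 + complex_of_real (2 * w) + complex_of_real (2 * w) * \<i>) \<le> 4 * (1 + w)" using w by simp
    show "sqrt w * sqrt ((1 + w) / 2) * (1 + w) * (1 + w) \<le> norm (hroot w) * (1 + w) * norm P"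
      using norm_hroot_ge(2)[OF w] P w by (intro mult_mono) auto
  qed (use w in auto)
  also have "\<dots> = 4 / sqrt ((1 + w) / 2) * (1 / (sqrt w * (1 + w)))"
  proof -
    have "(4 * c) / (a * b * c * c) = 4 / b * (1 / (a * c))" if "c \<noteq> 0" for a b c :: real
      using that by (simp add: divide_simps)
    from this[of "1 + w" "sqrt w" "sqrt ((1 + w) / 2)"] show ?thesis using w by linarith
  qed
  also have "\<dots> \<le> 6 * (1 / (sqrt w * (1 + w)))"
  proof (rule mult_right_mono)
    have "(2 / 3)\<^sup>2 \<le> (1 + w) / 2" using w by (simp add: power2_eq_square)
    hence "2 / 3 \<le> sqrt ((1 + w) / 2)" using real_le_rsqrt by blast
    hence "4 / sqrt ((1 + w) / 2) \<le> 4 / (2 / 3)" using w by (intro divide_left_mono mult_pos_pos) auto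
    thus "4 / sqrt ((1 + w) / 2) \<le> 6" by simp
  qed (use w in auto)
  finally show ?thesis .
qed

text \<open>The primitive is \<open>hprim w - ln (1 + w)\<close>, with limits ln 2 at infinity and
  -i pi/2 at 0.\<close>

lemma hroot_diff_integral:
  shows "set_integrable lborel {0<..} (\<lambda>w. hroot_diff w)"
    and "(LINT w:{0<..}|lborel. hroot_diff w) = complex_of_real (ln 2) + \<i> * pi / 2"
proof -
  have c: "isCont (\<lambda>w. hroot_diff w) w" if "w > 0" for w
    using that hroot_isCont[OF that] hroot_nz[OF that] by (intro continuous_intros) auto
  show i: "set_integrable lborel {0<..} (\<lambda>w. hroot_diff w)"
    unfolding set_integrable_def
  proof (rule Bochner_Integration.integrable_bound[OF integrable_mult_right[OF inverse_sqrt_integrable[unfolded set_integrable_def], of 6]])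
    have "continuous_on {0<..} (\<lambda>w. hroot_diff w)"
      by (rule continuous_at_imp_continuous_on) (use c in blast)
    hence "(\<lambda>w. indicator {0<..} w *\<^sub>R (hroot_diff w)) \<in> borel_measurable borel"
      by (rule borel_measurable_continuous_on_indicator[rotated]) simp
    thus "(\<lambda>w. indicator {0<..} w *\<^sub>R (hroot_diff w)) \<in> borel_measurable lborel" by simp
    show "AE w in lborel. norm (indicator {0<..} w *\<^sub>R (hroot_diff w)) \<le> norm (6 * (indicator {0<..} w *\<^sub>R (1 / (sqrt w * (1 + w)))))"
    proof (rule AE_I2)
      fix w :: real
      show "norm (indicator {0<..} w *\<^sub>R (hroot_diff w)) \<le> norm (6 * (indicator {0<..} w *\<^sub>R (1 / (sqrt w * (1 + w)))))"
        using hroot_diff_bound[of w] by (cases "w > 0") (auto simp: indicator_def)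
    qed
  qed
  have "(LINT w:{0<..}|lborel. hroot_diff w) = complex_of_real (ln 2) - (- (\<i> * pi / 2) - complex_of_real (ln (1 + 0)))"
  proof (rule integral_FTC_0_infty[OF _ c i])
    fix w :: real assume w: "w > 0"
    have "((\<lambda>w. ln (1 + w)) has_real_derivative 1 / (1 + w)) (at w)"
      using w by (auto intro!: derivative_eq_intros)
    hence "((\<lambda>w. complex_of_real (ln (1 + w))) has_vector_derivative complex_of_real (1 / (1 + w))) (at w)"
      by (rule has_vector_derivative_of_real)
    thus "((\<lambda>w. hprim w - complex_of_real (ln (1 + w))) has_vector_derivative (hroot_diff w)) (at w)"
      by (intro has_vector_derivative_diff hprim_deriv[OF w])
  next
    show "((\<lambda>w. hprim w - complex_of_real (ln (1 + w))) \<longlongrightarrow> - (\<i> * pi / 2) - complex_of_real (ln (1 + 0))) (at_right 0)"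
      by (intro tendsto_intros hprim_at_0) auto
  qed (auto intro: hprim_at_infinity)
  thus "(LINT w:{0<..}|lborel. hroot_diff w) = complex_of_real (ln 2) + \<i> * pi / 2" by simp
qed

text \<open>From x \<le> e^x at x = r w/(2 (j + 1)), raised to the power j: half of the exponential
  pays for the power. Taking j + 1 in place of j avoids a division by zero at j = 0.\<close>

lemma power_times_exp_le:
  assumes r: "r > 0" and w: "w > 0"
  shows "w ^ j * exp (- r * w) \<le> (2 * (real j + 1) / r) ^ j * exp (- (r / 2) * w)"
proof -
  define J where "J = real j + 1"
  have J: "J > 0" "real j \<le> J" by (auto simp: J_def)
  define x where "x = r * w / (2 * J)"
  have x: "x > 0" using r w J by (simp add: x_def)
  have "x \<le> exp x" using exp_ge_add_one_self[of x] by linarith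
  hence "x ^ j \<le> exp x ^ j" using x by (intro power_mono) auto
  also have "\<dots> = exp (real j * x)" by (simp add: exp_of_nat_mult)
  also have "\<dots> \<le> exp (J * x)" using x J by (simp add: mult_right_mono)
  also have "J * x = r * w / 2" using J by (simp add: x_def)
  finally have "x ^ j \<le> exp (r * w / 2)" .
  moreover have "w = (2 * J / r) * x" using r J by (simp add: x_def field_simps)
  hence "w ^ j = (2 * J / r) ^ j * x ^ j" by (metis power_mult_distrib)
  ultimately have "w ^ j \<le> (2 * J / r) ^ j * exp (r * w / 2)"
    using r J by (simp add: mult_left_mono)
  hence "w ^ j * exp (- r * w) \<le> (2 * J / r) ^ j * exp (r * w / 2) * exp (- r * w)"
    by (intro mult_right_mono) auto
  also have "\<dots> = (2 * J / r) ^ j * exp (- (r / 2) * w)"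
    by (simp add: mult.assoc flip: exp_add)
  finally show ?thesis unfolding J_def .
qed

section \<open>Moments of the Laplace integral\<close>

abbreviation hmoment_integrand :: "nat \<Rightarrow> complex \<Rightarrow> real \<Rightarrow> complex" where
  "hmoment_integrand j z w \<equiv> complex_of_real w ^ j * exp (- z * complex_of_real w) / hroot w"

text \<open>The factor w^j comes from differentiation under the integral: up to the sign (-1)^j this
  is the j-th derivative of \<open>hankel_laplace 1\<close>.\<close>

definition hmoment :: "nat \<Rightarrow> complex \<Rightarrow> complex" where
  "hmoment j z = (LINT w:{0<..}|lborel. hmoment_integrand j z w)"

lemma hankel_laplace_1: "hankel_laplace 1 = hmoment 0"
  unfolding hankel_laplace_def[abs_def] hmoment_def[abs_def] hroot_def
  by (intro ext set_lebesgue_integral_cong) auto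

lemma hmoment_bound:
  assumes r: "r > 0" and w: "w > 0" and z: "Re z \<ge> r"
  shows "norm (hmoment_integrand j z w) \<le> (2 * (real j + 1) / r) ^ j * sqrt 2 * (exp (- (r / 2) * w) / sqrt w)"
proof -
  have h: "norm (hroot w) \<ge> sqrt w * sqrt (1 / 2)"
    by (rule order_trans[OF _ norm_hroot_ge(2)[OF w]]) (use w in \<open>intro mult_left_mono, auto\<close>)
  have "norm (hmoment_integrand j z w) = w ^ j * exp (- Re z * w) / norm (hroot w)"
    using w by (simp add: norm_mult norm_divide norm_power)
  also have "\<dots> \<le> w ^ j * exp (- r * w) / (sqrt w * sqrt (1 / 2))"
    using h w z by (intro frac_le mult_left_mono) auto
  also have "\<dots> = w ^ j * exp (- r * w) * (sqrt 2 / sqrt w)" by (simp add: real_sqrt_divide)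
  also have "\<dots> \<le> (2 * (real j + 1) / r) ^ j * exp (- (r / 2) * w) * (sqrt 2 / sqrt w)"
    using power_times_exp_le[OF r w, of j] w by (intro mult_right_mono) auto
  finally show ?thesis by (simp add: mult_ac)
qed

lemma hmoment_measurable:
  "(\<lambda>w. indicator {0<..} w *\<^sub>R (hmoment_integrand j z w)) \<in> borel_measurable borel"
  by (rule borel_measurable_continuous_on_indicator)
     (auto intro!: continuous_at_imp_continuous_on continuous_intros hroot_isCont hroot_nz)

lemma hmoment_dominant:
  assumes r: "r > 0"
  shows "integrable lborel (\<lambda>w. indicator {0<..} w *\<^sub>R ((2 * (real j + 1) / r) ^ j * sqrt 2 * (exp (- (r / 2) * w) / sqrt w)))"
proof -
  have "integrable lborel (\<lambda>w. ((2 * (real j + 1) / r) ^ j * sqrt 2) * (indicator {0<..} w *\<^sub>R (exp (- (r / 2) * w) / sqrt w)))"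
    by (rule integrable_mult_right[OF exp_over_sqrt_integrable[unfolded set_integrable_def]]) (use r in simp)
  thus ?thesis by (simp only: real_scaleR_def mult.left_commute)
qed

lemma hmoment_integrable:
  assumes z: "Re z > 0"
  shows "set_integrable lborel {0<..} (\<lambda>w. hmoment_integrand j z w)"
  unfolding set_integrable_def
proof (rule Bochner_Integration.integrable_bound[OF hmoment_dominant[OF z, of j]])
  show "AE w in lborel. norm (indicator {0<..} w *\<^sub>R (hmoment_integrand j z w))
     \<le> norm (indicator {0<..} w *\<^sub>R ((2 * (real j + 1) / Re z) ^ j * sqrt 2 * (exp (- (Re z / 2) * w) / sqrt w)))"
  proof (rule AE_I2)
    fix w :: real
    show "norm (indicator {0<..} w *\<^sub>R (hmoment_integrand j z w))
     \<le> norm (indicator {0<..} w *\<^sub>R ((2 * (real j + 1) / Re z) ^ j * sqrt 2 * (exp (- (Re z / 2) * w) / sqrt w)))"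
    proof (cases "w > 0")
      case True
      have "norm (hmoment_integrand j z w) \<le> \<bar>(2 * (real j + 1) / Re z) ^ j * sqrt 2 * (exp (- (Re z / 2) * w) / sqrt w)\<bar>"
        by (rule order_trans[OF hmoment_bound[OF z True order_refl] abs_ge_self])
      thus ?thesis using True by simp
    qed simp
  qed
qed (use hmoment_measurable in simp)

lemma hmoment_deriv:
  assumes z: "Re z > 0"
  shows "(hmoment j has_field_derivative - hmoment (Suc j) z) (at z)"
proof -
  define r where "r = Re z / 2"
  have r: "r > 0" "z \<in> {z. Re z > r}" using z by (auto simp: r_def)
  let ?f = "\<lambda>z w. indicator {0<..} w *\<^sub>R (hmoment_integrand j z w)"
  have D: "((\<lambda>z. ?f z w) has_field_derivative - (indicator {0<..} w *\<^sub>R (complex_of_real w ^ Suc j * exp (- z * complex_of_real w) / hroot w))) (at z)" for z w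
  proof (cases "w > 0")
    case True
    thus ?thesis using hroot_nz[OF True] by (auto intro!: derivative_eq_intros simp: field_simps)
  qed simp
  have "((\<lambda>z. \<integral>w. ?f z w \<partial>lborel) has_field_derivative (\<integral>w. deriv (\<lambda>z. ?f z w) z \<partial>lborel)) (at z)"
  proof (rule has_field_derivative_lebesgue_integral[OF open_halfspace_Re_gt _ _ hmoment_dominant[OF r(1), of j] _ r(2)])
    show "(\<lambda>z. ?f z w) holomorphic_on {z. Re z > r}" for w
      using D by (meson field_differentiable_at_within field_differentiable_def holomorphic_onI)
    show "norm (?f z w) \<le> indicator {0<..} w *\<^sub>R ((2 * (real j + 1) / r) ^ j * sqrt 2 * (exp (- (r / 2) * w) / sqrt w))"
      if "z \<in> {z. Re z > r}" for z w
      using hmoment_bound[OF r(1), of w z j] that by (auto simp: indicator_def)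
  qed (use hmoment_measurable in simp)
  moreover have "(\<integral>w. deriv (\<lambda>z. ?f z w) z \<partial>lborel) = - hmoment (Suc j) z"
    unfolding hmoment_def set_lebesgue_integral_def DERIV_imp_deriv[OF D] by (rule Bochner_Integration.integral_minus)
  ultimately show ?thesis by (simp add: hmoment_def[abs_def] set_lebesgue_integral_def)
qed

text \<open>The function -e^(-z w) hroot w vanishes at 0 and at infinity, so its derivative has
  integral 0. With hroot^2 = w^2 - 2 i w this relates three moments, and multiplication by e^(i z)
  turns the relation into Bessel's equation.\<close>

lemma hmoment_recurrence:
  assumes z: "Re z > 0"
  shows "z * (hmoment 2 z - 2 * \<i> * hmoment 1 z) = hmoment 1 z - \<i> * hmoment 0 z"
proof -
  let ?t = "\<lambda>j w. hmoment_integrand j z w"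
  let ?f = "\<lambda>w. z * ?t 2 w - 2 * \<i> * z * ?t 1 w - ?t 1 w + \<i> * ?t 0 w"
  note i = hmoment_integrable[OF z]
  have fi: "set_integrable lborel {0<..} ?f"
    by (intro set_integral_add set_integral_diff set_integrable_mult_right i)
  have "(LINT w:{0<..}|lborel. ?f w) = z * hmoment 2 z - 2 * \<i> * z * hmoment 1 z - hmoment 1 z + \<i> * hmoment 0 z"
    unfolding hmoment_def
    by (simp only: set_integral_add set_integral_diff set_integral_mult_right set_integrable_mult_right i)
  moreover have "(LINT w:{0<..}|lborel. ?f w) = 0 - 0"
  proof (rule integral_FTC_0_infty[OF _ _ fi])
    fix w :: real assume w: "w > 0"
    show "isCont ?f w" using hroot_isCont[OF w] hroot_nz[OF w] by (intro continuous_intros)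
    have "((\<lambda>w. exp (- z * complex_of_real w)) has_vector_derivative exp (- z * complex_of_real w) * (- z)) (at w)"
    proof -
      have "((\<lambda>x. exp (- z * x)) has_field_derivative exp (- z * complex_of_real w) * (- z)) (at (complex_of_real w))"
        by (auto intro!: derivative_eq_intros)
      from has_vector_derivative_real_field[OF this, of UNIV] show ?thesis by simp
    qed
    from has_vector_derivative_minus[OF has_vector_derivative_mult[OF this hroot_deriv[OF w]]]
    have "((\<lambda>w. - (exp (- z * complex_of_real w) * hroot w)) has_vector_derivative
       - (exp (- z * complex_of_real w) * ((complex_of_real w - \<i>) / hroot w) + exp (- z * complex_of_real w) * (- z) * hroot w)) (at w)" .
    also have "- (exp (- z * complex_of_real w) * ((complex_of_real w - \<i>) / hroot w) + exp (- z * complex_of_real w) * (- z) * hroot w) = ?f w"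
    proof -
      have "hroot w = ((complex_of_real w)\<^sup>2 - 2 * \<i> * complex_of_real w) / hroot w"
        using hroot_square[of w] hroot_nz[OF w] by (simp add: power2_eq_square field_simps)
      hence "- (exp (- z * complex_of_real w) * ((complex_of_real w - \<i>) / hroot w) + exp (- z * complex_of_real w) * (- z) * hroot w)
         = - (exp (- z * complex_of_real w) * ((complex_of_real w - \<i>) / hroot w) + exp (- z * complex_of_real w) * (- z) * (((complex_of_real w)\<^sup>2 - 2 * \<i> * complex_of_real w) / hroot w))"
        by (simp only:)
      also have "\<dots> = ?f w" using hroot_nz[OF w] by (simp add: field_simps)
      finally show ?thesis .
    qed
    finally show "((\<lambda>w. - (exp (- z * complex_of_real w) * hroot w)) has_vector_derivative ?f w) (at w)" .
  next
    have "((\<lambda>w. - (exp (- z * complex_of_real w) * hroot w)) \<longlongrightarrow> - (exp (- z * complex_of_real 0) * 0)) (at_right 0)"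
      by (intro tendsto_intros hroot_at_0)
    thus "((\<lambda>w. - (exp (- z * complex_of_real w) * hroot w)) \<longlongrightarrow> 0) (at_right 0)" by simp
  next
    show "((\<lambda>w. - (exp (- z * complex_of_real w) * hroot w)) \<longlongrightarrow> 0) at_top"
    proof (rule Lim_null_comparison)
      show "\<forall>\<^sub>F w in at_top. norm (- (exp (- z * complex_of_real w) * hroot w)) \<le> exp (- Re z * w) * (sqrt w * sqrt (w + 2))"
        using eventually_gt_at_top[of 0]
      proof eventually_elim
        case (elim w)
        have "norm (complex_of_real w - 2 * \<i>) \<le> w + 2"
          by (rule norm_triangle_le_diff) (use elim in \<open>simp add: norm_mult\<close>)
        thus ?case using elim by (simp add: norm_mult hroot_eq)
      qed
      show "((\<lambda>w. exp (- Re z * w) * (sqrt w * sqrt (w + 2))) \<longlongrightarrow> 0) at_top" using z by real_asymp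
    qed
  qed
  ultimately have "z * hmoment 2 z - 2 * \<i> * z * hmoment 1 z - hmoment 1 z + \<i> * hmoment 0 z = 0" by simp
  thus ?thesis by (simp add: algebra_simps)
qed

section \<open>Euler's constant and the behaviour of the moments at the origin\<close>

lemma exp_weight_integrable: "integrable lborel (\<lambda>v. indicator {0<..} v *\<^sub>R (c * (exp (- (1 / 2) * v) / sqrt v)))"
proof -
  have "integrable lborel (\<lambda>v. c * (indicator {0<..} v *\<^sub>R (exp (- (1 / 2) * v) / sqrt v)))"
    by (rule integrable_mult_right[OF exp_over_sqrt_integrable[unfolded set_integrable_def]]) simp
  thus ?thesis by (simp only: real_scaleR_def mult.left_commute)
qed

text \<open>Differentiating Euler's integral for Gamma under the integral sign at z = 1 gives
  Gamma'(1) = Gamma(1) Digamma(1).\<close>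

lemma integral_ln_exp:
  "(LINT v:{0<..}|lborel. ln v * exp (- v)) = - (euler_mascheroni :: real)"
proof -
  define U where "U = {z. 1/2 < Re z} \<inter> {z. Re z < 3/2}"
  have "open U" unfolding U_def by (intro open_Int open_halfspace_Re_gt open_halfspace_Re_lt)
  moreover have "1 \<in> U" by (simp add: U_def)
  ultimately have U: "open U" "1 \<in> U" .
  let ?f = "\<lambda>z t. indicator {0<..} t *\<^sub>R (complex_of_real t powr (z - 1) / complex_of_real (exp t))"
  have D: "((\<lambda>z. ?f z t) has_field_derivative indicator {0<..} t *\<^sub>R (Ln (complex_of_real t) * complex_of_real t powr (z - 1) / complex_of_real (exp t))) (at z)" for z t
  proof (cases "t > 0")
    case True
    hence "complex_of_real t \<noteq> 0" by simp
    hence "((\<lambda>z. complex_of_real t powr (z - 1)) has_field_derivative Ln (complex_of_real t) * complex_of_real t powr (z - 1) * 1) (at z)"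
      by (intro DERIV_chain2[OF has_field_derivative_powr_right]) (auto intro!: derivative_eq_intros)
    from DERIV_cdivide[OF this, of "complex_of_real (exp t)"] show ?thesis using True by simp
  qed simp
  \<comment> \<open>On \<open>U\<close> the power of \<open>t\<close> is at most (1 + t)/sqrt t;
    then 5 = 1 + 4 comes from \<open>power_times_exp_le\<close> with j = 0 and j = 1.\<close>
  have bound: "norm (?f z t) \<le> indicator {0<..} t *\<^sub>R (5 * (exp (- (1 / 2) * t) / sqrt t))" if z: "z \<in> U" for z t
  proof (cases "t > 0")
    case True
    have p: "t powr (Re z - 1) \<le> (1 + t) / sqrt t"
    proof (cases "t \<ge> 1")
      case True
      have "t powr (Re z - 1) \<le> t powr (1 / 2)" using True z by (intro powr_mono) (auto simp: U_def)
      also have "\<dots> = t / sqrt t" using True by (simp add: powr_half_sqrt real_div_sqrt)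
      also have "\<dots> \<le> (1 + t) / sqrt t" using True by (intro divide_right_mono) auto
      finally show ?thesis .
    next
      case False
      have "t powr (Re z - 1) \<le> t powr (- (1 / 2))" using False \<open>t > 0\<close> z by (intro powr_mono') (auto simp: U_def)
      also have "\<dots> = 1 / sqrt t" using \<open>t > 0\<close> by (simp add: powr_minus powr_half_sqrt inverse_eq_divide)
      also have "\<dots> \<le> (1 + t) / sqrt t" using \<open>t > 0\<close> by (intro divide_right_mono) auto
      finally show ?thesis .
    qed
    have "norm (?f z t) = t powr (Re z - 1) * exp (- t)"
      using True by (simp add: norm_divide norm_powr_real_powr exp_minus inverse_eq_divide)
    also have "\<dots> \<le> (1 + t) / sqrt t * exp (- t)" using p by (intro mult_right_mono) auto
    also have "\<dots> = (t ^ 0 * exp (- 1 * t) + t ^ 1 * exp (- 1 * t)) / sqrt t" by (simp add: algebra_simps)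
    also have "\<dots> \<le> (1 * exp (- (1 / 2) * t) + 4 * exp (- (1 / 2) * t)) / sqrt t"
      using power_times_exp_le[of 1 t 0] power_times_exp_le[of 1 t 1] True
      by (intro divide_right_mono add_mono) auto
    finally show ?thesis using True by simp
  qed simp
  have meas: "?f z \<in> borel_measurable lborel" for z
  proof -
    have "continuous_on {0<..} (\<lambda>t. complex_of_real t powr (z - 1) / complex_of_real (exp t))"
      by (intro continuous_intros) auto
    from borel_measurable_continuous_on_indicator[OF _ this] show ?thesis by simp
  qed
  have "((\<lambda>z. \<integral>t. ?f z t \<partial>lborel) has_field_derivative (\<integral>t. deriv (\<lambda>z. ?f z t) 1 \<partial>lborel)) (at 1)"
  proof (rule has_field_derivative_lebesgue_integral[OF U(1) _ meas exp_weight_integrable[of 5] bound U(2)])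
    show "(\<lambda>z. ?f z t) holomorphic_on U" for t
      using D by (meson field_differentiable_at_within field_differentiable_def holomorphic_onI)
  qed
  hence "(Gamma has_field_derivative (\<integral>t. deriv (\<lambda>z. ?f z t) 1 \<partial>lborel)) (at 1)"
  proof (rule has_field_derivative_transform_within_open[OF _ U])
    fix z assume z: "z \<in> U"
    hence "Re z > 0" by (auto simp: U_def)
    have i: "set_integrable lborel {0<..} (\<lambda>t. complex_of_real t powr (z - 1) / complex_of_real (exp t))"
      unfolding set_integrable_def
    proof (rule Bochner_Integration.integrable_bound[OF exp_weight_integrable[of 5] meas])
      show "AE t in lborel. norm (?f z t) \<le> norm (indicator {0<..} t *\<^sub>R (5 * (exp (- (1 / 2) * t) / sqrt t)))"
      proof (rule AE_I2)
        fix t :: real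
        show "norm (?f z t) \<le> norm (indicator {0<..} t *\<^sub>R (5 * (exp (- (1 / 2) * t) / sqrt t)))"
          unfolding real_norm_def by (rule order_trans[OF bound[OF z] abs_ge_self])
      qed
    qed
    show "(\<integral>t. ?f z t \<partial>lborel) = Gamma z"
      using set_borel_integral_eq_integral(2)[OF i] integral_unique[OF Gamma_integral_complex'[OF \<open>Re z > 0\<close>]]
      by (simp add: set_lebesgue_integral_def)
  qed
  moreover have "(Gamma has_field_derivative (Gamma 1 * Digamma 1 :: complex)) (at 1)"
    by (rule has_field_derivative_Gamma) auto
  ultimately have "(\<integral>t. deriv (\<lambda>z. ?f z t) 1 \<partial>lborel) = Gamma 1 * Digamma 1"
    by (rule DERIV_unique)
  hence "(\<integral>t. deriv (\<lambda>z. ?f z t) 1 \<partial>lborel) = - euler_mascheroni"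
    by (simp only: Digamma_1 Gamma_1 mult_1)
  also have "(\<integral>t. deriv (\<lambda>z. ?f z t) 1 \<partial>lborel) = (\<integral>t. complex_of_real (indicator {0<..} t *\<^sub>R (ln t * exp (- t))) \<partial>lborel)"
  proof (rule Bochner_Integration.integral_cong[OF refl])
    fix t :: real
    show "deriv (\<lambda>z. ?f z t) 1 = complex_of_real (indicator {0<..} t *\<^sub>R (ln t * exp (- t)))"
      unfolding DERIV_imp_deriv[OF D] by (cases "t > 0") (auto simp: Ln_of_real exp_minus divide_inverse)
  qed
  also have "\<dots> = complex_of_real (LINT v:{0<..}|lborel. ln v * exp (- v))"
    unfolding set_lebesgue_integral_def by (rule integral_complex_of_real)
  finally have "complex_of_real (LINT v:{0<..}|lborel. ln v * exp (- v)) = complex_of_real (- euler_mascheroni)"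
    by simp
  thus ?thesis by (simp only: of_real_eq_iff)
qed

text \<open>A bound uniform in the shift: ln (r + v) is at least ln v \<ge> -2/sqrt v and, as r
  \<le> 1, at most v. The constant 76 is 4 + 2 times 36, from \<open>power_times_exp_le\<close> with
  j = 0 and j = 2.\<close>

lemma ln_shift_bound:
  assumes v: "v > 0" and r: "0 \<le> r" "r \<le> 1"
  shows "\<bar>ln (r + v) * exp (- v)\<bar> \<le> 76 * (exp (- (1 / 2) * v) / sqrt v)"
proof -
  have l1: "- (2 / sqrt v) \<le> ln v"
  proof -
    have "ln (1 / sqrt v) \<le> 1 / sqrt v - 1" using v by (intro ln_le_minus_one) auto
    moreover have "ln (1 / sqrt v) = - ln v / 2" using v by (simp add: ln_div ln_sqrt)
    ultimately show ?thesis by simp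
  qed
  have "ln v \<le> ln (r + v)" using v r by simp
  moreover have "ln (r + v) \<le> r + v - 1" using v r by (intro ln_le_minus_one) auto
  ultimately have "\<bar>ln (r + v)\<bar> \<le> 2 / sqrt v + v" using l1 r v by (smt (verit) divide_nonneg_pos real_sqrt_gt_zero)
  also have "\<dots> \<le> (4 + 2 * v\<^sup>2) / sqrt v"
  proof -
    have "sqrt v \<le> 1 + v" using v by (intro real_le_lsqrt) (auto simp: power2_eq_square algebra_simps)
    hence "v * sqrt v \<le> v * (1 + v)" using v by (intro mult_left_mono) auto
    also have "\<dots> \<le> 2 + 2 * v\<^sup>2"
    proof -
      have "0 \<le> (v - 1)\<^sup>2" by simp
      hence "2 * v \<le> 1 + v * v" by (simp add: power2_eq_square algebra_simps)
      thus ?thesis using v zero_le_square[of v] unfolding power2_eq_square distrib_left by linarith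
    qed
    finally have "2 + v * sqrt v \<le> 4 + 2 * v\<^sup>2" by simp
    hence "(2 + v * sqrt v) / sqrt v \<le> (4 + 2 * v\<^sup>2) / sqrt v" using v by (intro divide_right_mono) auto
    thus ?thesis using v by (simp add: add_divide_distrib)
  qed
  finally have "\<bar>ln (r + v) * exp (- v)\<bar> \<le> (4 + 2 * v\<^sup>2) / sqrt v * exp (- v)"
    unfolding abs_mult by (intro mult_mono) (use v in auto)
  also have "\<dots> = (4 * (v ^ 0 * exp (- 1 * v)) + 2 * (v ^ 2 * exp (- 1 * v))) / sqrt v" by (simp add: algebra_simps)
  also have "\<dots> \<le> (4 * (1 * exp (- (1 / 2) * v)) + 2 * (36 * exp (- (1 / 2) * v))) / sqrt v"
    using power_times_exp_le[of 1 v 0] power_times_exp_le[of 1 v 2] v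
    by (intro divide_right_mono add_mono mult_left_mono) auto
  finally show ?thesis by simp
qed

lemma ln_shift_measurable: "(\<lambda>v::real. indicator {0<..} v *\<^sub>R (ln (r + v) * exp (- v))) \<in> borel_measurable lborel"
  by measurable

lemma ln_shift_integrable:
  fixes r :: real
  assumes "0 \<le> r" "r \<le> 1"
  shows "integrable lborel (\<lambda>v. indicator {0<..} v *\<^sub>R (ln (r + v) * exp (- v)))"
proof (rule Bochner_Integration.integrable_bound[OF exp_weight_integrable[of 76] ln_shift_measurable])
  show "AE v in lborel. norm (indicator {0<..} v *\<^sub>R (ln (r + v) * exp (- v))) \<le> norm (indicator {0<..} v *\<^sub>R (76 * (exp (- (1 / 2) * v) / sqrt v)))"
    using ln_shift_bound[OF _ assms] by (intro AE_I2) (auto simp: indicator_def abs_mult)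
qed

lemma integral_ln_shift_limit:
  "((\<lambda>r. LINT v:{0<..}|lborel. ln (r + v) * exp (- v)) \<longlongrightarrow> - (euler_mascheroni :: real)) (at_right 0)"
  unfolding integral_ln_exp[symmetric] set_lebesgue_integral_def
proof (rule tendsto_integral_at_right_0[OF _ _ exp_weight_integrable[of 76], of _ _ 1])
  show "(\<lambda>v::real. indicator {0<..} v *\<^sub>R (ln v * exp (- v))) \<in> borel_measurable lborel" by measurable
  show "norm (indicator {0<..} v *\<^sub>R (ln (r + v) * exp (- v))) \<le> indicator {0<..} v *\<^sub>R (76 * (exp (- (1 / 2) * v) / sqrt v))"
    if "0 < r" "r \<le> 1" for r v
    using ln_shift_bound[of v r] that by (auto simp: indicator_def)
  fix v :: real
  show "((\<lambda>r. indicator {0<..} v *\<^sub>R (ln (r + v) * exp (- v))) \<longlongrightarrow> indicator {0<..} v *\<^sub>R (ln v * exp (- v))) (at_right 0)"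
  proof (cases "v > 0")
    case True
    have "((\<lambda>r. ln (r + v) * exp (- v)) \<longlongrightarrow> ln (0 + v) * exp (- v)) (at_right 0)"
      using True by (intro tendsto_intros) auto
    thus ?thesis using True by simp
  qed simp
qed (use ln_shift_measurable in auto)

lemma exp_integral_1: "(LINT v:{0<..}|lborel. exp (- v)) = (1::real)"
  using exponential_integral(2)[of 1] by (simp add: set_lebesgue_integral_def)

lemma exp_over_linear_integrable:
  assumes r: "r > 0"
  shows "set_integrable lborel {0<..} (\<lambda>w::real. exp (- r * w) / (1 + w))"
  unfolding set_integrable_def
proof (rule Bochner_Integration.integrable_bound[OF exp_integrable[OF r, unfolded set_integrable_def]])
  show "AE w in lborel. norm (indicator {0<..} w *\<^sub>R (exp (- r * w) / (1 + w))) \<le> norm (indicator {0<..} w *\<^sub>R exp (- r * w))"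
  proof (rule AE_I2)
    fix w :: real
    have "exp (- r * w) / (1 + w) \<le> exp (- r * w) / 1" if "w > 0" using that by (intro divide_left_mono) auto
    thus "norm (indicator {0<..} w *\<^sub>R (exp (- r * w) / (1 + w))) \<le> norm (indicator {0<..} w *\<^sub>R exp (- r * w))"
      by (cases "w > 0") auto
  qed
qed measurable

text \<open>The integral is e^r E_1(r), with E_1 the exponential integral. Integration by parts and
  w = v/r turn it into the integral of ln (r + v) e^(-v) minus ln r, and
  \<open>integral_ln_shift_limit\<close> gives the limit.\<close>

lemma exp_integral_asymptotics:
  "((\<lambda>r. (LINT w:{0<..}|lborel. exp (- r * w) / (1 + w)) + ln r) \<longlongrightarrow> - (euler_mascheroni :: real)) (at_right 0)"
proof (rule Lim_transform_eventually[OF integral_ln_shift_limit])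
  have "\<forall>\<^sub>F r in at_right 0. r < (1::real)" by (rule order_tendstoD(2)[OF tendsto_ident_at]) simp
  thus "\<forall>\<^sub>F r::real in at_right 0. (LINT v:{0<..}|lborel. ln (r + v) * exp (- v)) = (LINT w:{0<..}|lborel. exp (- r * w) / (1 + w)) + ln r"
    using eventually_at_right_less[of 0]
  proof eventually_elim
    case (elim r)
    hence r: "r > 0" "r \<le> 1" by auto
    note i1 = exp_over_linear_integrable[OF r(1)]
    have i2: "set_integrable lborel {0<..} (\<lambda>w. r * (exp (- r * w) * ln (1 + w)))"
      unfolding set_integrable_def
    proof (rule Bochner_Integration.integrable_bound[OF integrable_mult_right[OF exp_integrable[of "r / 2", unfolded set_integrable_def], of 4]])
      show "AE w in lborel. norm (indicator {0<..} w *\<^sub>R (r * (exp (- r * w) * ln (1 + w)))) \<le> norm (4 * (indicator {0<..} w *\<^sub>R exp (- (r / 2) * w)))"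
      proof (rule AE_I2)
        fix w :: real
        have "r * (exp (- r * w) * ln (1 + w)) \<le> 4 * exp (- (r / 2) * w)" if "w > 0"
        proof -
          have "exp (- r * w) * ln (1 + w) \<le> exp (- r * w) * w" using that ln_add_one_self_le_self2[of w] by (intro mult_left_mono) auto
          also have "\<dots> \<le> (4 / r) * exp (- (r / 2) * w)" using power_times_exp_le[OF r(1) that, of 1] by (simp add: mult.commute)
          finally have "r * (exp (- r * w) * ln (1 + w)) \<le> r * ((4 / r) * exp (- (r / 2) * w))" using r by (intro mult_left_mono) auto
          thus ?thesis using r by simp
        qed
        thus "norm (indicator {0<..} w *\<^sub>R (r * (exp (- r * w) * ln (1 + w)))) \<le> norm (4 * (indicator {0<..} w *\<^sub>R exp (- (r / 2) * w)))"
          using r by (cases "w > 0") (auto simp: abs_mult)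
      qed
    qed (use r in auto)
    have "(LINT w:{0<..}|lborel. exp (- r * w) / (1 + w) - r * (exp (- r * w) * ln (1 + w))) = 0 - exp (- r * 0) * ln (1 + 0)"
    proof (rule integral_FTC_0_infty[where F = "\<lambda>w. exp (- r * w) * ln (1 + w)"])
      show "set_integrable lborel {0<..} (\<lambda>w. exp (- r * w) / (1 + w) - r * (exp (- r * w) * ln (1 + w)))"
        by (rule set_integral_diff(1)[OF i1 i2])
      show "((\<lambda>w. exp (- r * w) * ln (1 + w)) has_vector_derivative exp (- r * w) / (1 + w) - r * (exp (- r * w) * ln (1 + w))) (at w)" if "w > 0" for w
        using that by (auto intro!: derivative_eq_intros simp flip: has_real_derivative_iff_has_vector_derivative)
      show "isCont (\<lambda>w. exp (- r * w) / (1 + w) - r * (exp (- r * w) * ln (1 + w))) w" if "w > 0" for w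
        using that by (intro continuous_intros) auto
      show "((\<lambda>w. exp (- r * w) * ln (1 + w)) \<longlongrightarrow> exp (- r * 0) * ln (1 + 0)) (at_right 0)"
        by (intro tendsto_intros) auto
      show "((\<lambda>w. exp (- r * w) * ln (1 + w)) \<longlongrightarrow> 0) at_top" using r(1) by real_asymp
    qed
    hence "(LINT w:{0<..}|lborel. exp (- r * w) / (1 + w)) = (LINT w:{0<..}|lborel. r * (exp (- r * w) * ln (1 + w)))"
      by (simp only: set_integral_diff(2)[OF i1 i2]) simp
    also have "\<dots> = (1 / r) *\<^sub>R (LINT v|lborel. indicator {0<..} (0 + 1 / r * v) *\<^sub>R (r * (exp (- r * (0 + 1 / r * v)) * ln (1 + (0 + 1 / r * v)))))"
      unfolding set_lebesgue_integral_def using r by (subst lborel_integral_real_affine[where c = "1 / r" and t = 0]) auto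
    also have "(\<lambda>v. indicator {0<..} (0 + 1 / r * v) *\<^sub>R (r * (exp (- r * (0 + 1 / r * v)) * ln (1 + (0 + 1 / r * v)))))
        = (\<lambda>v. r * (indicator {0<..} v *\<^sub>R (ln (r + v) * exp (- v)) - ln r * (indicator {0<..} v *\<^sub>R exp (- v))))"
    proof
      fix v :: real
      have lr: "ln (1 + v / r) = ln (r + v) - ln r" if "v > 0"
      proof -
        have "1 + v / r = (r + v) / r" using r by (simp add: field_simps)
        thus ?thesis using r that by (simp add: ln_div)
      qed
      show "indicator {0<..} (0 + 1 / r * v) *\<^sub>R (r * (exp (- r * (0 + 1 / r * v)) * ln (1 + (0 + 1 / r * v))))
          = r * (indicator {0<..} v *\<^sub>R (ln (r + v) * exp (- v)) - ln r * (indicator {0<..} v *\<^sub>R exp (- v)))"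
      proof (cases "v > 0")
        case True
        thus ?thesis using r by (simp add: lr[OF True] algebra_simps)
      qed (use r in \<open>simp add: indicator_def zero_less_divide_iff\<close>)
    qed
    also have "(1 / r) *\<^sub>R (LINT v|lborel. r * (indicator {0<..} v *\<^sub>R (ln (r + v) * exp (- v)) - ln r * (indicator {0<..} v *\<^sub>R exp (- v))))
        = (LINT v|lborel. indicator {0<..} v *\<^sub>R (ln (r + v) * exp (- v)) - ln r * (indicator {0<..} v *\<^sub>R exp (- v)))"
      by (subst integral_mult_right_zero) (use r in simp)
    also have "\<dots> = (LINT v|lborel. indicator {0<..} v *\<^sub>R (ln (r + v) * exp (- v))) - (LINT v|lborel. ln r * (indicator {0<..} v *\<^sub>R exp (- v)))"
      by (rule Bochner_Integration.integral_diff[OF ln_shift_integrable integrable_mult_right])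
         (use r exp_integrable[of 1] in \<open>auto simp: set_integrable_def\<close>)
    also have "(LINT v|lborel. ln r * (indicator {0<..} v *\<^sub>R exp (- v))) = ln r * (LINT v|lborel. indicator {0<..} v *\<^sub>R exp (- v))"
      by (rule integral_mult_right_zero)
    also have "(LINT v|lborel. indicator {0<..} v *\<^sub>R exp (- v)) = (1::real)" using exp_integral_1 by (simp add: set_lebesgue_integral_def)
    finally show ?case by (simp add: set_lebesgue_integral_def)
  qed
qed

text \<open>1/hroot splits into 1/(1 + w), which carries the logarithm and Euler's constant, and
  \<open>hroot_diff\<close>, which contributes ln 2 + i pi/2 by dominated convergence.\<close>

lemma hmoment_0_asymptotics:
  "((\<lambda>r. hmoment 0 (complex_of_real r) + complex_of_real (ln r)) \<longlongrightarrow> complex_of_real (ln 2) + \<i> * pi / 2 - euler_mascheroni) (at_right 0)"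
proof -
  let ?g = "\<lambda>r w. indicator {0<..} w *\<^sub>R (complex_of_real (exp (- r * w)) * (hroot_diff w))"
  have c: "isCont (\<lambda>w. complex_of_real (exp (- r * w)) * (hroot_diff w)) w" if "w > 0" for w r
    using that hroot_isCont[OF that] hroot_nz[OF that] by (intro continuous_intros) auto
  have "((\<lambda>r. LINT w|lborel. ?g r w) \<longlongrightarrow> (LINT w|lborel. indicator {0<..} w *\<^sub>R (hroot_diff w))) (at_right 0)"
  proof (rule tendsto_integral_at_right_0[OF _ _ integrable_mult_right[OF inverse_sqrt_integrable[unfolded set_integrable_def], of 6], of _ _ 1])
    show "?g r \<in> borel_measurable lborel" for r
    proof -
      have "continuous_on {0<..} (\<lambda>w. complex_of_real (exp (- r * w)) * (hroot_diff w))"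
        by (rule continuous_at_imp_continuous_on) (use c in blast)
      from borel_measurable_continuous_on_indicator[OF _ this] show ?thesis by simp
    qed
    show "(\<lambda>w. indicator {0<..} w *\<^sub>R (hroot_diff w)) \<in> borel_measurable lborel"
      using hroot_diff_integral(1) unfolding set_integrable_def by (rule borel_measurable_integrable)
    fix w :: real
    show "norm (?g r w) \<le> 6 * (indicator {0<..} w *\<^sub>R (1 / (sqrt w * (1 + w))))" if r: "0 < r" "r \<le> 1" for r
    proof (cases "w > 0")
      case True
      have "norm (complex_of_real (exp (- r * w)) * (hroot_diff w)) = exp (- r * w) * norm (hroot_diff w)"
        by (simp only: norm_mult norm_of_real abs_exp_cancel)
      also have "\<dots> \<le> 1 * (6 * (1 / (sqrt w * (1 + w))))" using r True hroot_diff_bound[OF True] by (intro mult_mono) auto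
      finally show ?thesis using True by simp
    qed simp
    have "((\<lambda>r. indicator {0<..} w *\<^sub>R (complex_of_real (exp (- r * w)) * (hroot_diff w)))
       \<longlongrightarrow> indicator {0<..} w *\<^sub>R (complex_of_real (exp (- 0 * w)) * (hroot_diff w))) (at_right 0)"
      by (intro tendsto_intros)
    thus "((\<lambda>r. ?g r w) \<longlongrightarrow> indicator {0<..} w *\<^sub>R (hroot_diff w)) (at_right 0)" by simp
  qed simp
  hence 1: "((\<lambda>r. LINT w|lborel. ?g r w) \<longlongrightarrow> complex_of_real (ln 2) + \<i> * pi / 2) (at_right 0)"
    using hroot_diff_integral(2) by (simp add: set_lebesgue_integral_def)
  have "((\<lambda>r. (LINT w|lborel. ?g r w) + complex_of_real ((LINT w:{0<..}|lborel. exp (- r * w) / (1 + w)) + ln r))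
      \<longlongrightarrow> (complex_of_real (ln 2) + \<i> * pi / 2) + complex_of_real (- euler_mascheroni)) (at_right 0)"
    by (intro tendsto_add 1 tendsto_of_real exp_integral_asymptotics)
  moreover have "\<forall>\<^sub>F r in at_right 0. (LINT w|lborel. ?g r w) + complex_of_real ((LINT w:{0<..}|lborel. exp (- r * w) / (1 + w)) + ln r)
     = hmoment 0 (complex_of_real r) + complex_of_real (ln r)"
    using eventually_at_right_less[of 0]
  proof eventually_elim
    case (elim r)
    have i1: "integrable lborel (\<lambda>w. indicator {0<..} w *\<^sub>R (complex_of_real w ^ 0 * exp (- complex_of_real r * complex_of_real w) / hroot w))"
      using hmoment_integrable[of "complex_of_real r" 0] elim by (simp add: set_integrable_def)
    have i2: "integrable lborel (\<lambda>w. complex_of_real (indicator {0<..} w *\<^sub>R (exp (- r * w) / (1 + w))))"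
      using exp_over_linear_integrable[OF elim] by (intro integrable_of_real) (simp only: set_integrable_def)
    have "(LINT w|lborel. ?g r w) = (LINT w|lborel. indicator {0<..} w *\<^sub>R (complex_of_real w ^ 0 * exp (- complex_of_real r * complex_of_real w) / hroot w)
        - complex_of_real (indicator {0<..} w *\<^sub>R (exp (- r * w) / (1 + w))))"
      by (rule Bochner_Integration.integral_cong[OF refl])
         (simp add: indicator_def algebra_simps exp_of_real[symmetric])
    also have "\<dots> = hmoment 0 (complex_of_real r) - complex_of_real (LINT w:{0<..}|lborel. exp (- r * w) / (1 + w))"
      unfolding Bochner_Integration.integral_diff[OF i1 i2] hmoment_def set_lebesgue_integral_def
      by (simp only: integral_complex_of_real)
    finally show ?case by simp
  qed
  ultimately have "((\<lambda>r. hmoment 0 (complex_of_real r) + complex_of_real (ln r)) \<longlongrightarrow> (complex_of_real (ln 2) + \<i> * pi / 2) + complex_of_real (- euler_mascheroni)) (at_right 0)"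
    by (rule Lim_transform_eventually)
  thus ?thesis by (simp add: euler_mascheroni_def)
qed

text \<open>With v = r w the integrand becomes e^(-v) (v/r)/hroot (v/r), which is dominated by
  e^(-v) and tends to it because hroot w behaves like w for large w.\<close>

lemma hmoment_1_asymptotics:
  "((\<lambda>r. complex_of_real r * hmoment 1 (complex_of_real r)) \<longlongrightarrow> 1) (at_right 0)"
proof -
  let ?g = "\<lambda>r v. indicator {0<..} v *\<^sub>R (complex_of_real (exp (- v)) * (complex_of_real (v / r) / hroot (v / r)))"
  have "((\<lambda>r. LINT v|lborel. ?g r v) \<longlongrightarrow> (LINT v|lborel. indicator {0<..} v *\<^sub>R (complex_of_real (exp (- v)) * 1))) (at_right 0)"
  proof (rule tendsto_integral_at_right_0[OF _ _ exp_integrable[of 1, unfolded set_integrable_def], of _ _ 1])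
    show "?g r \<in> borel_measurable lborel" if r: "r > 0" for r
    proof -
      have "continuous_on {0<..} hroot" by (auto intro!: continuous_at_imp_continuous_on hroot_isCont)
      hence "continuous_on {0<..} (\<lambda>v. hroot (v / r))"
        by (rule continuous_on_compose2) (use r in \<open>auto intro!: continuous_intros\<close>)
      hence "continuous_on {0<..} (\<lambda>v. complex_of_real (exp (- v)) * (complex_of_real (v / r) / hroot (v / r)))"
        using r hroot_nz by (intro continuous_intros) auto
      from borel_measurable_continuous_on_indicator[OF _ this] show ?thesis by simp
    qed
    show "(\<lambda>v. indicator {0<..} v *\<^sub>R (complex_of_real (exp (- v)) * 1)) \<in> borel_measurable lborel" by measurable
    fix v :: real
    show "norm (?g r v) \<le> indicator {0<..} v *\<^sub>R exp (- 1 * v)" if r: "0 < r" "r \<le> 1" for r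
    proof (cases "v > 0")
      case True
      hence w: "v / r > 0" using r by simp
      have "norm (complex_of_real (v / r) / hroot (v / r)) \<le> 1"
      proof -
        have "norm (complex_of_real w / hroot w) \<le> 1" if "w > 0" for w
          using norm_hroot_ge(1)[OF that] that by (simp add: norm_divide divide_le_eq_1)
        from this[OF w] show ?thesis .
      qed
      hence "exp (- v) * norm (complex_of_real (v / r) / hroot (v / r)) \<le> exp (- v) * 1" by (intro mult_left_mono) auto
      moreover have "norm (complex_of_real (exp (- v)) * (complex_of_real (v / r) / hroot (v / r))) = exp (- v) * norm (complex_of_real (v / r) / hroot (v / r))"
        by (simp only: norm_mult norm_of_real abs_exp_cancel)
      ultimately have "norm (complex_of_real (exp (- v)) * (complex_of_real (v / r) / hroot (v / r))) \<le> exp (- v)" by linarith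
      thus ?thesis using True by simp
    qed simp
    show "((\<lambda>r. ?g r v) \<longlongrightarrow> indicator {0<..} v *\<^sub>R (complex_of_real (exp (- v)) * 1)) (at_right 0)"
    proof (cases "v > 0")
      case True
      have "((\<lambda>r. csqrt (1 - 2 * \<i> * complex_of_real (r / v))) \<longlongrightarrow> csqrt (1 - 2 * \<i> * complex_of_real (0 / v))) (at_right 0)"
        by (intro tendsto_compose[OF isContD[OF continuous_at_csqrt]] tendsto_intros) (use True in \<open>auto simp: complex_nonpos_Reals_iff\<close>)
      hence "((\<lambda>r. 1 / csqrt (1 - 2 * \<i> * complex_of_real (r / v))) \<longlongrightarrow> 1 / 1) (at_right 0)"
        by (intro tendsto_divide tendsto_const) auto
      moreover have "\<forall>\<^sub>F r in at_right 0. 1 / csqrt (1 - 2 * \<i> * complex_of_real (r / v)) = complex_of_real (v / r) / hroot (v / r)"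
        using eventually_at_right_less[of 0]
      proof eventually_elim
        case (elim r)
        have w: "v / r > 0" using True elim by simp
        have "hroot (v / r) / complex_of_real (v / r) = csqrt (1 - 2 * \<i> * complex_of_real (r / v))"
          using hroot_ratio[OF w w] w True elim by simp
        thus ?case by (metis inverse_divide inverse_eq_divide)
      qed
      ultimately have "((\<lambda>r. complex_of_real (v / r) / hroot (v / r)) \<longlongrightarrow> 1 / 1) (at_right 0)"
        by (rule Lim_transform_eventually)
      hence "((\<lambda>r. indicator {0<..} v *\<^sub>R (complex_of_real (exp (- v)) * (complex_of_real (v / r) / hroot (v / r)))) \<longlongrightarrow> indicator {0<..} v *\<^sub>R (complex_of_real (exp (- v)) * (1 / 1))) (at_right 0)"
        by (rule tendsto_scaleR[OF tendsto_const tendsto_mult[OF tendsto_const]])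
      thus ?thesis by (simp only: div_by_1)
    qed simp
  qed auto
  moreover have "(LINT v|lborel. indicator {0<..} v *\<^sub>R (complex_of_real (exp (- v)) * 1)) = 1"
  proof -
    have "(LINT v|lborel. indicator {0<..} v *\<^sub>R (complex_of_real (exp (- v)) * 1)) = (LINT v|lborel. complex_of_real (indicator {0<..} v *\<^sub>R exp (- v)))"
      by (simp add: scaleR_conv_of_real)
    also have "\<dots> = complex_of_real (LINT v:{0<..}|lborel. exp (- v))"
      unfolding set_lebesgue_integral_def by (rule integral_complex_of_real)
    finally show ?thesis by (simp add: exp_integral_1)
  qed
  moreover have "\<forall>\<^sub>F r in at_right 0. (LINT v|lborel. ?g r v) = complex_of_real r * hmoment 1 (complex_of_real r)"
    using eventually_at_right_less[of 0]
  proof eventually_elim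
    case (elim r)
    have "hmoment 1 (complex_of_real r) = (1 / r) *\<^sub>R (LINT v|lborel. indicator {0<..} (0 + 1 / r * v) *\<^sub>R (complex_of_real (0 + 1 / r * v) ^ 1 * exp (- complex_of_real r * complex_of_real (0 + 1 / r * v)) / hroot (0 + 1 / r * v)))"
      unfolding hmoment_def set_lebesgue_integral_def using elim by (subst lborel_integral_real_affine[where c = "1 / r" and t = 0]) auto
    also have "(\<lambda>v. indicator {0<..} (0 + 1 / r * v) *\<^sub>R (complex_of_real (0 + 1 / r * v) ^ 1 * exp (- complex_of_real r * complex_of_real (0 + 1 / r * v)) / hroot (0 + 1 / r * v))) = ?g r"
    proof
      fix v
      have "- complex_of_real r * complex_of_real (0 + 1 / r * v) = complex_of_real (- v)" using elim by simp
      hence "exp (- complex_of_real r * complex_of_real (0 + 1 / r * v)) = complex_of_real (exp (- v))" by (simp only: exp_of_real)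
      thus "indicator {0<..} (0 + 1 / r * v) *\<^sub>R (complex_of_real (0 + 1 / r * v) ^ 1 * exp (- complex_of_real r * complex_of_real (0 + 1 / r * v)) / hroot (0 + 1 / r * v)) = ?g r v"
        using elim by (simp add: indicator_def zero_less_divide_iff)
    qed
    finally show ?case using elim by (simp add: scaleR_conv_of_real)
  qed
  ultimately show ?thesis using Lim_transform_eventually by force
qed

text \<open>Each derivative raises the order of the moments by one, and the equation itself is
  \<open>hmoment_recurrence\<close>.\<close>

lemma outgoing_solution:
  "bessel_solution (\<lambda>z. exp (\<i> * z) * hmoment 0 z) (\<lambda>z. exp (\<i> * z) * (\<i> * hmoment 0 z - hmoment 1 z))
     (\<lambda>z. exp (\<i> * z) * (hmoment 2 z - 2 * \<i> * hmoment 1 z - hmoment 0 z))"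
  unfolding bessel_solution_def
proof (intro allI impI conjI)
  fix z :: complex assume z: "Re z > 0"
  have e: "((\<lambda>z. exp (\<i> * z)) has_field_derivative \<i> * exp (\<i> * z)) (at z)"
    by (auto intro!: derivative_eq_intros)
  have d0: "(hmoment 0 has_field_derivative - hmoment 1 z) (at z)" using hmoment_deriv[OF z, of 0] by simp
  have d1: "(hmoment 1 has_field_derivative - hmoment 2 z) (at z)" using hmoment_deriv[OF z, of 1] by (simp add: numeral_2_eq_2)
  show "((\<lambda>z. exp (\<i> * z) * hmoment 0 z) has_field_derivative exp (\<i> * z) * (\<i> * hmoment 0 z - hmoment 1 z)) (at z)"
    by (rule DERIV_cong[OF DERIV_mult[OF e d0]]) (simp add: algebra_simps)
  show "((\<lambda>z. exp (\<i> * z) * (\<i> * hmoment 0 z - hmoment 1 z)) has_field_derivative exp (\<i> * z) * (hmoment 2 z - 2 * \<i> * hmoment 1 z - hmoment 0 z)) (at z)"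
    by (rule DERIV_cong[OF DERIV_mult[OF e DERIV_diff[OF DERIV_cmult[OF d0] d1]]]) (simp add: algebra_simps)
  have "z * (exp (\<i> * z) * (hmoment 2 z - 2 * \<i> * hmoment 1 z - hmoment 0 z)) + exp (\<i> * z) * (\<i> * hmoment 0 z - hmoment 1 z) + z * (exp (\<i> * z) * hmoment 0 z)
    = exp (\<i> * z) * (z * (hmoment 2 z - 2 * \<i> * hmoment 1 z) + (\<i> * hmoment 0 z - hmoment 1 z))" by (simp add: algebra_simps)
  thus "z * (exp (\<i> * z) * (hmoment 2 z - 2 * \<i> * hmoment 1 z - hmoment 0 z)) + exp (\<i> * z) * (\<i> * hmoment 0 z - hmoment 1 z) + z * (exp (\<i> * z) * hmoment 0 z) = 0"
    unfolding hmoment_recurrence[OF z] by simp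
qed

text \<open>Near 0 the left side behaves like -ln r + ln 2 + i pi/2 - gamma and
  \<open>neumann\<close> like ln (r/2) + gamma, so the difference of the two sides tends to 0; r
  times its derivative tends to -1 + 1. Thus \<open>bessel_solution_unique\<close> applies.\<close>

lemma outgoing_eq_bessel:
  assumes z: "Re z > 0"
  shows "exp (\<i> * z) * hmoment 0 z = (\<i> * pi / 2) * besselJ z - neumann z"
proof -
  note sol = bessel_solution_add[OF outgoing_solution bessel_solution_add[OF besselJ_solution neumann_solution, of "- (\<i> * pi / 2)" 1], of 1 1]
  let ?c = "\<lambda>r. complex_of_real r"
  note J = besselJ_derivs(1)[THEN DERIV_isCont] besselJ_derivs(2)[THEN DERIV_isCont]
  have limJ: "((\<lambda>r. besselJ (?c r)) \<longlongrightarrow> 1) (at_right 0)" "((\<lambda>r. besselJ1 (?c r)) \<longlongrightarrow> 0) (at_right 0)"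
    using filterlim_compose[OF J(1)[of 0, unfolded isCont_def] of_real_at_right_0]
      filterlim_compose[OF J(2)[of 0, unfolded isCont_def] of_real_at_right_0] by (simp_all add: besselJ_at_0)
  have K: "isCont (\<lambda>z. pser c (z\<^sup>2)) 0" if c: "\<And>y. summable (\<lambda>m. c m * y ^ m)" for c
  proof -
    have "((\<lambda>z::complex. z\<^sup>2) has_field_derivative 2 * 0) (at 0)" by (auto intro!: derivative_eq_intros)
    from DERIV_chain2[OF pser_derivative[OF c] this] show ?thesis by (rule DERIV_isCont)
  qed
  note K0 = K[OF neumann_summable] K[OF summable_diffs[OF neumann_summable]]
  have "pser neumann_coeff 0 = neumann_coeff 0" unfolding pser_def by (rule powser_zero)
  hence K00: "pser neumann_coeff 0 = 0" by (simp add: neumann_coeff_def harm_def)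
  have limK: "((\<lambda>r. pser neumann_coeff ((?c r)\<^sup>2)) \<longlongrightarrow> 0) (at_right 0)"
      "((\<lambda>r. pser (diffs neumann_coeff) ((?c r)\<^sup>2)) \<longlongrightarrow> pser (diffs neumann_coeff) (0\<^sup>2)) (at_right 0)"
    using filterlim_compose[OF K0(1)[unfolded isCont_def] of_real_at_right_0]
      filterlim_compose[OF K0(2)[unfolded isCont_def] of_real_at_right_0] by (simp_all add: K00)
  have limr: "((\<lambda>r. ?c r) \<longlongrightarrow> 0) (at_right 0)" by (auto intro!: tendsto_eq_intros)
  have "((\<lambda>r. exp (\<i> * ?c r)) \<longlongrightarrow> exp (\<i> * 0)) (at_right 0)" by (intro tendsto_intros limr)
  hence lime: "((\<lambda>r. exp (\<i> * ?c r)) \<longlongrightarrow> 1) (at_right 0)" by simp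
  have "((\<lambda>r::real. r * ln r) \<longlongrightarrow> 0) (at_right 0)" by real_asymp
  hence "((\<lambda>r. ?c (r * ln r)) \<longlongrightarrow> ?c 0) (at_right 0)" by (rule tendsto_of_real)
  hence rln: "((\<lambda>r. ?c r * ?c (ln r)) \<longlongrightarrow> 0) (at_right 0)" by simp
  \<comment> \<open>The two logarithms carry different factors, \<open>besselJ\<close> and e^(i r).
    Both equal 1 at the origin, so their difference is O(r) and the mismatch O(r ln r).\<close>
  have jdiff: "((\<lambda>r. ?c (ln r) * (besselJ (?c r) - exp (\<i> * ?c r))) \<longlongrightarrow> 0) (at_right 0)"
  proof -
    have "((\<lambda>z. besselJ z - exp (\<i> * z)) has_field_derivative (besselJ1 0 - exp (\<i> * 0) * \<i>)) (at 0)"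
      by (auto intro!: derivative_eq_intros besselJ_derivs)
    hence "((\<lambda>z. (besselJ z - exp (\<i> * z)) / z) \<longlongrightarrow> - \<i>) (at 0)"
      by (simp add: has_field_derivative_iff besselJ_at_0)
    from filterlim_compose[OF this of_real_at_right_0]
    have "((\<lambda>r. (besselJ (?c r) - exp (\<i> * ?c r)) / ?c r) \<longlongrightarrow> - \<i>) (at_right 0)" .
    hence "((\<lambda>r. (?c r * ?c (ln r)) * ((besselJ (?c r) - exp (\<i> * ?c r)) / ?c r)) \<longlongrightarrow> 0 * (- \<i>)) (at_right 0)"
      by (intro tendsto_mult rln)
    moreover have "\<forall>\<^sub>F r in at_right 0. (?c r * ?c (ln r)) * ((besselJ (?c r) - exp (\<i> * ?c r)) / ?c r) = ?c (ln r) * (besselJ (?c r) - exp (\<i> * ?c r))"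
      using eventually_at_right_less[of 0] by eventually_elim simp
    ultimately show ?thesis using Lim_transform_eventually by force
  qed
  have Ln2: "Ln (?c r / 2) = ?c (ln r) - ?c (ln 2)" if "r > 0" for r
    using that Ln_of_real[of "r / 2"] by (simp add: ln_div)
  have "(\<lambda>z. 1 * (exp (\<i> * z) * hmoment 0 z) + 1 * (- (\<i> * pi / 2) * besselJ z + 1 * neumann z)) z = 0"
  proof (rule bessel_solution_unique[OF sol _ _ z])
    have "((\<lambda>r. exp (\<i> * ?c r) * (hmoment 0 (?c r) + ?c (ln r)) + ?c (ln r) * (besselJ (?c r) - exp (\<i> * ?c r))
          - (\<i> * pi / 2) * besselJ (?c r) + (euler_mascheroni - ?c (ln 2)) * besselJ (?c r) + pser neumann_coeff ((?c r)\<^sup>2))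
       \<longlongrightarrow> 1 * (?c (ln 2) + \<i> * pi / 2 - euler_mascheroni) + 0 - (\<i> * pi / 2) * 1 + (euler_mascheroni - ?c (ln 2)) * 1 + 0) (at_right 0)"
      by (intro tendsto_intros lime hmoment_0_asymptotics jdiff limJ limK)
    hence "((\<lambda>r. exp (\<i> * ?c r) * (hmoment 0 (?c r) + ?c (ln r)) + ?c (ln r) * (besselJ (?c r) - exp (\<i> * ?c r))
          - (\<i> * pi / 2) * besselJ (?c r) + (euler_mascheroni - ?c (ln 2)) * besselJ (?c r) + pser neumann_coeff ((?c r)\<^sup>2)) \<longlongrightarrow> 0) (at_right 0)"
      by simp
    thus "((\<lambda>r. 1 * (exp (\<i> * ?c r) * hmoment 0 (?c r)) + 1 * (- (\<i> * pi / 2) * besselJ (?c r) + 1 * neumann (?c r))) \<longlongrightarrow> 0) (at_right 0)"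
    proof (rule Lim_transform_eventually)
      show "\<forall>\<^sub>F r in at_right 0. exp (\<i> * ?c r) * (hmoment 0 (?c r) + ?c (ln r)) + ?c (ln r) * (besselJ (?c r) - exp (\<i> * ?c r))
          - (\<i> * pi / 2) * besselJ (?c r) + (euler_mascheroni - ?c (ln 2)) * besselJ (?c r) + pser neumann_coeff ((?c r)\<^sup>2)
          = 1 * (exp (\<i> * ?c r) * hmoment 0 (?c r)) + 1 * (- (\<i> * pi / 2) * besselJ (?c r) + 1 * neumann (?c r))"
        using eventually_at_right_less[of 0] by eventually_elim (simp add: neumann_def Ln2 algebra_simps)
    qed
    have "((\<lambda>r. exp (\<i> * ?c r) * (\<i> * (?c r * (hmoment 0 (?c r) + ?c (ln r)) - ?c r * ?c (ln r)) - ?c r * hmoment 1 (?c r))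
          - (\<i> * pi / 2) * (?c r * besselJ1 (?c r)) + besselJ (?c r) + (?c r * ?c (ln r) + ?c r * (euler_mascheroni - ?c (ln 2))) * besselJ1 (?c r)
          + 2 * (?c r)\<^sup>2 * pser (diffs neumann_coeff) ((?c r)\<^sup>2))
       \<longlongrightarrow> 1 * (\<i> * (0 * (?c (ln 2) + \<i> * pi / 2 - euler_mascheroni) - 0) - 1) - (\<i> * pi / 2) * (0 * 0) + 1
          + (0 + 0 * (euler_mascheroni - ?c (ln 2))) * 0 + 2 * 0\<^sup>2 * pser (diffs neumann_coeff) (0\<^sup>2)) (at_right 0)"
      by (intro tendsto_intros lime hmoment_0_asymptotics hmoment_1_asymptotics rln limJ limK limr)
    hence "((\<lambda>r. exp (\<i> * ?c r) * (\<i> * (?c r * (hmoment 0 (?c r) + ?c (ln r)) - ?c r * ?c (ln r)) - ?c r * hmoment 1 (?c r))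
          - (\<i> * pi / 2) * (?c r * besselJ1 (?c r)) + besselJ (?c r) + (?c r * ?c (ln r) + ?c r * (euler_mascheroni - ?c (ln 2))) * besselJ1 (?c r)
          + 2 * (?c r)\<^sup>2 * pser (diffs neumann_coeff) ((?c r)\<^sup>2)) \<longlongrightarrow> 0) (at_right 0)"
      by simp
    thus "((\<lambda>r. ?c r * (1 * (exp (\<i> * ?c r) * (\<i> * hmoment 0 (?c r) - hmoment 1 (?c r))) + 1 * (- (\<i> * pi / 2) * besselJ1 (?c r) + 1 * neumann1 (?c r)))) \<longlongrightarrow> 0) (at_right 0)"
    proof (rule Lim_transform_eventually)
      show "\<forall>\<^sub>F r in at_right 0. exp (\<i> * ?c r) * (\<i> * (?c r * (hmoment 0 (?c r) + ?c (ln r)) - ?c r * ?c (ln r)) - ?c r * hmoment 1 (?c r))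
          - (\<i> * pi / 2) * (?c r * besselJ1 (?c r)) + besselJ (?c r) + (?c r * ?c (ln r) + ?c r * (euler_mascheroni - ?c (ln 2))) * besselJ1 (?c r)
          + 2 * (?c r)\<^sup>2 * pser (diffs neumann_coeff) ((?c r)\<^sup>2)
          = ?c r * (1 * (exp (\<i> * ?c r) * (\<i> * hmoment 0 (?c r) - hmoment 1 (?c r))) + 1 * (- (\<i> * pi / 2) * besselJ1 (?c r) + 1 * neumann1 (?c r)))"
        using eventually_at_right_less[of 0]
      proof eventually_elim
        case (elim r)
        have "?c r * (besselJ (?c r) / ?c r) = besselJ (?c r)" using elim by simp
        thus ?case using elim by (simp add: neumann1_def Ln2 algebra_simps power2_eq_square)
      qed
    qed
  qed
  thus ?thesis by (simp add: algebra_simps eq_neg_iff_add_eq_0)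
qed

text \<open>Under w = k v each of the two square roots yields sqrt k, and together they cancel the
  factor k from the measure.\<close>

lemma hankel_laplace_scaling:
  assumes k: "k > 0"
  shows "hankel_laplace (complex_of_real k) (complex_of_real r) = hankel_laplace 1 (complex_of_real (k * r))"
proof -
  let ?f = "\<lambda>w. indicator {0<..} w *\<^sub>R (exp (- complex_of_real r * complex_of_real w) / (complex_of_real (sqrt w) * csqrt (complex_of_real w - 2 * \<i> * complex_of_real k)))"
  have "hankel_laplace (complex_of_real k) (complex_of_real r) = k *\<^sub>R (LINT w|lborel. ?f (0 + k * w))"
    unfolding hankel_laplace_def set_lebesgue_integral_def using k by (subst lborel_integral_real_affine[where c = k and t = 0]) auto
  also have "(\<lambda>w. ?f (0 + k * w)) = (\<lambda>w. complex_of_real (1 / k) * (indicator {0<..} w *\<^sub>R (exp (- complex_of_real (k * r) * complex_of_real w) / (complex_of_real (sqrt w) * csqrt (complex_of_real w - 2 * \<i> * 1)))))"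
  proof
    fix w
    have "complex_of_real (k * w) - 2 * \<i> * complex_of_real k = complex_of_real k * (complex_of_real w - 2 * \<i>)"
      by (simp add: algebra_simps)
    hence c: "csqrt (complex_of_real (k * w) - 2 * \<i> * complex_of_real k) = complex_of_real (sqrt k) * csqrt (complex_of_real w - 2 * \<i>)"
      using csqrt_of_real_mult[of k] k by simp
    have s: "complex_of_real (sqrt (k * w)) * (complex_of_real (sqrt k) * X) = complex_of_real k * (complex_of_real (sqrt w) * X)" for X
    proof -
      have "sqrt (k * w) * sqrt k = k * sqrt w" using k by (simp add: real_sqrt_mult)
      thus ?thesis by (metis mult.assoc of_real_mult)
    qed
    have "indicator {0<..} (k * w) = (indicator {0<..} w :: real)" using k by (simp add: indicator_def zero_less_mult_iff)
    thus "?f (0 + k * w) = complex_of_real (1 / k) * (indicator {0<..} w *\<^sub>R (exp (- complex_of_real (k * r) * complex_of_real w) / (complex_of_real (sqrt w) * csqrt (complex_of_real w - 2 * \<i> * 1))))"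
      unfolding add_0_left c s by (simp add: mult_ac)
  qed
  also have "k *\<^sub>R (LINT w|lborel. complex_of_real (1 / k) * (indicator {0<..} w *\<^sub>R (exp (- complex_of_real (k * r) * complex_of_real w) / (complex_of_real (sqrt w) * csqrt (complex_of_real w - 2 * \<i> * 1)))))
     = hankel_laplace 1 (complex_of_real (k * r))"
    unfolding hankel_laplace_def set_lebesgue_integral_def
    by (subst integral_mult_right_zero) (use k in \<open>simp add: scaleR_conv_of_real\<close>)
  finally show ?thesis .
qed

theorem helm_profile_hankel:
  assumes k: "k > 0" and r: "r > 0"
  shows "helm_profile 2 (complex_of_real k) (complex_of_real r) = \<i> / 4 * hankel1_0 (k * r)"
proof -
  define z where "z = complex_of_real (k * r)"
  have z: "Re z > 0" "k * r > 0" using k r by (auto simp: z_def)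
  have "helm_profile 2 (complex_of_real k) (complex_of_real r) = exp (\<i> * z) * hmoment 0 z / (2 * complex_of_real pi)"
    unfolding helm_profile_def hankel_laplace_scaling[OF k] hankel_laplace_1 z_def[symmetric] by (simp add: z_def mult.assoc)
  also have "\<dots> = ((\<i> * pi / 2) * besselJ z - neumann z) / (2 * complex_of_real pi)"
    unfolding outgoing_eq_bessel[OF z(1)] ..
  also have "\<dots> = \<i> / 4 * (besselJ z + \<i> * (2 / pi) * neumann z)"
    by (simp add: field_simps)
  also have "besselJ z + \<i> * (2 / pi) * neumann z = hankel1_0 (k * r)"
    unfolding hankel1_0_series[OF z(2)] z_def ..
  finally show ?thesis .
qed

section \<open>The remainder\<close>

text \<open>The heat kernel as a function of the radius, continued to complex radius.\<close>

definition heat_profile :: "nat \<Rightarrow> real \<Rightarrow> complex \<Rightarrow> complex" where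
  "heat_profile n \<tau> z = exp (- (z\<^sup>2 / (4 * complex_of_real \<tau>))) / complex_of_real (sqrt (4 * pi * \<tau>) ^ n)"

text \<open>A weight on pairs (u, \<tau>): writing 1/(e^u + \<lambda>) as the integral of e^(-(e^u +
  \<lambda>) \<tau>) over \<tau> > 0 makes the remainder a single superposition of heat
  kernels.\<close>

definition frac_weight :: "real \<Rightarrow> complex \<Rightarrow> real \<times> real \<Rightarrow> complex" where
  "frac_weight s \<mu> p = indicator {0<..} (snd p) *\<^sub>R (frac_density s \<mu> (fst p) * complex_of_real (exp (- exp (fst p) * snd p)))"

definition frac_remainder :: "nat \<Rightarrow> real \<Rightarrow> complex \<Rightarrow> complex \<Rightarrow> complex" where
  "frac_remainder n s \<mu> z = (LINT p|lborel. frac_weight s \<mu> p * heat_profile n (snd p) z)"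

definition weight_bound :: "real \<Rightarrow> real \<Rightarrow> real \<times> real \<Rightarrow> real" where
  "weight_bound s K p = indicator {0<..} (snd p) *\<^sub>R (density_bound s K * exp (- s * \<bar>fst p\<bar>) * exp (fst p) * exp (- exp (fst p) * snd p))"

lemma heat_profile_real:
  fixes x :: "'a::euclidean_space"
  shows "heat_profile DIM('a) \<tau> (complex_of_real (norm x)) = complex_of_real (heat_kernel \<tau> x)"
  by (simp add: heat_profile_def heat_kernel_def exp_of_real[symmetric])

text \<open>With y = \<rho>/(4 \<tau>) the profile is bounded by sqrt(y)^n e^(-y)/sqrt(\<rho>)^n.
  Here sqrt(y)^n \<le> 1 + y^n, and \<open>power_times_exp_le\<close> with rate 1 removes the
  dependence on \<tau>.\<close>

lemma heat_profile_bound: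
  assumes \<tau>: "\<tau> > 0" and z: "Re (z\<^sup>2) \<ge> \<rho>" and \<rho>: "\<rho> > 0"
  shows "norm (heat_profile n \<tau> z) \<le> (1 + (2 * (real n + 1)) ^ n) / sqrt \<rho> ^ n"
proof -
  define y where "y = \<rho> / (4 * \<tau>)"
  have y: "y > 0" using \<tau> \<rho> by (simp add: y_def)
  have "norm (heat_profile n \<tau> z) = exp (- Re (z\<^sup>2 / (4 * complex_of_real \<tau>))) / sqrt (4 * pi * \<tau>) ^ n"
    using \<tau> by (simp add: heat_profile_def norm_divide norm_power)
  also have "Re (z\<^sup>2 / (4 * complex_of_real \<tau>)) = Re (z\<^sup>2) / (4 * \<tau>)"
    using Re_divide_of_real[of "z\<^sup>2" "4 * \<tau>"] by simp
  also have "exp (- (Re (z\<^sup>2) / (4 * \<tau>))) / sqrt (4 * pi * \<tau>) ^ n \<le> exp (- y) / sqrt (4 * \<tau>) ^ n"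
  proof (rule frac_le)
    show "exp (- (Re (z\<^sup>2) / (4 * \<tau>))) \<le> exp (- y)" using z \<tau> by (simp add: y_def divide_right_mono)
    have "4 * \<tau> * 1 \<le> 4 * \<tau> * pi" using \<tau> pi_gt3 by (intro mult_left_mono) auto
    thus "sqrt (4 * \<tau>) ^ n \<le> sqrt (4 * pi * \<tau>) ^ n" using \<tau> by (intro power_mono) (auto simp: mult_ac)
  qed (use \<tau> in auto)
  also have "\<dots> = (sqrt y ^ n * exp (- y)) / sqrt \<rho> ^ n"
  proof -
    have "1 / sqrt (4 * \<tau>) = sqrt y / sqrt \<rho>" using \<tau> \<rho> by (simp add: y_def real_sqrt_divide)
    hence "(1 / sqrt (4 * \<tau>)) ^ n = (sqrt y / sqrt \<rho>) ^ n" by (simp only:)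
    hence "1 / sqrt (4 * \<tau>) ^ n = sqrt y ^ n / sqrt \<rho> ^ n" by (simp only: power_divide power_one)
    hence "exp (- y) * (1 / sqrt (4 * \<tau>) ^ n) = exp (- y) * (sqrt y ^ n / sqrt \<rho> ^ n)" by (simp only:)
    thus ?thesis by (simp only: times_divide_eq_right mult_1_right mult.commute)
  qed
  also have "\<dots> \<le> (1 + (2 * (real n + 1)) ^ n) / sqrt \<rho> ^ n"
  proof (rule divide_right_mono)
    have "sqrt y ^ n \<le> 1 + y ^ n"
    proof (cases "y \<le> 1")
      case True
      hence "sqrt y ^ n \<le> 1" using y by (intro power_le_one) auto
      thus ?thesis using zero_le_power[of y n] y by linarith
    next
      case False
      have "sqrt y * 1 \<le> sqrt y * sqrt y" using False by (intro mult_left_mono) auto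
      hence "sqrt y ^ n \<le> y ^ n" using y by (intro power_mono) auto
      thus ?thesis by simp
    qed
    hence "sqrt y ^ n * exp (- y) \<le> (1 + y ^ n) * exp (- y)" by (intro mult_right_mono) auto
    also have "\<dots> = exp (- y) + y ^ n * exp (- 1 * y)" by (simp add: algebra_simps)
    also have "\<dots> \<le> 1 + (2 * (real n + 1)) ^ n * 1"
    proof (rule add_mono)
      have "y ^ n * exp (- 1 * y) \<le> (2 * (real n + 1)) ^ n * exp (- (1 / 2) * y)"
        using power_times_exp_le[of 1 y n] y by simp
      also have "\<dots> \<le> (2 * (real n + 1)) ^ n * 1" using y by (intro mult_left_mono) auto
      finally show "y ^ n * exp (- 1 * y) \<le> (2 * (real n + 1)) ^ n * 1" .
    qed (use y in auto)
    finally show "sqrt y ^ n * exp (- y) \<le> 1 + (2 * (real n + 1)) ^ n" by simp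
  qed (use \<rho> in auto)
  finally show ?thesis .
qed

lemma heat_profile_measurable[measurable]: "(\<lambda>p::real \<times> real. heat_profile n (snd p) z) \<in> borel_measurable borel"
  unfolding heat_profile_def borel_prod[symmetric] by measurable

text \<open>Where the complexified Gaussian still decays: |arg z| < pi/4 together with its mirror
  image.\<close>

definition sector :: "complex set" where "sector = {z. Re (z\<^sup>2) > 0}"

context
  fixes s K :: real
  assumes s: "0 < s" "s < 1" and K: "0 < K"
begin

lemma frac_weight_measurable[measurable]: "frac_weight s \<mu> \<in> borel_measurable borel"
proof -
  note [measurable] = frac_density_measurable[OF s K, of \<mu>]
  show ?thesis unfolding frac_weight_def[abs_def] borel_prod[symmetric] by measurable
qed

lemma density_bound_nonneg: "density_bound s K \<ge> 0"
  unfolding density_bound_def[OF s K] using sin_pi_s_pos[OF s K] by (intro mult_nonneg_nonneg divide_nonneg_pos) auto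

lemma frac_weight_bound:
  assumes "\<bar>\<epsilon>\<bar> \<le> sin (pi * s) * K / 4"
  shows "norm (frac_weight s (Complex K \<epsilon>) p) \<le> weight_bound s K p"
proof (cases "snd p > 0")
  case True
  have "norm (frac_density s (Complex K \<epsilon>) (fst p)) * exp (- exp (fst p) * snd p)
     \<le> (density_bound s K * exp (- s * \<bar>fst p\<bar>) * exp (fst p)) * exp (- exp (fst p) * snd p)"
    using frac_density_bound[OF s K assms] by (intro mult_right_mono) auto
  thus ?thesis using True by (simp add: frac_weight_def weight_bound_def norm_mult)
qed (simp add: frac_weight_def weight_bound_def)

text \<open>The integral over \<tau> equals e^(-u), which cancels the Jacobian e^u and leaves the
  integrable e^(-s |u|).\<close>

lemma weight_bound_integrable: "integrable lborel (weight_bound s K)"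
proof -
  have "integrable (lborel \<Otimes>\<^sub>M lborel) (weight_bound s K)"
  proof (rule lborel_pair.Fubini_integrable)
    show "weight_bound s K \<in> borel_measurable (lborel \<Otimes>\<^sub>M lborel)"
      unfolding weight_bound_def[abs_def] by measurable
    have e: "weight_bound s K (u, t) = (density_bound s K * exp (- s * \<bar>u\<bar>) * exp u) * (indicator {0<..} t *\<^sub>R exp (- exp u * t))" for u t
      by (simp add: weight_bound_def)
    have "(LINT t|lborel. norm (weight_bound s K (u, t))) = density_bound s K * exp (- s * \<bar>u\<bar>)" for u
    proof -
      have "(LINT t|lborel. norm (weight_bound s K (u, t))) = (LINT t|lborel. weight_bound s K (u, t))"
        using density_bound_nonneg by (intro Bochner_Integration.integral_cong) (auto simp: weight_bound_def)
      also have "\<dots> = density_bound s K * exp (- s * \<bar>u\<bar>) * exp u * (1 / exp u)"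
        unfolding e integral_mult_right_zero exponential_integral(2)[OF exp_gt_zero] ..
      finally show ?thesis by simp
    qed
    thus "integrable lborel (\<lambda>u. LINT t|lborel. norm (weight_bound s K (u, t)))"
      using integrable_mult_right[OF integrable_exp_neg_abs[OF s(1)], of "density_bound s K"] by simp
    show "AE u in lborel. integrable lborel (\<lambda>t. weight_bound s K (u, t))"
      unfolding e by (intro AE_I2 integrable_mult_right exponential_integral(1)) simp
  qed
  thus ?thesis by (simp add: lborel_prod)
qed

lemma frac_weight_integrable:
  assumes "\<bar>\<epsilon>\<bar> \<le> sin (pi * s) * K / 4"
  shows "integrable lborel (frac_weight s (Complex K \<epsilon>))"
proof (rule Bochner_Integration.integrable_bound[OF weight_bound_integrable])
  show "AE p in lborel. norm (frac_weight s (Complex K \<epsilon>) p) \<le> norm (weight_bound s K p)"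
    using frac_weight_bound[OF assms] by (intro AE_I2) (auto intro: order_trans[OF _ abs_ge_self])
qed simp

definition remainder_const :: "nat \<Rightarrow> real" where
  "remainder_const n = (LINT p|lborel. weight_bound s K p) * (1 + (2 * (real n + 1)) ^ n)"

lemma remainder_integrand_bound:
  assumes \<epsilon>: "\<bar>\<epsilon>\<bar> \<le> sin (pi * s) * K / 4" and z: "Re (z\<^sup>2) \<ge> \<rho>" and \<rho>: "\<rho> > 0"
  shows "norm (frac_weight s (Complex K \<epsilon>) p * heat_profile n (snd p) z) \<le> weight_bound s K p * ((1 + (2 * (real n + 1)) ^ n) / sqrt \<rho> ^ n)"
proof (cases "snd p > 0")
  case True
  have "0 \<le> weight_bound s K p" using frac_weight_bound[OF \<epsilon>, of p] norm_ge_zero order_trans by blast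
  thus ?thesis unfolding norm_mult
    using frac_weight_bound[OF \<epsilon>, of p] heat_profile_bound[OF True z \<rho>, of n] by (intro mult_mono) auto
qed (simp add: frac_weight_def weight_bound_def)

lemma frac_remainder_bound:
  assumes \<epsilon>: "\<bar>\<epsilon>\<bar> \<le> sin (pi * s) * K / 4" and z: "Re (z\<^sup>2) \<ge> \<rho>" and \<rho>: "\<rho> > 0"
  shows "norm (frac_remainder n s (Complex K \<epsilon>) z) \<le> remainder_const n / sqrt \<rho> ^ n"
proof -
  have i: "integrable lborel (\<lambda>p. frac_weight s (Complex K \<epsilon>) p * heat_profile n (snd p) z)"
  proof (rule Bochner_Integration.integrable_bound[OF integrable_mult_left[OF weight_bound_integrable]])
    show "AE p in lborel. norm (frac_weight s (Complex K \<epsilon>) p * heat_profile n (snd p) z) \<le> norm (weight_bound s K p * ((1 + (2 * (real n + 1)) ^ n) / sqrt \<rho> ^ n))"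
      unfolding real_norm_def by (intro AE_I2 order_trans[OF remainder_integrand_bound[OF assms] abs_ge_self])
  qed measurable
  have "norm (frac_remainder n s (Complex K \<epsilon>) z) \<le> (LINT p|lborel. norm (frac_weight s (Complex K \<epsilon>) p * heat_profile n (snd p) z))"
    unfolding frac_remainder_def by (rule integral_norm_bound)
  also have "\<dots> \<le> (LINT p|lborel. weight_bound s K p * ((1 + (2 * (real n + 1)) ^ n) / sqrt \<rho> ^ n))"
    by (rule Bochner_Integration.integral_mono[OF integrable_norm[OF i] integrable_mult_left[OF weight_bound_integrable]])
       (rule remainder_integrand_bound[OF assms])
  also have "\<dots> = remainder_const n / sqrt \<rho> ^ n" by (simp add: remainder_const_def)
  finally show ?thesis .
qed

lemma frac_remainder_holomorphic:
  assumes \<epsilon>: "\<bar>\<epsilon>\<bar> \<le> sin (pi * s) * K / 4"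
  shows "frac_remainder n s (Complex K \<epsilon>) holomorphic_on sector"
proof -
  have eq: "sector = (\<Union>\<rho>\<in>{0<..}. {z. Re (z\<^sup>2) > \<rho>})"
  proof (intro equalityI subsetI)
    fix z assume "z \<in> sector"
    thus "z \<in> (\<Union>\<rho>\<in>{0<..}. {z. Re (z\<^sup>2) > \<rho>})" unfolding sector_def by (auto intro!: bexI[of _ "Re (z\<^sup>2) / 2"])
  qed (auto simp: sector_def)
  have op: "open {z. Re (z\<^sup>2) > \<rho>}" for \<rho>
    by (intro open_Collect_less continuous_intros)
  show ?thesis unfolding eq
  proof (rule holomorphic_on_UN_open)
    fix \<rho> :: real assume "\<rho> \<in> {0<..}"
    hence \<rho>: "\<rho> > 0" by simp
    show "frac_remainder n s (Complex K \<epsilon>) holomorphic_on {z. Re (z\<^sup>2) > \<rho>}"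
      unfolding frac_remainder_def[abs_def]
    proof (rule holomorphic_on_lebesgue_integral[OF op _ _ integrable_mult_left[OF weight_bound_integrable]])
      show "(\<lambda>z. frac_weight s (Complex K \<epsilon>) p * heat_profile n (snd p) z) holomorphic_on {z. Re (z\<^sup>2) > \<rho>}" for p
      proof (cases "snd p > 0")
        case True
        thus ?thesis unfolding heat_profile_def by (intro holomorphic_intros) auto
      qed (simp add: frac_weight_def)
      show "norm (frac_weight s (Complex K \<epsilon>) p * heat_profile n (snd p) z) \<le> weight_bound s K p * ((1 + (2 * (real n + 1)) ^ n) / sqrt \<rho> ^ n)"
        if "z \<in> {z. Re (z\<^sup>2) > \<rho>}" for z p
        using remainder_integrand_bound[OF \<epsilon> _ \<rho>, of z p n] that by auto
    qed measurable
  qed (rule op)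
qed

lemma frac_density_continuous: "((\<lambda>\<epsilon>. frac_density s (Complex K \<epsilon>) u) \<longlongrightarrow> frac_density s (complex_of_real K) u) (at_right 0)"
proof -
  have nz: "complex_of_real (exp (s * u)) * cis \<alpha> - complex_of_real K \<noteq> 0" if "\<alpha> = pi * s \<or> \<alpha> = - (pi * s)" for \<alpha>
  proof -
    have "0 < sin (pi * s) * (exp (s * u) + K) / 4" using sin_pi_s_pos[OF s K] K by (simp add: add_pos_pos)
    also have "\<dots> \<le> norm (complex_of_real (exp (s * u)) * cis \<alpha> - Complex K 0)"
      using frac_denominator_ge[OF s K, of 0 \<alpha> u] that sin_pi_s_pos[OF s K] K by simp
    finally show ?thesis by (simp add: complex_of_real_def)
  qed
  have "((\<lambda>\<epsilon>. complex_of_real K + \<i> * complex_of_real \<epsilon>) \<longlongrightarrow> complex_of_real K + \<i> * complex_of_real 0) (at_right 0)"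
    by (intro tendsto_intros)
  hence l: "((\<lambda>\<epsilon>. Complex K \<epsilon>) \<longlongrightarrow> complex_of_real K) (at_right 0)" by (simp add: Complex_eq)
  show ?thesis unfolding frac_density_def
    by (intro tendsto_intros l) (use nz in auto)
qed

abbreviation remainder_symbol :: "real \<Rightarrow> 'a::euclidean_space \<Rightarrow> complex" where
  "remainder_symbol \<epsilon> xi \<equiv> LINT u|lborel. frac_density s (Complex K \<epsilon>) u / complex_of_real (exp u + (norm xi)\<^sup>2)"

lemma frac_remainder_limit:
  assumes z: "z \<in> sector"
  shows "((\<lambda>\<epsilon>. frac_remainder n s (Complex K \<epsilon>) z) \<longlongrightarrow> frac_remainder n s (complex_of_real K) z) (at_right 0)"
  unfolding frac_remainder_def
proof (rule tendsto_integral_at_right_0[OF _ _ integrable_mult_left[OF weight_bound_integrable], of _ _ "sin (pi * s) * K / 4"])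
  show "sin (pi * s) * K / 4 > 0" using sin_pi_s_pos[OF s K] K by simp
  show "norm (frac_weight s (Complex K \<epsilon>) p * heat_profile n (snd p) z) \<le> weight_bound s K p * ((1 + (2 * (real n + 1)) ^ n) / sqrt (Re (z\<^sup>2)) ^ n)"
    if "0 < \<epsilon>" "\<epsilon> \<le> sin (pi * s) * K / 4" for \<epsilon> p
    using remainder_integrand_bound[of \<epsilon> "Re (z\<^sup>2)" z p n] that z by (auto simp: sector_def)
  show "((\<lambda>\<epsilon>. frac_weight s (Complex K \<epsilon>) p * heat_profile n (snd p) z) \<longlongrightarrow> frac_weight s (complex_of_real K) p * heat_profile n (snd p) z) (at_right 0)" for p
    unfolding frac_weight_def by (intro tendsto_intros frac_density_continuous)
qed measurable

text \<open>\<open>heat_superposition\<close> on pairs (u, \<tau>); integrating over \<tau> first,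
  in \<open>symb\<close>, identifies the multiplier with the integral term of
  \<open>frac_partial_fractions\<close>.\<close>

lemma frac_remainder_distribution:
  assumes \<epsilon>: "\<bar>\<epsilon>\<bar> \<le> sin (pi * s) * K / 4"
  shows "integrable lborel (\<lambda>x::'a::euclidean_space. frac_remainder DIM('a) s (Complex K \<epsilon>) (complex_of_real (norm x)))"
    and "test_fun \<phi> \<Longrightarrow> integrable lborel (\<lambda>xi. (remainder_symbol \<epsilon> xi) * inv_fourier \<phi> (xi::'a))"
    and "test_fun \<phi> \<Longrightarrow> (LINT x|lborel. frac_remainder DIM('a) s (Complex K \<epsilon>) (complex_of_real (norm x)) * \<phi> (x::'a))
       = (LINT xi|lborel. (remainder_symbol \<epsilon> xi) * inv_fourier \<phi> xi)"
proof -
  let ?w = "frac_weight s (Complex K \<epsilon>)"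
  have w0: "?w p \<noteq> 0 \<Longrightarrow> snd p > 0" for p by (auto simp: frac_weight_def indicator_def split: if_splits)
  have snd_m: "snd \<in> borel_measurable (lborel :: (real \<times> real) measure)"
    by (simp add: borel_prod[symmetric])
  note sup = heat_superposition[OF sigma_finite_lborel frac_weight_integrable[OF \<epsilon>] snd_m w0, where 'a='a]
  have rem: "frac_remainder DIM('a) s (Complex K \<epsilon>) (complex_of_real (norm x)) = (\<integral>p. ?w p * heat_kernel (snd p) (x::'a) \<partial>lborel)" for x
    by (simp only: frac_remainder_def heat_profile_real)
  show "integrable lborel (\<lambda>x::'a::euclidean_space. frac_remainder DIM('a) s (Complex K \<epsilon>) (complex_of_real (norm x)))"
    unfolding rem by (rule sup(1)) auto
  have symb: "(\<integral>p. ?w p * complex_of_real (exp (- snd p * l)) \<partial>lborel) = (LINT u|lborel. frac_density s (Complex K \<epsilon>) u / complex_of_real (exp u + l))"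
    if l: "l \<ge> 0" for l
  proof -
    have i: "integrable (lborel \<Otimes>\<^sub>M lborel) (\<lambda>p. ?w p * complex_of_real (exp (- snd p * l)))"
      unfolding lborel_prod
    proof (rule Bochner_Integration.integrable_bound[OF frac_weight_integrable[OF \<epsilon>]])
      have "(\<lambda>p::real\<times>real. complex_of_real (exp (- snd p * l))) \<in> borel_measurable borel"
        unfolding borel_prod[symmetric] by measurable
      thus "(\<lambda>p. ?w p * complex_of_real (exp (- snd p * l))) \<in> borel_measurable lborel" by measurable
      show "AE p in lborel. norm (?w p * complex_of_real (exp (- snd p * l))) \<le> norm (?w p)"
      proof (rule AE_I2)
        fix p
        show "norm (?w p * complex_of_real (exp (- snd p * l))) \<le> norm (?w p)"
          using w0[of p] l by (cases "?w p = 0") (auto simp: norm_mult intro!: mult_left_le)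
      qed
    qed
    have "(\<integral>p. ?w p * complex_of_real (exp (- snd p * l)) \<partial>lborel) = (\<integral>p. ?w p * complex_of_real (exp (- snd p * l)) \<partial>(lborel \<Otimes>\<^sub>M lborel))"
      by (simp only: lborel_prod)
    also have "\<dots> = (LINT u|lborel. LINT t|lborel. ?w (u, t) * complex_of_real (exp (- t * l)))"
      using lborel_pair.integral_fst'[OF i] by simp
    also have "\<dots> = (LINT u|lborel. frac_density s (Complex K \<epsilon>) u / complex_of_real (exp u + l))"
    proof (rule Bochner_Integration.integral_cong[OF refl])
      fix u :: real
      have p: "exp u + l > 0" using l by (simp add: add_pos_nonneg)
      have "(LINT t|lborel. ?w (u, t) * complex_of_real (exp (- t * l)))
         = (LINT t|lborel. frac_density s (Complex K \<epsilon>) u * complex_of_real (indicator {0<..} t *\<^sub>R exp (- (exp u + l) * t)))"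
      proof (rule Bochner_Integration.integral_cong[OF refl])
        fix t :: real
        have "exp (- exp u * t) * exp (- t * l) = exp (- (exp u + l) * t)"
          by (simp add: algebra_simps flip: exp_add)
        hence E: "complex_of_real (exp (- exp u * t)) * complex_of_real (exp (- t * l)) = complex_of_real (exp (- (exp u + l) * t))"
          by (simp only: of_real_mult[symmetric])
        show "?w (u, t) * complex_of_real (exp (- t * l)) = frac_density s (Complex K \<epsilon>) u * complex_of_real (indicator {0<..} t *\<^sub>R exp (- (exp u + l) * t))"
        proof (cases "t > 0")
          case True
          hence ind: "indicator {0<..} t = (1::real)" by simp
          show ?thesis unfolding frac_weight_def fst_conv snd_conv ind scaleR_one mult.assoc E ..
        qed (simp add: frac_weight_def)
      qed
      also have "\<dots> = frac_density s (Complex K \<epsilon>) u * complex_of_real (1 / (exp u + l))"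
        by (simp only: integral_mult_right_zero integral_complex_of_real exponential_integral(2)[OF p])
      finally show "(LINT t|lborel. ?w (u, t) * complex_of_real (exp (- t * l))) = frac_density s (Complex K \<epsilon>) u / complex_of_real (exp u + l)"
        by (simp add: divide_inverse)
    qed
    finally show ?thesis .
  qed
  have symb': "(remainder_symbol \<epsilon> xi) = (\<integral>p. ?w p * complex_of_real (exp (- snd p * (norm xi)\<^sup>2)) \<partial>lborel)" for xi :: 'a
    by (rule symb[symmetric]) simp
  assume \<phi>: "test_fun \<phi>"
  note [measurable] = frac_density_measurable[OF s K, of "Complex K \<epsilon>"]
  have [measurable]: "inv_fourier \<phi> \<in> borel_measurable borel" using test_funD(3)[OF \<phi>] by auto
  show "integrable lborel (\<lambda>xi. (remainder_symbol \<epsilon> xi) * inv_fourier \<phi> (xi::'a))"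
  proof (rule Bochner_Integration.integrable_bound[OF integrable_mult_right[OF integrable_norm[OF test_funD(3)[OF \<phi>]], of "LINT p|lborel. norm (?w p)"]])
    show "(\<lambda>xi. (remainder_symbol \<epsilon> xi) * inv_fourier \<phi> (xi::'a)) \<in> borel_measurable lborel"
      by measurable
    have "norm (remainder_symbol \<epsilon> xi) \<le> (LINT p|lborel. norm (?w p))" for xi :: 'a
      unfolding symb'
    proof (rule order_trans[OF integral_norm_bound], rule integral_mono')
      show "integrable lborel (\<lambda>p. norm (?w p))" by (rule integrable_norm[OF frac_weight_integrable[OF \<epsilon>]])
      show "norm (?w p * complex_of_real (exp (- snd p * (norm xi)\<^sup>2))) \<le> norm (?w p)" for p
        using w0[of p] by (cases "?w p = 0") (auto simp: norm_mult intro!: mult_left_le)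
    qed auto
    thus "AE xi::'a in lborel. norm ((remainder_symbol \<epsilon> xi) * inv_fourier \<phi> xi)
        \<le> norm ((LINT p|lborel. norm (?w p)) * norm (inv_fourier \<phi> xi))"
      unfolding norm_mult by (intro AE_I2 mult_mono) (auto intro: order_trans[OF _ abs_ge_self])
  qed
  show "(LINT x|lborel. frac_remainder DIM('a) s (Complex K \<epsilon>) (complex_of_real (norm x)) * \<phi> (x::'a))
       = (LINT xi|lborel. (remainder_symbol \<epsilon> xi) * inv_fourier \<phi> xi)"
    unfolding rem symb' using sup(2)[OF _ \<phi>] by simp
qed

end

section \<open>Asymptotics\<close>

lemma norm_Cauchy_deriv:
  assumes f: "f holomorphic_on S" and S: "cball z r \<subseteq> S" and r: "r > 0"
    and B: "\<And>w. w \<in> cball z r \<Longrightarrow> norm (f w) \<le> B"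
  shows "norm (deriv f z) \<le> B / r"
proof -
  have "norm ((deriv ^^ 1) f z) \<le> fact 1 * B / r ^ 1"
  proof (rule Cauchy_inequality[OF _ _ r])
    show "f holomorphic_on ball z r" using f S by (meson ball_subset_cball holomorphic_on_subset order_trans)
    show "continuous_on (cball z r) f"
      using f S by (meson holomorphic_on_imp_continuous_on holomorphic_on_subset)
  qed (auto intro!: B simp: dist_norm)
  thus ?thesis by simp
qed

text \<open>The profile P stripped of its phase e^(i k z). In P' - i k P only the derivative of this
  amplitude survives, so the radiation condition for P is decay of that derivative.\<close>

definition helm_amplitude :: "nat \<Rightarrow> real \<Rightarrow> complex \<Rightarrow> complex" where
  "helm_amplitude n k z = (if n = 1 then \<i> / (2 * complex_of_real k)
     else if n = 2 then hankel_laplace (complex_of_real k) z / (2 * complex_of_real pi)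
     else 1 / (4 * complex_of_real pi * z))"

lemma helm_profile_amplitude:
  "helm_profile n (complex_of_real k) z = exp (\<i> * complex_of_real k * z) * helm_amplitude n k z"
  by (simp add: helm_profile_def helm_amplitude_def)

lemma real_half_planes: "k > 0 \<Longrightarrow> complex_of_real k \<in> half_planes 0"
  by (simp add: half_planes_def)

lemma helm_amplitude_holomorphic:
  assumes k: "k > 0"
  shows "helm_amplitude n k holomorphic_on {z. Re z > 0}"
proof -
  have [simp]: "z \<noteq> 0" if "Re z > 0" for z using that by auto
  show ?thesis using hankel_laplace_holomorphic[OF real_half_planes[OF k]]
    unfolding helm_amplitude_def[abs_def] by (cases "n = 1"; cases "n = 2"; simp) (auto intro!: holomorphic_intros)
qed

lemma helm_amplitude_bound:
  assumes k: "k > 0" and n: "n \<in> {1, 2, 3}"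
  obtains C where "\<And>z. Re z > 0 \<Longrightarrow> norm (helm_amplitude n k z) \<le> C / sqrt (Re z) ^ (n - 1)"
proof -
  consider "n = 1" | "n = 2" | "n = 3" using n by auto
  thus ?thesis
  proof cases
    case 1
    thus ?thesis using that[of "norm (\<i> / (2 * complex_of_real k))"] by (simp add: helm_amplitude_def)
  next
    case 2
    obtain C where C: "\<And>z. Re z > 0 \<Longrightarrow> norm (hankel_laplace (complex_of_real k) z) \<le> C / sqrt (Re z)"
      using hankel_laplace_bound[OF real_half_planes[OF k]] by blast
    have "norm (helm_amplitude n k z) \<le> (C / (2 * pi)) / sqrt (Re z) ^ (n - 1)" if "Re z > 0" for z
      using divide_right_mono[OF C[OF that], of "2 * pi"] 2 by (simp add: helm_amplitude_def norm_divide norm_mult mult.commute)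
    thus ?thesis by (rule that)
  next
    case 3
    have "norm (helm_amplitude n k z) \<le> (1 / (4 * pi)) / sqrt (Re z) ^ (n - 1)" if z: "Re z > 0" for z
    proof -
      have "1 / norm z \<le> 1 / Re z" using z abs_Re_le_cmod[of z] by (intro divide_left_mono) (auto intro!: mult_pos_pos)
      hence "(1 / norm z) / (4 * pi) \<le> (1 / Re z) / (4 * pi)" by (rule divide_right_mono) auto
      thus ?thesis using 3 z by (simp add: helm_amplitude_def norm_divide norm_mult mult.commute)
    qed
    thus ?thesis by (rule that)
  qed
qed

text \<open>The disc of radius r/2 around r stays in Re z \<ge> r/2, so Cauchy's estimate gains a
  factor 1/r over the size of the amplitude.\<close>

lemma helm_amplitude_deriv_decay:
  assumes k: "k > 0" and n: "n \<in> {1, 2, 3}"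
  shows "((\<lambda>r. sqrt r ^ (n - 1) * norm (deriv (helm_amplitude n k) (complex_of_real r))) \<longlongrightarrow> 0) at_top"
proof -
  obtain C where C: "\<And>z. Re z > 0 \<Longrightarrow> norm (helm_amplitude n k z) \<le> C / sqrt (Re z) ^ (n - 1)"
    using helm_amplitude_bound[OF k n] by blast
  have C0: "C \<ge> 0" using order_trans[OF norm_ge_zero C[of 1]] by simp
  have "norm (deriv (helm_amplitude n k) (complex_of_real r)) \<le> (C / sqrt (r / 2) ^ (n - 1)) / (r / 2)" if r: "r > 0" for r
  proof (rule norm_Cauchy_deriv[OF helm_amplitude_holomorphic[OF k]])
    have re: "Re w \<ge> r / 2" if "w \<in> cball (complex_of_real r) (r / 2)" for w
      using that abs_Re_le_cmod[of "complex_of_real r - w"] by (simp add: dist_norm abs_le_iff)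
    show "cball (complex_of_real r) (r / 2) \<subseteq> {z. Re z > 0}" using re r by force
    show "norm (helm_amplitude n k w) \<le> C / sqrt (r / 2) ^ (n - 1)" if w: "w \<in> cball (complex_of_real r) (r / 2)" for w
    proof -
      have "norm (helm_amplitude n k w) \<le> C / sqrt (Re w) ^ (n - 1)" using C re[OF w] r by simp
      also have "\<dots> \<le> C / sqrt (r / 2) ^ (n - 1)"
        using re[OF w] r C0 by (intro divide_left_mono power_mono mult_pos_pos) auto
      finally show ?thesis .
    qed
  qed (use r in auto)
  hence b: "sqrt r ^ (n - 1) * norm (deriv (helm_amplitude n k) (complex_of_real r)) \<le> C * sqrt 2 ^ (n - 1) * 2 / r" if r: "r > 0" for r
  proof -
    have "sqrt r ^ (n - 1) * norm (deriv (helm_amplitude n k) (complex_of_real r)) \<le> sqrt r ^ (n - 1) * ((C / sqrt (r / 2) ^ (n - 1)) / (r / 2))"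
      using \<open>\<And>r. r > 0 \<Longrightarrow> _\<close>[OF r] r by (intro mult_left_mono) auto
    also have "\<dots> = C * sqrt 2 ^ (n - 1) * 2 / r" using r by (simp add: real_sqrt_divide power_divide)
    finally show ?thesis .
  qed
  show ?thesis
  proof (rule Lim_null_comparison)
    show "\<forall>\<^sub>F r in at_top. norm (sqrt r ^ (n - 1) * norm (deriv (helm_amplitude n k) (complex_of_real r))) \<le> C * sqrt 2 ^ (n - 1) * 2 / r"
      using eventually_gt_at_top[of 0] by eventually_elim (use b in simp)
    show "((\<lambda>r. C * sqrt 2 ^ (n - 1) * 2 / r) \<longlongrightarrow> 0) at_top" by real_asymp
  qed
qed

lemma of_real_sector: "r > 0 \<Longrightarrow> complex_of_real r \<in> sector"
  by (simp add: sector_def power2_eq_square)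

lemma open_sector: "open sector"
  unfolding sector_def by (intro open_Collect_less continuous_intros)

text \<open>\<open>frac_remainder_bound\<close> with \<rho> comparable to r^2 gives r^(-n), against
  a weight of r^((n-1)/2) only; for r \<ge> 1 the product is at most a constant over r.\<close>

lemma remainder_decay:
  assumes s: "0 < s" "s < 1" and K: "0 < K" and n: "n \<ge> 1"
  shows "((\<lambda>r. sqrt r ^ (n - 1) * norm (frac_remainder n s (complex_of_real K) (complex_of_real r))) \<longlongrightarrow> 0) at_top" (is ?A)
    and "((\<lambda>r. sqrt r ^ (n - 1) * norm (deriv (frac_remainder n s (complex_of_real K)) (complex_of_real r))) \<longlongrightarrow> 0) at_top" (is ?B)
proof -
  define B where "B = remainder_const s K n"
  have \<epsilon>: "\<bar>0::real\<bar> \<le> sin (pi * s) * K / 4" using sin_pi_s_pos[OF s K] K by simp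
  have bound: "norm (frac_remainder n s (complex_of_real K) z) \<le> B / sqrt \<rho> ^ n" if "Re (z\<^sup>2) \<ge> \<rho>" "\<rho> > 0" for z \<rho>
    using frac_remainder_bound[OF s K \<epsilon> that] by (simp add: B_def complex_of_real_def)
  have B0: "B \<ge> 0" using order_trans[OF norm_ge_zero bound[of 1 1]] by simp
  have holo: "frac_remainder n s (complex_of_real K) holomorphic_on sector"
    using frac_remainder_holomorphic[OF s K \<epsilon>] by (simp add: complex_of_real_def)
  have pw: "sqrt r ^ (n - 1) / r ^ n \<le> 1 / r" if r: "r \<ge> 1" for r
  proof -
    have "sqrt r \<le> r" using r real_sqrt_le_mono[of r "r\<^sup>2"] by (simp add: power2_eq_square)
    hence "sqrt r ^ (n - 1) \<le> r ^ (n - 1)" using r by (intro power_mono) auto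
    hence "sqrt r ^ (n - 1) / r ^ n \<le> r ^ (n - 1) / r ^ n" using r by (intro divide_right_mono) auto
    also have "r ^ n = r * r ^ (n - 1)" using n by (cases n) auto
    hence "r ^ (n - 1) / r ^ n = 1 / r" using r by simp
    finally show ?thesis .
  qed
  show ?A
  proof (rule Lim_null_comparison)
    show "\<forall>\<^sub>F r in at_top. norm (sqrt r ^ (n - 1) * norm (frac_remainder n s (complex_of_real K) (complex_of_real r))) \<le> B / r"
      using eventually_ge_at_top[of 1]
    proof eventually_elim
      case (elim r)
      have "norm (frac_remainder n s (complex_of_real K) (complex_of_real r)) \<le> B / r ^ n"
        using bound[of "r\<^sup>2" "complex_of_real r"] elim by (simp flip: of_real_power)
      hence "sqrt r ^ (n - 1) * norm (frac_remainder n s (complex_of_real K) (complex_of_real r)) \<le> sqrt r ^ (n - 1) * (B / r ^ n)"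
        using elim by (intro mult_left_mono) auto
      also have "\<dots> = B * (sqrt r ^ (n - 1) / r ^ n)" by simp
      also have "\<dots> \<le> B * (1 / r)" by (rule mult_left_mono[OF pw[OF elim] B0])
      finally show ?case using elim by simp
    qed
    show "((\<lambda>r. B / r) \<longlongrightarrow> 0) at_top" by real_asymp
  qed
  have db: "norm (deriv (frac_remainder n s (complex_of_real K)) (complex_of_real r)) \<le> (B / sqrt (r\<^sup>2 / 2) ^ n) / (r / 4)" if r: "r > 0" for r
  proof (rule norm_Cauchy_deriv[OF holo])
    \<comment> \<open>On this disc Re w \<ge> 3r/4 and |Im w| \<le> r/4, and (3/4)^2 - (1/4)^2 =
      1/2.\<close>
    have re: "Re (w\<^sup>2) \<ge> r\<^sup>2 / 2" if "w \<in> cball (complex_of_real r) (r / 4)" for w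
    proof -
      have "\<bar>Re w - r\<bar> \<le> r / 4" "\<bar>Im w\<bar> \<le> r / 4"
        using that abs_Re_le_cmod[of "complex_of_real r - w"] abs_Im_le_cmod[of "complex_of_real r - w"]
        by (auto simp: dist_norm abs_minus_commute)
      hence "3 / 4 * r \<le> Re w" "\<bar>Im w\<bar> \<le> r / 4" by linarith+
      hence "(3 / 4 * r)\<^sup>2 \<le> (Re w)\<^sup>2" "(Im w)\<^sup>2 \<le> (r / 4)\<^sup>2"
        using r power_mono[of "3 / 4 * r" "Re w" 2] power_mono[of "\<bar>Im w\<bar>" "r / 4" 2] by simp_all
      thus ?thesis by (simp add: power2_eq_square)
    qed
    show "cball (complex_of_real r) (r / 4) \<subseteq> sector"
    proof
      fix w assume "w \<in> cball (complex_of_real r) (r / 4)"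
      from re[OF this] r show "w \<in> sector" unfolding sector_def by (smt (verit) mem_Collect_eq zero_less_power half_gt_zero)
    qed
    show "norm (frac_remainder n s (complex_of_real K) w) \<le> B / sqrt (r\<^sup>2 / 2) ^ n" if w: "w \<in> cball (complex_of_real r) (r / 4)" for w
      by (rule bound[OF re[OF w]]) (use r in simp)
  qed (use r in auto)
  show ?B
  proof (rule Lim_null_comparison)
    show "\<forall>\<^sub>F r in at_top. norm (sqrt r ^ (n - 1) * norm (deriv (frac_remainder n s (complex_of_real K)) (complex_of_real r))) \<le> (B * sqrt 2 ^ n * 4) / r"
      using eventually_ge_at_top[of 1]
    proof eventually_elim
      case (elim r)
      have sq: "sqrt (r\<^sup>2 / 2) = r / sqrt 2" using elim by (simp add: real_sqrt_divide)
      have "sqrt r ^ (n - 1) * norm (deriv (frac_remainder n s (complex_of_real K)) (complex_of_real r)) \<le> sqrt r ^ (n - 1) * ((B / sqrt (r\<^sup>2 / 2) ^ n) / (r / 4))"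
        using db[of r] elim by (intro mult_left_mono) auto
      also have "\<dots> = (B * sqrt 2 ^ n * 4) * (sqrt r ^ (n - 1) / r ^ n) * (1 / r)"
        unfolding sq power_divide using elim by simp
      also have "\<dots> \<le> (B * sqrt 2 ^ n * 4) * (1 / r) * 1"
        using pw[OF elim] B0 elim by (intro mult_mono mult_nonneg_nonneg) auto
      finally show ?case using elim by simp
    qed
    show "((\<lambda>r. (B * sqrt 2 ^ n * 4) / r) \<longlongrightarrow> 0) at_top" by real_asymp
  qed
qed

text \<open>\<open>helmholtz_distribution\<close> and \<open>frac_remainder_distribution\<close>
  treat the two summands of the partial fraction at lam = |xi|^2 separately; linearity joins
  them.\<close>

lemma is_inv_fourier_distr_frac:
  assumes s: "0 < s" "s < 1" and k: "0 < k" and K: "K = k powr (2 * s)"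
    and \<epsilon>: "0 < \<epsilon>" "\<epsilon> \<le> sin (pi * s) * K / 4" and n: "DIM('a::euclidean_space) \<in> {1, 2, 3}"
    and \<kappa>: "\<kappa>\<^sup>2 = exp (Ln (Complex K \<epsilon>) / s)" "Im \<kappa> > 0"
  shows "is_inv_fourier_distr (frac_symbol s k \<epsilon>)
     (\<lambda>x::'a. \<kappa>\<^sup>2 / (s * Complex K \<epsilon>) * helm_profile DIM('a) \<kappa> (complex_of_real (norm x))
         + frac_remainder DIM('a) s (Complex K \<epsilon>) (complex_of_real (norm x)))"
  unfolding is_inv_fourier_distr_def
proof (intro conjI allI impI)
  have K0: "K > 0" using k by (simp add: K)
  have \<epsilon>': "\<bar>\<epsilon>\<bar> \<le> sin (pi * s) * K / 4" using \<epsilon> by simp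
  define c where "c = \<kappa>\<^sup>2 / (s * Complex K \<epsilon>)"
  let ?P = "\<lambda>x::'a. helm_profile DIM('a) \<kappa> (complex_of_real (norm x))"
  let ?R = "\<lambda>x::'a. frac_remainder DIM('a) s (Complex K \<epsilon>) (complex_of_real (norm x))"
  let ?S = "\<lambda>xi::'a. LINT u|lborel. frac_density s (Complex K \<epsilon>) u / complex_of_real (exp u + (norm xi)\<^sup>2)"
  have iP: "set_integrable lborel C ?P" if "compact C" for C
    by (rule helm_profile_compact_integrable[OF \<kappa>(2) n that])
  have iR: "set_integrable lborel C ?R" if "compact C" for C
    unfolding set_integrable_def
    by (intro integrable_mult_indicator frac_remainder_distribution(1)[OF s K0 \<epsilon>']) (use that in \<open>simp add: borel_compact\<close>)
  show "set_integrable lborel C (\<lambda>x. \<kappa>\<^sup>2 / (s * Complex K \<epsilon>) * ?P x + ?R x)" if "compact C" for C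
    by (intro set_integral_add set_integrable_mult_right iP iR that)
  fix \<phi> :: "'a \<Rightarrow> complex" assume \<phi>: "test_fun \<phi>"
  have [measurable]: "inv_fourier \<phi> \<in> borel_measurable borel" using test_funD(3)[OF \<phi>] by auto
  have jP: "integrable lborel (\<lambda>x. c * (?P x * \<phi> x))" by (intro integrable_mult_right test_fun_mult_integrable iP \<phi>)
  have jR: "integrable lborel (\<lambda>x. ?R x * \<phi> x)" by (intro test_fun_mult_integrable iR \<phi>)
  have hP: "integrable lborel (\<lambda>xi. c * (1 / (complex_of_real ((norm xi)\<^sup>2) - \<kappa>\<^sup>2) * inv_fourier \<phi> xi))"
  proof (intro integrable_mult_right, rule Bochner_Integration.integrable_bound[OF integrable_mult_right[OF integrable_norm[OF test_funD(3)[OF \<phi>]], of "1 / (Im \<kappa>)\<^sup>2"]])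
    show "AE xi in lborel. norm (1 / (complex_of_real ((norm xi)\<^sup>2) - \<kappa>\<^sup>2) * inv_fourier \<phi> xi) \<le> norm (1 / (Im \<kappa>)\<^sup>2 * norm (inv_fourier \<phi> xi))"
    proof (rule AE_I2)
      fix xi :: 'a
      have b: "norm (complex_of_real ((norm xi)\<^sup>2) - \<kappa>\<^sup>2) \<ge> (Im \<kappa>)\<^sup>2" by (rule norm_square_diff_ge[OF \<kappa>(2)])
      have "(Im \<kappa>)\<^sup>2 > 0" using \<kappa>(2) by simp
      hence "norm (1 / (complex_of_real ((norm xi)\<^sup>2) - \<kappa>\<^sup>2)) \<le> 1 / (Im \<kappa>)\<^sup>2"
        unfolding norm_divide norm_one using b by (intro divide_left_mono mult_pos_pos) auto
      hence "norm (1 / (complex_of_real ((norm xi)\<^sup>2) - \<kappa>\<^sup>2)) * norm (inv_fourier \<phi> xi) \<le> 1 / (Im \<kappa>)\<^sup>2 * norm (inv_fourier \<phi> xi)"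
        by (intro mult_right_mono) auto
      thus "norm (1 / (complex_of_real ((norm xi)\<^sup>2) - \<kappa>\<^sup>2) * inv_fourier \<phi> xi) \<le> norm (1 / (Im \<kappa>)\<^sup>2 * norm (inv_fourier \<phi> xi))"
        by (simp only: norm_mult[of "_ / _ :: complex"] real_norm_def)
    qed
  qed measurable
  note hR = frac_remainder_distribution(2)[OF s K0 \<epsilon>' \<phi>]
  have "(LINT x|lborel. (\<kappa>\<^sup>2 / (s * Complex K \<epsilon>) * ?P x + ?R x) * \<phi> x) = (LINT x|lborel. c * (?P x * \<phi> x) + ?R x * \<phi> x)"
    by (simp only: c_def distrib_right mult.assoc)
  also have "\<dots> = c * (LINT x|lborel. ?P x * \<phi> x) + (LINT x|lborel. ?R x * \<phi> x)"
    by (simp only: Bochner_Integration.integral_add[OF jP jR] integral_mult_right_zero)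
  also have "\<dots> = c * (LINT xi|lborel. 1 / (complex_of_real ((norm xi)\<^sup>2) - \<kappa>\<^sup>2) * inv_fourier \<phi> xi) + (LINT xi|lborel. ?S xi * inv_fourier \<phi> xi)"
    by (simp only: helmholtz_distribution[OF \<kappa>(2) n \<phi>] frac_remainder_distribution(3)[OF s K0 \<epsilon>' \<phi>])
  also have "\<dots> = (LINT xi|lborel. c * (1 / (complex_of_real ((norm xi)\<^sup>2) - \<kappa>\<^sup>2) * inv_fourier \<phi> xi) + ?S xi * inv_fourier \<phi> xi)"
    by (simp only: Bochner_Integration.integral_add[OF hP hR] integral_mult_right_zero)
  also have "\<dots> = (LINT xi|lborel. frac_symbol s k \<epsilon> xi * inv_fourier \<phi> xi)"
  proof (rule integral_cong_AE)
    show "(\<lambda>xi. c * (1 / (complex_of_real ((norm xi)\<^sup>2) - \<kappa>\<^sup>2) * inv_fourier \<phi> xi) + ?S xi * inv_fourier \<phi> xi) \<in> borel_measurable lborel"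
      by (intro borel_measurable_integrable Bochner_Integration.integrable_add hP hR)
    show "(\<lambda>xi. frac_symbol s k \<epsilon> xi * inv_fourier \<phi> xi) \<in> borel_measurable lborel"
      unfolding frac_symbol_def by measurable
    \<comment> \<open>The partial fraction requires lam > 0, so xi = 0 is left out as a null
      set.\<close>
    show "AE xi in lborel. c * (1 / (complex_of_real ((norm xi)\<^sup>2) - \<kappa>\<^sup>2) * inv_fourier \<phi> xi) + ?S xi * inv_fourier \<phi> xi
        = frac_symbol s k \<epsilon> xi * inv_fourier \<phi> xi"
      using AE_lborel_singleton[of "0::'a"]
    proof eventually_elim
      case (elim xi)
      hence l: "(norm xi)\<^sup>2 > 0" by simp
      have p: "((norm xi)\<^sup>2) powr s = norm xi powr (2 * s)"
        using elim by (simp add: powr_powr flip: powr_numeral)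
      have "frac_symbol s k \<epsilon> xi = 1 / (complex_of_real (((norm xi)\<^sup>2) powr s) - Complex K \<epsilon>)"
        unfolding frac_symbol_def p K by (simp add: Complex_eq algebra_simps)
      also have "\<dots> = c / (complex_of_real ((norm xi)\<^sup>2) - \<kappa>\<^sup>2) + ?S xi"
        using frac_partial_fractions[OF s K0 \<epsilon> l] unfolding c_def \<kappa>(1) .
      finally show ?case by (simp add: distrib_right)
    qed
  qed
  finally show "(LINT x|lborel. (\<kappa>\<^sup>2 / (s * Complex K \<epsilon>) * ?P x + ?R x) * \<phi> x) = (LINT xi|lborel. frac_symbol s k \<epsilon> xi * inv_fourier \<phi> xi)" .
qed

section \<open>The limit of vanishing absorption\<close>

context
  fixes s k K :: real
  assumes s: "0 < s" "s < 1" and k: "0 < k" and K_def: "K = k powr (2 * s)"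
begin

lemma K_pos: "K > 0" using k by (simp add: K_def)

lemma G_eps_formula:
  fixes x :: "'a::euclidean_space"
  assumes \<epsilon>: "0 < \<epsilon>" "\<epsilon> \<le> sin (pi * s) * K / 4" and n: "DIM('a) \<in> {1, 2, 3}" and x: "x \<noteq> 0"
  shows "G_eps s k \<epsilon> x = exp (Ln (Complex K \<epsilon>) / s) / (s * Complex K \<epsilon>) * helm_profile DIM('a) (exp (Ln (Complex K \<epsilon>) / (2 * s))) (complex_of_real (norm x))
      + frac_remainder DIM('a) s (Complex K \<epsilon>) (complex_of_real (norm x))"
proof -
  define \<kappa> where "\<kappa> = exp (Ln (Complex K \<epsilon>) / (2 * s))"
  have \<kappa>2: "\<kappa>\<^sup>2 = exp (Ln (Complex K \<epsilon>) / s)"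
    unfolding \<kappa>_def exp_double[symmetric] using s by (simp add: field_simps)
  \<comment> \<open>\<kappa> has argument arg \<mu>/(2 s), which \<open>Arg_bound\<close> keeps
    between 0 and pi; so \<kappa> is the square root in the upper half-plane, the outgoing
    choice.\<close>
  have a: "0 < Im (Ln (Complex K \<epsilon>))" "Im (Ln (Complex K \<epsilon>)) < pi * s" using Arg_bound[OF s K_pos \<epsilon>] by auto
  have "Im (Ln (Complex K \<epsilon>) / (2 * s)) = Im (Ln (Complex K \<epsilon>)) / (2 * s)"
    using Im_divide_of_real[of "Ln (Complex K \<epsilon>)" "2 * s"] by simp
  moreover have "0 < Im (Ln (Complex K \<epsilon>)) / (2 * s)" using a s by simp
  moreover have "Im (Ln (Complex K \<epsilon>)) / (2 * s) < pi" using a s pi_gt_zero by (simp add: field_simps)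
  ultimately have \<kappa>: "Im \<kappa> > 0" unfolding \<kappa>_def Im_exp by (simp add: sin_gt_zero)
  have hp: "\<kappa> \<in> half_planes 0" using \<kappa> by (simp add: half_planes_def)
  have \<epsilon>': "\<bar>\<epsilon>\<bar> \<le> sin (pi * s) * K / 4" using \<epsilon> by simp
  have "G_eps s k \<epsilon> x = \<kappa>\<^sup>2 / (s * Complex K \<epsilon>) * helm_profile DIM('a) \<kappa> (complex_of_real (norm x))
         + frac_remainder DIM('a) s (Complex K \<epsilon>) (complex_of_real (norm x))"
  proof (rule G_eps_eqI[OF is_inv_fourier_distr_frac[OF s k K_def \<epsilon> n \<kappa>2 \<kappa>] _ x])
    have "continuous_on (UNIV - {0}) (\<lambda>x::'a. frac_remainder DIM('a) s (Complex K \<epsilon>) (complex_of_real (norm x)))"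
      by (rule continuous_on_compose2[OF holomorphic_on_imp_continuous_on[OF frac_remainder_holomorphic[OF s K_pos \<epsilon>']]])
         (auto intro!: continuous_intros of_real_sector)
    thus "continuous_on (UNIV - {0}) (\<lambda>x::'a. \<kappa>\<^sup>2 / (s * Complex K \<epsilon>) * helm_profile DIM('a) \<kappa> (complex_of_real (norm x))
         + frac_remainder DIM('a) s (Complex K \<epsilon>) (complex_of_real (norm x)))"
      by (intro continuous_intros helm_profile_continuous hp)
  qed
  thus ?thesis unfolding \<kappa>2 unfolding \<kappa>_def .
qed

text \<open>The factor k^(2-2s)/s is the limit of exp (Ln \<mu> / s)/(s \<mu>), namely k^2/(s
  k^(2s)).\<close>

definition outgoing_profile :: "nat \<Rightarrow> complex \<Rightarrow> complex" where
  "outgoing_profile n z = complex_of_real (k powr (2 - 2 * s) / s) * helm_profile n (complex_of_real k) z + frac_remainder n s (complex_of_real K) z"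

text \<open>The wave number exp (Ln \<mu> / (2 s)) tends to the real \<open>k\<close>, on the
  boundary of the upper half-plane but interior to \<open>half_planes 0\<close>, where the profile
  is continuous in it. The remainder passes to the limit by dominated convergence.\<close>

lemma G_out_formula:
  fixes x :: "'a::euclidean_space"
  assumes n: "DIM('a) \<in> {1, 2, 3}" and x: "x \<noteq> 0"
  shows "G_out s k x = outgoing_profile DIM('a) (complex_of_real (norm x))"
proof -
  have K: "K > 0" by (rule K_pos)
  have "((\<lambda>\<epsilon>. complex_of_real K + \<i> * complex_of_real \<epsilon>) \<longlongrightarrow> complex_of_real K + \<i> * complex_of_real 0) (at_right 0)"
    by (intro tendsto_intros)
  hence l: "((\<lambda>\<epsilon>. Complex K \<epsilon>) \<longlongrightarrow> complex_of_real K) (at_right 0)" by (simp add: Complex_eq)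
  have LnK: "Ln (complex_of_real K) = complex_of_real (2 * s * ln k)"
    using Ln_of_real[OF K] k by (simp add: K_def ln_powr)
  have lL: "((\<lambda>\<epsilon>. Ln (Complex K \<epsilon>)) \<longlongrightarrow> complex_of_real (2 * s * ln k)) (at_right 0)"
    unfolding LnK[symmetric] by (intro tendsto_Ln l) (use K in auto)
  have "((\<lambda>\<epsilon>. exp (Ln (Complex K \<epsilon>) / (2 * s))) \<longlongrightarrow> exp (complex_of_real (2 * s * ln k) / (2 * s))) (at_right 0)"
    by (intro tendsto_intros lL) (use s in auto)
  also have "complex_of_real (2 * s * ln k) / (2 * s) = complex_of_real (ln k)" using s by simp
  also have "exp (complex_of_real (ln k)) = complex_of_real k" using k by (simp add: exp_of_real)
  finally have l\<kappa>: "((\<lambda>\<epsilon>. exp (Ln (Complex K \<epsilon>) / (2 * s))) \<longlongrightarrow> complex_of_real k) (at_right 0)" .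
  have "isCont (\<lambda>\<kappa>. helm_profile DIM('a) \<kappa> (complex_of_real (norm x))) (complex_of_real k)"
    using holomorphic_on_imp_continuous_on[OF helm_profile_holomorphic_kappa[of "complex_of_real (norm x)" "DIM('a)"]] x
      open_half_planes[of 0] real_half_planes[OF k] by (simp add: continuous_on_eq_continuous_at)
  from isCont_tendsto_compose[OF this l\<kappa>]
  have lP: "((\<lambda>\<epsilon>. helm_profile DIM('a) (exp (Ln (Complex K \<epsilon>) / (2 * s))) (complex_of_real (norm x))) \<longlongrightarrow> helm_profile DIM('a) (complex_of_real k) (complex_of_real (norm x))) (at_right 0)" .
  have "((\<lambda>\<epsilon>. exp (Ln (Complex K \<epsilon>) / s) / (s * Complex K \<epsilon>)) \<longlongrightarrow> exp (complex_of_real (2 * s * ln k) / s) / (s * complex_of_real K)) (at_right 0)"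
    by (intro tendsto_intros lL l) (use s K in auto)
  also have "exp (complex_of_real (2 * s * ln k) / s) / (s * complex_of_real K) = complex_of_real (k powr (2 - 2 * s) / s)"
  proof -
    have "complex_of_real (2 * s * ln k) / s = complex_of_real (2 * ln k)" using s by simp
    moreover have "exp (2 * ln k) = k powr 2" using k by (simp add: powr_def)
    moreover have "k powr 2 / (s * K) = k powr (2 - 2 * s) / s" by (simp add: K_def powr_diff)
    ultimately show ?thesis by (simp only: exp_of_real of_real_mult[symmetric] of_real_divide[symmetric])
  qed
  finally have lc: "((\<lambda>\<epsilon>. exp (Ln (Complex K \<epsilon>) / s) / (s * Complex K \<epsilon>)) \<longlongrightarrow> complex_of_real (k powr (2 - 2 * s) / s)) (at_right 0)" .
  have lR: "((\<lambda>\<epsilon>. frac_remainder DIM('a) s (Complex K \<epsilon>) (complex_of_real (norm x))) \<longlongrightarrow> frac_remainder DIM('a) s (complex_of_real K) (complex_of_real (norm x))) (at_right 0)"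
    by (rule frac_remainder_limit[OF s K of_real_sector]) (use x in simp)
  have "((\<lambda>\<epsilon>. exp (Ln (Complex K \<epsilon>) / s) / (s * Complex K \<epsilon>) * helm_profile DIM('a) (exp (Ln (Complex K \<epsilon>) / (2 * s))) (complex_of_real (norm x))
      + frac_remainder DIM('a) s (Complex K \<epsilon>) (complex_of_real (norm x))) \<longlongrightarrow> outgoing_profile DIM('a) (complex_of_real (norm x))) (at_right 0)"
    unfolding outgoing_profile_def by (intro tendsto_add tendsto_mult lc lP lR)
  moreover have "\<forall>\<^sub>F \<epsilon> in at_right 0. exp (Ln (Complex K \<epsilon>) / s) / (s * Complex K \<epsilon>) * helm_profile DIM('a) (exp (Ln (Complex K \<epsilon>) / (2 * s))) (complex_of_real (norm x))
      + frac_remainder DIM('a) s (Complex K \<epsilon>) (complex_of_real (norm x)) = G_eps s k \<epsilon> x"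
  proof -
    have "0 < sin (pi * s) * K / 4" using sin_pi_s_pos[OF s K] K by simp
    hence "\<forall>\<^sub>F \<epsilon> in at_right 0. \<epsilon> < sin (pi * s) * K / 4" by (rule order_tendstoD(2)[OF tendsto_ident_at])
    thus ?thesis using eventually_at_right_less[of 0]
      by eventually_elim (rule G_eps_formula[OF _ _ n x, symmetric], auto)
  qed
  ultimately have "((\<lambda>\<epsilon>. G_eps s k \<epsilon> x) \<longlongrightarrow> outgoing_profile DIM('a) (complex_of_real (norm x))) (at_right 0)"
    by (rule Lim_transform_eventually)
  thus ?thesis unfolding G_out_def by (intro tendsto_Lim) auto
qed

text \<open>One factor k^(2-2s)/s serves all dimensions: for n = 1 it absorbs the 1/(2 k) of the
  profile, and for n = 2 \<open>helm_profile_hankel\<close> brings in the Hankel function.\<close>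

lemma G_helm_formula:
  fixes x :: "'a::euclidean_space"
  assumes n: "DIM('a) \<in> {1, 2, 3}" and x: "x \<noteq> 0"
  shows "G_helm s k x = complex_of_real (k powr (2 - 2 * s) / s) * helm_profile DIM('a) (complex_of_real k) (complex_of_real (norm x))"
proof -
  have c: "exp (\<i> * complex_of_real k * complex_of_real (norm x)) = cis (k * norm x)"
    by (simp add: cis_conv_exp mult.assoc)
  consider "DIM('a) = 1" | "DIM('a) = 2" | "DIM('a) = 3" using n by auto
  thus ?thesis
  proof cases
    case 1
    have "k powr (2 - 2 * s) / s * (1 / (2 * k)) = 1 / (2 * s * k powr (2 * s - 1))"
    proof -
      have "k powr (2 - 2 * s) = k powr 1 * k powr (1 - 2 * s)" by (simp only: powr_add[symmetric]) simp
      moreover have "k powr (1 - 2 * s) * k powr (2 * s - 1) = 1" using k by (simp flip: powr_add)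
      ultimately show ?thesis using k s by (simp add: field_simps)
    qed
    hence "complex_of_real (k powr (2 - 2 * s) / s) * complex_of_real (1 / (2 * k)) = complex_of_real (1 / (2 * s * k powr (2 * s - 1)))"
      by (simp only: of_real_mult[symmetric])
    hence e: "\<i> * cis (k * norm x) * (complex_of_real (k powr (2 - 2 * s) / s) * complex_of_real (1 / (2 * k))) = \<i> * cis (k * norm x) * complex_of_real (1 / (2 * s * k powr (2 * s - 1)))"
      by (simp only:)
    have "complex_of_real (k powr (2 - 2 * s) / s) * (\<i> / (2 * complex_of_real k) * cis (k * norm x)) = \<i> * cis (k * norm x) * (complex_of_real (k powr (2 - 2 * s) / s) * complex_of_real (1 / (2 * k)))"
      by simp
    also have "\<dots> = \<i> * cis (k * norm x) / complex_of_real (2 * s * k powr (2 * s - 1))"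
      unfolding e by simp
    finally show ?thesis using 1 by (simp only: G_helm_def helm_profile_def c if_True refl)
  next
    case 2
    have "complex_of_real (k powr (2 - 2 * s) / s) * (\<i> / 4 * hankel1_0 (k * norm x)) = \<i> * complex_of_real (k powr (2 - 2 * s) / (4 * s)) * hankel1_0 (k * norm x)"
      by (simp add: mult_ac)
    moreover have "helm_profile 2 (complex_of_real k) (complex_of_real (norm x)) = \<i> / 4 * hankel1_0 (k * norm x)"
      using helm_profile_hankel[OF k, of "norm x"] x by simp
    ultimately show ?thesis unfolding G_helm_def 2 by (simp only: if_False if_True refl) simp
  next
    case 3
    thus ?thesis using x unfolding G_helm_def 3 helm_profile_def c by simp
  qed
qed

end

section \<open>Radial functions and their derivatives\<close>

lemma sqrt_power_eq_powr:
  assumes "r > 0" "n \<ge> 1" shows "r powr ((real n - 1) / 2) = sqrt r ^ (n - 1)"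
proof -
  have "sqrt r ^ (n - 1) = (r powr (1 / 2)) powr real (n - 1)"
    using assms powr_realpow[of "sqrt r" "n - 1"] by (simp add: powr_half_sqrt)
  also have "\<dots> = r powr ((real n - 1) / 2)" using assms by (simp add: powr_powr of_nat_diff)
  finally show ?thesis ..
qed

lemma radial_deriv_eq:
  fixes x :: "'a::euclidean_space" and F :: "complex \<Rightarrow> complex"
  assumes x: "x \<noteq> 0" and f: "\<And>y. y \<noteq> 0 \<Longrightarrow> f y = F (complex_of_real (norm y))"
    and F: "(F has_field_derivative D) (at (complex_of_real (norm x)))"
  shows "radial_deriv f x = D"
proof -
  have "((\<lambda>t. F (complex_of_real t)) has_vector_derivative D) (at (norm x))"
    by (rule has_vector_derivative_real_field[OF F])
  hence "((\<lambda>t. f (t *\<^sub>R sgn x)) has_vector_derivative D) (at (norm x))"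
  proof (rule has_vector_derivative_transform_within_open[where S = "{0<..}"])
    fix t :: real assume "t \<in> {0<..}"
    thus "F (complex_of_real t) = f (t *\<^sub>R sgn x)" using x by (subst f) (auto simp: norm_sgn sgn_zero_iff)
  qed (use x in auto)
  thus ?thesis unfolding radial_deriv_def by (rule vector_derivative_at)
qed

text \<open>The derivative is assembled from bounded linear operations on \<open>blinfun\<close>, so
  that its continuity in \<open>x\<close> follows from that of \<open>D\<close> and of
  \<open>sgn x\<close>.\<close>

lemma radial_has_derivative:
  fixes x :: "'a::euclidean_space" and F :: "complex \<Rightarrow> complex"
  assumes x: "x \<noteq> 0" and f: "\<And>y. y \<noteq> 0 \<Longrightarrow> f y = F (complex_of_real (norm y))"
    and F: "(F has_field_derivative D) (at (complex_of_real (norm x)))"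
  shows "(f has_derivative blinfun_apply (blinfun_scaleR_left D o\<^sub>L blinfun_inner_left (sgn x))) (at x)"
proof -
  have "((\<lambda>t. F (complex_of_real t)) has_derivative (\<lambda>h. h *\<^sub>R D)) (at (norm x))"
    using has_vector_derivative_real_field[OF F] by (simp add: has_vector_derivative_def)
  from has_derivative_compose[OF has_derivative_norm[OF x] this]
  have "((\<lambda>y. F (complex_of_real (norm y))) has_derivative (\<lambda>h. (h \<bullet> sgn x) *\<^sub>R D)) (at x)"
    by (simp add: inner_commute)
  moreover have "(\<lambda>h. (h \<bullet> sgn x) *\<^sub>R D) = blinfun_apply (blinfun_scaleR_left D o\<^sub>L blinfun_inner_left (sgn x))"
    by (auto simp: fun_eq_iff inner_commute)
  ultimately have "((\<lambda>y. F (complex_of_real (norm y))) has_derivative blinfun_apply (blinfun_scaleR_left D o\<^sub>L blinfun_inner_left (sgn x))) (at x)"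
    by simp
  thus ?thesis
    by (rule has_derivative_transform_within_open[where s = "- {0}"]) (use x f in auto)
qed

theorem theorem2p1:
  fixes s k :: real
  assumes dim: "DIM('a::euclidean_space) \<in> {1, 2, 3}"
    and s: "0 < s" "s < 1"
    and k: "0 < k"
  shows "(\<exists>D :: 'a \<Rightarrow> ('a \<Rightarrow>\<^sub>L complex).
            (\<forall>x. norm x > 1 \<longrightarrow> (G_out s k has_derivative blinfun_apply (D x)) (at x))
            \<and> continuous_on {x. norm x > 1} D)
       \<and> ((\<lambda>x::'a. norm x powr ((real DIM('a) - 1) / 2) * norm (G_out s k x - G_helm s k x))
            \<longlongrightarrow> 0) at_infinity
       \<and> ((\<lambda>x::'a. norm x powr ((real DIM('a) - 1) / 2)
               * norm (radial_deriv (\<lambda>y. G_out s k y - G_helm s k y) x)) \<longlongrightarrow> 0) at_infinity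
       \<and> (\<forall>e>0. \<exists>R>0. \<forall>r\<ge>R. \<forall>xh::'a. norm xh = 1 \<longrightarrow>
            r powr ((real DIM('a) - 1) / 2)
              * norm (radial_deriv (G_out s k) (r *\<^sub>R xh) - \<i> * complex_of_real k * G_out s k (r *\<^sub>R xh)) < e)"
proof -
  define n where "n = DIM('a)"
  define K where "K = k powr (2 * s)"
  have n: "n \<in> {1, 2, 3}" "n \<ge> 1" using dim by (auto simp: n_def)
  have K: "K > 0" using k by (simp add: K_def)
  define c where "c = complex_of_real (k powr (2 - 2 * s) / s)"
  define P where "P = helm_profile n (complex_of_real k)"
  define A where "A = helm_amplitude n k"
  define R where "R = frac_remainder n s (complex_of_real K)"
  define g where "g = outgoing_profile s k K n"
  have g: "g z = c * P z + R z" for z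
    by (simp add: g_def outgoing_profile_def[OF s k K_def] c_def P_def R_def)
  have out: "G_out s k x = g (complex_of_real (norm x))" if "x \<noteq> 0" for x :: 'a
    using G_out_formula[OF s k K_def dim that] by (simp add: g_def n_def)
  \<comment> \<open>The Helmholtz parts cancel exactly and not only asymptotically, so the first two
    limits concern \<open>R\<close> alone.\<close>
  have diff: "G_out s k x - G_helm s k x = R (complex_of_real (norm x))" if "x \<noteq> 0" for x :: 'a
    using out[OF that] G_helm_formula[OF s k K_def dim that] by (simp add: g c_def P_def n_def)
  have \<epsilon>: "\<bar>0::real\<bar> \<le> sin (pi * s) * K / 4" using sin_pi_s_pos[OF s K] K by simp
  have holR: "R holomorphic_on sector"
    unfolding R_def using frac_remainder_holomorphic[OF s K \<epsilon>] by (simp add: complex_of_real_def)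
  have holP: "P holomorphic_on {z. Re z > 0}"
    unfolding P_def by (rule helm_profile_holomorphic[OF real_half_planes[OF k]])
  have holA: "A holomorphic_on {z. Re z > 0}"
    unfolding A_def by (rule helm_amplitude_holomorphic[OF k])
  \<comment> \<open>\<open>P\<close> is holomorphic on the right half-plane and \<open>R\<close> on
    the sector; their sum is differentiated on the intersection.\<close>
  define S where "S = {z. Re z > 0} \<inter> sector"
  have S: "open S" "\<And>r. r > 0 \<Longrightarrow> complex_of_real r \<in> S"
    unfolding S_def using of_real_sector by (auto intro: open_Int open_halfspace_Re_gt open_sector)
  have holg: "g holomorphic_on S"
    unfolding g[abs_def] S_def
    by (intro holomorphic_intros holomorphic_on_subset[OF holP] holomorphic_on_subset[OF holR]) auto
  have dR: "(R has_field_derivative deriv R (complex_of_real r)) (at (complex_of_real r))" if "r > 0" for r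
    by (rule holomorphic_derivI[OF holR open_sector of_real_sector[OF that]])
  have dg: "(g has_field_derivative deriv g (complex_of_real r)) (at (complex_of_real r))" if "r > 0" for r
    by (rule holomorphic_derivI[OF holg S(1) S(2)[OF that]])
  have dA: "(A has_field_derivative deriv A (complex_of_real r)) (at (complex_of_real r))" if "r > 0" for r
    by (rule holomorphic_derivI[OF holA open_halfspace_Re_gt]) (use that in simp)
  have limR: "((\<lambda>r. sqrt r ^ (n - 1) * norm (R (complex_of_real r))) \<longlongrightarrow> 0) at_top"
    "((\<lambda>r. sqrt r ^ (n - 1) * norm (deriv R (complex_of_real r))) \<longlongrightarrow> 0) at_top"
    unfolding R_def by (rule remainder_decay[OF s K n(2)])+
  have limA: "((\<lambda>r. sqrt r ^ (n - 1) * norm (deriv A (complex_of_real r))) \<longlongrightarrow> 0) at_top"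
    unfolding A_def by (rule helm_amplitude_deriv_decay[OF k n(1)])
  have big: "\<forall>\<^sub>F x::'a in at_infinity. x \<noteq> 0"
    unfolding eventually_at_infinity by (rule exI[of _ 1]) auto
  have 1: "\<exists>D :: 'a \<Rightarrow> ('a \<Rightarrow>\<^sub>L complex).
            (\<forall>x. norm x > 1 \<longrightarrow> (G_out s k has_derivative blinfun_apply (D x)) (at x)) \<and> continuous_on {x. norm x > 1} D"
  proof (intro exI conjI allI impI)
    let ?D = "\<lambda>x::'a. blinfun_scaleR_left (deriv g (complex_of_real (norm x))) o\<^sub>L blinfun_inner_left (sgn x)"
    show "(G_out s k has_derivative blinfun_apply (?D x)) (at x)" if "norm x > 1" for x :: 'a
      by (rule radial_has_derivative[OF _ out dg]) (use that in auto)
    have "continuous_on {x::'a. norm x > 1} (\<lambda>x. deriv g (complex_of_real (norm x)))"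
      by (rule continuous_on_compose2[OF holomorphic_on_imp_continuous_on[OF holomorphic_deriv[OF holg S(1)]]])
         (auto intro!: continuous_intros S(2))
    moreover have "continuous_on {x::'a. norm x > 1} (\<lambda>x. sgn x)"
      by (intro continuous_intros) auto
    ultimately show "continuous_on {x. norm x > 1} ?D"
      by (intro bounded_bilinear.continuous_on[OF bounded_bilinear_blinfun_compose]
          bounded_linear.continuous_on[OF bounded_linear_blinfun_scaleR_left]
          bounded_linear.continuous_on[OF bounded_linear_blinfun_inner_left])
  qed
  have 2: "((\<lambda>x::'a. norm x powr ((real DIM('a) - 1) / 2) * norm (G_out s k x - G_helm s k x)) \<longlongrightarrow> 0) at_infinity"
  proof (rule Lim_transform_eventually[OF filterlim_compose[OF limR(1) filterlim_norm_at_top]])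
    show "\<forall>\<^sub>F x::'a in at_infinity. sqrt (norm x) ^ (n - 1) * norm (R (complex_of_real (norm x))) = norm x powr ((real DIM('a) - 1) / 2) * norm (G_out s k x - G_helm s k x)"
      using big by eventually_elim (use n(2) in \<open>simp add: diff sqrt_power_eq_powr n_def\<close>)
  qed
  have 3: "((\<lambda>x::'a. norm x powr ((real DIM('a) - 1) / 2) * norm (radial_deriv (\<lambda>y. G_out s k y - G_helm s k y) x)) \<longlongrightarrow> 0) at_infinity"
  proof (rule Lim_transform_eventually[OF filterlim_compose[OF limR(2) filterlim_norm_at_top]])
    show "\<forall>\<^sub>F x::'a in at_infinity. sqrt (norm x) ^ (n - 1) * norm (deriv R (complex_of_real (norm x))) = norm x powr ((real DIM('a) - 1) / 2) * norm (radial_deriv (\<lambda>y. G_out s k y - G_helm s k y) x)"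
      using big
    proof eventually_elim
      case (elim x)
      have "radial_deriv (\<lambda>y. G_out s k y - G_helm s k y) x = deriv R (complex_of_real (norm x))"
        by (rule radial_deriv_eq[OF elim diff dR]) (use elim in auto)
      thus ?case using elim n(2) by (simp add: sqrt_power_eq_powr n_def)
    qed
  qed
  \<comment> \<open>These are the three terms that remain in the radiation condition: the derivative
    of the amplitude, the derivative of the remainder, and k times the remainder.\<close>
  have "((\<lambda>r. norm c * (sqrt r ^ (n - 1) * norm (deriv A (complex_of_real r))) + sqrt r ^ (n - 1) * norm (deriv R (complex_of_real r))
      + k * (sqrt r ^ (n - 1) * norm (R (complex_of_real r)))) \<longlongrightarrow> norm c * 0 + 0 + k * 0) at_top"
    by (intro tendsto_intros limR limA)
  hence lim: "((\<lambda>r. norm c * (sqrt r ^ (n - 1) * norm (deriv A (complex_of_real r))) + sqrt r ^ (n - 1) * norm (deriv R (complex_of_real r))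
      + k * (sqrt r ^ (n - 1) * norm (R (complex_of_real r)))) \<longlongrightarrow> 0) at_top" by simp
  \<comment> \<open>All functions are radial, so a threshold found for \<open>r\<close> alone is
    uniform in the direction \<open>xh\<close>.\<close>
  have 4: "\<exists>R>0. \<forall>r\<ge>R. \<forall>xh::'a. norm xh = 1 \<longrightarrow>
            r powr ((real DIM('a) - 1) / 2)
              * norm (radial_deriv (G_out s k) (r *\<^sub>R xh) - \<i> * complex_of_real k * G_out s k (r *\<^sub>R xh)) < e" if e: "e > 0" for e
  proof -
    obtain R0 where R0: "\<And>r. r \<ge> R0 \<Longrightarrow> norm c * (sqrt r ^ (n - 1) * norm (deriv A (complex_of_real r))) + sqrt r ^ (n - 1) * norm (deriv R (complex_of_real r))
      + k * (sqrt r ^ (n - 1) * norm (R (complex_of_real r))) < e"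
      using order_tendstoD(2)[OF lim e] unfolding eventually_at_top_linorder by auto
    show ?thesis
    proof (intro exI[of _ "max R0 1"] conjI allI impI)
      fix r :: real and xh :: 'a assume r: "r \<ge> max R0 1" and xh: "norm xh = 1"
      let ?r = "complex_of_real r"
      have r0: "r > 0" using r by simp
      have nx: "norm (r *\<^sub>R xh) = r" using r0 xh by simp
      have x0: "r *\<^sub>R xh \<noteq> 0" using r0 xh by auto
      have E: "((\<lambda>z. exp (\<i> * complex_of_real k * z)) has_field_derivative \<i> * complex_of_real k * exp (\<i> * complex_of_real k * ?r)) (at ?r)"
        by (auto intro!: derivative_eq_intros)
      \<comment> \<open>Differentiating the phase reproduces i k P, which cancels against the
        Helmholtz part of i k G.\<close>
      have Pe: "P = (\<lambda>z. exp (\<i> * complex_of_real k * z) * A z)"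
        unfolding P_def A_def by (rule ext) (rule helm_profile_amplitude)
      have "(g has_field_derivative (c * ((\<i> * complex_of_real k * exp (\<i> * complex_of_real k * ?r)) * A ?r + deriv A ?r * exp (\<i> * complex_of_real k * ?r)) + deriv R ?r)) (at ?r)"
        unfolding g[abs_def] Pe by (intro DERIV_add DERIV_cmult DERIV_mult E dA dR r0)
      hence rd: "radial_deriv (G_out s k) (r *\<^sub>R xh) = c * ((\<i> * complex_of_real k * exp (\<i> * complex_of_real k * ?r)) * A ?r + deriv A ?r * exp (\<i> * complex_of_real k * ?r)) + deriv R ?r"
        using radial_deriv_eq[where f = "G_out s k" and F = g and x = "r *\<^sub>R xh", OF x0 out] unfolding nx by blast
      have "radial_deriv (G_out s k) (r *\<^sub>R xh) - \<i> * complex_of_real k * G_out s k (r *\<^sub>R xh)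
         = c * (deriv A ?r * exp (\<i> * complex_of_real k * ?r)) + deriv R ?r - \<i> * complex_of_real k * R ?r"
        unfolding rd out[OF x0] nx g Pe by (simp add: algebra_simps)
      also have "norm \<dots> \<le> norm (c * (deriv A ?r * exp (\<i> * complex_of_real k * ?r))) + norm (deriv R ?r) + norm (\<i> * complex_of_real k * R ?r)"
        by (rule order_trans[OF norm_triangle_ineq4]) (intro add_right_mono norm_triangle_ineq)
      also have "\<dots> = norm c * norm (deriv A ?r) + norm (deriv R ?r) + k * norm (R ?r)"
        using k by (simp add: norm_mult)
      finally have "sqrt r ^ (n - 1) * norm (radial_deriv (G_out s k) (r *\<^sub>R xh) - \<i> * complex_of_real k * G_out s k (r *\<^sub>R xh))
         \<le> sqrt r ^ (n - 1) * (norm c * norm (deriv A ?r) + norm (deriv R ?r) + k * norm (R ?r))"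
        using r0 by (intro mult_left_mono) auto
      also have "\<dots> = norm c * (sqrt r ^ (n - 1) * norm (deriv A ?r)) + sqrt r ^ (n - 1) * norm (deriv R ?r) + k * (sqrt r ^ (n - 1) * norm (R ?r))"
        by (simp add: algebra_simps)
      also have "\<dots> < e" using R0 r by simp
      finally show "r powr ((real DIM('a) - 1) / 2) * norm (radial_deriv (G_out s k) (r *\<^sub>R xh) - \<i> * complex_of_real k * G_out s k (r *\<^sub>R xh)) < e"
        using sqrt_power_eq_powr[OF r0 n(2)] by (simp add: n_def)
    qed simp
  qed
  show ?thesis using 1 2 3 4 by blast
qed

end
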